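(* As $|M|\to0$, $$\inf\sigma(H(M))=\inf\sigma(A_M)+\mathcal O(|M|^3),$$ i.e. there exist $C,\delta>0$ such that $|\inf\sigma(H(M))-\inf\sigma(A_M)|\le C|M|^3$ for all $M\in\mathbb R^P$ with $|M|<\delta$.
   Context: Fix an integer $P\ge1$ and points $x^{[1]},\dots,x^{[P]}\in\mathbb R^3$. Let $\phi\in\mathcal S(\mathbb R)$ and for $k\in\mathbb R^3$ write $\phi(|k|)$. Let $\mathfrak H=\{V\in L^2(\mathbb R^3,\mathbb C^3):\ k\cdot V(k)=0\text{ a.e.}\}$, $\mathcal H_{\rm ph}$ the symmetric Fock space over $\mathfrak H$ with vacuum $\Psi_0$, Segal fields $\Phi_S(V)=\frac1{\sqrt2}(a^*(V)+a(V))$, $H_{\rm ph}=d\Gamma(M_\omega)$ with $M_\omega$ multiplication by $|k|$ on $\mathfrak H$. Let $\mathcal H_{\rm sp}=(\mathbb C^2)^{\otimes P}$, $\mathcal H_{\rm tot}=\mathcal H_{\rm ph}\otimes\mathcal H_{\rm sp}$, $\sigma_1,\sigma_2,\sigma_3$ the Pauli matrices, $\sigma_m^{[\lambda]}$ acting as $\sigma_m$ on the $\lambda$-th factor and identity elsewhere. $B_{m,x}(k)=\frac{i\phi(|k|)|k|^{1/2}}{(2\pi)^{3/2}}e^{-ik\cdot x}\frac{k\times e_m}{|k|}$ ($e_m$ canonical basis). For $M=(M^{[1]},\dots,M^{[P]})\in\mathbb R^P$ with Euclidean norm $|M|$, $H_{\rm int}(M)=\sum_{\lambda=1}^P\sum_{m=1}^3M^{[\lambda]}\Phi_S(B_{m,x^{[\lambda]}})\otimes\sigma_m^{[\lambda]}$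 and $H(M)=H_{\rm ph}\otimes I+H_{\rm int}(M)$, self-adjoint on $D(H_{\rm ph}\otimes I)$; $\sigma(\cdot)$ denotes spectrum. With $EX=\Psi_0\otimes X$, $A_M$ is the operator on $\mathcal H_{\rm sp}$ given by $A_MX=-E^*H_{\rm int}(M)(H_{\rm ph}^{-1}\otimes I)H_{\rm int}(M)EX$ (with $H_{\rm ph}^{-1}$ acting as multiplication by $1/|k|$ on the one-photon sector, where $H_{\rm int}(M)EX$ lies). *)

theory Defs
  imports "HOL-Analysis.Analysis" "HOL-Analysis.Cross3"
begin

fun vderivs :: "nat \<Rightarrow> (real \<Rightarrow> complex) \<Rightarrow> real \<Rightarrow> complex" where
  "vderivs 0 f = f"
| "vderivs (Suc n) f = (\<lambda>t. vector_derivative (vderivs n f) (at t))"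

definition schwartz :: "(real \<Rightarrow> complex) \<Rightarrow> bool" where
  "schwartz f \<longleftrightarrow> (\<forall>n t. vderivs n f differentiable (at t))
     \<and> (\<forall>a b. bounded (range (\<lambda>t. complex_of_real (t ^ a) * vderivs b f t)))"

section \<open>Concrete model of H_tot = Fock(transverse L2(R^3,C^3)) tensor (C^2)^P\<close>

text \<open>A vector of the total space is represented by a function
  Psi n ks js s: n = photon number, ks : {..<n} -> R^3 momenta (extensional),
  js : {..<n} -> polarisation component of C^3, s : spin configuration
  (s l = True means the second basis vector of the l-th C^2 factor, l in {1..P}).\<close>

type_synonym fock = "nat \<Rightarrow> (nat \<Rightarrow> real^3) \<Rightarrow> (nat \<Rightarrow> 3) \<Rightarrow> (nat \<Rightarrow> bool) \<Rightarrow> complex"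

definition spins :: "nat \<Rightarrow> (nat \<Rightarrow> bool) set" where
  "spins P = {s. \<forall>i. s i \<longrightarrow> i \<in> {1..P}}"

definition nmeas :: "nat \<Rightarrow> (nat \<Rightarrow> real^3) measure" where
  "nmeas n = PiM {..<n} (\<lambda>_. lborel)"

definition pols :: "nat \<Rightarrow> (nat \<Rightarrow> 3) set" where
  "pols n = PiE {..<n} (\<lambda>_. UNIV)"

definition fnorm2 :: "nat \<Rightarrow> fock \<Rightarrow> ennreal" where
  "fnorm2 P \<Psi> = (\<Sum>n. \<integral>\<^sup>+ ks. ennreal (\<Sum>js\<in>pols n. \<Sum>s\<in>spins P. (cmod (\<Psi> n ks js s))\<^sup>2) \<partial>nmeas n)"

definition fnorm :: "nat \<Rightarrow> fock \<Rightarrow> real" where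
  "fnorm P \<Psi> = sqrt (enn2real (fnorm2 P \<Psi>))"

definition in_Htot :: "nat \<Rightarrow> fock \<Rightarrow> bool" where
  "in_Htot P \<Psi> \<longleftrightarrow>
     (\<forall>n. \<forall>js\<in>pols n. \<forall>s\<in>spins P. (\<lambda>ks. \<Psi> n ks js s) \<in> borel_measurable (nmeas n))
   \<and> (\<forall>n \<pi>. \<pi> permutes {..<n} \<longrightarrow>
        (AE ks in nmeas n. \<forall>js\<in>pols n. \<forall>s\<in>spins P. \<Psi> n (ks \<circ> \<pi>) (js \<circ> \<pi>) s = \<Psi> n ks js s))
   \<and> (\<forall>n. \<forall>i<n. AE ks in nmeas n. \<forall>js\<in>pols n. \<forall>s\<in>spins P.
        (\<Sum>j\<in>UNIV. complex_of_real (ks i $ j) * \<Psi> n ks (js(i := j)) s) = 0)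
   \<and> fnorm2 P \<Psi> < \<infinity>"

definition fcons :: "'a \<Rightarrow> (nat \<Rightarrow> 'a) \<Rightarrow> nat \<Rightarrow> 'a" where
  "fcons a f = (\<lambda>i. if i = 0 then a else f (i - 1))"

definition fdel :: "nat \<Rightarrow> (nat \<Rightarrow> 'a) \<Rightarrow> nat \<Rightarrow> 'a" where
  "fdel i f = (\<lambda>j. if j < i then f j else f (Suc j))"

text \<open>Free field energy H_ph = dGamma(|k|) (tensor identity) and its inverse
  (used only on the one-photon sector).\<close>
definition hph :: "fock \<Rightarrow> fock" where
  "hph \<Psi> = (\<lambda>n ks js s. complex_of_real (\<Sum>i<n. norm (ks i)) * \<Psi> n ks js s)"

definition hphinv :: "fock \<Rightarrow> fock" where
  "hphinv \<Psi> = (\<lambda>n ks js s. complex_of_real (inverse (\<Sum>i<n. norm (ks i))) * \<Psi> n ks js s)"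

definition annih :: "(real^3 \<Rightarrow> 3 \<Rightarrow> complex) \<Rightarrow> fock \<Rightarrow> fock" where
  "annih V \<Psi> = (\<lambda>n ks js s. complex_of_real (sqrt (real (Suc n))) *
      integral\<^sup>L lborel (\<lambda>k. \<Sum>j\<in>UNIV. cnj (V k j) * \<Psi> (Suc n) (fcons k ks) (fcons j js) s))"

definition create :: "(real^3 \<Rightarrow> 3 \<Rightarrow> complex) \<Rightarrow> fock \<Rightarrow> fock" where
  "create V \<Psi> = (\<lambda>n ks js s. if n = 0 then 0 else
      complex_of_real (1 / sqrt (real n)) *
      (\<Sum>i<n. V (ks i) (js i) * \<Psi> (n - 1) (fdel i ks) (fdel i js) s))"

definition segal :: "(real^3 \<Rightarrow> 3 \<Rightarrow> complex) \<Rightarrow> fock \<Rightarrow> fock" where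
  "segal V \<Psi> = (\<lambda>n ks js s. (create V \<Psi> n ks js s + annih V \<Psi> n ks js s) / complex_of_real (sqrt 2))"

text \<open>Pauli matrices sigma_1, sigma_2, sigma_3 (row index a, column index b;
  False = first basis vector, True = second).\<close>
definition pauli :: "nat \<Rightarrow> bool \<Rightarrow> bool \<Rightarrow> complex" where
  "pauli m a b =
     (if m = 1 then (if a \<noteq> b then 1 else 0)
      else if m = 2 then (if \<not> a \<and> b then - \<i> else if a \<and> \<not> b then \<i> else 0)
      else if m = 3 then (if a = b then (if a then -1 else 1) else 0)
      else 0)"

definition spin_op :: "nat \<Rightarrow> nat \<Rightarrow> fock \<Rightarrow> fock" where
  "spin_op m l \<Psi> = (\<lambda>n ks js s. \<Sum>b\<in>UNIV. pauli m (s l) b * \<Psi> n ks js (s(l := b)))"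

definition evec :: "nat \<Rightarrow> real^3" where
  "evec m = (if m = 1 then vector [1, 0, 0] else if m = 2 then vector [0, 1, 0] else vector [0, 0, 1])"

definition Bfield :: "(real \<Rightarrow> complex) \<Rightarrow> real^3 \<Rightarrow> nat \<Rightarrow> real^3 \<Rightarrow> 3 \<Rightarrow> complex" where
  "Bfield \<phi> x m k j = \<i> * \<phi> (norm k) * complex_of_real (sqrt (norm k) / ((2 * pi) powr (3/2)))
      * exp (- \<i> * complex_of_real (k \<bullet> x)) * complex_of_real ((cross3 k (evec m)) $ j / norm k)"

definition mnorm :: "nat \<Rightarrow> (nat \<Rightarrow> real) \<Rightarrow> real" where
  "mnorm P M = sqrt (\<Sum>l=1..P. (M l)\<^sup>2)"

definition Hint :: "nat \<Rightarrow> (nat \<Rightarrow> real^3) \<Rightarrow> (real \<Rightarrow> complex) \<Rightarrow> (nat \<Rightarrow> real) \<Rightarrow> fock \<Rightarrow> fock" where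
  "Hint P x \<phi> M \<Psi> = (\<lambda>n ks js s. \<Sum>l=1..P. \<Sum>m=1..3.
      complex_of_real (M l) * spin_op m l (segal (Bfield \<phi> (x l) m) \<Psi>) n ks js s)"

definition Hfull :: "nat \<Rightarrow> (nat \<Rightarrow> real^3) \<Rightarrow> (real \<Rightarrow> complex) \<Rightarrow> (nat \<Rightarrow> real) \<Rightarrow> fock \<Rightarrow> fock" where
  "Hfull P x \<phi> M \<Psi> = (\<lambda>n ks js s. hph \<Psi> n ks js s + Hint P x \<phi> M \<Psi> n ks js s)"

definition dom_H :: "nat \<Rightarrow> fock \<Rightarrow> bool" where
  "dom_H P \<Psi> \<longleftrightarrow> in_Htot P \<Psi> \<and> fnorm2 P (hph \<Psi>) < \<infinity>"

definition spec_H :: "nat \<Rightarrow> (nat \<Rightarrow> real^3) \<Rightarrow> (real \<Rightarrow> complex) \<Rightarrow> (nat \<Rightarrow> real) \<Rightarrow> complex set" where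
  "spec_H P x \<phi> M = {z. \<not> (
      (\<forall>\<Phi>. in_Htot P \<Phi> \<longrightarrow> (\<exists>\<Psi>. dom_H P \<Psi> \<and>
          fnorm2 P (\<lambda>n ks js s. Hfull P x \<phi> M \<Psi> n ks js s - z * \<Psi> n ks js s - \<Phi> n ks js s) = 0))
    \<and> (\<exists>C. \<forall>\<Psi>. dom_H P \<Psi> \<longrightarrow>
          fnorm P \<Psi> \<le> C * fnorm P (\<lambda>n ks js s. Hfull P x \<phi> M \<Psi> n ks js s - z * \<Psi> n ks js s)))}"

text \<open>E X = vacuum tensor X, and A_M X = - E^* H_int H_ph^{-1} H_int E X.\<close>
definition embE :: "((nat \<Rightarrow> bool) \<Rightarrow> complex) \<Rightarrow> fock" where
  "embE X = (\<lambda>n ks js s. if n = 0 then X s else 0)"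

definition A_op :: "nat \<Rightarrow> (nat \<Rightarrow> real^3) \<Rightarrow> (real \<Rightarrow> complex) \<Rightarrow> (nat \<Rightarrow> real)
      \<Rightarrow> ((nat \<Rightarrow> bool) \<Rightarrow> complex) \<Rightarrow> (nat \<Rightarrow> bool) \<Rightarrow> complex" where
  "A_op P x \<phi> M X = (\<lambda>s. - Hint P x \<phi> M (hphinv (Hint P x \<phi> M (embE X))) 0 (\<lambda>_. undefined) (\<lambda>_. undefined) s)"

definition spec_A :: "nat \<Rightarrow> (nat \<Rightarrow> real^3) \<Rightarrow> (real \<Rightarrow> complex) \<Rightarrow> (nat \<Rightarrow> real) \<Rightarrow> complex set" where
  "spec_A P x \<phi> M = {z. \<exists>X. (\<forall>s. s \<notin> spins P \<longrightarrow> X s = 0) \<and> (\<exists>s\<in>spins P. X s \<noteq> 0)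
      \<and> (\<forall>s\<in>spins P. A_op P x \<phi> M X s = z * X s)}"

definition inf_spec :: "complex set \<Rightarrow> real" where
  "inf_spec S = Inf {r::real. complex_of_real r \<in> S}"

end

theory Submission
  imports Defs "HOL-Library.Function_Algebras"
begin

text \<open>
Write \<open>V(k)\<close> for the matrix of spin operators coupled to the photon annihilation field \<open>a(k)\<close>, so that
\<open>H(M)\<close> is the integral of \<open>|k| a(k)* a(k) + a(k)* V(k) + V(k)* a(k)\<close>. Completing the square in
\<open>a(k) + V(k) / |k|\<close> leaves minus the integral of \<open>V(k)* V(k) / |k|\<close>, which is exactly \<open>A\<^sub>M\<close> acting on
the spins. Hence \<open>H(M)\<close> is bounded below by \<open>a = inf \<sigma>(A\<^sub>M)\<close>, without any error term.
For the upper bound take an eigenvector \<open>X\<close> of \<open>A\<^sub>M\<close> to \<open>a\<close> and the trial vector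
\<open>\<Psi> = E X - H\<^sub>p\<^sub>h\<^sup>-\<^sup>1 H\<^sub>i\<^sub>n\<^sub>t E X\<close>. Its one-photon component is cancelled by \<open>H(M)\<close>, so
the energy of \<open>\<Psi>\<close> is exactly \<open>a |X|\<^sup>2\<close>, while \<open>|\<Psi>|\<^sup>2 = (1 + O(|M|\<^sup>2)) |X|\<^sup>2\<close>. As \<open>a = O(|M|\<^sup>2)\<close>, the
error is even \<open>O(|M|\<^sup>4)\<close>.

That the bottom of the form is the bottom of the spectrum uses the Cauchy-Schwarz inequality for the
form of \<open>H(M)\<close> and, for real points further below, surjectivity by two Neumann series: from the free
operator to \<open>H(M)\<close> far to the left, and from there up to \<open>a\<close>.
\<close>

section \<open>Semi-Hilbert spaces and the bottom of the spectrum\<close>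

text \<open>The obstacle is that states are functions, not classes modulo null functions, and that
  an annihilation integral takes the default value 0 wherever it diverges. So \<open>annih\<close>,
  and with it \<open>Hint\<close> and \<open>Hfull\<close>, is additive only almost everywhere and
  only on the domain. All operator theory is therefore done in a complete space with a semidefinite
  inner product, where identities are stated as the vanishing of \<open>nm\<close>. A real inner
  product is enough, because \<open>inf_spec\<close> sees only real spectral points. Three momentum
  integrals of a majorant g of the form factors carry the estimates: g^2 enters the bound on
  creation and puts the trial vector into the domain, g^2/|k| bounds the fields by the free energy
  and gives A_M = O(|M|^2), and g^2/|k|^2 controls the norm of the trial vector. The last is the
  infrared condition; g^2 is at most of order |k| near 0, which leaves |k|^(-1), integrable in
  dimension 3. Adjointness of creation and annihilation and the free energy in terms of a(k) both
  come from one counting formula for configurations with a marked photon, without commutation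
  relations.\<close>

instantiation "fun" :: (type, real_vector) real_vector
begin
definition scaleR_fun :: "real \<Rightarrow> ('a \<Rightarrow> 'b) \<Rightarrow> 'a \<Rightarrow> 'b" where
  "scaleR_fun c f = (\<lambda>x. c *\<^sub>R f x)"
instance
  by standard (auto simp: scaleR_fun_def fun_eq_iff scaleR_add_right scaleR_add_left)
end

lemma scaleR_fun_apply [simp]: "(c *\<^sub>R f) x = c *\<^sub>R f x"
  by (simp add: scaleR_fun_def)

lemma sum_fun_apply: "(\<Sum>i\<in>A. f i) x = (\<Sum>i\<in>A. f i x)"
  by (induction A rule: infinite_finite_induct) auto

text \<open>The degenerate case \<open>C = 0\<close> is kept: there the polynomial is affine in
  \<open>t\<close>, so its slope must vanish. It is this case that later turns minimality of a
  Rayleigh quotient into the eigenvalue equation.\<close>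

lemma discriminant_le:
  fixes A B C :: real
  assumes "\<And>t. 0 \<le> A + 2 * t * B + t\<^sup>2 * C" "C \<ge> 0"
  shows "B\<^sup>2 \<le> A * C"
proof (cases "C = 0")
  case True
  have "B = 0"
  proof (rule ccontr)
    assume "B \<noteq> 0"
    \<comment> \<open>The chosen \<open>t\<close> makes the affine function equal to -1.\<close>
    then show False
      using assms(1)[of "- (A + 1) / (2 * B)"] True by (simp add: field_simps)
  qed
  then show ?thesis using True by simp
next
  case False
  then have "C > 0" using assms by simp
  then show ?thesis
    using assms(1)[of "- B / C"] by (simp add: field_simps power2_eq_square)
qed

text \<open>Definiteness is left out on purpose, since functions that vanish almost everywhere are
  null vectors different from \<open>0\<close>. In the application \<open>ip\<close> is the real
  part of the complex inner product and \<open>V\<close> consists of representatives.\<close>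

locale semi_inner =
  fixes V :: "'v::real_vector set" and ip :: "'v \<Rightarrow> 'v \<Rightarrow> real"
  assumes subspace_V: "subspace V"
    and ip_sym: "x \<in> V \<Longrightarrow> y \<in> V \<Longrightarrow> ip x y = ip y x"
    and ip_add: "x \<in> V \<Longrightarrow> y \<in> V \<Longrightarrow> z \<in> V \<Longrightarrow> ip (x + y) z = ip x z + ip y z"
    and ip_scale: "x \<in> V \<Longrightarrow> y \<in> V \<Longrightarrow> ip (c *\<^sub>R x) y = c * ip x y"
    and ip_nonneg: "x \<in> V \<Longrightarrow> ip x x \<ge> 0"
begin

definition nm :: "'v \<Rightarrow> real" where "nm x = sqrt (ip x x)"

lemma V_closed [simp]:
  "0 \<in> V" "x \<in> V \<Longrightarrow> y \<in> V \<Longrightarrow> x + y \<in> V" "x \<in> V \<Longrightarrow> c *\<^sub>R x \<in> V"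
  "x \<in> V \<Longrightarrow> y \<in> V \<Longrightarrow> x - y \<in> V" "x \<in> V \<Longrightarrow> - x \<in> V"
  using subspace_V by (auto intro: subspace_0 subspace_add subspace_scale subspace_diff subspace_neg)

lemma ip_add2: "x \<in> V \<Longrightarrow> y \<in> V \<Longrightarrow> z \<in> V \<Longrightarrow> ip z (x + y) = ip z x + ip z y"
  using ip_add ip_sym by auto

lemma ip_scale2: "x \<in> V \<Longrightarrow> y \<in> V \<Longrightarrow> ip x (c *\<^sub>R y) = c * ip x y"
  using ip_scale ip_sym by auto

lemma ip_diff: "x \<in> V \<Longrightarrow> y \<in> V \<Longrightarrow> z \<in> V \<Longrightarrow> ip (x - y) z = ip x z - ip y z"
  using ip_add[of x "(-1) *\<^sub>R y" z] ip_scale[of y z "-1"] by simp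

lemma ip_diff2: "x \<in> V \<Longrightarrow> y \<in> V \<Longrightarrow> z \<in> V \<Longrightarrow> ip z (x - y) = ip z x - ip z y"
  using ip_diff ip_sym by auto

lemma nm_nonneg [simp]: "x \<in> V \<Longrightarrow> nm x \<ge> 0"
  by (simp add: nm_def ip_nonneg)

lemma nm_sq: "x \<in> V \<Longrightarrow> (nm x)\<^sup>2 = ip x x"
  by (simp add: nm_def ip_nonneg)

lemma nm_scale: "x \<in> V \<Longrightarrow> nm (c *\<^sub>R x) = \<bar>c\<bar> * nm x"
  by (simp add: nm_def ip_scale ip_scale2 real_sqrt_mult power2_eq_square flip: mult.assoc)

lemma nm_minus: "x \<in> V \<Longrightarrow> nm (- x) = nm x"
  using nm_scale[of x "-1"] by simp

lemma nm_zero [simp]: "nm 0 = 0"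
  using nm_scale[of 0 0] by simp

lemma ip_cauchy_schwarz:
  assumes "x \<in> V" "y \<in> V" shows "\<bar>ip x y\<bar> \<le> nm x * nm y"
proof -
  have "0 \<le> ip x x + 2 * t * ip x y + t\<^sup>2 * ip y y" for t
    using ip_nonneg[of "x + t *\<^sub>R y"] assms
    by (simp add: ip_add ip_add2 ip_scale ip_scale2 ip_sym[of y x] algebra_simps power2_eq_square)
  then have "(ip x y)\<^sup>2 \<le> ip x x * ip y y"
    using discriminant_le ip_nonneg[OF assms(2)] by blast
  then have "(ip x y)\<^sup>2 \<le> (nm x * nm y)\<^sup>2"
    using assms by (simp add: nm_sq power_mult_distrib)
  then show ?thesis
    using assms by (simp add: abs_le_square_iff[symmetric])
qed

lemma nm_triangle:
  assumes "x \<in> V" "y \<in> V" shows "nm (x + y) \<le> nm x + nm y"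
proof (rule power2_le_imp_le)
  have "ip x y \<le> nm x * nm y" using ip_cauchy_schwarz[OF assms] by simp
  then show "(nm (x + y))\<^sup>2 \<le> (nm x + nm y)\<^sup>2"
    using assms by (simp add: nm_sq power2_sum ip_add ip_add2 ip_sym[of y x])
qed (use assms in auto)

lemma nm_diff_triangle:
  assumes "x \<in> V" "y \<in> V" shows "nm (x - y) \<le> nm x + nm y"
  using nm_triangle[of x "-y"] assms nm_minus by simp

lemma nm_sum:
  assumes "\<And>i. i \<in> A \<Longrightarrow> f i \<in> V" shows "sum f A \<in> V" "nm (sum f A) \<le> (\<Sum>i\<in>A. nm (f i))"
proof -
  have "sum f A \<in> V \<and> nm (sum f A) \<le> (\<Sum>i\<in>A. nm (f i))" using assms
  proof (induction A rule: infinite_finite_induct)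
    case (insert x F)
    then show ?case using nm_triangle[of "f x" "sum f F"] by force
  qed auto
  then show "sum f A \<in> V" "nm (sum f A) \<le> (\<Sum>i\<in>A. nm (f i))" by auto
qed

lemma ip_null: "x \<in> V \<Longrightarrow> y \<in> V \<Longrightarrow> nm y = 0 \<Longrightarrow> ip x y = 0"
  using ip_cauchy_schwarz[of x y] by simp

lemma nm_null_eq:
  assumes "x \<in> V" "y \<in> V" "nm (x - y) = 0" shows "nm x = nm y"
  using nm_triangle[of "x - y" y] nm_triangle[of "y - x" x] nm_minus[of "x - y"] assms by simp

lemma nm_null_add:
  assumes "x \<in> V" "y \<in> V" "nm x = 0" "nm y = 0" shows "nm (x + y) = 0" "nm (x - y) = 0"
  using nm_triangle[of x y] nm_diff_triangle[of x y] assms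
    nm_nonneg[of "x + y"] nm_nonneg[of "x - y"] by (auto intro!: antisym)

end

text \<open>Completeness is phrased with absolutely convergent series because the Neumann series
  uses it in this form. The limit \<open>g\<close> is determined only up to a null vector.\<close>

locale semi_hilbert = semi_inner V ip for V :: "'v::real_vector set" and ip +
  assumes ip_complete: "(\<And>j::nat. X j \<in> V) \<Longrightarrow> summable (\<lambda>j. sqrt (ip (X j) (X j)))
       \<Longrightarrow> \<exists>g\<in>V. (\<lambda>n. sqrt (ip (g - (\<Sum>j<n. X j)) (g - (\<Sum>j<n. X j)))) \<longlonglongrightarrow> 0"
begin

text \<open>Operators are given on representatives, so they are only additive up to null vectors.\<close>

lemma neumann:
  assumes K: "\<And>x. x \<in> V \<Longrightarrow> K x \<in> V"
    and add: "\<And>x y. x \<in> V \<Longrightarrow> y \<in> V \<Longrightarrow> nm (K (x + y) - K x - K y) = 0"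
    and bd: "\<And>x. x \<in> V \<Longrightarrow> nm (K x) \<le> q * nm x" and q: "0 \<le> q" "q < 1"
    and y: "y \<in> V"
  shows "\<exists>x\<in>V. nm (x + K x - y) = 0"
proof -
  define X where "X j = ((\<lambda>x. - K x) ^^ j) y" for j
  have X0: "X 0 = y" and XS: "X (Suc j) = - K (X j)" for j by (simp_all add: X_def)
  have XV: "X j \<in> V" for j by (induction j) (auto simp: X0 XS y K)
  have Xn: "nm (X j) \<le> q ^ j * nm y" for j
  proof (induction j)
    case (Suc j)
    have "nm (X (Suc j)) \<le> q * nm (X j)" using bd XV K by (simp add: XS nm_minus)
    also have "\<dots> \<le> q * (q ^ j * nm y)" using Suc q by (simp add: mult_left_mono)
    finally show ?case by (simp add: mult.assoc)
  qed (simp add: X0)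
  have geo: "summable (\<lambda>j. q ^ j * nm y)"
    using q by (intro summable_mult2 summable_geometric) auto
  have "summable (\<lambda>j. sqrt (ip (X j) (X j)))"
    using Xn XV by (intro summable_comparison_test'[OF geo, of 0]) (auto simp: nm_def[symmetric])
  then obtain g where g: "g \<in> V" and lim: "(\<lambda>n. nm (g - (\<Sum>j<n. X j))) \<longlonglongrightarrow> 0"
    using ip_complete[of X] XV unfolding nm_def by blast
  define S where "S n = (\<Sum>j<n. X j)" for n
  have SV: "S n \<in> V" for n unfolding S_def by (rule nm_sum) (rule XV)
  have KV: "(\<Sum>j<n. K (X j)) \<in> V" for n by (rule nm_sum) (simp add: K XV)
  have K0: "nm (K 0) = 0" using bd[of 0] nm_nonneg[OF K[of 0]] by simp
  have KS: "nm (K (S n) - (\<Sum>j<n. K (X j))) = 0" for n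
  proof (induction n)
    case 0 then show ?case using K0 by (simp add: S_def)
  next
    case (Suc n)
    have "K (S (Suc n)) - (\<Sum>j<Suc n. K (X j))
      = (K (S n + X n) - K (S n) - K (X n)) + (K (S n) - (\<Sum>j<n. K (X j)))"
      by (simp add: S_def)
    moreover have "nm ((K (S n + X n) - K (S n) - K (X n)) + (K (S n) - (\<Sum>j<n. K (X j)))) = 0"
      by (intro nm_null_add add Suc V_closed K SV XV KV)
    ultimately show ?case by metis
  qed
  \<comment> \<open>Telescoping, since \<open>K (X j) = - X (Suc j)\<close>: the partial sums solve
    the equation up to the last iterate.\<close>
  have tel: "S n + (\<Sum>j<n. K (X j)) - y = - X n" for n
    by (induction n) (auto simp: S_def X0 XS algebra_simps)
  have bound: "nm (g + K g - y) \<le> (1 + q) * nm (g - S n) + q ^ n * nm y" for n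
  proof -
    let ?a = "g - S n" and ?c = "K g - K (S n) - K (g - S n)"
      and ?d = "K (S n) - (\<Sum>j<n. K (X j))"
    have cV: "?a \<in> V" "K ?a \<in> V" "?c \<in> V" "?d \<in> V" using g SV K KV by auto
    have c0: "nm ?c = 0" using add[of "S n" "g - S n"] g SV by (simp add: algebra_simps)
    \<comment> \<open>The pieces are the error of the partial sum and its image, two null defects of
      additivity, and the last iterate.\<close>
    have eq: "g + K g - y = (?a + K ?a) + (?c + ?d) + (- X n)"
      unfolding tel[of n, symmetric] by (simp add: algebra_simps)
    have "nm (g + K g - y) \<le> nm ((?a + K ?a) + (?c + ?d)) + nm (- X n)"
      unfolding eq by (intro nm_triangle V_closed cV XV)
    also have "nm ((?a + K ?a) + (?c + ?d)) \<le> nm (?a + K ?a) + nm (?c + ?d)"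
      by (intro nm_triangle V_closed cV)
    also have "nm (?c + ?d) = 0" by (intro nm_null_add cV c0 KS)
    also have "nm (?a + K ?a) \<le> nm ?a + nm (K ?a)" by (rule nm_triangle) (use cV in auto)
    also have "nm (K ?a) \<le> q * nm ?a" by (rule bd) (use cV in auto)
    also have "nm (- X n) \<le> q ^ n * nm y" using Xn XV by (simp add: nm_minus)
    finally show ?thesis by (simp add: algebra_simps)
  qed
  have "(\<lambda>n. (1 + q) * nm (g - S n) + q ^ n * nm y) \<longlonglongrightarrow> (1 + q) * 0 + 0 * nm y"
    using lim q unfolding S_def by (intro tendsto_intros LIMSEQ_realpow_zero) auto
  then have "nm (g + K g - y) \<le> 0"
    using bound by (intro LIMSEQ_le_const[where X = "\<lambda>n. (1 + q) * nm (g - S n) + q ^ n * nm y"]) auto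
  then show ?thesis using g K y nm_nonneg[of "g + K g - y"] by (intro bexI[of _ g] antisym) auto
qed

text \<open>With a right inverse \<open>G\<close> of \<open>T\<close> the equation becomes
  \<open>x + S (G x) = y\<close>, and the relative bound gives \<open>S\<close> after
  \<open>G\<close> a norm below 1, so \<open>neumann\<close> applies. \<open>G\<close> is an
  arbitrary choice of preimages; additivity of the composition modulo null vectors holds because
  \<open>S\<close> sends to null vectors whatever \<open>T\<close> does.\<close>

lemma perturbation_surj:
  assumes D: "subspace D" "D \<subseteq> V"
    and T: "\<And>x. x \<in> D \<Longrightarrow> T x \<in> V" and S: "\<And>x. x \<in> D \<Longrightarrow> S x \<in> V"
    and Tadd: "\<And>x y. x \<in> D \<Longrightarrow> y \<in> D \<Longrightarrow> nm (T (x - y) - (T x - T y)) = 0"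
    and Sadd: "\<And>x y. x \<in> D \<Longrightarrow> y \<in> D \<Longrightarrow> nm (S (x - y) - (S x - S y)) = 0"
    and surj: "\<And>y. y \<in> V \<Longrightarrow> \<exists>x\<in>D. nm (T x - y) = 0"
    and bd: "\<And>x. x \<in> D \<Longrightarrow> nm (S x) \<le> q * nm (T x)" and q: "0 \<le> q" "q < 1"
    and y: "y \<in> V"
  shows "\<exists>x\<in>D. nm (T x + S x - y) = 0"
proof -
  define G where "G y = (SOME x. x \<in> D \<and> nm (T x - y) = 0)" for y
  have G: "G y \<in> D" "nm (T (G y) - y) = 0" if "y \<in> V" for y
    unfolding G_def using someI_ex[OF surj[OF that, unfolded Bex_def]] by auto
  have Dd: "a - b \<in> D" if "a \<in> D" "b \<in> D" for a b using D that by (simp add: subspace_diff)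
  have TG: "nm (T (G y)) = nm y" if "y \<in> V" for y
    by (rule nm_null_eq) (use that G T in auto)
  have "\<exists>x\<in>V. nm (x + S (G x) - y) = 0"
  proof (rule neumann[OF _ _ _ q y])
    fix x assume x: "x \<in> V"
    show "S (G x) \<in> V" using x G S by blast
    show "nm (S (G x)) \<le> q * nm x" using bd[of "G x"] x G TG by auto
  next
    fix u v assume uv: "u \<in> V" "v \<in> V"
    let ?w = "G (u + v) - G u" let ?z = "?w - G v"
    have inD: "G (u + v) \<in> D" "G u \<in> D" "G v \<in> D" "?w \<in> D" "?z \<in> D"
      using uv G Dd by auto
    \<comment> \<open>\<open>?z\<close> is the defect of additivity of \<open>G\<close>. It has null
      image under \<open>T\<close>, and the bound of \<open>S\<close> by \<open>T\<close> then makes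
      \<open>S ?z\<close> null, even if \<open>?z\<close> itself has positive norm.\<close>
    have Tz: "nm (T ?z) = 0"
    proof -
      have inV: "T ?z \<in> V" "T ?w \<in> V" "T (G (u + v)) \<in> V" "T (G u) \<in> V" "T (G v) \<in> V"
        using inD T by auto
      let ?n1 = "T ?z - (T ?w - T (G v))" and ?n2 = "T ?w - (T (G (u + v)) - T (G u))"
      let ?n3 = "T (G (u + v)) - (u + v)" and ?n4 = "T (G u) - u" and ?n5 = "T (G v) - v"
      have eq: "T ?z = ((?n1 + ?n2) + ?n3) - (?n4 + ?n5)" by (simp add: algebra_simps)
      have n: "nm ?n1 = 0" "nm ?n2 = 0" "nm ?n3 = 0" "nm ?n4 = 0" "nm ?n5 = 0"
        using Tadd inD G uv by auto
      show ?thesis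
        by (subst eq) (intro nm_null_add n V_closed inV uv)
    qed
    have Sz: "nm (S ?z) = 0" using bd[OF inD(5)] Tz S[OF inD(5)] nm_nonneg[of "S ?z"]
      by (intro antisym) auto
    have inV: "S ?z \<in> V" "S ?w \<in> V" "S (G (u + v)) \<in> V" "S (G u) \<in> V" "S (G v) \<in> V"
      using inD S by auto
    let ?n1 = "S ?z - (S ?w - S (G v))" and ?n2 = "S ?w - (S (G (u + v)) - S (G u))"
    have eq: "S (G (u + v)) - S (G u) - S (G v) = (S ?z - ?n1) - ?n2" by (simp add: algebra_simps)
    show "nm (S (G (u + v)) - S (G u) - S (G v)) = 0"
      by (subst eq) (intro nm_null_add V_closed inV Sz Sadd inD)
  qed
  then obtain x where x: "x \<in> V" "nm (x + S (G x) - y) = 0" by blast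
  have eq: "T (G x) + S (G x) - y = (T (G x) - x) + (x + S (G x) - y)" by (simp add: algebra_simps)
  have "nm (T (G x) + S (G x) - y) = 0"
    by (subst eq) (intro nm_null_add V_closed T S G x y)
  then show ?thesis using G x by blast
qed

text \<open>These are the real points outside \<open>spec_H\<close>, with equality modulo null
  vectors in place of a vanishing \<open>fnorm2\<close>; \<open>real_spectrum_eq\<close> makes the
  identification.\<close>

definition resolvent_pt :: "'v set \<Rightarrow> ('v \<Rightarrow> 'v) \<Rightarrow> real \<Rightarrow> bool" where
  "resolvent_pt D H r \<longleftrightarrow> (\<forall>y\<in>V. \<exists>x\<in>D. nm (H x - r *\<^sub>R x - y) = 0)
     \<and> (\<exists>C. \<forall>x\<in>D. nm x \<le> C * nm (H x - r *\<^sub>R x))"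

text \<open>Cauchy-Schwarz for \<open>ip x (y - r *\<^sub>R x)\<close>, with \<open>y\<close> in the
  role of \<open>H x\<close>. For \<open>r\<close> below a form bound it is the quantitative
  injectivity that a resolvent point needs.\<close>

lemma form_lower_bound_injective:
  assumes "x \<in> V" "y \<in> V" and low: "ip x y \<ge> a * ip x x"
  shows "(a - r) * nm x \<le> nm (y - r *\<^sub>R x)"
proof (cases "nm x = 0")
  case False
  then have pos: "nm x > 0" using nm_nonneg[OF assms(1)] by simp
  have "(a - r) * (nm x * nm x) \<le> ip x (y - r *\<^sub>R x)"
    using assms by (simp add: ip_diff2 ip_scale2 nm_sq power2_eq_square[symmetric] algebra_simps)
  also have "\<dots> \<le> nm x * nm (y - r *\<^sub>R x)"
    using ip_cauchy_schwarz[of x "y - r *\<^sub>R x"] assms by simp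
  finally have "nm x * ((a - r) * nm x) \<le> nm x * nm (y - r *\<^sub>R x)" by (simp add: mult_ac)
  then show ?thesis using pos by simp
qed (use assms in simp)

text \<open>The number shown to lie in the spectrum is neither \<open>a\<close> nor \<open>b\<close>
  but the infimum \<open>c\<close> of the Rayleigh quotients. The form bound and the trial vector
  place \<open>c\<close> between \<open>a\<close> and \<open>b\<close>, and all points below
  \<open>a\<close> are resolvent points. Self-adjointness enters through symmetry together with
  surjectivity of \<open>H - r\<close> for \<open>r \<le> R\<close>.\<close>

theorem Inf_spectrum_between:
  assumes D: "subspace D" "D \<subseteq> V"
    and H: "\<And>x. x \<in> D \<Longrightarrow> H x \<in> V"
    and Hadd: "\<And>x y c. x \<in> D \<Longrightarrow> y \<in> D \<Longrightarrow> nm (H (x + c *\<^sub>R y) - (H x + c *\<^sub>R H y)) = 0"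
    and sym: "\<And>x y. x \<in> D \<Longrightarrow> y \<in> D \<Longrightarrow> ip (H x) y = ip x (H y)"
    and low: "\<And>x. x \<in> D \<Longrightarrow> ip x (H x) \<ge> a * ip x x"
    and surj: "\<And>r y. r \<le> R \<Longrightarrow> y \<in> V \<Longrightarrow> \<exists>x\<in>D. nm (H x - r *\<^sub>R x - y) = 0"
    and trial: "x0 \<in> D" "ip x0 x0 > 0" "ip x0 (H x0) \<le> b * ip x0 x0"
  shows "a \<le> Inf {r. \<not> resolvent_pt D H r}" "Inf {r. \<not> resolvent_pt D H r} \<le> b"
proof -
  have DV: "x \<in> V" if "x \<in> D" for x using that D by auto
  have Dc: "x - y \<in> D" "x + y \<in> D" "c *\<^sub>R x \<in> D" if "x \<in> D" "y \<in> D" for x y c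
    using D that by (auto simp: subspace_diff subspace_add subspace_scale)
  have Hip: "ip z (H (x + c *\<^sub>R y)) = ip z (H x) + c * ip z (H y)"
    if "x \<in> D" "y \<in> D" "z \<in> V" for x y z c
  proof -
    have "ip z (H (x + c *\<^sub>R y) - (H x + c *\<^sub>R H y)) = 0"
      by (rule ip_null) (use that Hadd H Dc in auto)
    then show ?thesis using that H Dc
      by (simp add: ip_diff2 ip_add2 ip_scale2)
  qed
  have below: "resolvent_pt D H r" if r: "r < a" for r
  proof -
    have bd: "(a - s) * nm x \<le> nm (H x - s *\<^sub>R x)" if "x \<in> D" for x s
      by (rule form_lower_bound_injective) (use that DV H low in auto)
    have "\<exists>x\<in>D. nm (H x - r *\<^sub>R x - y) = 0" if y: "y \<in> V" for y
    proof (cases "r \<le> R")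
      case True then show ?thesis using surj y by blast
    next
      case False
      \<comment> \<open>One perturbation step leads from \<open>R\<close> up to \<open>r\<close>: by
        the form bound, \<open>(a - R) * nm x\<close> is at most the norm of
        \<open>H x - R *\<^sub>R x\<close>, so the shift by \<open>r - R < a - R\<close> has
        relative bound below 1.\<close>
      let ?T = "\<lambda>x. H x - R *\<^sub>R x" and ?S = "\<lambda>x. (R - r) *\<^sub>R x"
      have "\<exists>x\<in>D. nm (?T x + ?S x - y) = 0"
      proof (rule perturbation_surj[OF D, where T = ?T and S = ?S and q = "(r - R) / (a - R)"])
        fix x assume x: "x \<in> D"
        show "?T x \<in> V" "?S x \<in> V" using x H DV by auto
        have "nm (?S x) = (r - R) * nm x" using x DV False by (simp add: nm_scale)
        also have "\<dots> = (r - R) / (a - R) * ((a - R) * nm x)" using r False by simp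
        also have "\<dots> \<le> (r - R) / (a - R) * nm (?T x)"
          using bd[OF x, of R] r False by (intro mult_left_mono) auto
        finally show "nm (?S x) \<le> (r - R) / (a - R) * nm (?T x)" .
      next
        fix u v assume uv: "u \<in> D" "v \<in> D"
        have "?T (u - v) - (?T u - ?T v) = H (u + (-1) *\<^sub>R v) - (H u + (-1) *\<^sub>R H v)"
          by (simp add: algebra_simps)
        then show "nm (?T (u - v) - (?T u - ?T v)) = 0" using Hadd[OF uv, of "-1"] by metis
        show "nm (?S (u - v) - (?S u - ?S v)) = 0"
          by (simp add: scaleR_diff_right)
      next
        show "\<exists>x\<in>D. nm (?T x - y) = 0" if "y \<in> V" for y using surj[of R] that by auto
      qed (use r False y in auto)
      then show ?thesis by (simp add: algebra_simps)
    qed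
    moreover have "nm x \<le> (1 / (a - r)) * nm (H x - r *\<^sub>R x)" if "x \<in> D" for x
      using bd[OF that, of r] r by (simp add: field_simps)
    ultimately show ?thesis unfolding resolvent_pt_def by blast
  qed
  define N where "N = {ip x (H x) / ip x x | x. x \<in> D \<and> ip x x > 0}"
  define c where "c = Inf N"
  have N: "ip x0 (H x0) / ip x0 x0 \<in> N" using trial by (auto simp: N_def)
  have Nlow: "z \<ge> a" if "z \<in> N" for z
    using that low by (auto simp: N_def field_simps)
  have bddN: "bdd_below N" by (rule bdd_belowI[of _ a]) (rule Nlow)
  have "c \<le> ip x0 (H x0) / ip x0 x0" unfolding c_def by (rule cInf_lower[OF N bddN])
  also have "\<dots> \<le> b" using trial by (simp add: field_simps)
  finally have cb: "c \<le> b" .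
  have pos: "ip x (H x) - c * ip x x \<ge> 0" if x: "x \<in> D" for x
  proof (cases "ip x x > 0")
    case True
    then have "c \<le> ip x (H x) / ip x x"
      unfolding c_def by (intro cInf_lower[OF _ bddN]) (use x in \<open>auto simp: N_def\<close>)
    then show ?thesis using True by (simp add: field_simps)
  next
    case False
    then have "ip x x = 0" using ip_nonneg[OF DV[OF x]] by simp
    then have "ip x (H x) = 0"
      using ip_null[of "H x" x] H DV x ip_sym by (simp add: nm_def)
    then show ?thesis using \<open>ip x x = 0\<close> by simp
  qed
  \<comment> \<open>If \<open>c\<close> were a resolvent point, bounded invertibility of
    \<open>H - c\<close> would push all Rayleigh quotients above \<open>c + 1 / K\<close>, against
    the choice of \<open>c\<close>.\<close>
  have "\<not> resolvent_pt D H c"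
  proof
    assume "resolvent_pt D H c"
    then obtain C where surj_c: "\<And>y. y \<in> V \<Longrightarrow> \<exists>x\<in>D. nm (H x - c *\<^sub>R x - y) = 0"
      and C: "\<And>x. x \<in> D \<Longrightarrow> nm x \<le> C * nm (H x - c *\<^sub>R x)"
      unfolding resolvent_pt_def by blast
    \<comment> \<open>The maximum with 1 makes the constant positive whatever \<open>C\<close>
      is.\<close>
    define K where "K = max C 1"
    have gap: "ip x x \<le> K * (ip x (H x) - c * ip x x)" if x: "x \<in> D" for x
    proof -
      \<comment> \<open>\<open>u\<close> is a preimage of \<open>x\<close> under
        \<open>H - c\<close>, so the nonnegative form \<open>Q\<close> below satisfies
        \<open>Q x u = ip x x\<close> and \<open>Q u u = ip u x\<close>. Cauchy-Schwarz for
        \<open>Q\<close> bounds \<open>(ip x x)\<^sup>2\<close> by \<open>Q x x * Q u u\<close>, and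
        \<open>Q u u\<close> is at most \<open>K * ip x x\<close>; dividing by \<open>ip x x\<close>
        gives the gap.\<close>
      obtain u where u: "u \<in> D" "nm (H u - c *\<^sub>R u - x) = 0" using surj_c DV x by blast
      define Q where "Q v w = ip v (H w) - c * ip v w" for v w
      have in_V: "x \<in> V" "u \<in> V" "H x \<in> V" "H u \<in> V" using x u DV H by auto
      have ipx: "ip v (H u - c *\<^sub>R u - x) = 0" if "v \<in> V" for v
        by (rule ip_null) (use that u in_V in auto)
      have Qxu: "Q x u = ip x x" and Quu: "Q u u = ip u x"
        using ipx[of x] ipx[of u] in_V by (simp_all add: Q_def ip_diff2 ip_scale2)
      have "0 \<le> Q x x + 2 * t * Q x u + t\<^sup>2 * Q u u" for t
      proof -
        have tu: "t *\<^sub>R u \<in> D" "x + t *\<^sub>R u \<in> D" using u x D by (auto simp: subspace_add subspace_scale)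
        have sym': "ip u (H x) = ip x (H u)" using sym[OF u(1) x] in_V ip_sym by simp
        have lin: "ip (x + t *\<^sub>R u) w = ip x w + t * ip u w" if "w \<in> V" for w
          using that in_V by (simp add: ip_add ip_scale)
        have lin2: "ip w (x + t *\<^sub>R u) = ip w x + t * ip w u" if "w \<in> V" for w
          using that in_V by (simp add: ip_add2 ip_scale2)
        have h: "ip (x + t *\<^sub>R u) (H (x + t *\<^sub>R u))
            = ip x (H x) + t * ip u (H x) + t * (ip x (H u) + t * ip u (H u))"
          unfolding Hip[OF x u(1) DV[OF tu(2)]] lin[OF in_V(3)] lin[OF in_V(4)] ..
        have n: "ip (x + t *\<^sub>R u) (x + t *\<^sub>R u) = ip x x + t * ip x u + t * (ip u x + t * ip u u)"
          unfolding lin[OF DV[OF tu(2)]] lin2[OF in_V(1)] lin2[OF in_V(2)] ..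
        have "0 \<le> ip x (H x) + t * ip u (H x) + t * (ip x (H u) + t * ip u (H u))
            - c * (ip x x + t * ip x u + t * (ip u x + t * ip u u))"
          using pos[OF tu(2)] unfolding h n .
        also have "\<dots> = Q x x + 2 * t * Q x u + t\<^sup>2 * Q u u"
          unfolding Q_def sym' ip_sym[OF in_V(2,1)] by algebra
        finally show ?thesis .
      qed
      then have cs: "(Q x u)\<^sup>2 \<le> Q x x * Q u u"
        by (rule discriminant_le) (use pos[OF u(1)] in \<open>simp add: Q_def\<close>)
      have nmu: "nm u \<le> K * nm x"
      proof -
        have "nm (H u - c *\<^sub>R u) = nm x" by (rule nm_null_eq) (use in_V u in auto)
        then have "nm u \<le> C * nm x" using C[OF u(1)] by simp
        also have "\<dots> \<le> K * nm x" using in_V by (intro mult_right_mono) (auto simp: K_def)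
        finally show ?thesis .
      qed
      have "Q u u \<le> nm u * nm x" unfolding Quu using ip_cauchy_schwarz[of u x] in_V by simp
      also have "\<dots> \<le> K * nm x * nm x" using nmu in_V by (intro mult_right_mono) auto
      finally have Qu: "Q u u \<le> K * ip x x" using in_V by (simp add: nm_sq[symmetric] power2_eq_square)
      have Qx: "Q x x \<ge> 0" using pos[OF x] by (simp add: Q_def)
      have "(ip x x)\<^sup>2 \<le> Q x x * (K * ip x x)"
        using order_trans[OF cs mult_left_mono[OF Qu Qx]] by (simp only: Qxu)
      then have "ip x x * ip x x \<le> ip x x * (K * Q x x)" by (simp add: power2_eq_square mult_ac)
      moreover have "ip x x \<ge> 0" "K > 0" using ip_nonneg in_V by (auto simp: K_def)
      ultimately have "ip x x \<le> K * Q x x"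
        using Qx by (metis less_eq_real_def mult_le_cancel_left_pos mult_nonneg_nonneg)
      then show ?thesis by (simp only: Q_def)
    qed
    have "c + 1 / K \<le> z" if zN: "z \<in> N" for z
    proof -
      obtain x where x: "x \<in> D" "ip x x > 0" "z = ip x (H x) / ip x x" using zN unfolding N_def by blast
      have "K > 0" by (simp add: K_def)
      with gap[OF x(1)] have "ip x x / K \<le> ip x (H x) - c * ip x x" by (simp add: field_simps)
      then have "(c + 1 / K) * ip x x \<le> ip x (H x)" by (simp add: algebra_simps)
      then show ?thesis using x by (simp add: pos_le_divide_eq)
    qed
    then have "c + 1 / K \<le> c" unfolding c_def using N by (intro cInf_greatest) auto
    moreover have "K > 0" by (simp add: K_def)
    ultimately show False by simp
  qed
  then have cin: "c \<in> {r. \<not> resolvent_pt D H r}" by simp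
  have lows: "a \<le> z" if "z \<in> {r. \<not> resolvent_pt D H r}" for z
    using below[of z] that by (cases "z < a") auto
  show "a \<le> Inf {r. \<not> resolvent_pt D H r}" using cin lows by (intro cInf_greatest) auto
  have "Inf {r. \<not> resolvent_pt D H r} \<le> c"
    using cin by (rule cInf_lower) (rule bdd_belowI[of _ a], rule lows)
  then show "Inf {r. \<not> resolvent_pt D H r} \<le> b" using cb by simp
qed

end

section \<open>Disjoint sums of measures\<close>

text \<open>The direct sum of a family of measures. With photon number, polarisations and spins as
  the index it makes the Fock norm a single integral, so that L2 theory, Fubini and dominated
  convergence apply to all sectors at once.\<close>

definition dsum_measure :: "'d set \<Rightarrow> ('d \<Rightarrow> 'a measure) \<Rightarrow> ('d \<times> 'a) measure" where
  "dsum_measure D N = measure_of (SIGMA d:D. space (N d))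
     {A. A \<subseteq> (SIGMA d:D. space (N d)) \<and> (\<forall>d\<in>D. Pair d -` A \<in> sets (N d))}
     (\<lambda>A. \<integral>\<^sup>+ d. emeasure (N d) (Pair d -` A) \<partial>count_space D)"

lemma sigma_algebra_dsum:
  "sigma_algebra (SIGMA d:D. space (N d))
     {A. A \<subseteq> (SIGMA d:D. space (N d)) \<and> (\<forall>d\<in>D. Pair d -` A \<in> sets (N d))}"
proof (subst sigma_algebra_iff2, intro conjI ballI allI impI)
  fix A assume A: "A \<in> {A. A \<subseteq> (SIGMA d:D. space (N d)) \<and> (\<forall>d\<in>D. Pair d -` A \<in> sets (N d))}"
  have "Pair d -` ((SIGMA d:D. space (N d)) - A) = space (N d) - Pair d -` A" if "d \<in> D" for d
    using that by auto
  then show "(SIGMA d:D. space (N d)) - A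
      \<in> {A. A \<subseteq> (SIGMA d:D. space (N d)) \<and> (\<forall>d\<in>D. Pair d -` A \<in> sets (N d))}"
    using A by auto
qed (auto simp: vimage_Union vimage_UN)

lemma space_dsum [simp]: "space (dsum_measure D N) = (SIGMA d:D. space (N d))"
  unfolding dsum_measure_def by (rule space_measure_of) auto

lemma sets_dsum: "sets (dsum_measure D N)
    = {A. A \<subseteq> (SIGMA d:D. space (N d)) \<and> (\<forall>d\<in>D. Pair d -` A \<in> sets (N d))}"
  unfolding dsum_measure_def by (rule sigma_algebra.sets_measure_of_eq[OF sigma_algebra_dsum])

lemma emeasure_dsum:
  assumes "A \<in> sets (dsum_measure D N)"
  shows "emeasure (dsum_measure D N) A = (\<integral>\<^sup>+ d. emeasure (N d) (Pair d -` A) \<partial>count_space D)"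
proof (rule emeasure_measure_of[OF dsum_measure_def _ _ _ assms])
  show "countably_additive (sets (dsum_measure D N)) (\<lambda>A. \<integral>\<^sup>+ d. emeasure (N d) (Pair d -` A) \<partial>count_space D)"
  proof (rule countably_additiveI)
    fix A :: "nat \<Rightarrow> _" assume A: "range A \<subseteq> sets (dsum_measure D N)" "disjoint_family A"
    have *: "emeasure (N d) (Pair d -` (\<Union>i. A i)) = (\<Sum>i. emeasure (N d) (Pair d -` A i))"
      if d: "d \<in> D" for d
      unfolding vimage_UN
      by (rule suminf_emeasure[symmetric]) (use A d in \<open>auto simp: sets_dsum disjoint_family_on_def, blast\<close>)
    have "(\<integral>\<^sup>+ d. emeasure (N d) (Pair d -` (\<Union>i. A i)) \<partial>count_space D)
       = (\<integral>\<^sup>+ d. (\<Sum>i. emeasure (N d) (Pair d -` A i)) \<partial>count_space D)"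
      by (intro nn_integral_cong) (simp add: *)
    also have "\<dots> = (\<Sum>i. \<integral>\<^sup>+ d. emeasure (N d) (Pair d -` A i) \<partial>count_space D)"
      by (intro nn_integral_suminf) auto
    finally show "(\<Sum>i. \<integral>\<^sup>+ d. emeasure (N d) (Pair d -` A i) \<partial>count_space D)
       = (\<integral>\<^sup>+ d. emeasure (N d) (Pair d -` (\<Union>i. A i)) \<partial>count_space D)" by simp
  qed
qed (auto simp: positive_def)

lemma measurable_Pair_dsum [measurable (raw)]:
  assumes "d \<in> D" shows "Pair d \<in> measurable (N d) (dsum_measure D N)"
proof (rule measurableI)
  fix A assume "A \<in> sets (dsum_measure D N)"
  then have "A \<subseteq> (SIGMA d:D. space (N d))" "Pair d -` A \<in> sets (N d)"
    using assms by (auto simp: sets_dsum)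
  moreover from this have "Pair d -` A \<inter> space (N d) = Pair d -` A" by auto
  ultimately show "Pair d -` A \<inter> space (N d) \<in> sets (N d)" by simp
qed (use assms in auto)

lemma measurable_dsum_iff:
  "f \<in> measurable (dsum_measure D N) M \<longleftrightarrow> (\<forall>d\<in>D. (\<lambda>x. f (d, x)) \<in> measurable (N d) M)"
proof
  assume "f \<in> measurable (dsum_measure D N) M"
  then show "\<forall>d\<in>D. (\<lambda>x. f (d, x)) \<in> measurable (N d) M"
    by (auto intro: measurable_compose[OF measurable_Pair_dsum])
next
  assume f: "\<forall>d\<in>D. (\<lambda>x. f (d, x)) \<in> measurable (N d) M"
  show "f \<in> measurable (dsum_measure D N) M"
  proof (rule measurableI)
    fix w assume "w \<in> space (dsum_measure D N)"
    then obtain d x where "w = (d, x)" "d \<in> D" "x \<in> space (N d)" by auto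
    then show "f w \<in> space M" using f measurable_space[of "\<lambda>x. f (d, x)" "N d" M x] by auto
  next
    fix A assume A: "A \<in> sets M"
    have "Pair d -` (f -` A \<inter> space (dsum_measure D N)) \<in> sets (N d)" if "d \<in> D" for d
    proof -
      have "Pair d -` (f -` A \<inter> space (dsum_measure D N)) = (\<lambda>x. f (d, x)) -` A \<inter> space (N d)"
        using that by auto
      then show ?thesis using measurable_sets[OF bspec[OF f that] A] by simp
    qed
    then show "f -` A \<inter> space (dsum_measure D N) \<in> sets (dsum_measure D N)"
      by (simp add: sets_dsum)
  qed
qed

lemma nn_integral_dsum:
  assumes "f \<in> borel_measurable (dsum_measure D N)"
  shows "(\<integral>\<^sup>+ w. f w \<partial>dsum_measure D N) = (\<integral>\<^sup>+ d. \<integral>\<^sup>+ x. f (d, x) \<partial>N d \<partial>count_space D)"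
  using assms
proof (induction f rule: borel_measurable_induct)
  case (cong f g)
  have "(\<integral>\<^sup>+ d. \<integral>\<^sup>+ x. f (d, x) \<partial>N d \<partial>count_space D) = (\<integral>\<^sup>+ d. \<integral>\<^sup>+ x. g (d, x) \<partial>N d \<partial>count_space D)"
    using cong(3) by (intro nn_integral_cong) auto
  with cong show ?case by (metis nn_integral_cong)
next
  case (set A)
  have "(\<integral>\<^sup>+ x. indicator A (d, x) \<partial>N d) = emeasure (N d) (Pair d -` A)" if "d \<in> D" for d
  proof -
    have "(\<integral>\<^sup>+ x. indicator A (d, x) \<partial>N d) = (\<integral>\<^sup>+ x. indicator (Pair d -` A) x \<partial>N d)"
      by (intro nn_integral_cong) (simp add: indicator_def)
    then show ?thesis using set that by (simp add: sets_dsum)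
  qed
  then show ?case using set by (simp add: emeasure_dsum cong: nn_integral_cong_simp)
next
  case (mult u c)
  then have "(\<lambda>x. u (d, x)) \<in> borel_measurable (N d)" if "d \<in> D" for d
    using that by (simp add: measurable_dsum_iff)
  then have "(\<integral>\<^sup>+ d. \<integral>\<^sup>+ x. c * u (d, x) \<partial>N d \<partial>count_space D)
      = (\<integral>\<^sup>+ d. c * \<integral>\<^sup>+ x. u (d, x) \<partial>N d \<partial>count_space D)"
    by (intro nn_integral_cong nn_integral_cmult) auto
  then show ?case using mult by (simp add: nn_integral_cmult)
next
  case (add u v)
  then have "(\<lambda>x. u (d, x)) \<in> borel_measurable (N d)" "(\<lambda>x. v (d, x)) \<in> borel_measurable (N d)"
    if "d \<in> D" for d using that by (simp_all add: measurable_dsum_iff)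
  then have "(\<integral>\<^sup>+ d. \<integral>\<^sup>+ x. v (d, x) + u (d, x) \<partial>N d \<partial>count_space D)
      = (\<integral>\<^sup>+ d. (\<integral>\<^sup>+ x. v (d, x) \<partial>N d) + (\<integral>\<^sup>+ x. u (d, x) \<partial>N d) \<partial>count_space D)"
    by (intro nn_integral_cong nn_integral_add) auto
  then show ?case using add by (simp add: nn_integral_add)
next
  case (seq U)
  then have m: "(\<lambda>x. U i (d, x)) \<in> borel_measurable (N d)" if "d \<in> D" for d i
    using that by (simp add: measurable_dsum_iff)
  have inc: "incseq (\<lambda>i x. U i (d, x))" for d
    using \<open>incseq U\<close> by (auto simp: incseq_def le_fun_def)
  have "(\<integral>\<^sup>+ w. (SUP i. U i) w \<partial>dsum_measure D N) = (SUP i. \<integral>\<^sup>+ w. U i w \<partial>dsum_measure D N)"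
    unfolding SUP_apply using seq by (intro nn_integral_monotone_convergence_SUP) auto
  also have "\<dots> = (SUP i. \<integral>\<^sup>+ d. \<integral>\<^sup>+ x. U i (d, x) \<partial>N d \<partial>count_space D)"
    using seq by simp
  also have "\<dots> = (\<integral>\<^sup>+ d. (SUP i. \<integral>\<^sup>+ x. U i (d, x) \<partial>N d) \<partial>count_space D)"
    using inc by (intro nn_integral_monotone_convergence_SUP[symmetric])
      (auto simp: incseq_def le_fun_def intro!: nn_integral_mono)
  also have "\<dots> = (\<integral>\<^sup>+ d. \<integral>\<^sup>+ x. (SUP i. U i (d, x)) \<partial>N d \<partial>count_space D)"
    using inc m by (intro nn_integral_cong nn_integral_monotone_convergence_SUP[symmetric]) auto
  finally show ?case by (simp add: SUP_apply image_comp)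
qed

text \<open>Sections of a null set are null because counting measure charges every index.
  Conversely, exceptional sets chosen in each summand are glued into one set, which is measurable
  because its sections are.\<close>

lemma AE_dsum_iff: "(AE w in dsum_measure D N. Q w) \<longleftrightarrow> (\<forall>d\<in>D. AE x in N d. Q (d, x))"
proof
  assume "AE w in dsum_measure D N. Q w"
  then obtain Z where Z: "Z \<in> sets (dsum_measure D N)" "emeasure (dsum_measure D N) Z = 0"
     "{w \<in> space (dsum_measure D N). \<not> Q w} \<subseteq> Z" by (auto elim: AE_E)
  show "\<forall>d\<in>D. AE x in N d. Q (d, x)"
  proof
    fix d assume d: "d \<in> D"
    have "AE d in count_space D. emeasure (N d) (Pair d -` Z) = 0"
      using Z by (simp add: emeasure_dsum nn_integral_0_iff_AE)
    then have "emeasure (N d) (Pair d -` Z) = 0" using d by (simp add: AE_count_space)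
    moreover have "Pair d -` Z \<in> sets (N d)" using Z d by (simp add: sets_dsum)
    moreover have "{x \<in> space (N d). \<not> Q (d, x)} \<subseteq> Pair d -` Z" using Z d by auto
    ultimately show "AE x in N d. Q (d, x)" by (intro AE_I)
  qed
next
  assume "\<forall>d\<in>D. AE x in N d. Q (d, x)"
  then have "\<forall>d\<in>D. \<exists>Z. Z \<in> sets (N d) \<and> emeasure (N d) Z = 0 \<and> {x \<in> space (N d). \<not> Q (d, x)} \<subseteq> Z"
    by (auto simp: eventually_ae_filter null_sets_def Bex_def)
  then obtain Z where Z: "\<And>d. d \<in> D \<Longrightarrow> Z d \<in> sets (N d)" "\<And>d. d \<in> D \<Longrightarrow> emeasure (N d) (Z d) = 0"
     "\<And>d. d \<in> D \<Longrightarrow> {x \<in> space (N d). \<not> Q (d, x)} \<subseteq> Z d" by metis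
  have pre: "Pair d -` (SIGMA d:D. Z d) = Z d" if "d \<in> D" for d using that by auto
  have meas: "(SIGMA d:D. Z d) \<in> sets (dsum_measure D N)"
    using Z(1)[THEN sets.sets_into_space] Z(1) pre by (auto simp: sets_dsum)
  show "AE w in dsum_measure D N. Q w"
  proof (rule AE_I[OF _ _ meas])
    show "emeasure (dsum_measure D N) (SIGMA d:D. Z d) = 0"
      using meas pre Z by (simp add: emeasure_dsum nn_integral_0_iff_AE AE_count_space)
  qed (use Z in auto)
qed

lemma integrable_dsumD:
  fixes f :: "_ \<Rightarrow> real"
  assumes "integrable (dsum_measure D N) f" "d \<in> D" shows "integrable (N d) (\<lambda>x. f (d, x))"
proof (rule integrableI_bounded)
  have m: "f \<in> borel_measurable (dsum_measure D N)" using assms by auto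
  then show "(\<lambda>x. f (d, x)) \<in> borel_measurable (N d)" using assms by (simp add: measurable_dsum_iff)
  have "(\<integral>\<^sup>+ x. norm (f (d, x)) \<partial>N d) \<le> (\<integral>\<^sup>+ d. \<integral>\<^sup>+ x. norm (f (d, x)) \<partial>N d \<partial>count_space D)"
    by (rule nn_integral_ge_point[OF assms(2)])
  also have "\<dots> = (\<integral>\<^sup>+ w. norm (f w) \<partial>dsum_measure D N)"
    using m by (subst nn_integral_dsum) auto
  also have "\<dots> < \<infinity>" using assms by (simp add: integrable_iff_bounded)
  finally show "(\<integral>\<^sup>+ x. norm (f (d, x)) \<partial>N d) < \<infinity>" .
qed

lemma integral_dsum:
  fixes f :: "_ \<Rightarrow> real"
  assumes f: "integrable (dsum_measure D N) f"
  shows "(\<integral> w. f w \<partial>dsum_measure D N) = (\<integral> d. (\<integral> x. f (d, x) \<partial>N d) \<partial>count_space D)"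
proof -
  have nonneg: "integrable (count_space D) (\<lambda>d. \<integral> x. g (d, x) \<partial>N d)
      \<and> (\<integral> w. g w \<partial>dsum_measure D N) = (\<integral> d. (\<integral> x. g (d, x) \<partial>N d) \<partial>count_space D)"
    if g: "integrable (dsum_measure D N) g" "\<And>w. g w \<ge> 0" for g :: "_ \<Rightarrow> real"
  proof -
    have "(\<integral>\<^sup>+ w. ennreal (g w) \<partial>dsum_measure D N) = (\<integral>\<^sup>+ d. \<integral>\<^sup>+ x. ennreal (g (d, x)) \<partial>N d \<partial>count_space D)"
      using g by (intro nn_integral_dsum) auto
    also have "\<dots> = (\<integral>\<^sup>+ d. ennreal (\<integral> x. g (d, x) \<partial>N d) \<partial>count_space D)"
      using g integrable_dsumD[OF g(1)] by (intro nn_integral_cong nn_integral_eq_integral) auto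
    finally have eq: "(\<integral>\<^sup>+ w. ennreal (g w) \<partial>dsum_measure D N) = (\<integral>\<^sup>+ d. ennreal (\<integral> x. g (d, x) \<partial>N d) \<partial>count_space D)" .
    have fin: "(\<integral>\<^sup>+ w. ennreal (g w) \<partial>dsum_measure D N) = ennreal (\<integral> w. g w \<partial>dsum_measure D N)"
      using g by (intro nn_integral_eq_integral) auto
    have int: "integrable (count_space D) (\<lambda>d. \<integral> x. g (d, x) \<partial>N d)"
      using eq fin g by (intro integrableI_nonneg) (auto simp: less_top[symmetric])
    then have "ennreal (\<integral> w. g w \<partial>dsum_measure D N) = ennreal (\<integral> d. (\<integral> x. g (d, x) \<partial>N d) \<partial>count_space D)"
      using eq fin g nn_integral_eq_integral[OF int] by simp
    then show ?thesis using int g by (simp add: integral_nonneg_AE)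
  qed
  let ?p = "\<lambda>w. max 0 (f w)" and ?m = "\<lambda>w. max 0 (- f w)"
  have ip: "integrable (dsum_measure D N) ?p" and im: "integrable (dsum_measure D N) ?m" using f by auto
  have split: "f w = ?p w - ?m w" for w by auto
  have "(\<integral> w. f w \<partial>dsum_measure D N) = (\<integral> w. ?p w \<partial>dsum_measure D N) - (\<integral> w. ?m w \<partial>dsum_measure D N)"
    by (subst Bochner_Integration.integral_diff[OF ip im, symmetric]) (simp flip: split)
  also have "\<dots> = (\<integral> d. (\<integral> x. ?p (d, x) \<partial>N d) - (\<integral> x. ?m (d, x) \<partial>N d) \<partial>count_space D)"
    using nonneg[OF ip] nonneg[OF im] by simp
  also have "\<dots> = (\<integral> d. (\<integral> x. f (d, x) \<partial>N d) \<partial>count_space D)"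
  proof (rule Bochner_Integration.integral_cong[OF refl])
    fix d assume "d \<in> space (count_space D)"
    then have "integrable (N d) (\<lambda>x. ?p (d, x))" "integrable (N d) (\<lambda>x. ?m (d, x))"
      using integrable_dsumD[OF ip] integrable_dsumD[OF im] by auto
    then show "(\<integral> x. ?p (d, x) \<partial>N d) - (\<integral> x. ?m (d, x) \<partial>N d) = (\<integral> x. f (d, x) \<partial>N d)"
      by (subst Bochner_Integration.integral_diff[symmetric]) (auto simp flip: split)
  qed
  finally show ?thesis .
qed

text \<open>Used with \<open>L\<close> as the Lebesgue measure of one extra momentum: the
  annihilated photon is integrated out while the sector index stays fixed. The classical theorem is
  applied in each sector, and absolute integrability over all sectors allows the results to be
  added.\<close>

lemma Fubini_dsum:
  fixes f :: "'d \<times> ('k \<times> 'a) \<Rightarrow> real"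
  assumes L: "sigma_finite_measure L" and N: "\<And>d. d \<in> D \<Longrightarrow> sigma_finite_measure (N d)"
    and f: "integrable (dsum_measure D (\<lambda>d. L \<Otimes>\<^sub>M N d)) f"
  shows "integrable (dsum_measure D N) (\<lambda>(d, x). \<integral> k. f (d, (k, x)) \<partial>L)"
    and "(\<integral> w. f w \<partial>dsum_measure D (\<lambda>d. L \<Otimes>\<^sub>M N d)) = (\<integral> w. (case w of (d, x) \<Rightarrow> \<integral> k. f (d, (k, x)) \<partial>L) \<partial>dsum_measure D N)"
proof -
  interpret L: sigma_finite_measure L by fact
  have m: "f \<in> borel_measurable (dsum_measure D (\<lambda>d. L \<Otimes>\<^sub>M N d))" using f by auto
  have md: "(\<lambda>z. f (d, z)) \<in> borel_measurable (L \<Otimes>\<^sub>M N d)" if "d \<in> D" for d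
    using m that by (simp add: measurable_dsum_iff)
  have int: "integrable (L \<Otimes>\<^sub>M N d) (\<lambda>z. f (d, z))" if "d \<in> D" for d
    by (rule integrable_dsumD[OF f that])
  have mg: "(\<lambda>(d, x). \<integral> k. f (d, (k, x)) \<partial>L) \<in> borel_measurable (dsum_measure D N)"
    unfolding measurable_dsum_iff
  proof (intro ballI, unfold prod.case)
    fix d assume d [simp]: "d \<in> D"
    have [measurable]: "(\<lambda>z. f (d, z)) \<in> borel_measurable (L \<Otimes>\<^sub>M N d)" by (rule md) simp
    show "(\<lambda>x. \<integral> k. f (d, (k, x)) \<partial>L) \<in> borel_measurable (N d)" by measurable
  qed
  have pair: "pair_sigma_finite L (N d)" if "d \<in> D" for d
    using L N[OF that] by (simp add: pair_sigma_finite_def)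
  define h where "h = (\<lambda>w. case w of (d, x) \<Rightarrow> \<integral> k. f (d, (k, x)) \<partial>L)"
  have mh: "h \<in> borel_measurable (dsum_measure D N)" using mg by (simp add: h_def)
  have g: "integrable (dsum_measure D N) h"
  proof (rule integrableI_bounded[OF mh])
    have mn: "(\<lambda>w. ennreal (norm (h w))) \<in> borel_measurable (dsum_measure D N)"
      by (intro measurable_compose[OF measurable_compose[OF mh borel_measurable_norm]] measurable_ennreal)
    have "(\<integral>\<^sup>+ w. ennreal (norm (h w)) \<partial>dsum_measure D N)
        = (\<integral>\<^sup>+ d. \<integral>\<^sup>+ x. ennreal (norm (\<integral> k. f (d, (k, x)) \<partial>L)) \<partial>N d \<partial>count_space D)"
      unfolding nn_integral_dsum[OF mn] by (simp only: h_def prod.case)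
    also have "\<dots> \<le> (\<integral>\<^sup>+ d. \<integral>\<^sup>+ x. \<integral>\<^sup>+ k. ennreal (norm (f (d, (k, x)))) \<partial>L \<partial>N d \<partial>count_space D)"
    proof (rule nn_integral_mono, rule nn_integral_mono)
      fix d x assume "d \<in> space (count_space D)" and x: "x \<in> space (N d)"
      show "ennreal (norm (\<integral> k. f (d, (k, x)) \<partial>L)) \<le> (\<integral>\<^sup>+ k. ennreal (norm (f (d, (k, x)))) \<partial>L)"
      \<comment> \<open>Where the inner integral diverges, its default value 0 satisfies the
        bound.\<close>
      proof (cases "integrable L (\<lambda>k. f (d, (k, x)))")
        case True then show ?thesis by (rule integral_norm_bound_ennreal)
      qed (simp add: not_integrable_integral_eq)
    qed
    also have "\<dots> = (\<integral>\<^sup>+ d. \<integral>\<^sup>+ z. ennreal (norm (f (d, z))) \<partial>(L \<Otimes>\<^sub>M N d) \<partial>count_space D)"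
    proof (rule nn_integral_cong)
      fix d assume "d \<in> space (count_space D)"
      then have d: "d \<in> D" by simp
      have "(\<lambda>z. ennreal (norm (f (d, z)))) \<in> borel_measurable (L \<Otimes>\<^sub>M N d)"
        by (intro measurable_compose[OF measurable_compose[OF md[OF d] borel_measurable_norm]] measurable_ennreal)
      from pair_sigma_finite.nn_integral_snd[OF pair[OF d] this]
      show "(\<integral>\<^sup>+ x. \<integral>\<^sup>+ k. ennreal (norm (f (d, (k, x)))) \<partial>L \<partial>N d) = (\<integral>\<^sup>+ z. ennreal (norm (f (d, z))) \<partial>(L \<Otimes>\<^sub>M N d))" .
    qed
    also have "\<dots> = (\<integral>\<^sup>+ w. ennreal (norm (f w)) \<partial>dsum_measure D (\<lambda>d. L \<Otimes>\<^sub>M N d))"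
      by (rule nn_integral_dsum[symmetric],
          intro measurable_compose[OF measurable_compose[OF m borel_measurable_norm]] measurable_ennreal)
    also have "\<dots> < \<infinity>" using f by (simp add: integrable_iff_bounded)
    finally show "(\<integral>\<^sup>+ w. ennreal (norm (h w)) \<partial>dsum_measure D N) < \<infinity>" .
  qed
  then show "integrable (dsum_measure D N) (\<lambda>(d, x). \<integral> k. f (d, (k, x)) \<partial>L)" by (simp add: h_def)
  have "(\<integral> w. f w \<partial>dsum_measure D (\<lambda>d. L \<Otimes>\<^sub>M N d)) = (\<integral> d. (\<integral> z. f (d, z) \<partial>(L \<Otimes>\<^sub>M N d)) \<partial>count_space D)"
    by (rule integral_dsum[OF f])
  also have "\<dots> = (\<integral> d. (\<integral> x. (\<integral> k. f (d, (k, x)) \<partial>L) \<partial>N d) \<partial>count_space D)"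
  proof (rule Bochner_Integration.integral_cong[OF refl])
    fix d assume "d \<in> space (count_space D)"
    then have d: "d \<in> D" by simp
    have int': "integrable (L \<Otimes>\<^sub>M N d) (\<lambda>(k, x). f (d, (k, x)))"
      using int[OF d] by (simp add: case_prod_unfold)
    show "(\<integral> z. f (d, z) \<partial>(L \<Otimes>\<^sub>M N d)) = (\<integral> x. (\<integral> k. f (d, (k, x)) \<partial>L) \<partial>N d)"
      using pair_sigma_finite.integral_snd[OF pair[OF d] int'] by (simp add: case_prod_unfold)
  qed
  also have "\<dots> = (\<integral> w. (case w of (d, x) \<Rightarrow> \<integral> k. f (d, (k, x)) \<partial>L) \<partial>dsum_measure D N)"
    by (simp only: integral_dsum[OF g, unfolded h_def] prod.case)
  finally show "(\<integral> w. f w \<partial>dsum_measure D (\<lambda>d. L \<Otimes>\<^sub>M N d)) = (\<integral> w. (case w of (d, x) \<Rightarrow> \<integral> k. f (d, (k, x)) \<partial>L) \<partial>dsum_measure D N)" .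
qed

section \<open>Square-integrable functions\<close>

definition L2 :: "'w measure \<Rightarrow> ('w \<Rightarrow> complex) set" where
  "L2 M = {f \<in> borel_measurable M. integrable M (\<lambda>w. (cmod (f w))\<^sup>2)}"

text \<open>On complex numbers \<open>\<bullet>\<close> is the real part of the hermitian product,
  so this is the real part of the L2 inner product; the norm is the same.\<close>

definition l2ip :: "'w measure \<Rightarrow> ('w \<Rightarrow> complex) \<Rightarrow> ('w \<Rightarrow> complex) \<Rightarrow> real" where
  "l2ip M f g = (\<integral> w. f w \<bullet> g w \<partial>M)"

lemma L2_measurable: "f \<in> L2 M \<Longrightarrow> f \<in> borel_measurable M"
  by (simp add: L2_def)

lemma L2_iff: "f \<in> L2 M \<longleftrightarrow> f \<in> borel_measurable M \<and> (\<integral>\<^sup>+ w. ennreal ((cmod (f w))\<^sup>2) \<partial>M) < \<infinity>"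
  by (auto simp: L2_def integrable_iff_bounded)

lemma inner_le_half_squares: "\<bar>u \<bullet> v\<bar> \<le> ((norm u)\<^sup>2 + (norm v)\<^sup>2) / 2" for u v :: "'a::real_inner"
proof -
  have "\<bar>u \<bullet> v\<bar> \<le> norm u * norm v" by (rule Cauchy_Schwarz_ineq2)
  also have "\<dots> \<le> ((norm u)\<^sup>2 + (norm v)\<^sup>2) / 2"
    using sum_squares_bound[of "norm u" "norm v"] by simp
  finally show ?thesis .
qed

lemma L2_inner_integrable:
  assumes "f \<in> L2 M" "g \<in> L2 M" shows "integrable M (\<lambda>w. f w \<bullet> g w)"
proof (rule Bochner_Integration.integrable_bound)
  show "integrable M (\<lambda>w. ((cmod (f w))\<^sup>2 + (cmod (g w))\<^sup>2) / 2)"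
    using assms by (simp add: L2_def)
  show "(\<lambda>w. f w \<bullet> g w) \<in> borel_measurable M"
    using assms[THEN L2_measurable] by measurable
qed (use inner_le_half_squares in auto)

lemma norm_add_sq_le: "(norm (u + v))\<^sup>2 \<le> 2 * (norm u)\<^sup>2 + 2 * (norm v)\<^sup>2"
  for u v :: "'a::real_normed_vector"
proof -
  have "(norm (u + v))\<^sup>2 \<le> (norm u + norm v)\<^sup>2" by (intro power_mono norm_triangle_ineq) auto
  also have "\<dots> \<le> 2 * (norm u)\<^sup>2 + 2 * (norm v)\<^sup>2"
    using sum_squares_bound[of "norm u" "norm v"] by (simp add: power2_sum)
  finally show ?thesis .
qed

lemma subspace_L2: "subspace (L2 M)"
proof (rule subspaceI)
  fix f g assume fg: "f \<in> L2 M" "g \<in> L2 M"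
  have "integrable M (\<lambda>w. (cmod ((f + g) w))\<^sup>2)"
  proof (rule Bochner_Integration.integrable_bound)
    show "integrable M (\<lambda>w. 2 * (cmod (f w))\<^sup>2 + 2 * (cmod (g w))\<^sup>2)"
      using fg by (simp add: L2_def)
    show "(\<lambda>w. (cmod ((f + g) w))\<^sup>2) \<in> borel_measurable M"
      using fg[THEN L2_measurable] by simp
  qed (use norm_add_sq_le in auto)
  moreover have "f + g \<in> borel_measurable M"
    using fg[THEN L2_measurable] unfolding plus_fun_def by simp
  ultimately show "f + g \<in> L2 M" by (simp add: L2_def)
next
  fix c :: real and f assume f: "f \<in> L2 M"
  have "c *\<^sub>R f \<in> borel_measurable M"
    using f[THEN L2_measurable] unfolding scaleR_fun_def by simp
  then show "c *\<^sub>R f \<in> L2 M" using f by (simp add: L2_def power_mult_distrib)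
qed (simp add: L2_def zero_fun_def)

lemma l2ip_self: "l2ip M f f = (\<integral> w. (cmod (f w))\<^sup>2 \<partial>M)"
  by (simp add: l2ip_def power2_norm_eq_inner)

lemma l2ip_self_nn:
  assumes "f \<in> L2 M" shows "(\<integral>\<^sup>+ w. ennreal ((cmod (f w))\<^sup>2) \<partial>M) = ennreal (l2ip M f f)"
  using assms unfolding l2ip_self by (intro nn_integral_eq_integral) (auto simp: L2_def)

lemma semi_inner_L2: "semi_inner (L2 M) (l2ip M)"
proof
  fix f g h assume "f \<in> L2 M" "g \<in> L2 M" "h \<in> L2 M"
  then show "l2ip M (f + g) h = l2ip M f h + l2ip M g h"
    by (simp add: l2ip_def inner_add_left L2_inner_integrable)
qed (auto simp: subspace_L2 l2ip_def inner_commute)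

text \<open>The Riesz-Fischer argument, with the limit given as the pointwise series. The explicit
  \<open>g\<close> and the absolute convergence almost everywhere matter later: permutation symmetry
  and transversality are pointwise linear conditions and pass to this \<open>g\<close>
  directly.\<close>

lemma L2_series:
  fixes X :: "nat \<Rightarrow> 'w \<Rightarrow> complex"
  assumes X: "\<And>j. X j \<in> L2 M" and sum: "summable (\<lambda>j. sqrt (l2ip M (X j) (X j)))"
  defines "g \<equiv> (\<lambda>w. \<Sum>j. X j w)"
  shows "AE w in M. summable (\<lambda>j. cmod (X j w))" "g \<in> L2 M"
    "(\<lambda>n. sqrt (l2ip M (g - (\<Sum>j<n. X j)) (g - (\<Sum>j<n. X j)))) \<longlonglongrightarrow> 0"
proof -
  interpret semi_inner "L2 M" "l2ip M" by (rule semi_inner_L2)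
  have mX [measurable]: "X j \<in> borel_measurable M" for j using X by (rule L2_measurable)
  \<comment> \<open>Moduli of the terms, so that the triangle inequality in L2 bounds the partial
    sums of \<open>cmod (X j w)\<close>.\<close>
  define Y where "Y j = (\<lambda>w. complex_of_real (cmod (X j w)))" for j
  define h where "h n w = (\<Sum>j<n. cmod (X j w))" for n w
  define S where "S = (\<Sum>j. nm (X j))"
  have Y: "Y j \<in> L2 M" "nm (Y j) = nm (X j)" for j
    using X[of j] mX[of j] by (auto simp: L2_def Y_def nm_def l2ip_self)
  have YS: "(\<Sum>j<n. Y j) \<in> L2 M" "nm (\<Sum>j<n. Y j) \<le> S" for n
  proof -
    show "(\<Sum>j<n. Y j) \<in> L2 M" by (rule nm_sum) (rule Y)
    have "nm (\<Sum>j<n. Y j) \<le> (\<Sum>j<n. nm (Y j))" by (rule nm_sum) (rule Y)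
    also have "\<dots> \<le> S" unfolding S_def Y(2)
      by (rule sum_le_suminf) (use sum X nm_nonneg in \<open>auto simp: nm_def\<close>)
    finally show "nm (\<Sum>j<n. Y j) \<le> S" .
  qed
  have hY: "(cmod ((\<Sum>j<n. Y j) w))\<^sup>2 = (h n w)\<^sup>2" for n w
  proof -
    have "(\<Sum>j<n. Y j) w = complex_of_real (h n w)" by (simp add: sum_fun_apply Y_def h_def)
    then show ?thesis by simp
  qed
  have mh [measurable]: "h n \<in> borel_measurable M" for n unfolding h_def by measurable
  have h0: "h n w \<ge> 0" for n w by (simp add: h_def sum_nonneg)
  have hmono: "h m w \<le> h n w" if "m \<le> n" for m n w
    unfolding h_def using that by (intro sum_mono2) auto
  \<comment> \<open>By monotone convergence the supremum of the squared partial sums has integral at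
    most \<open>S\<^sup>2\<close>. Its real version \<open>b\<close> gives absolute convergence
    almost everywhere and dominates all squared tails.\<close>
  define B where "B w = (SUP n. ennreal ((h n w)\<^sup>2))" for w
  have mB [measurable]: "B \<in> borel_measurable M" unfolding B_def by measurable
  have "(\<integral>\<^sup>+ w. B w \<partial>M) = (SUP n. \<integral>\<^sup>+ w. ennreal ((h n w)\<^sup>2) \<partial>M)"
    unfolding B_def
    by (intro nn_integral_monotone_convergence_SUP)
      (auto simp: incseq_def le_fun_def intro!: ennreal_leI power_mono hmono h0)
  also have "\<dots> \<le> ennreal (S\<^sup>2)"
  proof (rule SUP_least)
    fix n
    have "(\<integral>\<^sup>+ w. ennreal ((h n w)\<^sup>2) \<partial>M) = ennreal ((nm (\<Sum>j<n. Y j))\<^sup>2)"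
      using l2ip_self_nn[OF YS(1)[of n]] YS(1)[of n] unfolding hY by (simp add: nm_sq)
    also have "\<dots> \<le> ennreal (S\<^sup>2)" using YS by (intro ennreal_leI power_mono) auto
    finally show "(\<integral>\<^sup>+ w. ennreal ((h n w)\<^sup>2) \<partial>M) \<le> ennreal (S\<^sup>2)" .
  qed
  finally have fin: "(\<integral>\<^sup>+ w. B w \<partial>M) < \<infinity>" by (simp add: le_less_trans)
  then have AEB: "AE w in M. B w \<noteq> \<infinity>" by (intro nn_integral_noteq_infinite) auto
  define b where "b w = enn2real (B w)" for w
  have ib: "integrable M b"
  proof (rule integrableI_bounded)
    have "(\<integral>\<^sup>+ w. ennreal (norm (b w)) \<partial>M) = (\<integral>\<^sup>+ w. B w \<partial>M)"
      using AEB by (intro nn_integral_cong_AE) (auto simp: b_def less_top)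
    then show "(\<integral>\<^sup>+ w. ennreal (norm (b w)) \<partial>M) < \<infinity>" using fin by simp
  qed (unfold b_def, measurable)
  have hb: "(h n w)\<^sup>2 \<le> b w" if "B w \<noteq> \<infinity>" for n w
  proof -
    have "ennreal ((h n w)\<^sup>2) \<le> B w" unfolding B_def by (rule SUP_upper) simp
    also have "B w = ennreal (b w)" using that by (simp add: b_def less_top)
    finally show ?thesis by (simp add: b_def ennreal_le_iff)
  qed
  have summ: "summable (\<lambda>j. cmod (X j w)) \<and> (\<Sum>j. cmod (X j w)) \<le> sqrt (b w)"
    if "B w \<noteq> \<infinity>" for w
  proof -
    have le: "(\<Sum>j<n. cmod (X j w)) \<le> sqrt (b w)" for n
      using hb[OF that, of n] by (simp add: h_def real_le_rsqrt)
    have "summable (\<lambda>j. cmod (X j w))" by (rule summableI_nonneg_bounded[OF _ le]) auto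
    then show ?thesis using le by (auto intro: suminf_le_const)
  qed
  show "AE w in M. summable (\<lambda>j. cmod (X j w))" using AEB summ by auto
  have mg [measurable]: "g \<in> borel_measurable M" unfolding g_def by measurable
  have tail: "(cmod (g w - (\<Sum>j<n. X j w)))\<^sup>2 \<le> b w" if "B w \<noteq> \<infinity>" for n w
  proof -
    have s: "summable (\<lambda>j. cmod (X j w))" "(\<Sum>j. cmod (X j w)) \<le> sqrt (b w)" using summ that by auto
    then have s': "summable (\<lambda>j. X j w)" by (rule_tac summable_norm_cancel)
    have "g w - (\<Sum>j<n. X j w) = (\<Sum>j. X (j + n) w)"
      using suminf_split_initial_segment[OF s', of n] by (simp add: g_def)
    then have "cmod (g w - (\<Sum>j<n. X j w)) \<le> (\<Sum>j. cmod (X (j + n) w))"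
      using summable_norm[of "\<lambda>j. X (j + n) w"] summable_ignore_initial_segment[OF s(1), of n] by simp
    also have "\<dots> \<le> (\<Sum>j. cmod (X j w))"
      using suminf_split_initial_segment[OF s(1), of n] by (simp add: sum_nonneg)
    also have "\<dots> \<le> sqrt (b w)" by (rule s)
    finally show ?thesis using power_mono[of _ "sqrt (b w)" 2] by (simp add: b_def)
  qed
  show "g \<in> L2 M"
  proof -
    have "integrable M (\<lambda>w. (cmod (g w))\<^sup>2)"
      by (rule Bochner_Integration.integrable_bound[OF ib])
        (use AEB tail[where n = 0] in \<open>auto simp: b_def\<close>)
    then show ?thesis by (simp add: L2_def)
  qed
  have "(\<lambda>n. \<integral> w. (cmod (g w - (\<Sum>j<n. X j w)))\<^sup>2 \<partial>M) \<longlonglongrightarrow> (\<integral> w. 0 \<partial>M)"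
  proof (rule integral_dominated_convergence[where w = b])
    show "AE w in M. (\<lambda>n. (cmod (g w - (\<Sum>j<n. X j w)))\<^sup>2) \<longlonglongrightarrow> 0"
    proof (rule AE_mp[OF AEB], rule AE_I2, rule impI)
      fix w assume "B w \<noteq> \<infinity>"
      then have "summable (\<lambda>j. X j w)" using summ[of w] by (intro summable_norm_cancel[of "\<lambda>j. X j w"]) simp
      then have "(\<lambda>n. \<Sum>j<n. X j w) \<longlonglongrightarrow> g w" unfolding g_def by (rule summable_LIMSEQ)
      then have "(\<lambda>n. (cmod (g w - (\<Sum>j<n. X j w)))\<^sup>2) \<longlonglongrightarrow> (cmod (g w - g w))\<^sup>2"
        by (intro tendsto_intros)
      then show "(\<lambda>n. (cmod (g w - (\<Sum>j<n. X j w)))\<^sup>2) \<longlonglongrightarrow> 0" by simp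
    qed
  qed (use AEB tail ib in auto)
  then have "(\<lambda>n. l2ip M (g - (\<Sum>j<n. X j)) (g - (\<Sum>j<n. X j))) \<longlonglongrightarrow> 0"
    by (simp add: l2ip_self sum_fun_apply)
  then show "(\<lambda>n. sqrt (l2ip M (g - (\<Sum>j<n. X j)) (g - (\<Sum>j<n. X j)))) \<longlonglongrightarrow> 0"
    using tendsto_real_sqrt[where x = 0] by simp
qed

section \<open>Configurations of photons\<close>

text \<open>Increasing enumeration of the indices other than \<open>i\<close>. Deletion of slot
  \<open>i\<close> is composition with it; \<open>insr i\<close> is the inverse operation, and
  \<open>fcons\<close> its case \<open>i = 0\<close>.\<close>

definition skip :: "nat \<Rightarrow> nat \<Rightarrow> nat" where
  "skip i j = (if j < i then j else Suc j)"

definition insr :: "nat \<Rightarrow> 'a \<Rightarrow> (nat \<Rightarrow> 'a) \<Rightarrow> nat \<Rightarrow> 'a" where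
  "insr i a f = (\<lambda>j. if j < i then f j else if j = i then a else f (j - 1))"

lemma fdel_skip: "fdel i f = f \<circ> skip i"
  by (auto simp: fdel_def skip_def fun_eq_iff)

lemma fdel_apply: "fdel i f j = f (skip i j)"
  by (simp add: fdel_skip)

lemma fcons_insr: "fcons = insr 0"
  by (auto simp: fcons_def insr_def fun_eq_iff)

lemma insr_at [simp]: "insr i a f i = a"
  by (simp add: insr_def)

lemma insr_skip [simp]: "insr i a f (skip i j) = f j"
  by (auto simp: insr_def skip_def)

lemma fdel_insr [simp]: "fdel i (insr i a f) = f"
  by (simp add: fdel_def insr_def fun_eq_iff)

lemma insr_fdel [simp]: "insr i (f i) (fdel i f) = f"
  by (auto simp: fdel_def insr_def fun_eq_iff)

lemma inj_skip: "inj (skip i)"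
  by (rule injI) (auto simp: skip_def split: if_splits)

lemma skip_image: "i \<le> n \<Longrightarrow> skip i ` {..<n} = {..<Suc n} - {i}"
proof (intro equalityI subsetI)
  fix j assume "i \<le> n" "j \<in> {..<Suc n} - {i}"
  then show "j \<in> skip i ` {..<n}"
    by (cases "j < i") (auto simp: skip_def image_def intro!: bexI[of _ "if j < i then j else j - 1"])
qed (auto simp: skip_def split: if_splits)

text \<open>Stated for a commutative monoid so that it serves both the sum of photon energies and
  the product of the measures of the sides of a box.\<close>

lemma (in comm_monoid_set) remove_skip:
  assumes "i \<le> n" shows "F g {..<Suc n} = f (g i) (F (\<lambda>j. g (skip i j)) {..<n})"
proof -
  have "F g {..<Suc n} = f (g i) (F g ({..<Suc n} - {i}))"
    using assms by (intro remove) auto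
  also have "F g ({..<Suc n} - {i}) = F (\<lambda>j. g (skip i j)) {..<n}"
    unfolding skip_image[OF assms, symmetric]
    by (subst reindex) (auto intro: inj_on_subset[OF inj_skip] simp: comp_def)
  finally show ?thesis .
qed

lemma sum_remove_skip: "i \<le> n \<Longrightarrow> (\<Sum>j<Suc n. g j) = g i + (\<Sum>j<n. g (skip i j))"
  by (rule sum.remove_skip)

lemma prod_remove_skip: "i \<le> n \<Longrightarrow> (\<Prod>j<Suc n. g j) = g i * (\<Prod>j<n. g (skip i j))"
  by (rule prod.remove_skip)

lemma insr_extensional: "i \<le> n \<Longrightarrow> f \<in> extensional {..<n} \<Longrightarrow> insr i a f \<in> extensional {..<Suc n}"
  by (auto simp: insr_def extensional_def)

lemma fdel_extensional: "i \<le> n \<Longrightarrow> f \<in> extensional {..<Suc n} \<Longrightarrow> fdel i f \<in> extensional {..<n}"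
  by (auto simp: fdel_def extensional_def)

section \<open>Lebesgue measure on tuples of momenta\<close>

lemma space_nmeas [simp]: "space (nmeas n) = extensional {..<n}"
  by (auto simp: nmeas_def space_PiM PiE_def)

lemma sets_nmeas [measurable_cong]: "sets (nmeas n) = sets (PiM {..<n} (\<lambda>_. borel))"
  unfolding nmeas_def by (intro sets_PiM_cong) auto

interpretation lborel_product: product_sigma_finite "\<lambda>_::nat. lborel :: (real^3) measure"
  by standard

lemma sigma_finite_nmeas [simp]: "sigma_finite_measure (nmeas n)"
  unfolding nmeas_def by (rule lborel_product.sigma_finite) simp

lemma pair_sigma_finite_nmeas: "pair_sigma_finite (lborel :: (real^3) measure) (nmeas n)"
  by (simp add: pair_sigma_finite_def sigma_finite_lborel)

lemma measurable_nmeas_component: "i < n \<Longrightarrow> (\<lambda>ks. ks i) \<in> borel_measurable (nmeas n)"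
proof -
  assume "i < n"
  then have "(\<lambda>ks. ks i) \<in> measurable (nmeas n) lborel"
    unfolding nmeas_def by (intro measurable_component_singleton) simp
  then show ?thesis by simp
qed

lemma measurable_into_nmeas:
  assumes "\<And>w. w \<in> space M \<Longrightarrow> f w \<in> extensional {..<n}"
    and "\<And>i. i < n \<Longrightarrow> (\<lambda>w. f w i) \<in> borel_measurable M"
  shows "f \<in> measurable M (nmeas n)"
  unfolding nmeas_def
  by (rule measurable_PiM_single') (use assms in \<open>auto simp: PiE_def\<close>)

lemma measurable_insr:
  assumes "i \<le> n"
  shows "(\<lambda>z. insr i (fst z) (snd z)) \<in> measurable (lborel \<Otimes>\<^sub>M nmeas n) (nmeas (Suc n))"
proof (rule measurable_into_nmeas)
  fix j assume j: "j < Suc n"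
  have c: "(\<lambda>z::(real^3) \<times> (nat \<Rightarrow> real^3). snd z l) \<in> borel_measurable (lborel \<Otimes>\<^sub>M nmeas n)" if "l < n" for l
    by (rule measurable_compose[OF measurable_snd measurable_nmeas_component[OF that]])
  have f: "fst \<in> borel_measurable (lborel \<Otimes>\<^sub>M nmeas n)" by measurable
  consider "j < i" | "j = i" | "i < j" by linarith
  then show "(\<lambda>z. insr i (fst z) (snd z) j) \<in> borel_measurable (lborel \<Otimes>\<^sub>M nmeas n)"
    using c[of j] c[of "j - 1"] f assms j by cases (simp_all add: insr_def)
qed (use assms in \<open>auto simp: space_pair_measure intro!: insr_extensional\<close>)

lemma measurable_fdel:
  assumes "i \<le> n" shows "fdel i \<in> measurable (nmeas (Suc n)) (nmeas n)"
proof (rule measurable_into_nmeas)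
  fix j assume "j < n"
  then show "(\<lambda>ks. fdel i ks j) \<in> borel_measurable (nmeas (Suc n))"
    unfolding fdel_apply by (intro measurable_nmeas_component) (auto simp: skip_def)
qed (use assms in \<open>auto intro!: fdel_extensional\<close>)

text \<open>Any slot may be split off from Lebesgue measure on \<open>Suc n\<close> momenta. The two
  measures agree on boxes, since the preimage of a box is its side at \<open>i\<close> times the box
  formed by the remaining sides.\<close>

lemma distr_insr:
  assumes i: "i \<le> n"
  shows "distr (lborel \<Otimes>\<^sub>M nmeas n) (nmeas (Suc n)) (\<lambda>z. insr i (fst z) (snd z)) = nmeas (Suc n)"
proof -
  interpret N: sigma_finite_measure "nmeas n" by simp
  have "distr (lborel \<Otimes>\<^sub>M nmeas n) (nmeas (Suc n)) (\<lambda>z. insr i (fst z) (snd z))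
      = PiM {..<Suc n} (\<lambda>_. lborel)"
  proof (rule lborel_product.PiM_eqI)
    fix A :: "nat \<Rightarrow> (real^3) set" assume A: "\<And>i. i \<in> {..<Suc n} \<Longrightarrow> A i \<in> sets lborel"
    have sk: "skip i j \<in> {..<Suc n}" if "j < n" for j using that i by (auto simp: skip_def)
    have eq: "(\<lambda>z. insr i (fst z) (snd z)) -` (PiE {..<Suc n} A) \<inter> space (lborel \<Otimes>\<^sub>M nmeas n)
        = A i \<times> PiE {..<n} (\<lambda>j. A (skip i j))"
    proof (intro equalityI subsetI)
      fix z assume "z \<in> A i \<times> PiE {..<n} (\<lambda>j. A (skip i j))"
      then obtain k ks where z: "z = (k, ks)" "k \<in> A i" "ks \<in> extensional {..<n}"
        and ks: "\<And>j. j < n \<Longrightarrow> ks j \<in> A (skip i j)"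
        by (auto simp: PiE_iff)
      have "insr i k ks j \<in> A j" if "j < Suc n" for j
      proof (cases "j = i")
        case False
        then have "j \<in> skip i ` {..<n}" unfolding skip_image[OF i] using that by simp
        then obtain l where "l < n" "j = skip i l" by auto
        then show ?thesis using ks by simp
      qed (use z in simp)
      then have "insr i k ks \<in> PiE {..<Suc n} A"
        using insr_extensional[OF i z(3)] by (simp add: PiE_iff)
      then show "z \<in> (\<lambda>z. insr i (fst z) (snd z)) -` (PiE {..<Suc n} A) \<inter> space (lborel \<Otimes>\<^sub>M nmeas n)"
        using z by (simp add: space_pair_measure)
    next
      fix z assume "z \<in> (\<lambda>z. insr i (fst z) (snd z)) -` (PiE {..<Suc n} A) \<inter> space (lborel \<Otimes>\<^sub>M nmeas n)"
      then obtain k ks where z: "z = (k, ks)" "ks \<in> extensional {..<n}"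
        and h: "\<And>j. j < Suc n \<Longrightarrow> insr i k ks j \<in> A j"
        by (cases z) (simp add: space_pair_measure PiE_iff)
      have "k \<in> A i" using h[of i] i by simp
      moreover have "ks j \<in> A (skip i j)" if "j < n" for j
        using h[of "skip i j"] sk[OF that] by simp
      ultimately show "z \<in> A i \<times> PiE {..<n} (\<lambda>j. A (skip i j))"
        using z by (simp add: PiE_iff)
    qed
    have S: "PiE {..<Suc n} A \<in> sets (nmeas (Suc n))"
      unfolding nmeas_def using A by (intro sets_PiM_I_finite) auto
    have S': "PiE {..<n} (\<lambda>j. A (skip i j)) \<in> sets (nmeas n)"
      unfolding nmeas_def using A sk by (intro sets_PiM_I_finite) auto
    have "emeasure (distr (lborel \<Otimes>\<^sub>M nmeas n) (nmeas (Suc n)) (\<lambda>z. insr i (fst z) (snd z))) (PiE {..<Suc n} A)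
        = emeasure (lborel \<Otimes>\<^sub>M nmeas n) (A i \<times> PiE {..<n} (\<lambda>j. A (skip i j)))"
      using S by (simp add: emeasure_distr measurable_insr[OF i] eq)
    also have "\<dots> = emeasure lborel (A i) * emeasure (nmeas n) (PiE {..<n} (\<lambda>j. A (skip i j)))"
      using S' A[of i] i by (intro N.emeasure_pair_measure_Times) auto
    also have "emeasure (nmeas n) (PiE {..<n} (\<lambda>j. A (skip i j))) = (\<Prod>j<n. emeasure lborel (A (skip i j)))"
      unfolding nmeas_def using A sk by (intro lborel_product.emeasure_PiM) auto
    also have "emeasure lborel (A i) * \<dots> = (\<Prod>j<Suc n. emeasure lborel (A j))"
      using prod_remove_skip[OF i, of "\<lambda>j. emeasure lborel (A j)"] by simp
    finally show "emeasure (distr (lborel \<Otimes>\<^sub>M nmeas n) (nmeas (Suc n)) (\<lambda>z. insr i (fst z) (snd z))) (PiE {..<Suc n} A)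
        = (\<Prod>j\<in>{..<Suc n}. emeasure lborel (A j))" .
  qed (auto simp: nmeas_def)
  then show ?thesis by (simp add: nmeas_def)
qed

lemma nn_integral_nmeas_Suc:
  assumes "i \<le> n" "F \<in> borel_measurable (nmeas (Suc n))"
  shows "(\<integral>\<^sup>+ ks. F ks \<partial>nmeas (Suc n)) = (\<integral>\<^sup>+ z. F (insr i (fst z) (snd z)) \<partial>(lborel \<Otimes>\<^sub>M nmeas n))"
  by (subst distr_insr[OF assms(1), symmetric])
     (use assms in \<open>simp add: nn_integral_distr measurable_insr\<close>)

lemma AE_insr:
  assumes "i \<le> n" "AE ks in nmeas (Suc n). Q ks"
  shows "AE z in lborel \<Otimes>\<^sub>M nmeas n. Q (insr i (fst z) (snd z))"
  by (rule AE_distrD[OF measurable_insr[OF assms(1)]], subst distr_insr[OF assms(1)], rule assms(2))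

text \<open>Reverses \<open>AE_insr\<close>: taking out slot \<open>i\<close> undoes the insertion,
  so it carries \<open>nmeas (Suc n)\<close> back to the product measure.\<close>

lemma AE_fdel_pair:
  assumes "i \<le> n" "AE z in lborel \<Otimes>\<^sub>M nmeas n. Q (fst z) (snd z)"
  shows "AE ks in nmeas (Suc n). Q (ks i) (fdel i ks)"
proof -
  have m: "(\<lambda>ks. (ks i, fdel i ks)) \<in> measurable (nmeas (Suc n)) (lborel \<Otimes>\<^sub>M nmeas n)"
  proof (rule measurable_Pair)
    have "(\<lambda>ks. ks i) \<in> borel_measurable (nmeas (Suc n))"
      using assms(1) by (intro measurable_nmeas_component) simp
    then show "(\<lambda>ks. ks i) \<in> measurable (nmeas (Suc n)) lborel" by simp
  qed (rule measurable_fdel[OF assms(1)])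
  have "distr (nmeas (Suc n)) (lborel \<Otimes>\<^sub>M nmeas n) (\<lambda>ks. (ks i, fdel i ks))
      = distr (distr (lborel \<Otimes>\<^sub>M nmeas n) (nmeas (Suc n)) (\<lambda>z. insr i (fst z) (snd z)))
          (lborel \<Otimes>\<^sub>M nmeas n) (\<lambda>ks. (ks i, fdel i ks))"
    by (simp only: distr_insr[OF assms(1)])
  also have "\<dots> = distr (lborel \<Otimes>\<^sub>M nmeas n) (lborel \<Otimes>\<^sub>M nmeas n) (\<lambda>z. z)"
    by (subst distr_distr[OF m measurable_insr[OF assms(1)]]) (simp add: comp_def)
  also have "\<dots> = lborel \<Otimes>\<^sub>M nmeas n" by (rule distr_id)
  finally have "AE z in distr (nmeas (Suc n)) (lborel \<Otimes>\<^sub>M nmeas n) (\<lambda>ks. (ks i, fdel i ks)). Q (fst z) (snd z)"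
    using assms(2) by (rule ssubst)
  from AE_distrD[OF m this] show ?thesis by simp
qed

lemma AE_pair_snd:
  assumes "AE ks in nmeas n. Q ks"
  shows "AE z in lborel \<Otimes>\<^sub>M nmeas n. Q (snd z)"
proof -
  interpret pair_sigma_finite "lborel :: (real^3) measure" "nmeas n" by (rule pair_sigma_finite_nmeas)
  obtain Z where Z: "Z \<in> sets (nmeas n)" "emeasure (nmeas n) Z = 0" "{ks \<in> space (nmeas n). \<not> Q ks} \<subseteq> Z"
    using assms by (auto elim: AE_E)
  show ?thesis
  proof (rule AE_I)
    show "emeasure (lborel \<Otimes>\<^sub>M nmeas n) (space lborel \<times> Z) = 0"
      using Z by (subst M2.emeasure_pair_measure_Times) auto
    show "space lborel \<times> Z \<in> sets (lborel \<Otimes>\<^sub>M nmeas n)" using Z by (intro pair_measureI) auto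
    show "{z \<in> space (lborel \<Otimes>\<^sub>M nmeas n). \<not> Q (snd z)} \<subseteq> space lborel \<times> Z"
      using Z by (auto simp: space_pair_measure)
  qed
qed

lemma AE_fdel:
  assumes "i \<le> n" "AE ks in nmeas n. Q ks" shows "AE ks in nmeas (Suc n). Q (fdel i ks)"
  by (rule AE_fdel_pair[OF assms(1), of "\<lambda>_ ks. Q ks"]) (rule AE_pair_snd[OF assms(2)])

text \<open>Puts the exceptional set into the form that annihilation requires: for almost all
  remaining photons \<open>ks\<close>, a property of almost all annihilated momenta
  \<open>k\<close>.\<close>

lemma AE_pair_nmeas_swap:
  fixes Q :: "real^3 \<Rightarrow> (nat \<Rightarrow> real^3) \<Rightarrow> bool"
  assumes "AE z in lborel \<Otimes>\<^sub>M nmeas n. Q (fst z) (snd z)"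
  shows "AE ks in nmeas n. AE k in lborel. Q k ks"
proof -
  interpret pair_sigma_finite "lborel :: (real^3) measure" "nmeas n" by (rule pair_sigma_finite_nmeas)
  interpret Q: pair_sigma_finite "nmeas n" "lborel :: (real^3) measure" ..
  have "AE z in distr (nmeas n \<Otimes>\<^sub>M lborel) (lborel \<Otimes>\<^sub>M nmeas n) (\<lambda>(x, y). (y, x)). Q (fst z) (snd z)"
    by (rule subst[where P = "\<lambda>M. AE z in M. Q (fst z) (snd z)", OF distr_pair_swap assms])
  from AE_distrD[OF measurable_pair_swap' this]
  have "AE z in nmeas n \<Otimes>\<^sub>M lborel. Q (snd z) (fst z)"
    by (simp add: case_prod_unfold)
  from Q.AE_pair[OF this] show ?thesis by simp
qed

section \<open>Polarisation indices, spin configurations, and moving a slot to the front\<close>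

lemma finite_pols [simp]: "finite (pols n)"
  by (simp add: pols_def finite_PiE)

lemma finite_spins [simp]: "finite (spins P)"
proof -
  have "spins P \<subseteq> (\<lambda>A i. i \<in> A) ` Pow {1..P}"
  proof
    fix s assume "s \<in> spins P"
    then have "s = (\<lambda>i. i \<in> {i. s i})" "{i. s i} \<in> Pow {1..P}" by (auto simp: spins_def)
    then show "s \<in> (\<lambda>A i. i \<in> A) ` Pow {1..P}" by (metis imageI)
  qed
  then show ?thesis by (rule finite_subset) simp
qed

lemma pols_iff: "js \<in> pols n \<longleftrightarrow> js \<in> extensional {..<n}"
  by (simp add: pols_def PiE_def)

lemma sum_pols_Suc:
  assumes "i \<le> n"
  shows "(\<Sum>js\<in>pols (Suc n). F js) = (\<Sum>js\<in>pols n. \<Sum>j\<in>UNIV. F (insr i j js))"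
proof -
  have "(\<Sum>js\<in>pols n. \<Sum>j\<in>UNIV. F (insr i j js)) = (\<Sum>(js, j)\<in>pols n \<times> UNIV. F (insr i j js))"
    by (simp add: sum.cartesian_product)
  also have "\<dots> = (\<Sum>js\<in>pols (Suc n). F js)"
    by (rule sum.reindex_bij_witness[where j = "\<lambda>(js, j). insr i j js" and i = "\<lambda>js. (fdel i js, js i)"])
       (auto simp: pols_iff fdel_extensional[OF assms] insr_extensional[OF assms])
  finally show ?thesis by simp
qed

text \<open>The cycle that turns insertion in front into insertion at slot \<open>i\<close>.
  Combined with permutation symmetry of a state it reduces every slot to slot 0.\<close>

definition rot :: "nat \<Rightarrow> nat \<Rightarrow> nat" where
  "rot i m = (if m < i then Suc m else if m = i then 0 else m)"

lemma insr_rot: "insr i a f = fcons a f \<circ> rot i"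
  by (auto simp: insr_def fcons_def rot_def fun_eq_iff)

lemma rot_permutes: "i \<le> n \<Longrightarrow> rot i permutes {..<Suc n}"
proof (rule bij_imp_permutes)
  assume i: "i \<le> n"
  have inj: "inj_on (rot i) {..<Suc n}" by (rule inj_onI) (auto simp: rot_def split: if_splits)
  moreover have "rot i ` {..<Suc n} \<subseteq> {..<Suc n}" using i by (auto simp: rot_def)
  ultimately have "rot i ` {..<Suc n} = {..<Suc n}" by (intro endo_inj_surj) auto
  with inj show "bij_betw (rot i) {..<Suc n} {..<Suc n}" by (simp add: bij_betw_def)
qed (auto simp: rot_def)

section \<open>The Fock space measure\<close>

definition sectors :: "nat \<Rightarrow> (nat \<times> (nat \<Rightarrow> 3) \<times> (nat \<Rightarrow> bool)) set" where
  "sectors P = (SIGMA n:UNIV. pols n \<times> spins P)"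

definition fmeas :: "nat \<Rightarrow> ((nat \<times> (nat \<Rightarrow> 3) \<times> (nat \<Rightarrow> bool)) \<times> (nat \<Rightarrow> real^3)) measure" where
  "fmeas P = dsum_measure (sectors P) (\<lambda>d. nmeas (fst d))"

text \<open>Configurations with one additional photon, of which only the momentum is part of the
  point; its polarisation does not belong to the sector index and is summed over inside the
  integrands.\<close>

definition fmeas1 :: "nat \<Rightarrow> ((nat \<times> (nat \<Rightarrow> 3) \<times> (nat \<Rightarrow> bool)) \<times> ((real^3) \<times> (nat \<Rightarrow> real^3))) measure" where
  "fmeas1 P = dsum_measure (sectors P) (\<lambda>d. lborel \<Otimes>\<^sub>M nmeas (fst d))"

definition flat :: "(nat \<Rightarrow> 'k \<Rightarrow> (nat \<Rightarrow> 3) \<Rightarrow> (nat \<Rightarrow> bool) \<Rightarrow> 'a) \<Rightarrow> (nat \<times> (nat \<Rightarrow> 3) \<times> (nat \<Rightarrow> bool)) \<times> 'k \<Rightarrow> 'a" where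
  "flat \<Psi> = (\<lambda>((n, js, s), ks). \<Psi> n ks js s)"

lemma flat_apply [simp]: "flat \<Psi> ((n, js, s), ks) = \<Psi> n ks js s"
  by (simp add: flat_def)

lemma mem_sectors [simp]: "(n, js, s) \<in> sectors P \<longleftrightarrow> js \<in> pols n \<and> s \<in> spins P"
  by (simp add: sectors_def)

lemma nn_integral_sectors:
  fixes F :: "_ \<Rightarrow> ennreal"
  shows "(\<integral>\<^sup>+ d. F d \<partial>count_space (sectors P)) = (\<Sum>n. \<Sum>js\<in>pols n. \<Sum>s\<in>spins P. F (n, js, s))"
proof -
  have "(\<integral>\<^sup>+ d. F d \<partial>count_space (sectors P)) = (\<integral>\<^sup>+ d. F d * indicator (sectors P) d \<partial>count_space UNIV)"
    by (subst nn_integral_restrict_space[symmetric]) (simp_all add: restrict_count_space)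
  also have "\<dots> = (\<integral>\<^sup>+ n. \<integral>\<^sup>+ y. F (n, y) * indicator (sectors P) (n, y) \<partial>count_space UNIV \<partial>count_space UNIV)"
    by (rule nn_integral_fst_count_space[symmetric])
  also have "\<dots> = (\<integral>\<^sup>+ n. (\<Sum>js\<in>pols n. \<Sum>s\<in>spins P. F (n, js, s)) \<partial>count_space UNIV)"
  proof (rule nn_integral_cong)
    fix n :: nat
    have "(\<integral>\<^sup>+ y. F (n, y) * indicator (sectors P) (n, y) \<partial>count_space UNIV)
        = (\<integral>\<^sup>+ y. F (n, y) * indicator (pols n \<times> spins P) y \<partial>count_space UNIV)"
      by (intro nn_integral_cong) (auto simp: indicator_def sectors_def)
    also have "\<dots> = (\<integral>\<^sup>+ y. F (n, y) \<partial>count_space (pols n \<times> spins P))"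
      by (subst nn_integral_restrict_space[symmetric]) (simp_all add: restrict_count_space)
    also have "\<dots> = (\<Sum>y\<in>pols n \<times> spins P. F (n, y))"
      by (rule nn_integral_count_space_finite) simp
    also have "\<dots> = (\<Sum>js\<in>pols n. \<Sum>s\<in>spins P. F (n, js, s))"
      by (simp add: sum.cartesian_product)
    finally show "(\<integral>\<^sup>+ y. F (n, y) * indicator (sectors P) (n, y) \<partial>count_space UNIV)
        = (\<Sum>js\<in>pols n. \<Sum>s\<in>spins P. F (n, js, s))" .
  qed
  also have "\<dots> = (\<Sum>n. \<Sum>js\<in>pols n. \<Sum>s\<in>spins P. F (n, js, s))"
    by (rule nn_integral_count_space_nat)
  finally show ?thesis .
qed

lemma measurable_flat_iff:
  "flat F \<in> measurable (fmeas P) M \<longleftrightarrow>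
     (\<forall>n. \<forall>js\<in>pols n. \<forall>s\<in>spins P. (\<lambda>ks. F n ks js s) \<in> measurable (nmeas n) M)"
  by (simp add: fmeas_def measurable_dsum_iff sectors_def)

lemma measurable_flat1_iff:
  "flat F \<in> measurable (fmeas1 P) M \<longleftrightarrow>
     (\<forall>n. \<forall>js\<in>pols n. \<forall>s\<in>spins P. (\<lambda>z. F n z js s) \<in> measurable (lborel \<Otimes>\<^sub>M nmeas n) M)"
  by (simp add: fmeas1_def measurable_dsum_iff sectors_def)

lemma AE_fmeas_iff:
  "(AE w in fmeas P. Q w) \<longleftrightarrow> (\<forall>n. \<forall>js\<in>pols n. \<forall>s\<in>spins P. AE ks in nmeas n. Q ((n, js, s), ks))"
  unfolding fmeas_def AE_dsum_iff sectors_def split_paired_Ball_Sigma fst_conv by blast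

lemma nn_integral_fmeas:
  assumes "flat F \<in> borel_measurable (fmeas P)"
  shows "(\<integral>\<^sup>+ w. flat F w \<partial>fmeas P)
     = (\<Sum>n. \<Sum>js\<in>pols n. \<Sum>s\<in>spins P. \<integral>\<^sup>+ ks. F n ks js s \<partial>nmeas n)"
  using assms unfolding fmeas_def by (simp add: nn_integral_dsum nn_integral_sectors)

lemma nn_integral_fmeas1:
  assumes "flat F \<in> borel_measurable (fmeas1 P)"
  shows "(\<integral>\<^sup>+ w. flat F w \<partial>fmeas1 P)
     = (\<Sum>n. \<Sum>js\<in>pols n. \<Sum>s\<in>spins P. \<integral>\<^sup>+ z. F n z js s \<partial>(lborel \<Otimes>\<^sub>M nmeas n))"
  using assms unfolding fmeas1_def by (simp add: nn_integral_dsum nn_integral_sectors)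

lemma suminf_ennreal_Suc:
  fixes f :: "nat \<Rightarrow> ennreal" assumes "f 0 = 0" shows "(\<Sum>n. f n) = (\<Sum>n. f (Suc n))"
  using suminf_offset[of f 1] assms by simp

lemma insr_mem_pols: "i \<le> n \<Longrightarrow> js \<in> pols n \<Longrightarrow> insr i j js \<in> pols (Suc n)"
  by (simp add: pols_iff insr_extensional)

lemma fcons_mem_pols: "js \<in> pols n \<Longrightarrow> fcons j js \<in> pols (Suc n)"
  by (simp add: fcons_insr insr_mem_pols)

lemma measurable_fcons:
  "(\<lambda>z. fcons (fst z) (snd z)) \<in> measurable (lborel \<Otimes>\<^sub>M nmeas n) (nmeas (Suc n))"
  unfolding fcons_insr by (rule measurable_insr) simp

text \<open>The Mecke (Campbell) formula of the Fock space measure: choosing one of the n photons of a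
  configuration is the same as adding a photon to a configuration.\<close>

lemma mecke_nn:
  fixes F :: "nat \<Rightarrow> nat \<Rightarrow> (nat \<Rightarrow> real^3) \<Rightarrow> (nat \<Rightarrow> 3) \<Rightarrow> (nat \<Rightarrow> bool) \<Rightarrow> ennreal"
  assumes meas: "\<And>i n js s. i < n \<Longrightarrow> js \<in> pols n \<Longrightarrow> s \<in> spins P \<Longrightarrow> (\<lambda>ks. F i n ks js s) \<in> borel_measurable (nmeas n)"
    and sym: "\<And>i n js s j. i \<le> n \<Longrightarrow> js \<in> pols n \<Longrightarrow> s \<in> spins P \<Longrightarrow>
      AE z in lborel \<Otimes>\<^sub>M nmeas n. F i (Suc n) (insr i (fst z) (snd z)) (insr i j js) s
        = F 0 (Suc n) (fcons (fst z) (snd z)) (fcons j js) s"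
  shows "(\<integral>\<^sup>+ w. flat (\<lambda>n ks js s. \<Sum>i<n. F i n ks js s) w \<partial>fmeas P)
    = (\<integral>\<^sup>+ w. flat (\<lambda>n z js s. of_nat (Suc n) * (\<Sum>j\<in>UNIV. F 0 (Suc n) (fcons (fst z) (snd z)) (fcons j js) s)) w \<partial>fmeas1 P)"
proof -
  have m0: "(\<lambda>z. F 0 (Suc n) (fcons (fst z) (snd z)) (fcons j js) s) \<in> borel_measurable (lborel \<Otimes>\<^sub>M nmeas n)"
    if "js \<in> pols n" "s \<in> spins P" for n js s j
    by (rule measurable_compose[OF measurable_fcons meas]) (use that fcons_mem_pols in auto)
  have mi: "(\<lambda>z. F i (Suc n) (insr i (fst z) (snd z)) (insr i j js) s) \<in> borel_measurable (lborel \<Otimes>\<^sub>M nmeas n)"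
    if "js \<in> pols n" "s \<in> spins P" "i \<le> n" for n js s j i
    by (rule measurable_compose[OF measurable_insr meas]) (use that insr_mem_pols in auto)
  define U where "U n = (\<Sum>js\<in>pols n. \<Sum>j\<in>UNIV. \<Sum>s\<in>spins P.
      \<integral>\<^sup>+ z. F 0 (Suc n) (fcons (fst z) (snd z)) (fcons j js) s \<partial>(lborel \<Otimes>\<^sub>M nmeas n))" for n
  \<comment> \<open>Every slot contributes the same amount: slot \<open>i\<close> is split off from
    momenta and polarisations and then moved to the front by \<open>sym\<close>.\<close>
  have one: "(\<Sum>js\<in>pols (Suc n). \<Sum>s\<in>spins P. \<integral>\<^sup>+ ks. F i (Suc n) ks js s \<partial>nmeas (Suc n)) = U n"
    if i: "i \<le> n" for i n
  proof -
    have "(\<Sum>js\<in>pols (Suc n). \<Sum>s\<in>spins P. \<integral>\<^sup>+ ks. F i (Suc n) ks js s \<partial>nmeas (Suc n))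
      = (\<Sum>js\<in>pols n. \<Sum>j\<in>UNIV. \<Sum>s\<in>spins P. \<integral>\<^sup>+ ks. F i (Suc n) ks (insr i j js) s \<partial>nmeas (Suc n))"
      by (rule sum_pols_Suc[OF i])
    also have "\<dots> = U n" unfolding U_def
    proof (intro sum.cong refl)
      fix js j s assume js: "js \<in> pols n" and s: "s \<in> spins P"
      have "(\<integral>\<^sup>+ ks. F i (Suc n) ks (insr i j js) s \<partial>nmeas (Suc n))
        = (\<integral>\<^sup>+ z. F i (Suc n) (insr i (fst z) (snd z)) (insr i j js) s \<partial>(lborel \<Otimes>\<^sub>M nmeas n))"
        by (rule nn_integral_nmeas_Suc[OF i]) (use i s js in \<open>auto intro!: meas insr_mem_pols\<close>)
      also have "\<dots> = (\<integral>\<^sup>+ z. F 0 (Suc n) (fcons (fst z) (snd z)) (fcons j js) s \<partial>(lborel \<Otimes>\<^sub>M nmeas n))"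
        by (rule nn_integral_cong_AE) (rule sym[OF i js s])
      finally show "(\<integral>\<^sup>+ ks. F i (Suc n) ks (insr i j js) s \<partial>nmeas (Suc n)) = \<dots>" .
    qed
    finally show ?thesis .
  qed
  have "(\<integral>\<^sup>+ w. flat (\<lambda>n ks js s. \<Sum>i<n. F i n ks js s) w \<partial>fmeas P)
    = (\<Sum>n. \<Sum>js\<in>pols n. \<Sum>s\<in>spins P. \<integral>\<^sup>+ ks. (\<Sum>i<n. F i n ks js s) \<partial>nmeas n)"
    by (rule nn_integral_fmeas) (auto simp: measurable_flat_iff intro!: borel_measurable_sum meas)
  \<comment> \<open>The vacuum sector carries an empty sum, so the photon number can be shifted by
    one.\<close>
  also have "\<dots> = (\<Sum>n. \<Sum>js\<in>pols (Suc n). \<Sum>s\<in>spins P. \<integral>\<^sup>+ ks. (\<Sum>i<Suc n. F i (Suc n) ks js s) \<partial>nmeas (Suc n))"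
    by (rule suminf_ennreal_Suc) simp
  also have "\<dots> = (\<Sum>n. of_nat (Suc n) * U n)"
  proof (rule suminf_cong)
    fix n
    have "(\<Sum>js\<in>pols (Suc n). \<Sum>s\<in>spins P. \<integral>\<^sup>+ ks. (\<Sum>i<Suc n. F i (Suc n) ks js s) \<partial>nmeas (Suc n))
      = (\<Sum>js\<in>pols (Suc n). \<Sum>s\<in>spins P. \<Sum>i<Suc n. \<integral>\<^sup>+ ks. F i (Suc n) ks js s \<partial>nmeas (Suc n))"
      by (intro sum.cong refl nn_integral_sum meas) auto
    also have "\<dots> = (\<Sum>js\<in>pols (Suc n). \<Sum>i<Suc n. \<Sum>s\<in>spins P. \<integral>\<^sup>+ ks. F i (Suc n) ks js s \<partial>nmeas (Suc n))"
      by (intro sum.cong refl sum.swap)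
    also have "\<dots> = (\<Sum>i<Suc n. \<Sum>js\<in>pols (Suc n). \<Sum>s\<in>spins P. \<integral>\<^sup>+ ks. F i (Suc n) ks js s \<partial>nmeas (Suc n))"
      by (rule sum.swap)
    also have "\<dots> = (\<Sum>i<Suc n. U n)" by (intro sum.cong refl one) auto
    finally show "(\<Sum>js\<in>pols (Suc n). \<Sum>s\<in>spins P. \<integral>\<^sup>+ ks. (\<Sum>i<Suc n. F i (Suc n) ks js s) \<partial>nmeas (Suc n))
      = of_nat (Suc n) * U n" by (simp only: sum_constant card_lessThan)
  qed
  also have "\<dots> = (\<integral>\<^sup>+ w. flat (\<lambda>n z js s. of_nat (Suc n) * (\<Sum>j\<in>UNIV. F 0 (Suc n) (fcons (fst z) (snd z)) (fcons j js) s)) w \<partial>fmeas1 P)"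
  proof (subst nn_integral_fmeas1, unfold measurable_flat1_iff, safe)
    fix n js s assume js: "js \<in> pols n" and s: "s \<in> spins P"
    have [measurable]: "(\<lambda>z. F 0 (Suc n) (fcons (fst z) (snd z)) (fcons j js) s) \<in> borel_measurable (lborel \<Otimes>\<^sub>M nmeas n)" for j
      by (rule m0[OF js s])
    show "(\<lambda>z. of_nat (Suc n) * (\<Sum>j\<in>UNIV. F 0 (Suc n) (fcons (fst z) (snd z)) (fcons j js) s)) \<in> borel_measurable (lborel \<Otimes>\<^sub>M nmeas n)"
      by measurable
  next
    show "(\<Sum>n. of_nat (Suc n) * U n) = (\<Sum>n. \<Sum>js\<in>pols n. \<Sum>s\<in>spins P.
        \<integral>\<^sup>+ z. of_nat (Suc n) * (\<Sum>j\<in>UNIV. F 0 (Suc n) (fcons (fst z) (snd z)) (fcons j js) s) \<partial>(lborel \<Otimes>\<^sub>M nmeas n))"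
    proof (rule suminf_cong)
      fix n
      have "(\<Sum>js\<in>pols n. \<Sum>s\<in>spins P.
        \<integral>\<^sup>+ z. of_nat (Suc n) * (\<Sum>j\<in>UNIV. F 0 (Suc n) (fcons (fst z) (snd z)) (fcons j js) s) \<partial>(lborel \<Otimes>\<^sub>M nmeas n))
       = (\<Sum>js\<in>pols n. \<Sum>s\<in>spins P. of_nat (Suc n) *
        (\<Sum>j\<in>UNIV. \<integral>\<^sup>+ z. F 0 (Suc n) (fcons (fst z) (snd z)) (fcons j js) s \<partial>(lborel \<Otimes>\<^sub>M nmeas n)))"
      proof (intro sum.cong refl)
        fix js s assume js: "js \<in> pols n" and s: "s \<in> spins P"
        show "(\<integral>\<^sup>+ z. of_nat (Suc n) * (\<Sum>j\<in>UNIV. F 0 (Suc n) (fcons (fst z) (snd z)) (fcons j js) s) \<partial>(lborel \<Otimes>\<^sub>M nmeas n))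
          = of_nat (Suc n) * (\<Sum>j\<in>UNIV. \<integral>\<^sup>+ z. F 0 (Suc n) (fcons (fst z) (snd z)) (fcons j js) s \<partial>(lborel \<Otimes>\<^sub>M nmeas n))"
          by (subst nn_integral_cmult) (auto intro!: borel_measurable_sum m0 js s nn_integral_sum arg_cong2[where f = "(*)"])
      qed
      also have "\<dots> = of_nat (Suc n) * U n"
        unfolding U_def sum_distrib_left[symmetric]
        by (intro arg_cong2[where f = "(*)"] sum.cong refl sum.swap)
      finally show "of_nat (Suc n) * U n = (\<Sum>js\<in>pols n. \<Sum>s\<in>spins P.
        \<integral>\<^sup>+ z. of_nat (Suc n) * (\<Sum>j\<in>UNIV. F 0 (Suc n) (fcons (fst z) (snd z)) (fcons j js) s) \<partial>(lborel \<Otimes>\<^sub>M nmeas n))"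
        by simp
    qed
  qed
  finally show ?thesis .
qed

text \<open>Positive and negative part are treated by \<open>mecke_nn\<close>. Both inherit
  measurability and slot symmetry from \<open>F\<close> and are dominated by its modulus, whose
  integrability is assumed on the side with the marked photon.\<close>

lemma mecke:
  fixes F :: "nat \<Rightarrow> nat \<Rightarrow> (nat \<Rightarrow> real^3) \<Rightarrow> (nat \<Rightarrow> 3) \<Rightarrow> (nat \<Rightarrow> bool) \<Rightarrow> real"
  assumes meas: "\<And>i n js s. i < n \<Longrightarrow> js \<in> pols n \<Longrightarrow> s \<in> spins P \<Longrightarrow> (\<lambda>ks. F i n ks js s) \<in> borel_measurable (nmeas n)"
    and sym: "\<And>i n js s j. i \<le> n \<Longrightarrow> js \<in> pols n \<Longrightarrow> s \<in> spins P \<Longrightarrow>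
      AE z in lborel \<Otimes>\<^sub>M nmeas n. F i (Suc n) (insr i (fst z) (snd z)) (insr i j js) s
        = F 0 (Suc n) (fcons (fst z) (snd z)) (fcons j js) s"
    and int: "integrable (fmeas1 P) (flat (\<lambda>n z js s. real (Suc n) * (\<Sum>j\<in>UNIV. \<bar>F 0 (Suc n) (fcons (fst z) (snd z)) (fcons j js) s\<bar>)))"
  shows "integrable (fmeas P) (flat (\<lambda>n ks js s. \<Sum>i<n. F i n ks js s))"
    and "(\<integral> w. flat (\<lambda>n ks js s. \<Sum>i<n. F i n ks js s) w \<partial>fmeas P)
      = (\<integral> w. flat (\<lambda>n z js s. real (Suc n) * (\<Sum>j\<in>UNIV. F 0 (Suc n) (fcons (fst z) (snd z)) (fcons j js) s)) w \<partial>fmeas1 P)"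
proof -
  let ?L = "\<lambda>G. flat (\<lambda>n ks js s. \<Sum>i<n. G i n ks js s)"
  let ?R = "\<lambda>G. flat (\<lambda>n z js s. real (Suc n) * (\<Sum>j\<in>UNIV. G 0 (Suc n) (fcons (fst z) (snd z)) (fcons j js) s))"
  \<comment> \<open>\<open>f\<close> stands for the positive or the negative part.\<close>
  have nonneg: "integrable (fmeas P) (?L G) \<and> integrable (fmeas1 P) (?R G)
       \<and> (\<integral> w. ?L G w \<partial>fmeas P) = (\<integral> w. ?R G w \<partial>fmeas1 P)"
    if G: "G = (\<lambda>i n ks js s. f (F i n ks js s))" and f: "f \<in> borel_measurable borel" "\<And>x. 0 \<le> f x" "\<And>x. f x \<le> \<bar>x\<bar>"
    for G :: "nat \<Rightarrow> nat \<Rightarrow> (nat \<Rightarrow> real^3) \<Rightarrow> (nat \<Rightarrow> 3) \<Rightarrow> (nat \<Rightarrow> bool) \<Rightarrow> real" and f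
  proof -
    have mG: "(\<lambda>ks. G i n ks js s) \<in> borel_measurable (nmeas n)"
      if "i < n" "js \<in> pols n" "s \<in> spins P" for i n js s
      unfolding G by (rule measurable_compose[OF meas[OF that] f(1)])
    have mG0: "(\<lambda>z. G 0 (Suc n) (fcons (fst z) (snd z)) (fcons j js) s) \<in> borel_measurable (lborel \<Otimes>\<^sub>M nmeas n)"
      if "js \<in> pols n" "s \<in> spins P" for n js s j
      by (rule measurable_compose[OF measurable_fcons mG]) (use that fcons_mem_pols in auto)
    have G0: "G i n ks js s \<ge> 0" for i n ks js s by (simp add: G f)
    have L0: "?L G w \<ge> 0" for w by (cases w) (auto intro!: sum_nonneg G0)
    have R0: "?R G w \<ge> 0" for w by (cases w) (auto intro!: sum_nonneg mult_nonneg_nonneg G0)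
    have mL: "?L G \<in> borel_measurable (fmeas P)"
      unfolding measurable_flat_iff by (auto intro!: borel_measurable_sum mG)
    have mR: "?R G \<in> borel_measurable (fmeas1 P)"
      unfolding measurable_flat1_iff by (auto intro!: borel_measurable_sum borel_measurable_times mG0)
    have intR: "integrable (fmeas1 P) (?R G)"
    proof (rule Bochner_Integration.integrable_bound[OF int mR], rule AE_I2)
      fix w
      show "norm (?R G w) \<le> norm (flat (\<lambda>n z js s. real (Suc n) * (\<Sum>j\<in>UNIV. \<bar>F 0 (Suc n) (fcons (fst z) (snd z)) (fcons j js) s\<bar>)) w)"
        using R0[of w] by (cases w) (auto intro!: mult_left_mono sum_mono f(3) simp: G)
    qed
    have "(\<integral>\<^sup>+ w. ennreal (?L G w) \<partial>fmeas P) = (\<integral>\<^sup>+ w. flat (\<lambda>n ks js s. \<Sum>i<n. ennreal (G i n ks js s)) w \<partial>fmeas P)"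
      by (intro nn_integral_cong) (auto simp: sum_ennreal G0)
    also have "\<dots> = (\<integral>\<^sup>+ w. flat (\<lambda>n z js s. of_nat (Suc n) * (\<Sum>j\<in>UNIV. ennreal (G 0 (Suc n) (fcons (fst z) (snd z)) (fcons j js) s))) w \<partial>fmeas1 P)"
    proof (rule mecke_nn)
      show "(\<lambda>ks. ennreal (G i n ks js s)) \<in> borel_measurable (nmeas n)"
        if "i < n" "js \<in> pols n" "s \<in> spins P" for i n js s
        using mG[OF that] by simp
      show "AE z in lborel \<Otimes>\<^sub>M nmeas n. ennreal (G i (Suc n) (insr i (fst z) (snd z)) (insr i j js) s)
        = ennreal (G 0 (Suc n) (fcons (fst z) (snd z)) (fcons j js) s)"
        if "i \<le> n" "js \<in> pols n" "s \<in> spins P" for i n js s j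
        using sym[OF that, of j] by (auto simp: G)
    qed
    also have "\<dots> = (\<integral>\<^sup>+ w. ennreal (?R G w) \<partial>fmeas1 P)"
      by (intro nn_integral_cong)
        (auto simp: sum_ennreal G0 ennreal_mult'' ennreal_of_nat_eq_real_of_nat sum_nonneg simp del: of_nat_Suc)
    finally have eq: "(\<integral>\<^sup>+ w. ennreal (?L G w) \<partial>fmeas P) = (\<integral>\<^sup>+ w. ennreal (?R G w) \<partial>fmeas1 P)" .
    have "integrable (fmeas P) (?L G)"
    proof (rule integrableI_nonneg[OF mL])
      show "(\<integral>\<^sup>+ w. ennreal (?L G w) \<partial>fmeas P) < \<infinity>"
        unfolding eq using intR R0 by (simp add: nn_integral_eq_integral)
    qed (use L0 in simp)
    moreover have "(\<integral> w. ?L G w \<partial>fmeas P) = (\<integral> w. ?R G w \<partial>fmeas1 P)"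
      using eq mL mR L0 R0 by (subst (1 2) integral_eq_nn_integral) auto
    ultimately show ?thesis using intR by blast
  qed
  define Fp where "Fp i n ks js s = max 0 (F i n ks js s)" for i n ks js s
  define Fm where "Fm i n ks js s = max 0 (- F i n ks js s)" for i n ks js s
  have p: "integrable (fmeas P) (?L Fp) \<and> integrable (fmeas1 P) (?R Fp)
       \<and> (\<integral> w. ?L Fp w \<partial>fmeas P) = (\<integral> w. ?R Fp w \<partial>fmeas1 P)"
    by (rule nonneg[of _ "\<lambda>x. max 0 x"]) (auto simp: Fp_def fun_eq_iff)
  have m: "integrable (fmeas P) (?L Fm) \<and> integrable (fmeas1 P) (?R Fm)
       \<and> (\<integral> w. ?L Fm w \<partial>fmeas P) = (\<integral> w. ?R Fm w \<partial>fmeas1 P)"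
    by (rule nonneg[of _ "\<lambda>x. max 0 (- x)"]) (auto simp: Fm_def fun_eq_iff)
  have F: "F i n ks js s = Fp i n ks js s - Fm i n ks js s" for i n ks js s
    by (auto simp: Fp_def Fm_def)
  have L: "?L F w = ?L Fp w - ?L Fm w" for w
    by (cases w) (auto simp: F sum_subtractf)
  have R: "?R F w = ?R Fp w - ?R Fm w" for w
    by (cases w) (auto simp: F sum_subtractf right_diff_distrib simp del: of_nat_Suc)
  show "integrable (fmeas P) (?L F)"
    using p m by (subst Bochner_Integration.integrable_cong[OF refl L]) auto
  have "(\<integral> w. ?L F w \<partial>fmeas P) = (\<integral> w. ?L Fp w \<partial>fmeas P) - (\<integral> w. ?L Fm w \<partial>fmeas P)"
    unfolding L using p m by (intro Bochner_Integration.integral_diff) auto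
  also have "\<dots> = (\<integral> w. ?R Fp w \<partial>fmeas1 P) - (\<integral> w. ?R Fm w \<partial>fmeas1 P)"
    using p m by simp
  also have "\<dots> = (\<integral> w. ?R F w \<partial>fmeas1 P)"
    unfolding R using p m by (intro Bochner_Integration.integral_diff[symmetric]) auto
  finally show "(\<integral> w. ?L F w \<partial>fmeas P) = (\<integral> w. ?R F w \<partial>fmeas1 P)" .
qed

section \<open>The Fock space\<close>

definition symmetric_fock :: "nat \<Rightarrow> fock \<Rightarrow> bool" where
  "symmetric_fock P \<Psi> \<longleftrightarrow> (\<forall>n \<pi>. \<pi> permutes {..<n} \<longrightarrow>
     (AE ks in nmeas n. \<forall>js\<in>pols n. \<forall>s\<in>spins P. \<Psi> n (ks \<circ> \<pi>) (js \<circ> \<pi>) s = \<Psi> n ks js s))"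

definition transversal_fock :: "nat \<Rightarrow> fock \<Rightarrow> bool" where
  "transversal_fock P \<Psi> \<longleftrightarrow> (\<forall>n. \<forall>i<n. AE ks in nmeas n. \<forall>js\<in>pols n. \<forall>s\<in>spins P.
     (\<Sum>j\<in>UNIV. complex_of_real (ks i $ j) * \<Psi> n ks (js(i := j)) s) = 0)"

definition Htot :: "nat \<Rightarrow> fock set" where
  "Htot P = {\<Psi>. in_Htot P \<Psi>}"

definition fock_inner :: "nat \<Rightarrow> fock \<Rightarrow> fock \<Rightarrow> real" where
  "fock_inner P \<Psi> \<Phi> = l2ip (fmeas P) (flat \<Psi>) (flat \<Phi>)"

lemma flat_add: "flat (\<Psi> + \<Phi> :: fock) = flat \<Psi> + flat \<Phi>"
  by (auto simp: fun_eq_iff)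

lemma flat_diff: "flat (\<Psi> - \<Phi> :: fock) = flat \<Psi> - flat \<Phi>"
  by (auto simp: fun_eq_iff)

lemma flat_scale: "flat (c *\<^sub>R \<Psi> :: fock) = c *\<^sub>R flat \<Psi>"
  by (auto simp: fun_eq_iff)

lemma flat_zero: "flat (0 :: fock) = 0"
  by (auto simp: fun_eq_iff)

lemma flat_sum: "flat (\<Sum>i\<in>A. \<Psi> i :: fock) = (\<Sum>i\<in>A. flat (\<Psi> i))"
  by (induction A rule: infinite_finite_induct) (simp_all only: flat_add flat_zero sum.infinite sum.empty sum.insert simp_thms)

text \<open>Connects the norm of the model, a series of integrals of finite sums, with one integral
  over \<open>fmeas\<close>, so that the L2 results apply.\<close>

lemma fnorm2_eq:
  assumes "flat \<Psi> \<in> borel_measurable (fmeas P)"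
  shows "fnorm2 P \<Psi> = (\<integral>\<^sup>+ w. ennreal ((cmod (flat \<Psi> w))\<^sup>2) \<partial>fmeas P)"
proof -
  have m: "(\<lambda>ks. \<Psi> n ks js s) \<in> borel_measurable (nmeas n)" if "js \<in> pols n" "s \<in> spins P" for n js s
    using assms that by (simp add: measurable_flat_iff)
  have m': "(\<lambda>ks. ennreal ((cmod (\<Psi> n ks js s))\<^sup>2)) \<in> borel_measurable (nmeas n)"
    if "js \<in> pols n" "s \<in> spins P" for n js s
    using m[OF that] by simp
  have "(\<integral>\<^sup>+ w. ennreal ((cmod (flat \<Psi> w))\<^sup>2) \<partial>fmeas P)
      = (\<integral>\<^sup>+ w. flat (\<lambda>n ks js s. ennreal ((cmod (\<Psi> n ks js s))\<^sup>2)) w \<partial>fmeas P)"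
    by (intro nn_integral_cong) auto
  also have "\<dots> = (\<Sum>n. \<Sum>js\<in>pols n. \<Sum>s\<in>spins P. \<integral>\<^sup>+ ks. ennreal ((cmod (\<Psi> n ks js s))\<^sup>2) \<partial>nmeas n)"
    by (rule nn_integral_fmeas) (unfold measurable_flat_iff, intro allI ballI m')
  also have "\<dots> = fnorm2 P \<Psi>"
    unfolding fnorm2_def
  proof (rule suminf_cong)
    fix n
    have "(\<integral>\<^sup>+ ks. ennreal (\<Sum>js\<in>pols n. \<Sum>s\<in>spins P. (cmod (\<Psi> n ks js s))\<^sup>2) \<partial>nmeas n)
      = (\<integral>\<^sup>+ ks. (\<Sum>js\<in>pols n. \<Sum>s\<in>spins P. ennreal ((cmod (\<Psi> n ks js s))\<^sup>2)) \<partial>nmeas n)"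
      by (simp add: sum_ennreal sum_nonneg)
    also have "\<dots> = (\<Sum>js\<in>pols n. \<integral>\<^sup>+ ks. (\<Sum>s\<in>spins P. ennreal ((cmod (\<Psi> n ks js s))\<^sup>2)) \<partial>nmeas n)"
      by (intro nn_integral_sum borel_measurable_sum m')
    also have "\<dots> = (\<Sum>js\<in>pols n. \<Sum>s\<in>spins P. \<integral>\<^sup>+ ks. ennreal ((cmod (\<Psi> n ks js s))\<^sup>2) \<partial>nmeas n)"
      by (intro sum.cong refl nn_integral_sum m')
    finally show "(\<Sum>js\<in>pols n. \<Sum>s\<in>spins P. \<integral>\<^sup>+ ks. ennreal ((cmod (\<Psi> n ks js s))\<^sup>2) \<partial>nmeas n)
      = (\<integral>\<^sup>+ ks. ennreal (\<Sum>js\<in>pols n. \<Sum>s\<in>spins P. (cmod (\<Psi> n ks js s))\<^sup>2) \<partial>nmeas n)" by simp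
  qed
  finally show ?thesis by simp
qed

lemma fnorm2_L2:
  assumes "flat \<Psi> \<in> L2 (fmeas P)"
  shows "fnorm2 P \<Psi> = ennreal (fock_inner P \<Psi> \<Psi>)" "fnorm P \<Psi> = sqrt (fock_inner P \<Psi> \<Psi>)"
proof -
  show *: "fnorm2 P \<Psi> = ennreal (fock_inner P \<Psi> \<Psi>)"
    using assms by (simp add: fnorm2_eq L2_measurable l2ip_self_nn fock_inner_def)
  have "fock_inner P \<Psi> \<Psi> \<ge> 0" by (simp add: fock_inner_def l2ip_self)
  then show "fnorm P \<Psi> = sqrt (fock_inner P \<Psi> \<Psi>)" by (simp add: fnorm_def *)
qed

lemma in_Htot_iff:
  "in_Htot P \<Psi> \<longleftrightarrow> flat \<Psi> \<in> L2 (fmeas P) \<and> symmetric_fock P \<Psi> \<and> transversal_fock P \<Psi>"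
proof -
  have "in_Htot P \<Psi> \<longleftrightarrow> flat \<Psi> \<in> borel_measurable (fmeas P) \<and> fnorm2 P \<Psi> < \<infinity>
     \<and> symmetric_fock P \<Psi> \<and> transversal_fock P \<Psi>"
    unfolding in_Htot_def symmetric_fock_def transversal_fock_def measurable_flat_iff by blast
  then show ?thesis using fnorm2_eq[of \<Psi> P] by (auto simp: L2_iff)
qed

lemma Htot_iff:
  "\<Psi> \<in> Htot P \<longleftrightarrow> flat \<Psi> \<in> L2 (fmeas P) \<and> symmetric_fock P \<Psi> \<and> transversal_fock P \<Psi>"
  by (simp add: Htot_def in_Htot_iff)

lemma symmetric_fock_add:
  assumes "symmetric_fock P \<Psi>" "symmetric_fock P \<Phi>" shows "symmetric_fock P (\<Psi> + \<Phi>)"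
  unfolding symmetric_fock_def
proof (intro allI impI)
  fix n \<pi> assume "\<pi> permutes {..<n::nat}"
  with assms have "AE ks in nmeas n. \<forall>js\<in>pols n. \<forall>s\<in>spins P. \<Psi> n (ks \<circ> \<pi>) (js \<circ> \<pi>) s = \<Psi> n ks js s"
    "AE ks in nmeas n. \<forall>js\<in>pols n. \<forall>s\<in>spins P. \<Phi> n (ks \<circ> \<pi>) (js \<circ> \<pi>) s = \<Phi> n ks js s"
    by (auto simp: symmetric_fock_def)
  then show "AE ks in nmeas n. \<forall>js\<in>pols n. \<forall>s\<in>spins P. (\<Psi> + \<Phi>) n (ks \<circ> \<pi>) (js \<circ> \<pi>) s = (\<Psi> + \<Phi>) n ks js s"
    by eventually_elim simp
qed

lemma symmetric_fock_scale:
  assumes "symmetric_fock P \<Psi>" shows "symmetric_fock P (c *\<^sub>R \<Psi>)"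
  unfolding symmetric_fock_def
proof (intro allI impI)
  fix n \<pi> assume "\<pi> permutes {..<n::nat}"
  with assms have "AE ks in nmeas n. \<forall>js\<in>pols n. \<forall>s\<in>spins P. \<Psi> n (ks \<circ> \<pi>) (js \<circ> \<pi>) s = \<Psi> n ks js s"
    by (auto simp: symmetric_fock_def)
  then show "AE ks in nmeas n. \<forall>js\<in>pols n. \<forall>s\<in>spins P. (c *\<^sub>R \<Psi>) n (ks \<circ> \<pi>) (js \<circ> \<pi>) s = (c *\<^sub>R \<Psi>) n ks js s"
    by eventually_elim simp
qed

lemma transversal_fock_add:
  assumes "transversal_fock P \<Psi>" "transversal_fock P \<Phi>" shows "transversal_fock P (\<Psi> + \<Phi>)"
  unfolding transversal_fock_def
proof (intro allI impI)
  fix n i assume "i < (n::nat)"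
  with assms have "AE ks in nmeas n. \<forall>js\<in>pols n. \<forall>s\<in>spins P.
     (\<Sum>j\<in>UNIV. complex_of_real (ks i $ j) * \<Psi> n ks (js(i := j)) s) = 0"
    "AE ks in nmeas n. \<forall>js\<in>pols n. \<forall>s\<in>spins P.
     (\<Sum>j\<in>UNIV. complex_of_real (ks i $ j) * \<Phi> n ks (js(i := j)) s) = 0"
    by (auto simp: transversal_fock_def)
  then show "AE ks in nmeas n. \<forall>js\<in>pols n. \<forall>s\<in>spins P.
     (\<Sum>j\<in>UNIV. complex_of_real (ks i $ j) * (\<Psi> + \<Phi>) n ks (js(i := j)) s) = 0"
    by eventually_elim (simp add: distrib_left sum.distrib)
qed

lemma transversal_fock_scale:
  assumes "transversal_fock P \<Psi>" shows "transversal_fock P (c *\<^sub>R \<Psi>)"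
  unfolding transversal_fock_def
proof (intro allI impI)
  fix n i assume "i < (n::nat)"
  with assms have "AE ks in nmeas n. \<forall>js\<in>pols n. \<forall>s\<in>spins P.
     (\<Sum>j\<in>UNIV. complex_of_real (ks i $ j) * \<Psi> n ks (js(i := j)) s) = 0"
    by (auto simp: transversal_fock_def)
  then show "AE ks in nmeas n. \<forall>js\<in>pols n. \<forall>s\<in>spins P.
     (\<Sum>j\<in>UNIV. complex_of_real (ks i $ j) * (c *\<^sub>R \<Psi>) n ks (js(i := j)) s) = 0"
    by eventually_elim (simp add: scaleR_sum_right[symmetric])
qed

lemma subspace_Htot: "subspace (Htot P)"
proof (rule subspaceI)
  have "flat (0::fock) \<in> L2 (fmeas P)" unfolding flat_zero by (rule subspace_0[OF subspace_L2])
  then show "0 \<in> Htot P" by (simp add: Htot_iff symmetric_fock_def transversal_fock_def)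
qed (auto simp: Htot_iff flat_add flat_scale subspace_add[OF subspace_L2] subspace_scale[OF subspace_L2]
      symmetric_fock_add transversal_fock_add symmetric_fock_scale transversal_fock_scale)

lemma fupd_mem_pols: "js \<in> pols n \<Longrightarrow> i < n \<Longrightarrow> js(i := j) \<in> pols n"
  by (auto simp: pols_iff extensional_def)

text \<open>The pointwise series of \<open>L2_series\<close> keeps both constraints. Countably many
  exceptional sets are united, and for transversality the finite sum over a polarisation is
  exchanged with the series, which uses its convergence almost everywhere.\<close>

lemma semi_hilbert_Htot: "semi_hilbert (Htot P) (fock_inner P)"
proof -
  interpret L2: semi_inner "L2 (fmeas P)" "l2ip (fmeas P)" by (rule semi_inner_L2)
  show ?thesis
  proof
    show "subspace (Htot P)" by (rule subspace_Htot)
  next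
    fix X :: "nat \<Rightarrow> fock"
    assume X: "\<And>j. X j \<in> Htot P" and sum: "summable (\<lambda>j. sqrt (fock_inner P (X j) (X j)))"
    define g :: fock where "g = (\<lambda>n ks js s. \<Sum>j. X j n ks js s)"
    have XL: "flat (X j) \<in> L2 (fmeas P)" for j using X by (simp add: Htot_iff)
    have flat_g: "flat g = (\<lambda>w. \<Sum>j. flat (X j) w)" by (auto simp: g_def fun_eq_iff)
    note series = L2_series[OF XL sum[unfolded fock_inner_def], folded flat_g]
    have "symmetric_fock P g" unfolding symmetric_fock_def
    proof (intro allI impI)
      fix n \<pi> assume "\<pi> permutes {..<n::nat}"
      then have "\<forall>j. AE ks in nmeas n. \<forall>js\<in>pols n. \<forall>s\<in>spins P. X j n (ks \<circ> \<pi>) (js \<circ> \<pi>) s = X j n ks js s"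
        using X by (auto simp: Htot_iff symmetric_fock_def)
      then have "AE ks in nmeas n. \<forall>j. \<forall>js\<in>pols n. \<forall>s\<in>spins P. X j n (ks \<circ> \<pi>) (js \<circ> \<pi>) s = X j n ks js s"
        by (simp add: AE_all_countable)
      then show "AE ks in nmeas n. \<forall>js\<in>pols n. \<forall>s\<in>spins P. g n (ks \<circ> \<pi>) (js \<circ> \<pi>) s = g n ks js s"
        by eventually_elim (simp add: g_def)
    qed
    moreover have "transversal_fock P g" unfolding transversal_fock_def
    proof (intro allI impI)
      fix n i assume i: "i < (n::nat)"
      then have "\<forall>j. AE ks in nmeas n. \<forall>js\<in>pols n. \<forall>s\<in>spins P.
           (\<Sum>c\<in>UNIV. complex_of_real (ks i $ c) * X j n ks (js(i := c)) s) = 0"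
        using X by (auto simp: Htot_iff transversal_fock_def)
      then have tr: "AE ks in nmeas n. \<forall>j. \<forall>js\<in>pols n. \<forall>s\<in>spins P.
           (\<Sum>c\<in>UNIV. complex_of_real (ks i $ c) * X j n ks (js(i := c)) s) = 0"
        by (simp add: AE_all_countable)
      have sm: "AE ks in nmeas n. \<forall>js\<in>pols n. \<forall>s\<in>spins P. summable (\<lambda>j. cmod (X j n ks js s))"
        using series(1) unfolding AE_fmeas_iff by (auto intro!: AE_finite_allI)
      from tr sm show "AE ks in nmeas n. \<forall>js\<in>pols n. \<forall>s\<in>spins P.
           (\<Sum>c\<in>UNIV. complex_of_real (ks i $ c) * g n ks (js(i := c)) s) = 0"
      proof (eventually_elim, intro ballI)
        fix ks js s
        assume tr: "\<forall>j. \<forall>js\<in>pols n. \<forall>s\<in>spins P. (\<Sum>c\<in>UNIV. complex_of_real (ks i $ c) * X j n ks (js(i := c)) s) = 0"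
          and sm: "\<forall>js\<in>pols n. \<forall>s\<in>spins P. summable (\<lambda>j. cmod (X j n ks js s))"
          and js: "js \<in> pols n" and s: "s \<in> spins P"
        have s': "summable (\<lambda>j. X j n ks (js(i := c)) s)" for c
          by (rule summable_norm_cancel) (use sm fupd_mem_pols[OF js i] s in blast)
        have "(\<Sum>c\<in>UNIV. complex_of_real (ks i $ c) * g n ks (js(i := c)) s)
          = (\<Sum>c\<in>UNIV. \<Sum>j. complex_of_real (ks i $ c) * X j n ks (js(i := c)) s)"
          by (simp add: g_def suminf_mult s')
        also have "\<dots> = (\<Sum>j. \<Sum>c\<in>UNIV. complex_of_real (ks i $ c) * X j n ks (js(i := c)) s)"
          by (rule suminf_sum[symmetric]) (simp add: summable_mult s')
        also have "\<dots> = 0" using tr js s by simp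
        finally show "(\<Sum>c\<in>UNIV. complex_of_real (ks i $ c) * g n ks (js(i := c)) s) = 0" .
      qed
    qed
    ultimately have "g \<in> Htot P" using series(2) by (simp add: Htot_iff)
    then show "\<exists>g\<in>Htot P. (\<lambda>n. sqrt (fock_inner P (g - (\<Sum>j<n. X j)) (g - (\<Sum>j<n. X j)))) \<longlonglongrightarrow> 0"
      using series(3) by (auto simp: fock_inner_def flat_diff flat_sum)
  qed (auto simp: fock_inner_def flat_add flat_scale Htot_iff L2.ip_add L2.ip_scale L2.ip_nonneg intro: L2.ip_sym)
qed

interpretation Fock: semi_hilbert "Htot P" "fock_inner P" for P
  by (rule semi_hilbert_Htot)

lemma fnorm_eq_nm: "flat \<Psi> \<in> L2 (fmeas P) \<Longrightarrow> fnorm P \<Psi> = Fock.nm P \<Psi>"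
  by (simp add: fnorm2_L2 Fock.nm_def)

lemma fnorm2_zero_iff: "flat \<Psi> \<in> L2 (fmeas P) \<Longrightarrow> fnorm2 P \<Psi> = 0 \<longleftrightarrow> Fock.nm P \<Psi> = 0"
proof -
  assume "flat \<Psi> \<in> L2 (fmeas P)"
  moreover have "fock_inner P \<Psi> \<Psi> \<ge> 0" by (simp add: fock_inner_def l2ip_self)
  ultimately show ?thesis by (simp add: fnorm2_L2 Fock.nm_def)
qed

lemma nm_zero_of_AE:
  assumes "AE w in fmeas P. flat \<Psi> w = 0" shows "Fock.nm P \<Psi> = 0"
proof -
  have "(\<integral> w. (cmod (flat \<Psi> w))\<^sup>2 \<partial>fmeas P) = 0"
    using assms by (intro integral_eq_zero_AE) auto
  then show ?thesis by (simp add: Fock.nm_def fock_inner_def l2ip_self)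
qed

text \<open>Symmetry under the permutation \<open>rot i\<close>, applied to the configuration with
  the new photon in front.\<close>

lemma symmetric_fock_insr:
  assumes \<Psi>: "symmetric_fock P \<Psi>" and i: "i \<le> n"
  shows "AE z in lborel \<Otimes>\<^sub>M nmeas n. \<forall>j. \<forall>js\<in>pols n. \<forall>s\<in>spins P.
     \<Psi> (Suc n) (insr i (fst z) (snd z)) (insr i j js) s = \<Psi> (Suc n) (fcons (fst z) (snd z)) (fcons j js) s"
proof -
  have "AE ks in nmeas (Suc n). \<forall>js\<in>pols (Suc n). \<forall>s\<in>spins P.
      \<Psi> (Suc n) (ks \<circ> rot i) (js \<circ> rot i) s = \<Psi> (Suc n) ks js s"
    using \<Psi> rot_permutes[OF i] by (auto simp: symmetric_fock_def)
  from AE_insr[OF _ this, of 0]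
  have "AE z in lborel \<Otimes>\<^sub>M nmeas n. \<forall>js\<in>pols (Suc n). \<forall>s\<in>spins P.
      \<Psi> (Suc n) (fcons (fst z) (snd z) \<circ> rot i) (js \<circ> rot i) s = \<Psi> (Suc n) (fcons (fst z) (snd z)) js s"
    by (simp add: fcons_insr)
  then show ?thesis
    by eventually_elim (auto simp: insr_rot fcons_mem_pols)
qed

section \<open>Creation and annihilation operators\<close>

lemma measurable_cnj:
  "f \<in> borel_measurable M \<Longrightarrow> (\<lambda>x. cnj (f x)) \<in> borel_measurable M"
  by (rule measurable_compose[where g = cnj and N = borel])
     (auto intro!: borel_measurable_continuous_onI continuous_intros)

definition photon_energy :: "nat \<Rightarrow> (nat \<Rightarrow> real^3) \<Rightarrow> real" where
  "photon_energy n ks = (\<Sum>i<n. norm (ks i))"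

text \<open>The annihilation field a(k) at k = fst z; the remaining n photons are snd z.\<close>
definition ann_field :: "fock \<Rightarrow> nat \<Rightarrow> (real^3) \<times> (nat \<Rightarrow> real^3) \<Rightarrow> 3 \<Rightarrow> (nat \<Rightarrow> 3) \<Rightarrow> (nat \<Rightarrow> bool) \<Rightarrow> complex" where
  "ann_field \<Psi> n z j js s = complex_of_real (sqrt (real (Suc n))) * \<Psi> (Suc n) (fcons (fst z) (snd z)) (fcons j js) s"

text \<open>An extended real, so that estimates can be carried out before finiteness is
  known.\<close>

definition field_energy :: "nat \<Rightarrow> fock \<Rightarrow> ennreal" where
  "field_energy P \<Psi> = (\<integral>\<^sup>+ w. flat (\<lambda>n ks js s. ennreal (photon_energy n ks * (cmod (\<Psi> n ks js s))\<^sup>2)) w \<partial>fmeas P)"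

definition domH :: "nat \<Rightarrow> fock set" where
  "domH P = {\<Psi>. dom_H P \<Psi>}"

lemma hph_photon_energy: "hph \<Psi> = (\<lambda>n ks js s. complex_of_real (photon_energy n ks) * \<Psi> n ks js s)"
  by (simp add: hph_def photon_energy_def)

lemma photon_energy_nonneg [simp]: "photon_energy n ks \<ge> 0"
  by (simp add: photon_energy_def sum_nonneg)

lemma measurable_photon_energy [measurable]: "photon_energy n \<in> borel_measurable (nmeas n)"
proof -
  have "(\<lambda>ks. norm (ks i)) \<in> borel_measurable (nmeas n)" if "i < n" for i
    using measurable_nmeas_component[OF that] by measurable
  then show ?thesis unfolding photon_energy_def[abs_def] by (intro borel_measurable_sum) auto
qed

lemma photon_energy_remove: "i \<le> n \<Longrightarrow> photon_energy (Suc n) ks = norm (ks i) + photon_energy n (fdel i ks)"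
  unfolding photon_energy_def fdel_apply by (rule sum_remove_skip)

lemma measurable_section:
  "flat \<Psi> \<in> borel_measurable (fmeas P) \<Longrightarrow> js \<in> pols n \<Longrightarrow> s \<in> spins P
    \<Longrightarrow> (\<lambda>ks. \<Psi> n ks js s) \<in> borel_measurable (nmeas n)"
  by (simp add: measurable_flat_iff)

lemma measurable_section_fcons:
  assumes "flat \<Psi> \<in> borel_measurable (fmeas P)" "js \<in> pols n" "s \<in> spins P"
  shows "(\<lambda>z. \<Psi> (Suc n) (fcons (fst z) (snd z)) (fcons j js) s) \<in> borel_measurable (lborel \<Otimes>\<^sub>M nmeas n)"
  by (rule measurable_compose[OF measurable_fcons measurable_section[OF assms(1)]])
     (use assms fcons_mem_pols in auto)

lemma measurable_ann_field:
  assumes "flat \<Psi> \<in> borel_measurable (fmeas P)" "js \<in> pols n" "s \<in> spins P"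
  shows "(\<lambda>z. ann_field \<Psi> n z j js s) \<in> borel_measurable (lborel \<Otimes>\<^sub>M nmeas n)"
  unfolding ann_field_def using measurable_section_fcons[OF assms] by measurable

lemma fdel_mem_pols: "i \<le> n \<Longrightarrow> js \<in> pols (Suc n) \<Longrightarrow> fdel i js \<in> pols n"
  by (simp add: pols_iff fdel_extensional)

lemma measurable_section_fdel:
  assumes "flat \<Psi> \<in> borel_measurable (fmeas P)" "i \<le> n" "js \<in> pols (Suc n)" "s \<in> spins P"
  shows "(\<lambda>ks. \<Psi> n (fdel i ks) (fdel i js) s) \<in> borel_measurable (nmeas (Suc n))"
  by (rule measurable_compose[OF measurable_fdel[OF assms(2)] measurable_section[OF assms(1)]])
     (use assms fdel_mem_pols in auto)

lemma Htot_measurable: "\<Psi> \<in> Htot P \<Longrightarrow> flat \<Psi> \<in> borel_measurable (fmeas P)"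
  by (simp add: Htot_iff L2_measurable)

lemma Htot_L2: "\<Psi> \<in> Htot P \<Longrightarrow> flat \<Psi> \<in> L2 (fmeas P)"
  by (simp add: Htot_iff)

lemma measurable_hph:
  assumes "flat \<Psi> \<in> borel_measurable (fmeas P)" shows "flat (hph \<Psi>) \<in> borel_measurable (fmeas P)"
  unfolding measurable_flat_iff hph_photon_energy
proof (intro allI ballI)
  fix n js s assume "js \<in> pols n" "s \<in> spins P"
  from measurable_section[OF assms this]
  show "(\<lambda>ks. complex_of_real (photon_energy n ks) * \<Psi> n ks js s) \<in> borel_measurable (nmeas n)"
    by measurable
qed

lemma L2_hph_iff:
  assumes "\<Psi> \<in> Htot P" shows "flat (hph \<Psi>) \<in> L2 (fmeas P) \<longleftrightarrow> fnorm2 P (hph \<Psi>) < \<infinity>"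
  using measurable_hph[OF Htot_measurable[OF assms]] by (simp add: L2_iff fnorm2_eq)

lemma domH_iff: "\<Psi> \<in> domH P \<longleftrightarrow> \<Psi> \<in> Htot P \<and> flat (hph \<Psi>) \<in> L2 (fmeas P)"
  using L2_hph_iff by (auto simp: domH_def dom_H_def Htot_def)

text \<open>The form of the free energy is the integral of |k| |a(k) Psi|^2. This is the
  marked-photon formula for the summands |k_i| |Psi|^2; its factor \<open>Suc n\<close> is absorbed
  by the square root in \<open>ann_field\<close>.\<close>

lemma field_energy_eq:
  assumes \<Psi>: "\<Psi> \<in> Htot P"
  shows "field_energy P \<Psi> = (\<integral>\<^sup>+ w. flat (\<lambda>n z js s.
      \<Sum>j\<in>UNIV. ennreal (norm (fst z) * (cmod (ann_field \<Psi> n z j js s))\<^sup>2)) w \<partial>fmeas1 P)"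
proof -
  have m: "(\<lambda>ks. \<Psi> n ks js s) \<in> borel_measurable (nmeas n)" if "js \<in> pols n" "s \<in> spins P" for n js s
    using measurable_section[OF Htot_measurable[OF \<Psi>] that] .
  have sy: "symmetric_fock P \<Psi>" using \<Psi> by (simp add: Htot_iff)
  have "field_energy P \<Psi> = (\<integral>\<^sup>+ w. flat (\<lambda>n ks js s. \<Sum>i<n. ennreal (norm (ks i) * (cmod (\<Psi> n ks js s))\<^sup>2)) w \<partial>fmeas P)"
    unfolding field_energy_def by (intro nn_integral_cong) (auto simp: photon_energy_def sum_distrib_right sum_ennreal)
  also have "\<dots> = (\<integral>\<^sup>+ w. flat (\<lambda>n z js s. of_nat (Suc n) * (\<Sum>j\<in>UNIV. ennreal (norm (fcons (fst z) (snd z) 0)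
         * (cmod (\<Psi> (Suc n) (fcons (fst z) (snd z)) (fcons j js) s))\<^sup>2))) w \<partial>fmeas1 P)"
  proof (rule mecke_nn)
    fix i n js s assume a: "i < (n::nat)" "js \<in> pols n" "s \<in> spins P"
    have [measurable]: "(\<lambda>ks. ks i) \<in> borel_measurable (nmeas n)" "(\<lambda>ks. \<Psi> n ks js s) \<in> borel_measurable (nmeas n)"
      using measurable_nmeas_component[OF a(1)] m[OF a(2,3)] by auto
    show "(\<lambda>ks. ennreal (norm (ks i) * (cmod (\<Psi> n ks js s))\<^sup>2)) \<in> borel_measurable (nmeas n)"
      by measurable
  next
    fix i n js s and j :: 3 assume a: "i \<le> (n::nat)" "js \<in> pols n" "s \<in> spins P"
    from symmetric_fock_insr[OF sy a(1)]
    show "AE z in lborel \<Otimes>\<^sub>M nmeas n.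
      ennreal (norm (insr i (fst z) (snd z) i) * (cmod (\<Psi> (Suc n) (insr i (fst z) (snd z)) (insr i j js) s))\<^sup>2) =
      ennreal (norm (fcons (fst z) (snd z) 0) * (cmod (\<Psi> (Suc n) (fcons (fst z) (snd z)) (fcons j js) s))\<^sup>2)"
      by eventually_elim (use a in \<open>simp add: fcons_insr\<close>)
  qed
  also have "\<dots> = (\<integral>\<^sup>+ w. flat (\<lambda>n z js s. \<Sum>j\<in>UNIV. ennreal (norm (fst z) * (cmod (ann_field \<Psi> n z j js s))\<^sup>2)) w \<partial>fmeas1 P)"
  proof (rule nn_integral_cong)
    fix w :: "(nat \<times> (nat \<Rightarrow> 3) \<times> (nat \<Rightarrow> bool)) \<times> (real^3) \<times> (nat \<Rightarrow> real^3)"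
    obtain n js s z where w: "w = ((n, js, s), z)" by (metis prod.exhaust)
    have "of_nat (Suc n) * ennreal (norm (fcons (fst z) (snd z) 0) * (cmod (\<Psi> (Suc n) (fcons (fst z) (snd z)) (fcons j js) s))\<^sup>2)
      = ennreal (norm (fst z) * (cmod (ann_field \<Psi> n z j js s))\<^sup>2)" for j
    proof -
      have "real (Suc n) * (norm (fst z) * (cmod (\<Psi> (Suc n) (fcons (fst z) (snd z)) (fcons j js) s))\<^sup>2)
        = norm (fst z) * (cmod (ann_field \<Psi> n z j js s))\<^sup>2"
        unfolding ann_field_def norm_mult power_mult_distrib norm_of_real power2_abs by simp
      then show ?thesis
        by (simp add: ennreal_of_nat_eq_real_of_nat fcons_def ennreal_mult'[symmetric] del: of_nat_Suc)
    qed
    then show "flat (\<lambda>n z js s. of_nat (Suc n) * (\<Sum>j\<in>UNIV. ennreal (norm (fcons (fst z) (snd z) 0)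
         * (cmod (\<Psi> (Suc n) (fcons (fst z) (snd z)) (fcons j js) s))\<^sup>2))) w
      = flat (\<lambda>n z js s. \<Sum>j\<in>UNIV. ennreal (norm (fst z) * (cmod (ann_field \<Psi> n z j js s))\<^sup>2)) w"
      unfolding w flat_apply sum_distrib_left by simp
  qed
  finally show ?thesis .
qed

lemma inner_hph: "u \<bullet> (complex_of_real c * u) = c * (cmod u)\<^sup>2" for u :: complex
  by (simp add: inner_mult_right' power2_norm_eq_inner scaleR_conv_of_real[symmetric])

lemma fock_inner_hph:
  assumes "\<Psi> \<in> domH P"
  shows "field_energy P \<Psi> = ennreal (fock_inner P \<Psi> (hph \<Psi>))" "fock_inner P \<Psi> (hph \<Psi>) \<ge> 0"
proof -
  have L: "flat \<Psi> \<in> L2 (fmeas P)" "flat (hph \<Psi>) \<in> L2 (fmeas P)" using assms by (auto simp: domH_iff Htot_iff)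
  have eq: "flat \<Psi> w \<bullet> flat (hph \<Psi>) w = flat (\<lambda>n ks js s. photon_energy n ks * (cmod (\<Psi> n ks js s))\<^sup>2) w" for w
    by (cases w) (auto simp: hph_photon_energy inner_hph)
  have nn: "flat \<Psi> w \<bullet> flat (hph \<Psi>) w \<ge> 0" for w unfolding eq by (cases w) auto
  have "field_energy P \<Psi> = (\<integral>\<^sup>+ w. ennreal (flat \<Psi> w \<bullet> flat (hph \<Psi>) w) \<partial>fmeas P)"
    unfolding field_energy_def eq by (intro nn_integral_cong) auto
  also have "\<dots> = ennreal (fock_inner P \<Psi> (hph \<Psi>))"
    unfolding fock_inner_def l2ip_def using L nn by (intro nn_integral_eq_integral L2_inner_integrable) auto
  finally show "field_energy P \<Psi> = ennreal (fock_inner P \<Psi> (hph \<Psi>))" .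
  show "fock_inner P \<Psi> (hph \<Psi>) \<ge> 0" unfolding fock_inner_def l2ip_def by (intro integral_nonneg_AE AE_I2 nn)
qed

lemma sum3_square_le: "(\<Sum>j\<in>(UNIV::3 set). a j)\<^sup>2 \<le> 3 * (\<Sum>j\<in>UNIV. (a j)\<^sup>2)" for a :: "3 \<Rightarrow> real"
  using Cauchy_Schwarz_ineq_sum[of a "\<lambda>_. 1" UNIV] by (simp add: mult.commute)

text \<open>A form factor \<open>V\<close> with a scalar majorant \<open>g\<close> common to all
  polarisations. \<open>g_int0\<close> is used for creation, \<open>g_int1\<close> for bounding both
  fields by the free energy. The value \<open>g 0 = 0\<close> keeps cancellations such as
  \<open>g k / sqrt (norm k) * sqrt (norm k) = g k\<close> true at the origin, where division by
  zero gives 0.\<close>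

locale form_factor =
  fixes V :: "real^3 \<Rightarrow> 3 \<Rightarrow> complex" and g :: "real^3 \<Rightarrow> real"
  assumes measurable_V: "\<And>j. (\<lambda>k. V k j) \<in> borel_measurable borel"
    and measurable_g: "g \<in> borel_measurable borel"
    and V_le: "\<And>k j. cmod (V k j) \<le> g k"
    and g_zero: "g 0 = 0"
    and g_int0: "integrable lborel (\<lambda>k. (g k)\<^sup>2)"
    and g_int1: "integrable lborel (\<lambda>k. (g k)\<^sup>2 / norm k)"
    and V_transversal: "\<And>k. (\<Sum>j\<in>UNIV. complex_of_real (k $ j) * V k j) = 0"
begin

lemma g_nonneg: "g k \<ge> 0"
  using V_le[of k 0] norm_ge_zero order_trans by blast

definition c0 where "c0 = (\<integral> k. (g k)\<^sup>2 \<partial>lborel)"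
definition c1 where "c1 = (\<integral> k. (g k)\<^sup>2 / norm k \<partial>lborel)"

lemma c_nonneg: "c0 \<ge> 0" "c1 \<ge> 0"
  by (auto simp: c0_def c1_def integral_nonneg_AE)

lemma nn_c1: "(\<integral>\<^sup>+ k. ennreal ((g k)\<^sup>2 / norm k) \<partial>lborel) = ennreal c1"
  unfolding c1_def by (rule nn_integral_eq_integral[OF g_int1]) auto

text \<open>Annihilation with moduli: defined whether or not the integral in \<open>annih\<close>
  converges, and its finiteness is what proves convergence.\<close>

definition ann_abs :: "fock \<Rightarrow> nat \<Rightarrow> (nat \<Rightarrow> real^3) \<Rightarrow> (nat \<Rightarrow> 3) \<Rightarrow> (nat \<Rightarrow> bool) \<Rightarrow> ennreal" where
  "ann_abs \<Psi> n ks js s = (\<integral>\<^sup>+ k. ennreal (g k * (\<Sum>j\<in>UNIV. cmod (ann_field \<Psi> n (k, ks) j js s))) \<partial>lborel)"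

lemma measurable_ann_abs:
  assumes "flat \<Psi> \<in> borel_measurable (fmeas P)"
  shows "flat (ann_abs \<Psi>) \<in> borel_measurable (fmeas P)"
  unfolding measurable_flat_iff
proof (intro allI ballI)
  fix n js s assume a: "js \<in> pols n" "s \<in> spins P"
  have [measurable]: "(\<lambda>z. ann_field \<Psi> n z j js s) \<in> borel_measurable (lborel \<Otimes>\<^sub>M nmeas n)" for j
    by (rule measurable_ann_field[OF assms a])
  have [measurable]: "(\<lambda>z. ann_field \<Psi> n (snd z, fst z) j js s) \<in> borel_measurable (nmeas n \<Otimes>\<^sub>M lborel)" for j
    by (rule measurable_compose[OF _ measurable_ann_field[OF assms a]]) measurable
  have [measurable]: "g \<in> borel_measurable lborel" using measurable_g by simp
  show "(\<lambda>ks. ann_abs \<Psi> n ks js s) \<in> borel_measurable (nmeas n)"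
    unfolding ann_abs_def
    by (rule sigma_finite_measure.borel_measurable_nn_integral[OF sigma_finite_lborel])
       (simp add: case_prod_unfold)
qed

text \<open>Cauchy-Schwarz in k after writing g as g / sqrt |k| times sqrt |k|: the first factor
  yields \<open>c1\<close>, the second the energy density of \<open>field_energy_eq\<close>. The 3
  is the number of polarisation components.\<close>

lemma ann_abs_bound:
  assumes \<Psi>: "\<Psi> \<in> Htot P"
  shows "(\<integral>\<^sup>+ w. (flat (ann_abs \<Psi>) w)\<^sup>2 \<partial>fmeas P) \<le> ennreal (3 * c1) * field_energy P \<Psi>"
proof -
  have m: "flat \<Psi> \<in> borel_measurable (fmeas P)" by (rule Htot_measurable[OF \<Psi>])
  define S where "S n z js s = (\<Sum>j\<in>UNIV. ennreal (norm (fst z) * (cmod (ann_field \<Psi> n z j js s))\<^sup>2))" for n z js s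
  have mS: "(\<lambda>z. S n z js s) \<in> borel_measurable (lborel \<Otimes>\<^sub>M nmeas n)" if "js \<in> pols n" "s \<in> spins P" for n js s
  proof -
    have [measurable]: "(\<lambda>z. ann_field \<Psi> n z j js s) \<in> borel_measurable (lborel \<Otimes>\<^sub>M nmeas n)" for j
      by (rule measurable_ann_field[OF m that])
    show ?thesis unfolding S_def by measurable
  qed
  have pt: "(ann_abs \<Psi> n ks js s)\<^sup>2 \<le> ennreal (3 * c1) * (\<integral>\<^sup>+ k. S n (k, ks) js s \<partial>lborel)"
    if a: "js \<in> pols n" "s \<in> spins P" "ks \<in> space (nmeas n)" for n ks js s
  proof -
    have sec: "(\<lambda>k. ann_field \<Psi> n (k, ks) j js s) \<in> borel_measurable lborel" for j
      by (rule measurable_compose[OF measurable_Pair2' measurable_ann_field[OF m a(1,2)]]) (rule a(3))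
    note [measurable] = sec
    have [measurable]: "g \<in> borel_measurable lborel" using measurable_g by simp
    let ?A = "\<lambda>k. \<Sum>j\<in>UNIV. cmod (ann_field \<Psi> n (k, ks) j js s)"
    have "ann_abs \<Psi> n ks js s = (\<integral>\<^sup>+ k. ennreal (g k / sqrt (norm k)) * ennreal (sqrt (norm k) * ?A k) \<partial>lborel)"
      unfolding ann_abs_def
    proof (rule nn_integral_cong)
      fix k :: "real^3"
      show "ennreal (g k * ?A k) = ennreal (g k / sqrt (norm k)) * ennreal (sqrt (norm k) * ?A k)"
        by (cases "k = 0") (simp_all add: g_zero g_nonneg ennreal_mult[symmetric] sum_nonneg)
    qed
    then have "(ann_abs \<Psi> n ks js s)\<^sup>2 \<le> (\<integral>\<^sup>+ k. (ennreal (g k / sqrt (norm k)))\<^sup>2 \<partial>lborel)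
        * (\<integral>\<^sup>+ k. (ennreal (sqrt (norm k) * ?A k))\<^sup>2 \<partial>lborel)"
      by (simp only:) (rule Cauchy_Schwarz_nn_integral; measurable)
    also have "(\<integral>\<^sup>+ k. (ennreal (g k / sqrt (norm k)))\<^sup>2 \<partial>lborel) = ennreal c1"
      unfolding nn_c1[symmetric]
      by (intro nn_integral_cong) (simp add: ennreal_power g_nonneg power_divide)
    also have "(\<integral>\<^sup>+ k. (ennreal (sqrt (norm k) * ?A k))\<^sup>2 \<partial>lborel) \<le> (\<integral>\<^sup>+ k. 3 * S n (k, ks) js s \<partial>lborel)"
    proof (rule nn_integral_mono)
      fix k :: "real^3"
      have "(ennreal (sqrt (norm k) * ?A k))\<^sup>2 = ennreal (norm k * (?A k)\<^sup>2)"
        by (simp add: ennreal_power sum_nonneg power_mult_distrib)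
      also have "\<dots> \<le> ennreal (norm k * (3 * (\<Sum>j\<in>UNIV. (cmod (ann_field \<Psi> n (k, ks) j js s))\<^sup>2)))"
        by (intro ennreal_leI mult_left_mono sum3_square_le) auto
      also have "\<dots> = ennreal (3 * (\<Sum>j\<in>UNIV. norm k * (cmod (ann_field \<Psi> n (k, ks) j js s))\<^sup>2))"
        by (simp add: sum_distrib_left mult.left_commute)
      also have "\<dots> = 3 * S n (k, ks) js s"
        unfolding S_def by (subst sum_ennreal) (simp_all add: ennreal_mult sum_nonneg)
      finally show "(ennreal (sqrt (norm k) * ?A k))\<^sup>2 \<le> 3 * S n (k, ks) js s" .
    qed
    also have "(\<integral>\<^sup>+ k. 3 * S n (k, ks) js s \<partial>lborel) = 3 * (\<integral>\<^sup>+ k. S n (k, ks) js s \<partial>lborel)"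
      by (rule nn_integral_cmult) (rule measurable_compose[OF measurable_Pair2'[OF a(3)] mS[OF a(1,2)]])
    finally have "(ann_abs \<Psi> n ks js s)\<^sup>2 \<le> ennreal c1 * (3 * (\<integral>\<^sup>+ k. S n (k, ks) js s \<partial>lborel))"
      by (simp add: mult_left_mono)
    also have "\<dots> = ennreal (3 * c1) * (\<integral>\<^sup>+ k. S n (k, ks) js s \<partial>lborel)"
      using c_nonneg by (simp add: ennreal_mult mult_ac)
    finally show ?thesis .
  qed
  have mA: "flat (\<lambda>n ks js s. (ann_abs \<Psi> n ks js s)\<^sup>2) \<in> borel_measurable (fmeas P)"
    unfolding measurable_flat_iff
  proof (intro allI ballI)
    fix n js s assume "js \<in> pols n" "s \<in> spins P"
    then have [measurable]: "(\<lambda>ks. ann_abs \<Psi> n ks js s) \<in> borel_measurable (nmeas n)"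
      using measurable_ann_abs[OF m] by (simp add: measurable_flat_iff)
    show "(\<lambda>ks. (ann_abs \<Psi> n ks js s)\<^sup>2) \<in> borel_measurable (nmeas n)" by measurable
  qed
  have "(\<integral>\<^sup>+ w. (flat (ann_abs \<Psi>) w)\<^sup>2 \<partial>fmeas P) = (\<integral>\<^sup>+ w. flat (\<lambda>n ks js s. (ann_abs \<Psi> n ks js s)\<^sup>2) w \<partial>fmeas P)"
    by (intro nn_integral_cong) auto
  also have "\<dots> = (\<Sum>n. \<Sum>js\<in>pols n. \<Sum>s\<in>spins P. \<integral>\<^sup>+ ks. (ann_abs \<Psi> n ks js s)\<^sup>2 \<partial>nmeas n)"
    by (rule nn_integral_fmeas[OF mA])
  also have "\<dots> \<le> (\<Sum>n. \<Sum>js\<in>pols n. \<Sum>s\<in>spins P. ennreal (3 * c1) * (\<integral>\<^sup>+ z. S n z js s \<partial>(lborel \<Otimes>\<^sub>M nmeas n)))"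
  proof (intro suminf_le sum_mono summableI)
    fix n js s assume a: "js \<in> pols n" "s \<in> spins P"
    interpret pair_sigma_finite "lborel :: (real^3) measure" "nmeas n" by (rule pair_sigma_finite_nmeas)
    have "(\<integral>\<^sup>+ ks. (ann_abs \<Psi> n ks js s)\<^sup>2 \<partial>nmeas n)
        \<le> (\<integral>\<^sup>+ ks. ennreal (3 * c1) * (\<integral>\<^sup>+ k. S n (k, ks) js s \<partial>lborel) \<partial>nmeas n)"
      by (rule nn_integral_mono) (rule pt[OF a])
    also have "\<dots> = ennreal (3 * c1) * (\<integral>\<^sup>+ ks. (\<integral>\<^sup>+ k. S n (k, ks) js s \<partial>lborel) \<partial>nmeas n)"
    proof (rule nn_integral_cmult)
      have "(\<lambda>z. S n (snd z, fst z) js s) \<in> borel_measurable (nmeas n \<Otimes>\<^sub>M lborel)"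
        by (rule measurable_compose[OF _ mS[OF a]]) measurable
      then show "(\<lambda>ks. \<integral>\<^sup>+ k. S n (k, ks) js s \<partial>lborel) \<in> borel_measurable (nmeas n)"
        by (intro sigma_finite_measure.borel_measurable_nn_integral[OF sigma_finite_lborel])
           (simp add: case_prod_unfold)
    qed
    also have "(\<integral>\<^sup>+ ks. (\<integral>\<^sup>+ k. S n (k, ks) js s \<partial>lborel) \<partial>nmeas n) = (\<integral>\<^sup>+ z. S n z js s \<partial>(lborel \<Otimes>\<^sub>M nmeas n))"
      by (rule nn_integral_snd[OF mS[OF a]])
    finally show "(\<integral>\<^sup>+ ks. (ann_abs \<Psi> n ks js s)\<^sup>2 \<partial>nmeas n)
        \<le> ennreal (3 * c1) * (\<integral>\<^sup>+ z. S n z js s \<partial>(lborel \<Otimes>\<^sub>M nmeas n))" .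
  qed
  also have "\<dots> = ennreal (3 * c1) * (\<Sum>n. \<Sum>js\<in>pols n. \<Sum>s\<in>spins P. \<integral>\<^sup>+ z. S n z js s \<partial>(lborel \<Otimes>\<^sub>M nmeas n))"
    by (simp add: sum_distrib_left[symmetric])
  also have "(\<Sum>n. \<Sum>js\<in>pols n. \<Sum>s\<in>spins P. \<integral>\<^sup>+ z. S n z js s \<partial>(lborel \<Otimes>\<^sub>M nmeas n)) = (\<integral>\<^sup>+ w. flat S w \<partial>fmeas1 P)"
    by (rule nn_integral_fmeas1[symmetric]) (use mS in \<open>simp add: measurable_flat1_iff\<close>)
  also have "\<dots> = field_energy P \<Psi>"
    unfolding field_energy_eq[OF \<Psi>] S_def ..
  finally show ?thesis .
qed

end

section \<open>Bounds on annihilation and creation by the free field energy\<close>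

context form_factor
begin

text \<open>The L2 bound makes \<open>ann_abs\<close> finite almost everywhere. At such
  configurations \<open>annih\<close> is a genuine integral, hence linear and compatible with the
  transversality condition.\<close>

lemma AE_annih_integrable:
  assumes \<Psi>: "\<Psi> \<in> domH P"
  shows "AE w in fmeas P. flat (\<lambda>n ks js s. \<forall>j. integrable lborel (\<lambda>k. cnj (V k j) * ann_field \<Psi> n (k, ks) j js s)) w"
proof -
  have H: "\<Psi> \<in> Htot P" using \<Psi> by (simp add: domH_iff)
  note m = Htot_measurable[OF H]
  have "(\<integral>\<^sup>+ w. (flat (ann_abs \<Psi>) w)\<^sup>2 \<partial>fmeas P) \<le> ennreal (3 * c1) * field_energy P \<Psi>"
    by (rule ann_abs_bound[OF H])
  also have "\<dots> < \<infinity>" using fock_inner_hph[OF \<Psi>] by (simp add: ennreal_mult_less_top)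
  finally have "AE w in fmeas P. (flat (ann_abs \<Psi>) w)\<^sup>2 \<noteq> \<infinity>"
    using measurable_ann_abs[OF m] by (intro nn_integral_noteq_infinite) auto
  then have "AE w in fmeas P. flat (ann_abs \<Psi>) w < \<infinity>"
    by eventually_elim (auto simp: less_top[symmetric])
  then show ?thesis
    unfolding AE_fmeas_iff
  proof (intro allI ballI)
    fix n js s assume fin: "\<forall>n. \<forall>js\<in>pols n. \<forall>s\<in>spins P. AE ks in nmeas n. flat (ann_abs \<Psi>) ((n, js, s), ks) < \<infinity>"
      and a: "js \<in> pols n" "s \<in> spins P"
    have "AE ks in nmeas n. ann_abs \<Psi> n ks js s < \<infinity>" using fin a by fastforce
    then show "AE ks in nmeas n. flat (\<lambda>n ks js s. \<forall>j. integrable lborel (\<lambda>k. cnj (V k j) * ann_field \<Psi> n (k, ks) j js s)) ((n, js, s), ks)"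
    proof (rule AE_mp, intro AE_I2 impI)
      fix ks assume ks: "ks \<in> space (nmeas n)" and fin: "ann_abs \<Psi> n ks js s < \<infinity>"
      have "integrable lborel (\<lambda>k. cnj (V k j) * ann_field \<Psi> n (k, ks) j js s)" for j
      proof (rule integrableI_bounded)
        have a': "(\<lambda>k. ann_field \<Psi> n (k, ks) j js s) \<in> borel_measurable lborel"
          by (rule measurable_compose[OF measurable_Pair2'[OF ks] measurable_ann_field[OF m a]])
        have "(\<lambda>k. V k j) \<in> borel_measurable lborel" using measurable_V by simp
        from borel_measurable_times[OF measurable_cnj[OF this] a']
        show "(\<lambda>k. cnj (V k j) * ann_field \<Psi> n (k, ks) j js s) \<in> borel_measurable lborel" .
        have "(\<integral>\<^sup>+ k. ennreal (norm (cnj (V k j) * ann_field \<Psi> n (k, ks) j js s)) \<partial>lborel) \<le> ann_abs \<Psi> n ks js s"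
          unfolding ann_abs_def norm_mult complex_mod_cnj
          by (intro nn_integral_mono ennreal_leI mult_mono V_le member_le_sum) (auto simp: g_nonneg)
        then show "(\<integral>\<^sup>+ k. ennreal (norm (cnj (V k j) * ann_field \<Psi> n (k, ks) j js s)) \<partial>lborel) < \<infinity>"
          using fin by simp
      qed
      then show "flat (\<lambda>n ks js s. \<forall>j. integrable lborel (\<lambda>k. cnj (V k j) * ann_field \<Psi> n (k, ks) j js s)) ((n, js, s), ks)"
        by simp
    qed
  qed
qed

lemma annih_ann_field: "annih V \<Psi> n ks js s = (\<integral> k. (\<Sum>j\<in>UNIV. cnj (V k j) * ann_field \<Psi> n (k, ks) j js s) \<partial>lborel)"
proof -
  have "(\<integral> k. (\<Sum>j\<in>UNIV. cnj (V k j) * ann_field \<Psi> n (k, ks) j js s) \<partial>lborel)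
    = (\<integral> k. complex_of_real (sqrt (real (Suc n))) *
        (\<Sum>j\<in>UNIV. cnj (V k j) * \<Psi> (Suc n) (fcons k ks) (fcons j js) s) \<partial>lborel)"
    by (simp add: ann_field_def sum_distrib_left mult.left_commute del: of_nat_Suc)
  then show ?thesis
    unfolding annih_def by (simp del: of_nat_Suc)
qed

lemma measurable_annih:
  assumes "flat \<Psi> \<in> borel_measurable (fmeas P)" shows "flat (annih V \<Psi>) \<in> borel_measurable (fmeas P)"
  unfolding measurable_flat_iff
proof (intro allI ballI)
  fix n js s assume a: "js \<in> pols n" "s \<in> spins P"
  have a': "(\<lambda>z. ann_field \<Psi> n (snd z, fst z) j js s) \<in> borel_measurable (nmeas n \<Otimes>\<^sub>M lborel)" for j
    by (rule measurable_compose[OF _ measurable_ann_field[OF assms a]]) measurable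
  have v': "(\<lambda>z. V (snd z) j) \<in> borel_measurable (nmeas n \<Otimes>\<^sub>M lborel)" for j
    by (rule measurable_compose[OF measurable_snd]) (use measurable_V in simp)
  show "(\<lambda>ks. annih V \<Psi> n ks js s) \<in> borel_measurable (nmeas n)"
    unfolding annih_ann_field
    by (rule sigma_finite_measure.borel_measurable_lebesgue_integral[OF sigma_finite_lborel],
        unfold case_prod_unfold, intro borel_measurable_sum borel_measurable_times measurable_cnj v' a')
qed

text \<open>Holds without any integrability, because a divergent integral counts as 0.\<close>

lemma cmod_annih_le: "ennreal (cmod (annih V \<Psi> n ks js s)) \<le> ann_abs \<Psi> n ks js s"
proof (cases "integrable lborel (\<lambda>k. \<Sum>j\<in>UNIV. cnj (V k j) * ann_field \<Psi> n (k, ks) j js s)")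
  case True
  then have "ennreal (cmod (annih V \<Psi> n ks js s))
     \<le> (\<integral>\<^sup>+ k. ennreal (cmod (\<Sum>j\<in>UNIV. cnj (V k j) * ann_field \<Psi> n (k, ks) j js s)) \<partial>lborel)"
    unfolding annih_ann_field by (rule integral_norm_bound_ennreal)
  also have "\<dots> \<le> ann_abs \<Psi> n ks js s"
    unfolding ann_abs_def sum_distrib_left
    by (intro nn_integral_mono ennreal_leI order.trans[OF norm_sum] sum_mono)
       (simp add: norm_mult V_le mult_right_mono)
  finally show ?thesis .
qed (simp add: annih_ann_field not_integrable_integral_eq)

lemma annih_bound:
  assumes \<Psi>: "\<Psi> \<in> domH P"
  shows "flat (annih V \<Psi>) \<in> L2 (fmeas P)"
    "fock_inner P (annih V \<Psi>) (annih V \<Psi>) \<le> 3 * c1 * fock_inner P \<Psi> (hph \<Psi>)"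
proof -
  have H: "\<Psi> \<in> Htot P" using \<Psi> by (simp add: domH_iff)
  have "(\<integral>\<^sup>+ w. ennreal ((cmod (flat (annih V \<Psi>) w))\<^sup>2) \<partial>fmeas P) \<le> (\<integral>\<^sup>+ w. (flat (ann_abs \<Psi>) w)\<^sup>2 \<partial>fmeas P)"
  proof (rule nn_integral_mono)
    fix w :: "(nat \<times> (nat \<Rightarrow> 3) \<times> (nat \<Rightarrow> bool)) \<times> (nat \<Rightarrow> real^3)"
    obtain n js s ks where w: "w = ((n, js, s), ks)" by (metis prod.exhaust)
    show "ennreal ((cmod (flat (annih V \<Psi>) w))\<^sup>2) \<le> (flat (ann_abs \<Psi>) w)\<^sup>2"
      unfolding w flat_apply ennreal_power[OF norm_ge_zero, symmetric]
      by (intro power_mono cmod_annih_le) simp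
  qed
  also have "\<dots> \<le> ennreal (3 * c1) * field_energy P \<Psi>" by (rule ann_abs_bound[OF H])
  also have "\<dots> = ennreal (3 * c1 * fock_inner P \<Psi> (hph \<Psi>))"
    using fock_inner_hph[OF \<Psi>] c_nonneg by (simp add: ennreal_mult)
  finally have le: "(\<integral>\<^sup>+ w. ennreal ((cmod (flat (annih V \<Psi>) w))\<^sup>2) \<partial>fmeas P) \<le> ennreal (3 * c1 * fock_inner P \<Psi> (hph \<Psi>))" .
  then show L: "flat (annih V \<Psi>) \<in> L2 (fmeas P)"
    using measurable_annih[OF Htot_measurable[OF H]] by (auto simp: L2_iff intro: le_less_trans)
  show "fock_inner P (annih V \<Psi>) (annih V \<Psi>) \<le> 3 * c1 * fock_inner P \<Psi> (hph \<Psi>)"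
    using le fock_inner_hph[OF \<Psi>] c_nonneg unfolding l2ip_self_nn[OF L] fock_inner_def by simp
qed

text \<open>The splitting used for annihilation, now over finitely many photons; the second factor
  is the total photon energy.\<close>

lemma weighted_cauchy_schwarz:
  fixes a :: "nat \<Rightarrow> real" and y :: "nat \<Rightarrow> real^3"
  assumes "\<And>i. i < n \<Longrightarrow> 0 \<le> a i"
  shows "(\<Sum>i<n. g (y i) * a i)\<^sup>2 \<le> (\<Sum>i<n. (g (y i))\<^sup>2 / norm (y i) * (a i)\<^sup>2) * (\<Sum>i<n. norm (y i))"
proof -
  have "(\<Sum>i<n. g (y i) * a i) = (\<Sum>i<n. (g (y i) / sqrt (norm (y i)) * a i) * sqrt (norm (y i)))"
  proof (rule sum.cong[OF refl])
    fix i show "g (y i) * a i = (g (y i) / sqrt (norm (y i)) * a i) * sqrt (norm (y i))"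
      by (cases "y i = 0") (simp_all add: g_zero)
  qed
  then show ?thesis
    using Cauchy_Schwarz_ineq_sum[of "\<lambda>i. g (y i) / sqrt (norm (y i)) * a i" "\<lambda>i. sqrt (norm (y i))" "{..<n}"]
    by (simp add: power_mult_distrib power_divide)
qed

text \<open>The weight is g^2/|k_i| times the total energy: the energy |k_i| of the created photon
  turns it into g^2, the energy of the others stays as a factor. The prefactor is the squared
  normalisation of creation and later cancels the multiplicity of the marked photon.\<close>

definition create_dens :: "fock \<Rightarrow> nat \<Rightarrow> nat \<Rightarrow> (nat \<Rightarrow> real^3) \<Rightarrow> (nat \<Rightarrow> 3) \<Rightarrow> (nat \<Rightarrow> bool) \<Rightarrow> real" where
  "create_dens \<Phi> i n ks js s = (1 / real n) * (((g (ks i))\<^sup>2 + (g (ks i))\<^sup>2 / norm (ks i) * photon_energy (n - 1) (fdel i ks))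
       * (cmod (\<Phi> (n - 1) (fdel i ks) (fdel i js) s))\<^sup>2)"

lemma cmod_create_le:
  "(cmod (create V \<Phi> n ks js s))\<^sup>2 \<le> (\<Sum>i<n. create_dens \<Phi> i n ks js s)"
proof (cases n)
  case (Suc m)
  let ?a = "\<lambda>i. cmod (\<Phi> m (fdel i ks) (fdel i js) s)"
  have "cmod (create V \<Phi> n ks js s) = 1 / sqrt (real n) * cmod (\<Sum>i<n. V (ks i) (js i) * \<Phi> m (fdel i ks) (fdel i js) s)"
    unfolding create_def using Suc by (simp add: norm_mult norm_divide del: of_nat_Suc)
  also have "\<dots> \<le> 1 / sqrt (real n) * (\<Sum>i<n. g (ks i) * ?a i)"
    by (intro mult_left_mono order.trans[OF norm_sum] sum_mono)
       (auto simp: norm_mult V_le mult_right_mono)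
  finally have "(cmod (create V \<Phi> n ks js s))\<^sup>2 \<le> (1 / sqrt (real n) * (\<Sum>i<n. g (ks i) * ?a i))\<^sup>2"
    by (rule power_mono) simp
  also have "\<dots> = 1 / real n * (\<Sum>i<n. g (ks i) * ?a i)\<^sup>2"
    by (simp add: power_mult_distrib power_divide)
  also have "\<dots> \<le> 1 / real n * ((\<Sum>i<n. (g (ks i))\<^sup>2 / norm (ks i) * (?a i)\<^sup>2) * photon_energy n ks)"
    unfolding photon_energy_def by (intro mult_left_mono weighted_cauchy_schwarz) auto
  also have "\<dots> = (\<Sum>i<n. create_dens \<Phi> i n ks js s)"
    unfolding sum_distrib_left sum_distrib_right
  proof (rule sum.cong[OF refl])
    fix i assume "i \<in> {..<n}"
    then have e: "photon_energy n ks = norm (ks i) + photon_energy m (fdel i ks)" using Suc photon_energy_remove[of i m ks] by simp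
    have gq: "(g (ks i))\<^sup>2 / norm (ks i) * norm (ks i) = (g (ks i))\<^sup>2"
      by (cases "ks i = 0") (simp_all add: g_zero)
    have "1 / real n * ((g (ks i))\<^sup>2 / norm (ks i) * (?a i)\<^sup>2 * photon_energy n ks)
      = 1 / real n * (((g (ks i))\<^sup>2 / norm (ks i) * norm (ks i)
          + (g (ks i))\<^sup>2 / norm (ks i) * photon_energy m (fdel i ks)) * (?a i)\<^sup>2)"
      unfolding e by algebra
    then show "1 / real n * ((g (ks i))\<^sup>2 / norm (ks i) * (?a i)\<^sup>2 * photon_energy n ks) = create_dens \<Phi> i n ks js s"
      unfolding create_dens_def gq using Suc by (simp only: diff_Suc_1)
  qed
  finally show ?thesis .
qed (simp add: create_def)

lemma measurable_create:
  assumes "flat \<Phi> \<in> borel_measurable (fmeas P)" shows "flat (create V \<Phi>) \<in> borel_measurable (fmeas P)"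
  unfolding measurable_flat_iff
proof (intro allI ballI)
  fix n js s assume a: "js \<in> pols n" "s \<in> spins P"
  show "(\<lambda>ks. create V \<Phi> n ks js s) \<in> borel_measurable (nmeas n)"
  proof (cases n)
    case (Suc m)
    have "(\<lambda>ks. V (ks i) (js i) * \<Phi> m (fdel i ks) (fdel i js) s) \<in> borel_measurable (nmeas n)" if "i < n" for i
    proof (rule borel_measurable_times)
      show "(\<lambda>ks. V (ks i) (js i)) \<in> borel_measurable (nmeas n)"
        by (rule measurable_compose[OF measurable_nmeas_component[OF that] measurable_V])
      show "(\<lambda>ks. \<Phi> m (fdel i ks) (fdel i js) s) \<in> borel_measurable (nmeas n)"
        unfolding Suc by (rule measurable_section_fdel[OF assms]) (use a Suc that in auto)
    qed
    then show ?thesis unfolding create_def using Suc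
      by (auto intro!: borel_measurable_times borel_measurable_sum simp del: of_nat_Suc)
  qed (simp add: create_def)
qed

text \<open>After the marked-photon formula the created momentum is independent of the rest, so
  integrating it out replaces g^2 by \<open>c0\<close> and g^2/|k| by \<open>c1\<close>. The 3
  counts the polarisations of the created photon, on which the majorant does not depend.\<close>

lemma create_bound:
  assumes \<Phi>: "\<Phi> \<in> domH P"
  shows "flat (create V \<Phi>) \<in> L2 (fmeas P)"
    "fock_inner P (create V \<Phi>) (create V \<Phi>) \<le> 3 * (c0 * fock_inner P \<Phi> \<Phi> + c1 * fock_inner P \<Phi> (hph \<Phi>))"
proof -
  have H: "\<Phi> \<in> Htot P" using \<Phi> by (simp add: domH_iff)
  note m = Htot_measurable[OF H]
  have gm [measurable]: "g \<in> borel_measurable borel" by (rule measurable_g)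
  define h where "h n k ks js s = ((g k)\<^sup>2 + (g k)\<^sup>2 / norm k * photon_energy n ks) * (cmod (\<Phi> n ks js s))\<^sup>2" for n k ks js s
  have h0: "h n k ks js s \<ge> 0" for n k ks js s by (simp add: h_def)
  have dens_h: "create_dens \<Phi> i (Suc n) ks js s = 1 / real (Suc n) * h n (ks i) (fdel i ks) (fdel i js) s" for i n ks js s
    by (simp add: create_dens_def h_def del: of_nat_Suc)
  have "(\<integral>\<^sup>+ w. ennreal ((cmod (flat (create V \<Phi>) w))\<^sup>2) \<partial>fmeas P)
     \<le> (\<integral>\<^sup>+ w. flat (\<lambda>n ks js s. \<Sum>i<n. ennreal (create_dens \<Phi> i n ks js s)) w \<partial>fmeas P)"
  proof (rule nn_integral_mono)
    fix w :: "(nat \<times> (nat \<Rightarrow> 3) \<times> (nat \<Rightarrow> bool)) \<times> (nat \<Rightarrow> real^3)"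
    obtain n js s ks where w: "w = ((n, js, s), ks)" by (metis prod.exhaust)
    have "(\<Sum>i<n. ennreal (create_dens \<Phi> i n ks js s)) = ennreal (\<Sum>i<n. create_dens \<Phi> i n ks js s)"
      by (rule sum_ennreal) (simp add: create_dens_def)
    then show "ennreal ((cmod (flat (create V \<Phi>) w))\<^sup>2) \<le> flat (\<lambda>n ks js s. \<Sum>i<n. ennreal (create_dens \<Phi> i n ks js s)) w"
      unfolding w by (simp add: cmod_create_le ennreal_leI)
  qed
  also have "\<dots> = (\<integral>\<^sup>+ w. flat (\<lambda>n z js s. of_nat (Suc n) * (\<Sum>j\<in>UNIV. ennreal (create_dens \<Phi> 0 (Suc n) (fcons (fst z) (snd z)) (fcons j js) s))) w \<partial>fmeas1 P)"
  proof (rule mecke_nn)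
    fix i n js s assume a: "i < (n::nat)" "js \<in> pols n" "s \<in> spins P"
    then obtain l where n: "n = Suc l" by (cases n) auto
    then have nl: "n - 1 = l" by simp
    have [measurable]: "(\<lambda>ks. ks i) \<in> borel_measurable (nmeas n)" by (rule measurable_nmeas_component[OF a(1)])
    have [measurable]: "(\<lambda>ks. photon_energy l (fdel i ks)) \<in> borel_measurable (nmeas n)"
      unfolding n by (rule measurable_compose[OF measurable_fdel measurable_photon_energy]) (use a n in simp)
    have [measurable]: "(\<lambda>ks. \<Phi> l (fdel i ks) (fdel i js) s) \<in> borel_measurable (nmeas n)"
      unfolding n by (rule measurable_section_fdel[OF m]) (use a n in auto)
    show "(\<lambda>ks. ennreal (create_dens \<Phi> i n ks js s)) \<in> borel_measurable (nmeas n)"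
      unfolding create_dens_def nl by measurable
  next
    fix i n js s and j :: 3
    show "AE z in lborel \<Otimes>\<^sub>M nmeas n. ennreal (create_dens \<Phi> i (Suc n) (insr i (fst z) (snd z)) (insr i j js) s)
        = ennreal (create_dens \<Phi> 0 (Suc n) (fcons (fst z) (snd z)) (fcons j js) s)"
      unfolding dens_h fcons_insr by simp
  qed
  also have "\<dots> = (\<integral>\<^sup>+ w. flat (\<lambda>n z js s. 3 * ennreal (h n (fst z) (snd z) js s)) w \<partial>fmeas1 P)"
  proof (rule nn_integral_cong)
    fix w :: "(nat \<times> (nat \<Rightarrow> 3) \<times> (nat \<Rightarrow> bool)) \<times> (real^3) \<times> (nat \<Rightarrow> real^3)"
    obtain n js s z where w: "w = ((n, js, s), z)" by (metis prod.exhaust)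
    have "(of_nat (Suc n) :: ennreal) * ennreal (1 / real (Suc n) * h n (fst z) (snd z) js s) = ennreal (h n (fst z) (snd z) js s)"
      by (simp add: ennreal_of_nat_eq_real_of_nat ennreal_mult'[symmetric] del: of_nat_Suc)
    moreover have "(\<Sum>j\<in>(UNIV::3 set). y) = 3 * y" for y :: ennreal by simp
    ultimately show "flat (\<lambda>n z js s. of_nat (Suc n) * (\<Sum>j\<in>UNIV. ennreal (create_dens \<Phi> 0 (Suc n) (fcons (fst z) (snd z)) (fcons j js) s))) w
      = flat (\<lambda>n z js s. 3 * ennreal (h n (fst z) (snd z) js s)) w"
      unfolding w dens_h fcons_insr flat_apply insr_at fdel_insr
      by (simp only: mult.left_commute[of "of_nat (Suc n)" "3 :: ennreal"])
  qed
  also have "\<dots> = (\<Sum>n. \<Sum>js\<in>pols n. \<Sum>s\<in>spins P. \<integral>\<^sup>+ z. 3 * ennreal (h n (fst z) (snd z) js s) \<partial>(lborel \<Otimes>\<^sub>M nmeas n))"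
  proof (rule nn_integral_fmeas1, unfold measurable_flat1_iff, intro allI ballI)
    fix n js s assume a: "js \<in> pols n" "s \<in> spins P"
    have [measurable]: "(\<lambda>ks. \<Phi> n ks js s) \<in> borel_measurable (nmeas n)" by (rule measurable_section[OF m a])
    show "(\<lambda>z. 3 * ennreal (h n (fst z) (snd z) js s)) \<in> borel_measurable (lborel \<Otimes>\<^sub>M nmeas n)"
      unfolding h_def by measurable
  qed
  also have "\<dots> = (\<Sum>n. \<Sum>js\<in>pols n. \<Sum>s\<in>spins P. \<integral>\<^sup>+ ks. ennreal (3 * ((c0 + c1 * photon_energy n ks) * (cmod (\<Phi> n ks js s))\<^sup>2)) \<partial>nmeas n)"
  proof (intro suminf_cong sum.cong refl)
    fix n js s assume a: "js \<in> pols n" "s \<in> spins P"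
    interpret pair_sigma_finite "lborel :: (real^3) measure" "nmeas n" by (rule pair_sigma_finite_nmeas)
    have [measurable]: "(\<lambda>ks. \<Phi> n ks js s) \<in> borel_measurable (nmeas n)" by (rule measurable_section[OF m a])
    have "(\<lambda>z. 3 * ennreal (h n (fst z) (snd z) js s)) \<in> borel_measurable (lborel \<Otimes>\<^sub>M nmeas n)"
      unfolding h_def by measurable
    from nn_integral_snd[OF this]
    have "(\<integral>\<^sup>+ z. 3 * ennreal (h n (fst z) (snd z) js s) \<partial>(lborel \<Otimes>\<^sub>M nmeas n))
       = (\<integral>\<^sup>+ ks. \<integral>\<^sup>+ k. 3 * ennreal (h n k ks js s) \<partial>lborel \<partial>nmeas n)" by simp
    also have "\<dots> = (\<integral>\<^sup>+ ks. ennreal (3 * ((c0 + c1 * photon_energy n ks) * (cmod (\<Phi> n ks js s))\<^sup>2)) \<partial>nmeas n)"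
    proof (rule nn_integral_cong)
      fix ks
      let ?p = "(cmod (\<Phi> n ks js s))\<^sup>2" and ?e = "photon_energy n ks"
      have i: "integrable lborel (\<lambda>k. 3 * h n k ks js s)"
        unfolding h_def by (intro integrable_mult_right integrable_mult_left Bochner_Integration.integrable_add g_int0 g_int1)
      have "(\<integral>\<^sup>+ k. 3 * ennreal (h n k ks js s) \<partial>lborel) = (\<integral>\<^sup>+ k. ennreal (3 * h n k ks js s) \<partial>lborel)"
        by (simp add: ennreal_mult h0)
      also have "\<dots> = ennreal (\<integral> k. 3 * h n k ks js s \<partial>lborel)"
        by (rule nn_integral_eq_integral[OF i]) (simp add: h0)
      also have "(\<integral> k. 3 * h n k ks js s \<partial>lborel) = 3 * ((c0 + c1 * ?e) * ?p)"
      proof -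
        have i: "integrable lborel (\<lambda>k. (g k)\<^sup>2 / norm k * ?e)" by (intro integrable_mult_left g_int1)
        show ?thesis
          unfolding h_def integral_mult_right_zero integral_mult_left_zero
            Bochner_Integration.integral_add[OF g_int0 i] c0_def c1_def ..
      qed
      finally show "(\<integral>\<^sup>+ k. 3 * ennreal (h n k ks js s) \<partial>lborel) = ennreal (3 * ((c0 + c1 * ?e) * ?p))" .
    qed
    finally show "(\<integral>\<^sup>+ z. 3 * ennreal (h n (fst z) (snd z) js s) \<partial>(lborel \<Otimes>\<^sub>M nmeas n))
       = (\<integral>\<^sup>+ ks. ennreal (3 * ((c0 + c1 * photon_energy n ks) * (cmod (\<Phi> n ks js s))\<^sup>2)) \<partial>nmeas n)" .
  qed
  also have "\<dots> = (\<integral>\<^sup>+ w. flat (\<lambda>n ks js s. ennreal (3 * ((c0 + c1 * photon_energy n ks) * (cmod (\<Phi> n ks js s))\<^sup>2))) w \<partial>fmeas P)"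
  proof (rule nn_integral_fmeas[symmetric], unfold measurable_flat_iff, intro allI ballI)
    fix n js s assume a: "js \<in> pols n" "s \<in> spins P"
    have [measurable]: "(\<lambda>ks. \<Phi> n ks js s) \<in> borel_measurable (nmeas n)" by (rule measurable_section[OF m a])
    show "(\<lambda>ks. ennreal (3 * ((c0 + c1 * photon_energy n ks) * (cmod (\<Phi> n ks js s))\<^sup>2))) \<in> borel_measurable (nmeas n)"
      by measurable
  qed
  also have "\<dots> = (\<integral>\<^sup>+ w. ennreal (3 * (c0 * (flat \<Phi> w \<bullet> flat \<Phi> w) + c1 * (flat \<Phi> w \<bullet> flat (hph \<Phi>) w))) \<partial>fmeas P)"
    by (intro nn_integral_cong) (auto simp: hph_photon_energy inner_hph power2_norm_eq_inner[symmetric] algebra_simps)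
  also have "\<dots> = ennreal (\<integral> w. 3 * (c0 * (flat \<Phi> w \<bullet> flat \<Phi> w) + c1 * (flat \<Phi> w \<bullet> flat (hph \<Phi>) w)) \<partial>fmeas P)"
  proof (rule nn_integral_eq_integral)
    show "integrable (fmeas P) (\<lambda>w. 3 * (c0 * (flat \<Phi> w \<bullet> flat \<Phi> w) + c1 * (flat \<Phi> w \<bullet> flat (hph \<Phi>) w)))"
      using \<Phi> by (intro integrable_mult_right Bochner_Integration.integrable_add L2_inner_integrable) (auto simp: domH_iff Htot_iff)
    have "flat \<Phi> w \<bullet> flat (hph \<Phi>) w \<ge> 0" for w by (cases w) (auto simp: hph_photon_energy inner_hph)
    then show "AE w in fmeas P. 0 \<le> 3 * (c0 * (flat \<Phi> w \<bullet> flat \<Phi> w) + c1 * (flat \<Phi> w \<bullet> flat (hph \<Phi>) w))"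
      using c_nonneg by simp
  qed
  also have "(\<integral> w. 3 * (c0 * (flat \<Phi> w \<bullet> flat \<Phi> w) + c1 * (flat \<Phi> w \<bullet> flat (hph \<Phi>) w)) \<partial>fmeas P)
     = 3 * (c0 * fock_inner P \<Phi> \<Phi> + c1 * fock_inner P \<Phi> (hph \<Phi>))"
    unfolding fock_inner_def l2ip_def using \<Phi>
    by (subst integral_mult_right_zero, subst Bochner_Integration.integral_add)
       (auto intro!: integrable_mult_right L2_inner_integrable simp: domH_iff Htot_iff)
  finally have le: "(\<integral>\<^sup>+ w. ennreal ((cmod (flat (create V \<Phi>) w))\<^sup>2) \<partial>fmeas P)
     \<le> ennreal (3 * (c0 * fock_inner P \<Phi> \<Phi> + c1 * fock_inner P \<Phi> (hph \<Phi>)))" .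
  then show L: "flat (create V \<Phi>) \<in> L2 (fmeas P)"
    using measurable_create[OF m] by (auto simp: L2_iff intro: le_less_trans)
  have "fock_inner P \<Phi> \<Phi> \<ge> 0" using Fock.ip_nonneg[OF H] .
  then show "fock_inner P (create V \<Phi>) (create V \<Phi>) \<le> 3 * (c0 * fock_inner P \<Phi> \<Phi> + c1 * fock_inner P \<Phi> (hph \<Phi>))"
    using le fock_inner_hph[OF \<Phi>] c_nonneg unfolding l2ip_self_nn[OF L] fock_inner_def
    by (subst (asm) ennreal_le_iff) auto
qed

end

section \<open>Creation and annihilation preserve symmetry and transversality\<close>

definition unskip :: "nat \<Rightarrow> nat \<Rightarrow> nat" where
  "unskip i j = (if j < i then j else j - 1)"

lemma unskip_skip [simp]: "unskip i (skip i j) = j"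
  by (auto simp: unskip_def skip_def)

lemma skip_unskip [simp]: "j \<noteq> i \<Longrightarrow> skip i (unskip i j) = j"
  by (auto simp: unskip_def skip_def)

lemma skip_neq [simp]: "skip i j \<noteq> i"
  by (auto simp: skip_def)

text \<open>Deleting slot \<open>i\<close> of a permuted tuple amounts to permuting the tuple
  without slot \<open>\<pi> i\<close>. The conclusion is listed for two types because the same
  \<open>\<pi>'\<close> must serve momenta and polarisations.\<close>

lemma fdel_permute:
  assumes \<pi>: "\<pi> permutes {..<Suc m}" and i: "i < Suc m"
  obtains \<pi>' where "\<pi>' permutes {..<m}" "\<And>f :: nat \<Rightarrow> 'a. fdel i (f \<circ> \<pi>) = fdel (\<pi> i) f \<circ> \<pi>'"
    "\<And>f :: nat \<Rightarrow> 'b. fdel i (f \<circ> \<pi>) = fdel (\<pi> i) f \<circ> \<pi>'"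
proof
  define \<pi>' where "\<pi>' = unskip (\<pi> i) \<circ> \<pi> \<circ> skip i"
  have inj: "inj \<pi>" using \<pi> by (rule permutes_inj)
  have sk: "skip (\<pi> i) (\<pi>' j) = \<pi> (skip i j)" for j
    unfolding \<pi>'_def comp_def by (rule skip_unskip) (use inj skip_neq in \<open>metis injD\<close>)
  have out: "\<pi>' j = j" if "j \<notin> {..<m}" for j
  proof -
    have "\<pi> i < Suc m" using permutes_in_image[OF \<pi>, of i] i by simp
    moreover have "skip i j = Suc j" using that i by (auto simp: skip_def)
    moreover have "\<pi> (Suc j) = Suc j" using permutes_not_in[OF \<pi>, of "Suc j"] that by simp
    ultimately show ?thesis using that by (auto simp: \<pi>'_def unskip_def)
  qed
  have inj': "inj \<pi>'"
  proof (rule injI)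
    fix a b assume "\<pi>' a = \<pi>' b"
    then have "\<pi> (skip i a) = \<pi> (skip i b)" using sk by metis
    then show "a = b" using inj inj_skip by (metis injD)
  qed
  \<comment> \<open>\<open>\<pi>'\<close> is injective and fixes every index outside, so no index
    inside can be sent outside.\<close>
  have "\<pi>' ` {..<m} \<subseteq> {..<m}"
  proof
    fix y assume "y \<in> \<pi>' ` {..<m}"
    then obtain j where j: "j < m" "y = \<pi>' j" by auto
    show "y \<in> {..<m}"
    proof (rule ccontr)
      assume "y \<notin> {..<m}"
      then have "\<pi>' y = y" by (rule out)
      then have "y = j" using inj' j by (metis injD)
      then show False using j \<open>y \<notin> {..<m}\<close> by simp
    qed
  qed
  then have "\<pi>' ` {..<m} = {..<m}" by (intro endo_inj_surj) (auto intro: inj_on_subset[OF inj'])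
  then show "\<pi>' permutes {..<m}"
    by (intro bij_imp_permutes) (auto simp: bij_betw_def out intro: inj_on_subset[OF inj'])
  show "fdel i (f \<circ> \<pi>) = fdel (\<pi> i) f \<circ> \<pi>'" for f :: "nat \<Rightarrow> 'a"
    by (simp add: fun_eq_iff fdel_apply sk)
  show "fdel i (f \<circ> \<pi>) = fdel (\<pi> i) f \<circ> \<pi>'" for f :: "nat \<Rightarrow> 'b"
    by (simp add: fun_eq_iff fdel_apply sk)
qed

text \<open>Keeps the annihilated photon in slot 0 and permutes the others.\<close>

definition lift_perm :: "(nat \<Rightarrow> nat) \<Rightarrow> nat \<Rightarrow> nat" where
  "lift_perm \<pi> m = (if m = 0 then 0 else Suc (\<pi> (m - 1)))"

lemma fcons_lift_perm: "fcons a (f \<circ> \<pi>) = fcons a f \<circ> lift_perm \<pi>"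
  by (auto simp: fcons_def lift_perm_def fun_eq_iff)

lemma lift_perm_permutes:
  assumes \<pi>: "\<pi> permutes {..<n}" shows "lift_perm \<pi> permutes {..<Suc n}"
proof (rule bij_imp_permutes)
  have inj: "inj_on (lift_perm \<pi>) {..<Suc n}"
  proof (rule inj_onI)
    fix a b assume "lift_perm \<pi> a = lift_perm \<pi> b"
    then show "a = b" using permutes_inj[OF \<pi>]
      by (cases a; cases b) (auto simp: lift_perm_def inj_eq)
  qed
  moreover have "lift_perm \<pi> ` {..<Suc n} \<subseteq> {..<Suc n}"
  proof
    fix y assume "y \<in> lift_perm \<pi> ` {..<Suc n}"
    then obtain a where a: "a < Suc n" "y = lift_perm \<pi> a" by auto
    show "y \<in> {..<Suc n}"
    proof (cases a)
      case (Suc b)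
      then have "\<pi> b \<in> {..<n}" unfolding permutes_in_image[OF \<pi>] using a by simp
      then show ?thesis using a Suc by (simp add: lift_perm_def)
    qed (use a in \<open>simp add: lift_perm_def\<close>)
  qed
  ultimately have "lift_perm \<pi> ` {..<Suc n} = {..<Suc n}" by (intro endo_inj_surj) auto
  with inj show "bij_betw (lift_perm \<pi>) {..<Suc n} {..<Suc n}" by (simp add: bij_betw_def)
next
  fix x assume "x \<notin> {..<Suc n}"
  then have "x - 1 \<notin> {..<n}" "x \<noteq> 0" by auto
  then show "lift_perm \<pi> x = x"
    using permutes_not_in[OF \<pi>, of "x - 1"] by (simp add: lift_perm_def)
qed

lemma permute_extensional: "\<pi> permutes {..<n} \<Longrightarrow> f \<in> extensional {..<n} \<Longrightarrow> f \<circ> \<pi> \<in> extensional {..<n}"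
  by (auto simp: extensional_def permutes_not_in)

lemma permute_mem_pols: "\<pi> permutes {..<n} \<Longrightarrow> js \<in> pols n \<Longrightarrow> js \<circ> \<pi> \<in> pols n"
  by (simp add: pols_iff permute_extensional)

lemma fdel_fupd_same: "fdel i (f(i := c)) = fdel i f"
  by (auto simp: fun_eq_iff fdel_def)

lemma fdel_fupd_other: "l \<noteq> i \<Longrightarrow> fdel i (f(l := c)) = (fdel i f)(unskip i l := c)"
  by (auto simp: fun_eq_iff fdel_def unskip_def)

lemma fcons_fupd: "fcons a (f(i := c)) = (fcons a f)(Suc i := c)"
  by (auto simp: fun_eq_iff fcons_def)

context form_factor
begin

text \<open>Permuting the arguments permutes the summands: the term that deletes slot
  \<open>i\<close> becomes the one that deletes slot \<open>\<pi> i\<close>, by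
  \<open>fdel_permute\<close> and the symmetry of \<open>\<Phi>\<close>.\<close>

lemma symmetric_create:
  assumes \<Phi>: "symmetric_fock P \<Phi>" shows "symmetric_fock P (create V \<Phi>)"
  unfolding symmetric_fock_def
proof (intro allI impI)
  fix n \<pi> assume \<pi>: "\<pi> permutes {..<n::nat}"
  show "AE ks in nmeas n. \<forall>js\<in>pols n. \<forall>s\<in>spins P. create V \<Phi> n (ks \<circ> \<pi>) (js \<circ> \<pi>) s = create V \<Phi> n ks js s"
  proof (cases n)
    case (Suc m)
    have all: "AE ks in nmeas n. \<forall>js\<in>pols n. \<forall>s\<in>spins P.
        \<Phi> m (fdel i (ks \<circ> \<pi>)) (fdel i (js \<circ> \<pi>)) s = \<Phi> m (fdel (\<pi> i) ks) (fdel (\<pi> i) js) s"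
      if i: "i < n" for i
    proof -
      obtain \<pi>' where \<pi>': "\<pi>' permutes {..<m}"
        "\<And>f :: nat \<Rightarrow> real^3. fdel i (f \<circ> \<pi>) = fdel (\<pi> i) f \<circ> \<pi>'" "\<And>f :: nat \<Rightarrow> 3. fdel i (f \<circ> \<pi>) = fdel (\<pi> i) f \<circ> \<pi>'"
        by (rule fdel_permute[OF \<pi>[unfolded Suc] i[unfolded Suc]]) (rule that)
      have pi: "\<pi> i \<le> m" using permutes_in_image[OF \<pi>, of i] i Suc by simp
      have "AE ks in nmeas m. \<forall>js\<in>pols m. \<forall>s\<in>spins P. \<Phi> m (ks \<circ> \<pi>') (js \<circ> \<pi>') s = \<Phi> m ks js s"
        using \<Phi> \<pi>'(1) by (auto simp: symmetric_fock_def)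
      from AE_fdel[OF pi this] show ?thesis unfolding Suc
        by eventually_elim (auto simp: \<pi>' fdel_mem_pols[OF pi])
    qed
    have "AE ks in nmeas n. \<forall>i\<in>{..<n}. \<forall>js\<in>pols n. \<forall>s\<in>spins P.
        \<Phi> m (fdel i (ks \<circ> \<pi>)) (fdel i (js \<circ> \<pi>)) s = \<Phi> m (fdel (\<pi> i) ks) (fdel (\<pi> i) js) s"
      by (rule AE_finite_allI[OF _ all]) auto
    then show ?thesis
    proof (eventually_elim, intro ballI)
      fix ks js s assume h: "\<forall>i\<in>{..<n}. \<forall>js\<in>pols n. \<forall>s\<in>spins P.
        \<Phi> m (fdel i (ks \<circ> \<pi>)) (fdel i (js \<circ> \<pi>)) s = \<Phi> m (fdel (\<pi> i) ks) (fdel (\<pi> i) js) s"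
        and a: "js \<in> pols n" "s \<in> spins P"
      have "(\<Sum>i<n. V ((ks \<circ> \<pi>) i) ((js \<circ> \<pi>) i) * \<Phi> m (fdel i (ks \<circ> \<pi>)) (fdel i (js \<circ> \<pi>)) s)
        = (\<Sum>i<n. V (ks (\<pi> i)) (js (\<pi> i)) * \<Phi> m (fdel (\<pi> i) ks) (fdel (\<pi> i) js) s)"
        using h a by (intro sum.cong) auto
      also have "\<dots> = (\<Sum>i<n. V (ks i) (js i) * \<Phi> m (fdel i ks) (fdel i js) s)"
        using sum.permute[OF \<pi>, of "\<lambda>i. V (ks i) (js i) * \<Phi> m (fdel i ks) (fdel i js) s"] by (simp add: comp_def)
      finally show "create V \<Phi> n (ks \<circ> \<pi>) (js \<circ> \<pi>) s = create V \<Phi> n ks js s"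
        using Suc by (simp add: create_def)
    qed
  qed (simp add: create_def)
qed

text \<open>In the summand that creates photon \<open>l\<close> the constraint falls on
  \<open>V\<close>; in all others slot \<open>l\<close> is a slot of \<open>\<Phi>\<close>, at
  position \<open>unskip i l\<close>.\<close>

lemma transversal_create:
  assumes \<Phi>: "transversal_fock P \<Phi>" shows "transversal_fock P (create V \<Phi>)"
  unfolding transversal_fock_def
proof (intro allI impI)
  fix n l assume l: "l < (n::nat)"
  then obtain m where Suc: "n = Suc m" by (cases n) auto
  have all: "AE ks in nmeas n. \<forall>js\<in>pols n. \<forall>s\<in>spins P. l \<noteq> i \<longrightarrow>
      (\<Sum>c\<in>UNIV. complex_of_real (ks l $ c) * \<Phi> m (fdel i ks) (fdel i (js(l := c))) s) = 0" if "i < n" for i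
  proof (cases "l = i")
    case False
    have u: "unskip i l < m" using l that Suc False by (auto simp: unskip_def)
    have i: "i \<le> m" using that Suc by simp
    have "AE ks in nmeas m. \<forall>js\<in>pols m. \<forall>s\<in>spins P.
       (\<Sum>c\<in>UNIV. complex_of_real (ks (unskip i l) $ c) * \<Phi> m ks (js(unskip i l := c)) s) = 0"
      using \<Phi> u by (auto simp: transversal_fock_def)
    from AE_fdel[OF i this] show ?thesis unfolding Suc
      by eventually_elim (auto simp: fdel_fupd_other[OF False] fdel_mem_pols[OF i] fdel_apply False)
  qed simp
  have "AE ks in nmeas n. \<forall>i\<in>{..<n}. \<forall>js\<in>pols n. \<forall>s\<in>spins P. l \<noteq> i \<longrightarrow>
      (\<Sum>c\<in>UNIV. complex_of_real (ks l $ c) * \<Phi> m (fdel i ks) (fdel i (js(l := c))) s) = 0"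
    by (rule AE_finite_allI[OF _ all]) auto
  then show "AE ks in nmeas n. \<forall>js\<in>pols n. \<forall>s\<in>spins P.
     (\<Sum>c\<in>UNIV. complex_of_real (ks l $ c) * create V \<Phi> n ks (js(l := c)) s) = 0"
  proof (eventually_elim, intro ballI)
    fix ks js s
    assume h: "\<forall>i\<in>{..<n}. \<forall>js\<in>pols n. \<forall>s\<in>spins P. l \<noteq> i \<longrightarrow>
      (\<Sum>c\<in>UNIV. complex_of_real (ks l $ c) * \<Phi> m (fdel i ks) (fdel i (js(l := c))) s) = 0"
      and a: "js \<in> pols n" "s \<in> spins P"
    have z: "(\<Sum>c\<in>UNIV. complex_of_real (ks l $ c) * (V (ks i) ((js(l := c)) i) * \<Phi> m (fdel i ks) (fdel i (js(l := c))) s)) = 0"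
      if i: "i \<in> {..<n}" for i
    proof (cases "l = i")
      case True
      then have "(\<Sum>c\<in>UNIV. complex_of_real (ks l $ c) * (V (ks i) ((js(l := c)) i) * \<Phi> m (fdel i ks) (fdel i (js(l := c))) s))
        = (\<Sum>c\<in>UNIV. complex_of_real (ks i $ c) * V (ks i) c) * \<Phi> m (fdel i ks) (fdel i js) s"
        by (simp add: fdel_fupd_same sum_distrib_right mult.assoc)
      then show ?thesis by (simp add: V_transversal)
    next
      case False
      then have "(\<Sum>c\<in>UNIV. complex_of_real (ks l $ c) * (V (ks i) ((js(l := c)) i) * \<Phi> m (fdel i ks) (fdel i (js(l := c))) s))
        = V (ks i) (js i) * (\<Sum>c\<in>UNIV. complex_of_real (ks l $ c) * \<Phi> m (fdel i ks) (fdel i (js(l := c))) s)"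
        by (simp add: sum_distrib_left mult.left_commute)
      then show ?thesis using h i a False by simp
    qed
    have cr: "create V \<Phi> n ks js' s = complex_of_real (1 / sqrt (real n)) *
        (\<Sum>i<n. V (ks i) (js' i) * \<Phi> m (fdel i ks) (fdel i js') s)" for js'
      using Suc by (simp only: create_def nat.distinct if_False diff_Suc_1)
    have "(\<Sum>c\<in>UNIV. complex_of_real (ks l $ c) * create V \<Phi> n ks (js(l := c)) s)
      = complex_of_real (1 / sqrt (real n)) * (\<Sum>c\<in>UNIV. \<Sum>i<n. complex_of_real (ks l $ c) *
           (V (ks i) ((js(l := c)) i) * \<Phi> m (fdel i ks) (fdel i (js(l := c))) s))"
      unfolding cr sum_distrib_left by (simp only: mult.left_commute)
    also have "\<dots> = 0" by (subst sum.swap) (simp add: z del: fun_upd_apply)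
    finally show "(\<Sum>c\<in>UNIV. complex_of_real (ks l $ c) * create V \<Phi> n ks (js(l := c)) s) = 0" .
  qed
qed

lemma create_Htot: "\<Phi> \<in> domH P \<Longrightarrow> create V \<Phi> \<in> Htot P"
  using create_bound(1)[of \<Phi> P] symmetric_create transversal_create by (auto simp: domH_iff Htot_iff)

lemma symmetric_annih:
  assumes \<Phi>: "\<Phi> \<in> Htot P" shows "symmetric_fock P (annih V \<Phi>)"
  unfolding symmetric_fock_def
proof (intro allI impI)
  fix n \<pi> assume \<pi>: "\<pi> permutes {..<n::nat}"
  let ?\<rho> = "lift_perm \<pi>"
  have "AE ks in nmeas (Suc n). \<forall>js\<in>pols (Suc n). \<forall>s\<in>spins P. \<Phi> (Suc n) (ks \<circ> ?\<rho>) (js \<circ> ?\<rho>) s = \<Phi> (Suc n) ks js s"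
    using \<Phi> lift_perm_permutes[OF \<pi>] by (auto simp: Htot_iff symmetric_fock_def)
  from AE_insr[OF le0 this]
  have "AE z in lborel \<Otimes>\<^sub>M nmeas n. \<forall>j. \<forall>js\<in>pols n. \<forall>s\<in>spins P.
     ann_field \<Phi> n (fst z, snd z \<circ> \<pi>) j (js \<circ> \<pi>) s = ann_field \<Phi> n (fst z, snd z) j js s"
    by eventually_elim (auto simp: ann_field_def fcons_lift_perm fcons_mem_pols fcons_insr[symmetric])
  from AE_pair_nmeas_swap[OF this]
  show "AE ks in nmeas n. \<forall>js\<in>pols n. \<forall>s\<in>spins P. annih V \<Phi> n (ks \<circ> \<pi>) (js \<circ> \<pi>) s = annih V \<Phi> n ks js s"
  proof (rule AE_mp, intro AE_I2 impI ballI)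
    fix ks js s assume ks: "ks \<in> space (nmeas n)" and js: "js \<in> pols n" and s: "s \<in> spins P"
      and h: "AE k in lborel. \<forall>j. \<forall>js\<in>pols n. \<forall>s\<in>spins P. ann_field \<Phi> n (k, ks \<circ> \<pi>) j (js \<circ> \<pi>) s = ann_field \<Phi> n (k, ks) j js s"
    have m: "(\<lambda>k. \<Sum>j\<in>UNIV. cnj (V k j) * ann_field \<Phi> n (k, ks) j js s) \<in> borel_measurable lborel"
      if "ks \<in> space (nmeas n)" "js \<in> pols n" for ks js
      by (intro borel_measurable_sum borel_measurable_times measurable_cnj
            measurable_compose[OF measurable_Pair2'[OF that(1)] measurable_ann_field[OF Htot_measurable[OF \<Phi>] that(2) s]])
         (use measurable_V in simp)
    have ks': "ks \<circ> \<pi> \<in> space (nmeas n)" using ks permute_extensional[OF \<pi>] by simp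
    show "annih V \<Phi> n (ks \<circ> \<pi>) (js \<circ> \<pi>) s = annih V \<Phi> n ks js s"
      unfolding annih_ann_field
    proof (rule integral_cong_AE)
      show "AE k in lborel. (\<Sum>j\<in>UNIV. cnj (V k j) * ann_field \<Phi> n (k, ks \<circ> \<pi>) j (js \<circ> \<pi>) s)
          = (\<Sum>j\<in>UNIV. cnj (V k j) * ann_field \<Phi> n (k, ks) j js s)"
        using h by eventually_elim (use js s in auto)
    qed (rule m[OF ks' permute_mem_pols[OF \<pi> js]], rule m[OF ks js])
  qed
qed

text \<open>Slot \<open>l\<close> of the result is slot \<open>Suc l\<close> of
  \<open>\<Phi>\<close>. The sum over polarisations has to pass through the integral over k, so
  \<open>\<Phi>\<close> is taken from the domain, where these integrals converge almost
  everywhere.\<close>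

lemma transversal_annih:
  assumes \<Phi>: "\<Phi> \<in> domH P" shows "transversal_fock P (annih V \<Phi>)"
  unfolding transversal_fock_def
proof (intro allI impI)
  fix n l assume l: "l < (n::nat)"
  have H: "\<Phi> \<in> Htot P" using \<Phi> by (simp add: domH_iff)
  have "AE ks in nmeas (Suc n). \<forall>js\<in>pols (Suc n). \<forall>s\<in>spins P.
     (\<Sum>c\<in>UNIV. complex_of_real (ks (Suc l) $ c) * \<Phi> (Suc n) ks (js(Suc l := c)) s) = 0"
    using H l by (auto simp: Htot_iff transversal_fock_def)
  from AE_insr[OF le0 this]
  have "AE z in lborel \<Otimes>\<^sub>M nmeas n. \<forall>j. \<forall>js\<in>pols n. \<forall>s\<in>spins P.
     (\<Sum>c\<in>UNIV. complex_of_real (snd z l $ c) * ann_field \<Phi> n (fst z, snd z) j (js(l := c)) s) = 0"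
  proof (eventually_elim, intro allI ballI)
    fix z :: "(real^3) \<times> (nat \<Rightarrow> real^3)" and j js s
    assume h: "\<forall>js\<in>pols (Suc n). \<forall>s\<in>spins P.
       (\<Sum>c\<in>UNIV. complex_of_real (insr 0 (fst z) (snd z) (Suc l) $ c) * \<Phi> (Suc n) (insr 0 (fst z) (snd z)) (js(Suc l := c)) s) = 0"
      and js: "js \<in> pols n" and s: "s \<in> spins P"
    have at: "insr 0 (fst z) (snd z) (Suc l) = snd z l" by (simp add: insr_def)
    have "(\<Sum>c\<in>UNIV. complex_of_real (snd z l $ c) * ann_field \<Phi> n (fst z, snd z) j (js(l := c)) s)
      = complex_of_real (sqrt (real (Suc n))) * (\<Sum>c\<in>UNIV. complex_of_real (insr 0 (fst z) (snd z) (Suc l) $ c)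
           * \<Phi> (Suc n) (insr 0 (fst z) (snd z)) ((fcons j js)(Suc l := c)) s)"
      unfolding ann_field_def fcons_fupd unfolding fcons_insr fst_conv snd_conv at sum_distrib_left
      by (simp only: mult.left_commute)
    also have "\<dots> = 0" using h fcons_mem_pols[OF js] s by simp
    finally show "(\<Sum>c\<in>UNIV. complex_of_real (snd z l $ c) * ann_field \<Phi> n (fst z, snd z) j (js(l := c)) s) = 0" .
  qed
  from AE_pair_nmeas_swap[OF this]
  have tr: "AE ks in nmeas n. AE k in lborel. \<forall>j. \<forall>js\<in>pols n. \<forall>s\<in>spins P.
     (\<Sum>c\<in>UNIV. complex_of_real (ks l $ c) * ann_field \<Phi> n (k, ks) j (js(l := c)) s) = 0" .
  have int: "AE ks in nmeas n. \<forall>js\<in>pols n. \<forall>s\<in>spins P. \<forall>j. integrable lborel (\<lambda>k. cnj (V k j) * ann_field \<Phi> n (k, ks) j js s)"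
    using AE_annih_integrable[OF \<Phi>] unfolding AE_fmeas_iff flat_apply by (intro AE_finite_allI) auto
  show "AE ks in nmeas n. \<forall>js\<in>pols n. \<forall>s\<in>spins P.
     (\<Sum>c\<in>UNIV. complex_of_real (ks l $ c) * annih V \<Phi> n ks (js(l := c)) s) = 0"
    using tr int
  proof (eventually_elim, intro ballI)
    fix ks js s
    assume tr: "AE k in lborel. \<forall>j. \<forall>js\<in>pols n. \<forall>s\<in>spins P.
        (\<Sum>c\<in>UNIV. complex_of_real (ks l $ c) * ann_field \<Phi> n (k, ks) j (js(l := c)) s) = 0"
      and int: "\<forall>js\<in>pols n. \<forall>s\<in>spins P. \<forall>j. integrable lborel (\<lambda>k. cnj (V k j) * ann_field \<Phi> n (k, ks) j js s)"
      and js: "js \<in> pols n" and s: "s \<in> spins P"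
    have i: "integrable lborel (\<lambda>k. cnj (V k j) * ann_field \<Phi> n (k, ks) j (js(l := c)) s)" for j c
      by (rule int[rule_format, OF fupd_mem_pols[OF js l] s])
    have "(\<Sum>c\<in>UNIV. complex_of_real (ks l $ c) * annih V \<Phi> n ks (js(l := c)) s)
      = (\<Sum>c\<in>UNIV. \<integral> k. complex_of_real (ks l $ c) * (\<Sum>j\<in>UNIV. cnj (V k j) * ann_field \<Phi> n (k, ks) j (js(l := c)) s) \<partial>lborel)"
      unfolding annih_ann_field by simp
    also have "\<dots> = (\<integral> k. (\<Sum>c\<in>UNIV. complex_of_real (ks l $ c) * (\<Sum>j\<in>UNIV. cnj (V k j) * ann_field \<Phi> n (k, ks) j (js(l := c)) s)) \<partial>lborel)"
      by (rule Bochner_Integration.integral_sum[symmetric]) (auto intro!: integrable_mult_right Bochner_Integration.integrable_sum i)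
    also have "\<dots> = 0"
    proof (rule integral_eq_zero_AE)
      show "AE k in lborel. (\<Sum>c\<in>UNIV. complex_of_real (ks l $ c) * (\<Sum>j\<in>UNIV. cnj (V k j) * ann_field \<Phi> n (k, ks) j (js(l := c)) s)) = 0"
        using tr
      proof eventually_elim
        fix k assume h: "\<forall>j. \<forall>js\<in>pols n. \<forall>s\<in>spins P.
          (\<Sum>c\<in>UNIV. complex_of_real (ks l $ c) * ann_field \<Phi> n (k, ks) j (js(l := c)) s) = 0"
        have "(\<Sum>c\<in>UNIV. complex_of_real (ks l $ c) * (\<Sum>j\<in>UNIV. cnj (V k j) * ann_field \<Phi> n (k, ks) j (js(l := c)) s))
          = (\<Sum>j\<in>UNIV. cnj (V k j) * (\<Sum>c\<in>UNIV. complex_of_real (ks l $ c) * ann_field \<Phi> n (k, ks) j (js(l := c)) s))"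
          unfolding sum_distrib_left by (subst sum.swap) (simp add: mult.left_commute)
        then show "(\<Sum>c\<in>UNIV. complex_of_real (ks l $ c) * (\<Sum>j\<in>UNIV. cnj (V k j) * ann_field \<Phi> n (k, ks) j (js(l := c)) s)) = 0"
          using h js s by simp
      qed
    qed
    finally show "(\<Sum>c\<in>UNIV. complex_of_real (ks l $ c) * annih V \<Phi> n ks (js(l := c)) s) = 0" .
  qed
qed

lemma annih_Htot: "\<Phi> \<in> domH P \<Longrightarrow> annih V \<Phi> \<in> Htot P"
  using annih_bound(1)[of \<Phi> P] symmetric_annih[of \<Phi> P] transversal_annih[of \<Phi> P] by (auto simp: domH_iff Htot_iff)

end

section \<open>Adjointness of creation and annihilation\<close>

lemma inner_cnj: "(v * p) \<bullet> a = p \<bullet> (cnj v * a)" for v p a :: complex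
  by (simp add: inner_complex_def algebra_simps)

lemma fmeas1_energy:
  assumes \<Psi>: "\<Psi> \<in> domH P"
  shows "integrable (fmeas1 P) (flat (\<lambda>n z js s. \<Sum>j\<in>UNIV. norm (fst z) * (cmod (ann_field \<Psi> n z j js s))\<^sup>2))" (is "integrable _ ?f")
    and "(\<integral> w. flat (\<lambda>n z js s. \<Sum>j\<in>UNIV. norm (fst z) * (cmod (ann_field \<Psi> n z j js s))\<^sup>2) w \<partial>fmeas1 P) = fock_inner P \<Psi> (hph \<Psi>)"
proof -
  have H: "\<Psi> \<in> Htot P" using \<Psi> by (simp add: domH_iff)
  have m: "?f \<in> borel_measurable (fmeas1 P)" unfolding measurable_flat1_iff
  proof (intro allI ballI)
    fix n js s assume a: "js \<in> pols n" "s \<in> spins P"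
    have [measurable]: "(\<lambda>z. ann_field \<Psi> n z j js s) \<in> borel_measurable (lborel \<Otimes>\<^sub>M nmeas n)" for j
      by (rule measurable_ann_field[OF Htot_measurable[OF H] a])
    show "(\<lambda>z. \<Sum>j\<in>UNIV. norm (fst z) * (cmod (ann_field \<Psi> n z j js s))\<^sup>2) \<in> borel_measurable (lborel \<Otimes>\<^sub>M nmeas n)"
      by measurable
  qed
  have nn: "?f w \<ge> 0" for w by (cases w) (auto intro!: sum_nonneg)
  have "(\<integral>\<^sup>+ w. ennreal (?f w) \<partial>fmeas1 P) = field_energy P \<Psi>"
    unfolding field_energy_eq[OF H] by (intro nn_integral_cong) (auto simp: sum_ennreal)
  also have "\<dots> = ennreal (fock_inner P \<Psi> (hph \<Psi>))" by (rule fock_inner_hph[OF \<Psi>])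
  finally have eq: "(\<integral>\<^sup>+ w. ennreal (?f w) \<partial>fmeas1 P) = ennreal (fock_inner P \<Psi> (hph \<Psi>))" .
  show "integrable (fmeas1 P) ?f"
    by (rule integrableI_nonneg[OF m]) (use nn eq in auto)
  show "(\<integral> w. ?f w \<partial>fmeas1 P) = fock_inner P \<Psi> (hph \<Psi>)"
    using eq nn m fock_inner_hph(2)[OF \<Psi>] by (subst integral_eq_nn_integral) auto
qed

context form_factor
begin

text \<open>Integrating out the extra momentum leaves \<open>c1\<close> times the squared norm. This
  is the part of the majorant of \<open>cross_dens\<close> that comes from
  \<open>\<Phi>\<close>.\<close>

lemma weighted_integrable:
  assumes \<Phi>: "\<Phi> \<in> Htot P"
  shows "integrable (fmeas1 P) (flat (\<lambda>n z js s. (g (fst z))\<^sup>2 / norm (fst z) * (cmod (\<Phi> n (snd z) js s))\<^sup>2))" (is "integrable _ (flat ?f)")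
proof (rule integrableI_nonneg)
  have gm [measurable]: "g \<in> borel_measurable borel" by (rule measurable_g)
  have meas: "(\<lambda>z. ?f n z js s) \<in> borel_measurable (lborel \<Otimes>\<^sub>M nmeas n)" if a: "js \<in> pols n" "s \<in> spins P" for n js s
  proof -
    have [measurable]: "(\<lambda>ks. \<Phi> n ks js s) \<in> borel_measurable (nmeas n)"
      by (rule measurable_section[OF Htot_measurable[OF \<Phi>] a])
    show ?thesis by measurable
  qed
  then show "flat ?f \<in> borel_measurable (fmeas1 P)" unfolding measurable_flat1_iff by blast
  show "AE w in fmeas1 P. 0 \<le> flat ?f w" by (rule AE_I2) auto
  have "(\<integral>\<^sup>+ w. ennreal (flat ?f w) \<partial>fmeas1 P) = (\<integral>\<^sup>+ w. flat (\<lambda>n z js s. ennreal (?f n z js s)) w \<partial>fmeas1 P)"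
    by (intro nn_integral_cong) auto
  also have "\<dots> = (\<Sum>n. \<Sum>js\<in>pols n. \<Sum>s\<in>spins P. \<integral>\<^sup>+ z. ennreal (?f n z js s) \<partial>(lborel \<Otimes>\<^sub>M nmeas n))"
    by (rule nn_integral_fmeas1, unfold measurable_flat1_iff, intro allI ballI measurable_compose[OF meas measurable_ennreal])
  also have "\<dots> = (\<Sum>n. \<Sum>js\<in>pols n. \<Sum>s\<in>spins P. ennreal c1 * (\<integral>\<^sup>+ ks. ennreal ((cmod (\<Phi> n ks js s))\<^sup>2) \<partial>nmeas n))"
  proof (intro suminf_cong sum.cong refl)
    fix n js s assume a: "js \<in> pols n" "s \<in> spins P"
    interpret pair_sigma_finite "lborel :: (real^3) measure" "nmeas n" by (rule pair_sigma_finite_nmeas)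
    have [measurable]: "(\<lambda>ks. \<Phi> n ks js s) \<in> borel_measurable (nmeas n)"
      by (rule measurable_section[OF Htot_measurable[OF \<Phi>] a])
    from nn_integral_snd[OF measurable_compose[OF meas[OF a] measurable_ennreal]]
    have "(\<integral>\<^sup>+ z. ennreal (?f n z js s) \<partial>(lborel \<Otimes>\<^sub>M nmeas n))
      = (\<integral>\<^sup>+ ks. \<integral>\<^sup>+ k. ennreal ((g k)\<^sup>2 / norm k * (cmod (\<Phi> n ks js s))\<^sup>2) \<partial>lborel \<partial>nmeas n)" by simp
    also have "\<dots> = (\<integral>\<^sup>+ ks. ennreal c1 * ennreal ((cmod (\<Phi> n ks js s))\<^sup>2) \<partial>nmeas n)"
    proof (rule nn_integral_cong)
      fix ks
      have "(\<integral>\<^sup>+ k. ennreal ((g k)\<^sup>2 / norm k * (cmod (\<Phi> n ks js s))\<^sup>2) \<partial>lborel)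
        = (\<integral>\<^sup>+ k. ennreal ((g k)\<^sup>2 / norm k) * ennreal ((cmod (\<Phi> n ks js s))\<^sup>2) \<partial>lborel)"
        by (intro nn_integral_cong ennreal_mult) auto
      also have "\<dots> = ennreal c1 * ennreal ((cmod (\<Phi> n ks js s))\<^sup>2)"
        unfolding nn_c1[symmetric] by (rule nn_integral_multc) measurable
      finally show "(\<integral>\<^sup>+ k. ennreal ((g k)\<^sup>2 / norm k * (cmod (\<Phi> n ks js s))\<^sup>2) \<partial>lborel)
        = ennreal c1 * ennreal ((cmod (\<Phi> n ks js s))\<^sup>2)" .
    qed
    also have "\<dots> = ennreal c1 * (\<integral>\<^sup>+ ks. ennreal ((cmod (\<Phi> n ks js s))\<^sup>2) \<partial>nmeas n)"
      by (rule nn_integral_cmult) measurable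
    finally show "(\<integral>\<^sup>+ z. ennreal (?f n z js s) \<partial>(lborel \<Otimes>\<^sub>M nmeas n))
       = ennreal c1 * (\<integral>\<^sup>+ ks. ennreal ((cmod (\<Phi> n ks js s))\<^sup>2) \<partial>nmeas n)" .
  qed
  also have "\<dots> = ennreal c1 * (\<Sum>n. \<Sum>js\<in>pols n. \<Sum>s\<in>spins P. \<integral>\<^sup>+ ks. ennreal ((cmod (\<Phi> n ks js s))\<^sup>2) \<partial>nmeas n)"
    by (simp add: sum_distrib_left[symmetric])
  also have "(\<Sum>n. \<Sum>js\<in>pols n. \<Sum>s\<in>spins P. \<integral>\<^sup>+ ks. ennreal ((cmod (\<Phi> n ks js s))\<^sup>2) \<partial>nmeas n)
     = (\<integral>\<^sup>+ w. flat (\<lambda>n ks js s. ennreal ((cmod (\<Phi> n ks js s))\<^sup>2)) w \<partial>fmeas P)"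
  proof (rule nn_integral_fmeas[symmetric], unfold measurable_flat_iff, intro allI ballI)
    fix n js s assume a: "js \<in> pols n" "s \<in> spins P"
    have [measurable]: "(\<lambda>ks. \<Phi> n ks js s) \<in> borel_measurable (nmeas n)"
      by (rule measurable_section[OF Htot_measurable[OF \<Phi>] a])
    show "(\<lambda>ks. ennreal ((cmod (\<Phi> n ks js s))\<^sup>2)) \<in> borel_measurable (nmeas n)" by measurable
  qed
  also have "\<dots> = (\<integral>\<^sup>+ w. ennreal ((cmod (flat \<Phi> w))\<^sup>2) \<partial>fmeas P)"
    by (intro nn_integral_cong) auto
  also have "ennreal c1 * \<dots> < \<infinity>" using Htot_L2[OF \<Phi>] by (simp add: L2_iff ennreal_mult_less_top)
  finally show "(\<integral>\<^sup>+ w. ennreal (flat ?f w) \<partial>fmeas1 P) < \<infinity>" .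
qed

definition cross_dens :: "fock \<Rightarrow> fock \<Rightarrow> nat \<Rightarrow> (real^3) \<times> (nat \<Rightarrow> real^3) \<Rightarrow> 3 \<Rightarrow> (nat \<Rightarrow> 3) \<Rightarrow> (nat \<Rightarrow> bool) \<Rightarrow> real" where
  "cross_dens \<Phi> \<Psi> n z j js s = (V (fst z) j * \<Phi> n (snd z) js s) \<bullet> ann_field \<Psi> n z j js s"

text \<open>The pairing of V(k) Phi with a(k) Psi over all configurations with an extra photon. Both
  \<open>fock_inner P \<Phi> (annih V \<Psi>)\<close> and
  \<open>fock_inner P (create V \<Phi>) \<Psi>\<close> turn out equal to it, which is the
  adjointness of the two operators.\<close>

definition cross :: "nat \<Rightarrow> fock \<Rightarrow> fock \<Rightarrow> real" where
  "cross P \<Phi> \<Psi> = (\<integral> w. flat (\<lambda>n z js s. \<Sum>j\<in>UNIV. cross_dens \<Phi> \<Psi> n z j js s) w \<partial>fmeas1 P)"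

lemma abs_cross_dens_le:
  "\<bar>cross_dens \<Phi> \<Psi> n z j js s\<bar> \<le> (g (fst z))\<^sup>2 / norm (fst z) * (cmod (\<Phi> n (snd z) js s))\<^sup>2
     + norm (fst z) * (cmod (ann_field \<Psi> n z j js s))\<^sup>2"
proof -
  let ?k = "fst z" and ?a = "cmod (ann_field \<Psi> n z j js s)" and ?p = "cmod (\<Phi> n (snd z) js s)"
  have "\<bar>cross_dens \<Phi> \<Psi> n z j js s\<bar> \<le> cmod (V ?k j * \<Phi> n (snd z) js s) * ?a"
    unfolding cross_dens_def by (rule Cauchy_Schwarz_ineq2)
  also have "\<dots> \<le> g ?k * ?p * ?a" by (simp add: norm_mult mult_right_mono V_le)
  also have "\<dots> = (g ?k / sqrt (norm ?k) * ?p) * (sqrt (norm ?k) * ?a)"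
    by (cases "?k = 0") (simp_all add: g_zero)
  also have "\<dots> \<le> (g ?k / sqrt (norm ?k) * ?p)\<^sup>2 + (sqrt (norm ?k) * ?a)\<^sup>2"
    using sum_squares_bound[of "g ?k / sqrt (norm ?k) * ?p" "sqrt (norm ?k) * ?a"]
      zero_le_power2[of "g ?k / sqrt (norm ?k) * ?p"] zero_le_power2[of "sqrt (norm ?k) * ?a"] by linarith
  also have "\<dots> = (g ?k)\<^sup>2 / norm ?k * ?p\<^sup>2 + norm ?k * ?a\<^sup>2"
    by (simp add: power_mult_distrib power_divide)
  finally show ?thesis .
qed

lemma measurable_cross_dens:
  assumes "\<Phi> \<in> Htot P" "\<Psi> \<in> Htot P" "js \<in> pols n" "s \<in> spins P"
  shows "(\<lambda>z. cross_dens \<Phi> \<Psi> n z j js s) \<in> borel_measurable (lborel \<Otimes>\<^sub>M nmeas n)"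
proof -
  have a: "(\<lambda>z. ann_field \<Psi> n z j js s) \<in> borel_measurable (lborel \<Otimes>\<^sub>M nmeas n)"
    by (rule measurable_ann_field[OF Htot_measurable[OF assms(2)] assms(3,4)])
  have p: "(\<lambda>z. \<Phi> n (snd z) js s) \<in> borel_measurable (lborel \<Otimes>\<^sub>M nmeas n)"
    by (rule measurable_compose[OF measurable_snd measurable_section[OF Htot_measurable[OF assms(1)] assms(3,4)]])
  have v: "(\<lambda>z. V (fst z) j) \<in> borel_measurable (lborel \<Otimes>\<^sub>M nmeas n)"
    by (rule measurable_compose[OF measurable_fst]) (use measurable_V in simp)
  show ?thesis unfolding cross_dens_def by (intro borel_measurable_inner borel_measurable_times a p v)
qed

lemma cross_abs_integrable:
  assumes \<Phi>: "\<Phi> \<in> Htot P" and \<Psi>: "\<Psi> \<in> domH P"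
  shows "integrable (fmeas1 P) (flat (\<lambda>n z js s. \<Sum>j\<in>UNIV. \<bar>cross_dens \<Phi> \<Psi> n z j js s\<bar>))"
proof (rule Bochner_Integration.integrable_bound)
  have H: "\<Psi> \<in> Htot P" using \<Psi> by (simp add: domH_iff)
  show "integrable (fmeas1 P) (\<lambda>w. 3 * flat (\<lambda>n z js s. (g (fst z))\<^sup>2 / norm (fst z) * (cmod (\<Phi> n (snd z) js s))\<^sup>2) w
     + flat (\<lambda>n z js s. \<Sum>j\<in>UNIV. norm (fst z) * (cmod (ann_field \<Psi> n z j js s))\<^sup>2) w)"
    by (intro Bochner_Integration.integrable_add integrable_mult_right weighted_integrable \<Phi> fmeas1_energy \<Psi>)
  show "flat (\<lambda>n z js s. \<Sum>j\<in>UNIV. \<bar>cross_dens \<Phi> \<Psi> n z j js s\<bar>) \<in> borel_measurable (fmeas1 P)"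
    unfolding measurable_flat1_iff
    by (intro allI ballI borel_measurable_sum borel_measurable_abs measurable_cross_dens[OF \<Phi> H])
  show "AE w in fmeas1 P. norm (flat (\<lambda>n z js s. \<Sum>j\<in>UNIV. \<bar>cross_dens \<Phi> \<Psi> n z j js s\<bar>) w)
     \<le> norm (3 * flat (\<lambda>n z js s. (g (fst z))\<^sup>2 / norm (fst z) * (cmod (\<Phi> n (snd z) js s))\<^sup>2) w
     + flat (\<lambda>n z js s. \<Sum>j\<in>UNIV. norm (fst z) * (cmod (ann_field \<Psi> n z j js s))\<^sup>2) w)"
  proof (rule AE_I2)
    fix w :: "(nat \<times> (nat \<Rightarrow> 3) \<times> (nat \<Rightarrow> bool)) \<times> (real^3) \<times> (nat \<Rightarrow> real^3)"
    obtain n js s z where w: "w = ((n, js, s), z)" by (metis prod.exhaust)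
    let ?q = "(g (fst z))\<^sup>2 / norm (fst z) * (cmod (\<Phi> n (snd z) js s))\<^sup>2"
    have "(\<Sum>j\<in>UNIV. \<bar>cross_dens \<Phi> \<Psi> n z j js s\<bar>) \<le> (\<Sum>j\<in>UNIV. ?q + norm (fst z) * (cmod (ann_field \<Psi> n z j js s))\<^sup>2)"
      by (intro sum_mono abs_cross_dens_le)
    also have "\<dots> = 3 * ?q + (\<Sum>j\<in>UNIV. norm (fst z) * (cmod (ann_field \<Psi> n z j js s))\<^sup>2)"
      by (simp add: sum.distrib)
    finally have le: "(\<Sum>j\<in>UNIV. \<bar>cross_dens \<Phi> \<Psi> n z j js s\<bar>) \<le> \<dots>" .
    have "0 \<le> (\<Sum>j\<in>UNIV. \<bar>cross_dens \<Phi> \<Psi> n z j js s\<bar>)" by (rule sum_nonneg) simp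
    with le show "norm (flat (\<lambda>n z js s. \<Sum>j\<in>UNIV. \<bar>cross_dens \<Phi> \<Psi> n z j js s\<bar>) w)
     \<le> norm (3 * flat (\<lambda>n z js s. (g (fst z))\<^sup>2 / norm (fst z) * (cmod (\<Phi> n (snd z) js s))\<^sup>2) w
     + flat (\<lambda>n z js s. \<Sum>j\<in>UNIV. norm (fst z) * (cmod (ann_field \<Psi> n z j js s))\<^sup>2) w)"
      unfolding w flat_apply real_norm_def by linarith
  qed
qed

lemma cross_integrable:
  assumes \<Phi>: "\<Phi> \<in> Htot P" and \<Psi>: "\<Psi> \<in> domH P"
  shows "integrable (fmeas1 P) (flat (\<lambda>n z js s. \<Sum>j\<in>UNIV. cross_dens \<Phi> \<Psi> n z j js s))"
proof (rule Bochner_Integration.integrable_bound[OF cross_abs_integrable[OF assms]])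
  have H: "\<Psi> \<in> Htot P" using \<Psi> by (simp add: domH_iff)
  show "flat (\<lambda>n z js s. \<Sum>j\<in>UNIV. cross_dens \<Phi> \<Psi> n z j js s) \<in> borel_measurable (fmeas1 P)"
    unfolding measurable_flat1_iff
    by (intro allI ballI borel_measurable_sum measurable_cross_dens[OF \<Phi> H])
  show "AE w in fmeas1 P. norm (flat (\<lambda>n z js s. \<Sum>j\<in>UNIV. cross_dens \<Phi> \<Psi> n z j js s) w)
    \<le> norm (flat (\<lambda>n z js s. \<Sum>j\<in>UNIV. \<bar>cross_dens \<Phi> \<Psi> n z j js s\<bar>) w)"
    by (rule AE_I2) (auto simp: intro!: order.trans[OF sum_abs])
qed

text \<open>Fubini isolates the integral over the annihilated momentum, and the factor
  \<open>\<Phi>\<close> is taken out of it at the configurations where it converges.\<close>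

lemma annih_cross:
  assumes \<Phi>: "\<Phi> \<in> Htot P" and \<Psi>: "\<Psi> \<in> domH P"
  shows "fock_inner P \<Phi> (annih V \<Psi>) = cross P \<Phi> \<Psi>"
proof -
  note ci = cross_integrable[OF assms, unfolded fmeas1_def]
  note fub = Fubini_dsum[OF sigma_finite_lborel _ ci]
  have "cross P \<Phi> \<Psi> = (\<integral> w. (case w of (d, ks) \<Rightarrow> \<integral> k. flat (\<lambda>n z js s. \<Sum>j\<in>UNIV. cross_dens \<Phi> \<Psi> n z j js s) (d, (k, ks)) \<partial>lborel) \<partial>fmeas P)"
    unfolding cross_def fmeas1_def fmeas_def by (rule fub(2)) simp
  also have "\<dots> = (\<integral> w. flat \<Phi> w \<bullet> flat (annih V \<Psi>) w \<partial>fmeas P)"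
  proof (rule integral_cong_AE)
    show "(\<lambda>w. flat \<Phi> w \<bullet> flat (annih V \<Psi>) w) \<in> borel_measurable (fmeas P)"
      using annih_bound(1)[OF \<Psi>] Htot_measurable[OF \<Phi>] by (auto dest: L2_measurable)
    show "(\<lambda>w. case w of (d, ks) \<Rightarrow> \<integral> k. flat (\<lambda>n z js s. \<Sum>j\<in>UNIV. cross_dens \<Phi> \<Psi> n z j js s) (d, (k, ks)) \<partial>lborel) \<in> borel_measurable (fmeas P)"
      unfolding fmeas_def by (rule borel_measurable_integrable[OF fub(1)]) simp
    show "AE w in fmeas P. (case w of (d, ks) \<Rightarrow> \<integral> k. flat (\<lambda>n z js s. \<Sum>j\<in>UNIV. cross_dens \<Phi> \<Psi> n z j js s) (d, (k, ks)) \<partial>lborel)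
       = flat \<Phi> w \<bullet> flat (annih V \<Psi>) w"
      using AE_annih_integrable[OF \<Psi>]
    proof eventually_elim
      fix w :: "(nat \<times> (nat \<Rightarrow> 3) \<times> (nat \<Rightarrow> bool)) \<times> (nat \<Rightarrow> real^3)"
      obtain n js s ks where w: "w = ((n, js, s), ks)" by (metis prod.exhaust)
      assume "flat (\<lambda>n ks js s. \<forall>j. integrable lborel (\<lambda>k. cnj (V k j) * ann_field \<Psi> n (k, ks) j js s)) w"
      then have i: "integrable lborel (\<lambda>k. \<Sum>j\<in>UNIV. cnj (V k j) * ann_field \<Psi> n (k, ks) j js s)"
        unfolding w by (intro Bochner_Integration.integrable_sum) simp
      have "(\<integral> k. (\<Sum>j\<in>UNIV. cross_dens \<Phi> \<Psi> n (k, ks) j js s) \<partial>lborel)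
        = (\<integral> k. \<Phi> n ks js s \<bullet> (\<Sum>j\<in>UNIV. cnj (V k j) * ann_field \<Psi> n (k, ks) j js s) \<partial>lborel)"
        by (simp add: cross_dens_def inner_cnj inner_sum_right)
      also have "\<dots> = \<Phi> n ks js s \<bullet> annih V \<Psi> n ks js s"
        unfolding annih_ann_field by (rule integral_inner_right) (rule i)
      finally show "(case w of (d, ks) \<Rightarrow> \<integral> k. flat (\<lambda>n z js s. \<Sum>j\<in>UNIV. cross_dens \<Phi> \<Psi> n z j js s) (d, (k, ks)) \<partial>lborel)
        = flat \<Phi> w \<bullet> flat (annih V \<Psi>) w" by (simp add: w)
    qed
  qed
  finally show ?thesis by (simp add: fock_inner_def l2ip_def)
qed

text \<open>The marked-photon formula with the created photon as the marked one; symmetry of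
  \<open>\<Psi>\<close> brings it to the front.\<close>

lemma create_cross:
  assumes \<Phi>: "\<Phi> \<in> domH P" and \<Psi>: "\<Psi> \<in> domH P"
  shows "fock_inner P (create V \<Phi>) \<Psi> = cross P \<Phi> \<Psi>"
proof -
  have H: "\<Phi> \<in> Htot P" "\<Psi> \<in> Htot P" using assms by (auto simp: domH_iff)
  have sy: "symmetric_fock P \<Psi>" using H by (simp add: Htot_iff)
  define F where "F i n ks js s = 1 / sqrt (real n) *
     ((V (ks i) (js i) * \<Phi> (n - 1) (fdel i ks) (fdel i js) s) \<bullet> \<Psi> n ks js s)" for i n ks js s
  have F0: "real (Suc n) * F 0 (Suc n) (fcons (fst z) (snd z)) (fcons j js) s = cross_dens \<Phi> \<Psi> n z j js s" for n z j js s
  proof -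
    \<comment> \<open>The multiplicity of the marked photon against the normalisation of creation
      leaves exactly the factor in \<open>ann_field\<close>.\<close>
    have "real (Suc n) * (1 / sqrt (real (Suc n))) = sqrt (real (Suc n))"
      by (simp add: real_div_sqrt del: of_nat_Suc)
    then have "real (Suc n) * F 0 (Suc n) (fcons (fst z) (snd z)) (fcons j js) s
      = sqrt (real (Suc n)) * ((V (fst z) j * \<Phi> n (snd z) js s) \<bullet> \<Psi> (Suc n) (fcons (fst z) (snd z)) (fcons j js) s)"
      unfolding F_def mult.assoc[symmetric] by (simp only: fcons_insr insr_at fdel_insr diff_Suc_1)
    then show ?thesis
      unfolding cross_dens_def ann_field_def scaleR_conv_of_real[symmetric] inner_scaleR_right .
  qed
  have mk: "(\<integral> w. flat (\<lambda>n ks js s. \<Sum>i<n. F i n ks js s) w \<partial>fmeas P)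
      = (\<integral> w. flat (\<lambda>n z js s. real (Suc n) * (\<Sum>j\<in>UNIV. F 0 (Suc n) (fcons (fst z) (snd z)) (fcons j js) s)) w \<partial>fmeas1 P)"
  proof (rule mecke(2))
    fix i n js s assume a: "i < (n::nat)" "js \<in> pols n" "s \<in> spins P"
    then obtain l where n: "n = Suc l" by (cases n) auto
    then have nl: "n - 1 = l" by simp
    have v: "(\<lambda>ks. V (ks i) (js i)) \<in> borel_measurable (nmeas n)"
      by (rule measurable_compose[OF measurable_nmeas_component[OF a(1)] measurable_V])
    have p: "(\<lambda>ks. \<Phi> l (fdel i ks) (fdel i js) s) \<in> borel_measurable (nmeas n)"
      unfolding n by (rule measurable_section_fdel[OF Htot_measurable[OF H(1)]]) (use a n in auto)
    have q: "(\<lambda>ks. \<Psi> n ks js s) \<in> borel_measurable (nmeas n)"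
      by (rule measurable_section[OF Htot_measurable[OF H(2)] a(2,3)])
    show "(\<lambda>ks. F i n ks js s) \<in> borel_measurable (nmeas n)"
      unfolding F_def nl by (intro borel_measurable_times borel_measurable_inner v p q borel_measurable_const)
  next
    fix i n js s and j :: 3 assume a: "i \<le> (n::nat)" "js \<in> pols n" "s \<in> spins P"
    from symmetric_fock_insr[OF sy a(1)]
    show "AE z in lborel \<Otimes>\<^sub>M nmeas n. F i (Suc n) (insr i (fst z) (snd z)) (insr i j js) s
        = F 0 (Suc n) (fcons (fst z) (snd z)) (fcons j js) s"
    proof eventually_elim
      fix z :: "(real^3) \<times> (nat \<Rightarrow> real^3)"
      assume "\<forall>j. \<forall>js\<in>pols n. \<forall>s\<in>spins P.
        \<Psi> (Suc n) (insr i (fst z) (snd z)) (insr i j js) s = \<Psi> (Suc n) (fcons (fst z) (snd z)) (fcons j js) s"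
      then have "\<Psi> (Suc n) (insr i (fst z) (snd z)) (insr i j js) s = \<Psi> (Suc n) (fcons (fst z) (snd z)) (fcons j js) s"
        using a by blast
      then show "F i (Suc n) (insr i (fst z) (snd z)) (insr i j js) s
        = F 0 (Suc n) (fcons (fst z) (snd z)) (fcons j js) s"
        unfolding F_def fcons_insr by simp
    qed
  next
    have "real (Suc n) * (\<Sum>j\<in>UNIV. \<bar>F 0 (Suc n) (fcons (fst z) (snd z)) (fcons j js) s\<bar>)
      = (\<Sum>j\<in>UNIV. \<bar>cross_dens \<Phi> \<Psi> n z j js s\<bar>)" for n z js s
      unfolding F0[symmetric] by (simp add: sum_distrib_left abs_mult del: of_nat_Suc)
    then show "integrable (fmeas1 P) (flat (\<lambda>n z js s. real (Suc n) * (\<Sum>j\<in>UNIV. \<bar>F 0 (Suc n) (fcons (fst z) (snd z)) (fcons j js) s\<bar>)))"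
      using cross_abs_integrable[OF H(1) \<Psi>] by simp
  qed
  have "fock_inner P (create V \<Phi>) \<Psi> = (\<integral> w. flat (\<lambda>n ks js s. \<Sum>i<n. F i n ks js s) w \<partial>fmeas P)"
    unfolding fock_inner_def l2ip_def
  proof (rule Bochner_Integration.integral_cong[OF refl])
    fix w :: "(nat \<times> (nat \<Rightarrow> 3) \<times> (nat \<Rightarrow> bool)) \<times> (nat \<Rightarrow> real^3)"
    obtain n js s ks where w: "w = ((n, js, s), ks)" by (metis prod.exhaust)
    show "flat (create V \<Phi>) w \<bullet> flat \<Psi> w = flat (\<lambda>n ks js s. \<Sum>i<n. F i n ks js s) w"
    proof (cases n)
      case (Suc l)
      have "create V \<Phi> n ks js s = (1 / sqrt (real n)) *\<^sub>R (\<Sum>i<n. V (ks i) (js i) * \<Phi> (n - 1) (fdel i ks) (fdel i js) s)"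
        unfolding scaleR_conv_of_real using Suc by (simp only: create_def nat.distinct if_False)
      then show ?thesis
        unfolding w flat_apply F_def by (simp only: inner_scaleR_left inner_sum_left sum_distrib_left)
    qed (simp add: w create_def)
  qed
  also have "\<dots> = cross P \<Phi> \<Psi>"
    unfolding cross_def mk sum_distrib_left F0 ..
  finally show ?thesis .
qed

end

section \<open>Spin operators\<close>

text \<open>Each Pauli matrix has one nonzero entry in every row, so it acts as a permutation of the
  spin configurations with a phase. The third is diagonal, the other two flip spin \<open>l\<close>.
  Norm and symmetry of \<open>spin_op\<close> thus reduce to invariance of the measure under a
  flip.\<close>

definition spin_flip :: "nat \<Rightarrow> nat \<Rightarrow> (nat \<Rightarrow> bool) \<Rightarrow> nat \<Rightarrow> bool" where
  "spin_flip m l s = (if m = 3 then s else s(l := \<not> s l))"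

definition spin_phase :: "nat \<Rightarrow> bool \<Rightarrow> complex" where
  "spin_phase m a = pauli m a (if m = 3 then a else \<not> a)"

definition spin_act :: "nat \<Rightarrow> nat \<Rightarrow> ((nat \<Rightarrow> bool) \<Rightarrow> complex) \<Rightarrow> (nat \<Rightarrow> bool) \<Rightarrow> complex" where
  "spin_act m l X s = (\<Sum>b\<in>UNIV. pauli m (s l) b * X (s(l := b)))"

lemma spin_op_act: "spin_op m l \<Psi> n ks js s = spin_act m l (\<Psi> n ks js) s"
  by (simp add: spin_op_def spin_act_def)

lemma spin_act_flip:
  assumes "m \<in> {1..3}" shows "spin_act m l X s = spin_phase m (s l) * X (spin_flip m l s)"
proof -
  have m: "m = 1 \<or> m = 2 \<or> m = 3" using assms by auto
  have upd: "s(l := True) = s" if "s l" using that by (simp add: fun_eq_iff)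
  have upd': "s(l := False) = s" if "\<not> s l" using that by (simp add: fun_eq_iff)
  show ?thesis
    using m upd upd' by (cases "s l") (auto simp: spin_act_def spin_phase_def spin_flip_def pauli_def UNIV_bool)
qed

lemma spin_flip_involutive [simp]: "spin_flip m l (spin_flip m l s) = s"
  by (auto simp: spin_flip_def fun_eq_iff)

lemma spin_flip_mem: "l \<in> {1..P} \<Longrightarrow> spin_flip m l s \<in> spins P \<longleftrightarrow> s \<in> spins P"
  by (auto simp: spin_flip_def spins_def)

lemma cmod_spin_phase: "m \<in> {1..3} \<Longrightarrow> cmod (spin_phase m a) = 1"
  by (auto simp: spin_phase_def pauli_def)

text \<open>Hermiticity of the Pauli matrices, read off from the phases.\<close>

lemma cnj_spin_phase:
  "m \<in> {1..3} \<Longrightarrow> cnj (spin_phase m (spin_flip m l s l)) = spin_phase m (s l)"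
  by (auto simp: spin_phase_def pauli_def spin_flip_def)

definition flip_pt :: "nat \<Rightarrow> nat \<Rightarrow> (nat \<times> (nat \<Rightarrow> 3) \<times> (nat \<Rightarrow> bool)) \<times> 'k \<Rightarrow> (nat \<times> (nat \<Rightarrow> 3) \<times> (nat \<Rightarrow> bool)) \<times> 'k" where
  "flip_pt m l = (\<lambda>((n, js, s), ks). ((n, js, spin_flip m l s), ks))"

lemma flip_pt_apply [simp]: "flip_pt m l ((n, js, s), ks) = ((n, js, spin_flip m l s), ks)"
  by (simp add: flip_pt_def)

lemma measurable_flip_pt:
  assumes l: "l \<in> {1..P}" shows "flip_pt m l \<in> measurable (fmeas P) (fmeas P)"
  unfolding fmeas_def[of P] measurable_dsum_iff[where M = "dsum_measure (sectors P) (\<lambda>d. nmeas (fst d))"]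
proof
  fix d assume "d \<in> sectors P"
  then obtain n js s where d: "d = (n, js, s)" "js \<in> pols n" "s \<in> spins P" by (cases d) auto
  then have "(n, js, spin_flip m l s) \<in> sectors P" using spin_flip_mem[OF l] by simp
  from measurable_Pair_dsum[OF this, of "\<lambda>d. nmeas (fst d)"]
  show "(\<lambda>ks. flip_pt m l (d, ks)) \<in> measurable (nmeas (fst d)) (dsum_measure (sectors P) (\<lambda>d. nmeas (fst d)))"
    by (simp add: d)
qed

text \<open>Sectors are permuted without changing the photon number, and the measure on a sector
  depends on that number alone.\<close>

lemma distr_flip_pt:
  assumes l: "l \<in> {1..P}" shows "distr (fmeas P) (fmeas P) (flip_pt m l) = fmeas P"
proof (rule measure_eqI)
  fix A assume "A \<in> sets (distr (fmeas P) (fmeas P) (flip_pt m l))"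
  then have A: "A \<in> sets (fmeas P)" by simp
  define h where "h = (\<lambda>(n::nat, js::nat \<Rightarrow> 3, s). (n, js, spin_flip m l s))"
  have bij: "bij_betw h (sectors P) (sectors P)"
    by (rule bij_betw_byWitness[where f' = h]) (auto simp: h_def sectors_def spin_flip_mem[OF l])
  let ?N = "\<lambda>d :: nat \<times> (nat \<Rightarrow> 3) \<times> (nat \<Rightarrow> bool). nmeas (fst d)"
  have B: "flip_pt m l -` A \<inter> space (fmeas P) \<in> sets (fmeas P)"
    by (rule measurable_sets[OF measurable_flip_pt[OF l] A])
  have sub: "A \<subseteq> space (fmeas P)" by (rule sets.sets_into_space[OF A])
  have sec: "Pair d -` (flip_pt m l -` A \<inter> space (fmeas P)) = Pair (h d) -` A" if "d \<in> sectors P" for d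
    using sub that by (cases d) (auto simp: h_def fmeas_def)
  have fh: "fst (h d) = fst d" for d by (cases d) (simp add: h_def)
  have "emeasure (distr (fmeas P) (fmeas P) (flip_pt m l)) A = emeasure (fmeas P) (flip_pt m l -` A \<inter> space (fmeas P))"
    by (rule emeasure_distr[OF measurable_flip_pt[OF l] A])
  also have "\<dots> = (\<integral>\<^sup>+ d. emeasure (?N d) (Pair d -` (flip_pt m l -` A \<inter> space (fmeas P))) \<partial>count_space (sectors P))"
    using B unfolding fmeas_def by (rule emeasure_dsum)
  also have "\<dots> = (\<integral>\<^sup>+ d. emeasure (?N (h d)) (Pair (h d) -` A) \<partial>count_space (sectors P))"
    by (rule nn_integral_cong) (simp only: sec fh space_count_space)
  also have "\<dots> = (\<integral>\<^sup>+ d. emeasure (?N d) (Pair d -` A) \<partial>count_space (sectors P))"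
    by (rule nn_integral_bij_count_space[OF bij])
  also have "\<dots> = emeasure (fmeas P) A"
    using A unfolding fmeas_def by (rule emeasure_dsum[symmetric])
  finally show "emeasure (distr (fmeas P) (fmeas P) (flip_pt m l)) A = emeasure (fmeas P) A" .
qed simp

lemma integral_flip_pt:
  fixes f :: "_ \<Rightarrow> real"
  assumes l: "l \<in> {1..P}" and f: "f \<in> borel_measurable (fmeas P)"
  shows "(\<integral> w. f (flip_pt m l w) \<partial>fmeas P) = (\<integral> w. f w \<partial>fmeas P)"
  using integral_distr[OF measurable_flip_pt[OF l] f, of m] by (simp only: distr_flip_pt[OF l])

lemma integrable_flip_pt:
  fixes f :: "_ \<Rightarrow> real"
  assumes l: "l \<in> {1..P}" and f: "integrable (fmeas P) f"
  shows "integrable (fmeas P) (\<lambda>w. f (flip_pt m l w))"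
  by (rule integrable_distr[OF measurable_flip_pt[OF l]]) (simp only: distr_flip_pt[OF l] f)

context
  fixes P l m :: nat
  assumes l: "l \<in> {1..P}" and m: "m \<in> {1..3}"
begin

lemma spin_op_flip: "spin_op m l \<Psi> n ks js s = spin_phase m (s l) * \<Psi> n ks js (spin_flip m l s)"
  unfolding spin_op_act by (rule spin_act_flip[OF m])

lemma flat_spin_op_cmod: "cmod (flat (spin_op m l \<Psi>) w) = cmod (flat \<Psi> (flip_pt m l w))"
  by (cases w) (auto simp: spin_op_flip norm_mult cmod_spin_phase[OF m])

lemma L2_spin_op:
  assumes "flat \<Psi> \<in> L2 (fmeas P)" shows "flat (spin_op m l \<Psi>) \<in> L2 (fmeas P)"
proof -
  have meas: "flat (spin_op m l \<Psi>) \<in> borel_measurable (fmeas P)"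
    unfolding measurable_flat_iff
  proof (intro allI ballI)
    fix n js s assume "js \<in> pols n" "s \<in> spins P"
    then have "(\<lambda>ks. \<Psi> n ks js (spin_flip m l s)) \<in> borel_measurable (nmeas n)"
      by (intro measurable_section[OF L2_measurable[OF assms]]) (auto simp: spin_flip_mem[OF l])
    then show "(\<lambda>ks. spin_op m l \<Psi> n ks js s) \<in> borel_measurable (nmeas n)"
      unfolding spin_op_flip by measurable
  qed
  have "integrable (fmeas P) (\<lambda>w. (cmod (flat (spin_op m l \<Psi>) w))\<^sup>2)"
    unfolding flat_spin_op_cmod
    by (rule integrable_flip_pt[OF l, of "\<lambda>w. (cmod (flat \<Psi> w))\<^sup>2"]) (use assms in \<open>simp add: L2_def\<close>)
  with meas show ?thesis by (simp add: L2_def)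
qed

lemma fock_inner_spin_op:
  assumes "flat \<Psi> \<in> L2 (fmeas P)" "flat \<Phi> \<in> L2 (fmeas P)"
  shows "fock_inner P (spin_op m l \<Psi>) \<Phi> = fock_inner P \<Psi> (spin_op m l \<Phi>)"
proof -
  have "fock_inner P (spin_op m l \<Psi>) \<Phi> = (\<integral> w. flat (spin_op m l \<Psi>) (flip_pt m l w) \<bullet> flat \<Phi> (flip_pt m l w) \<partial>fmeas P)"
    unfolding fock_inner_def l2ip_def
    by (rule integral_flip_pt[OF l, symmetric])
       (use assms(2) L2_spin_op[OF assms(1)] in \<open>auto dest!: L2_measurable\<close>)
  also have "\<dots> = fock_inner P \<Psi> (spin_op m l \<Phi>)"
    unfolding fock_inner_def l2ip_def
  proof (rule Bochner_Integration.integral_cong[OF refl])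
    fix w :: "(nat \<times> (nat \<Rightarrow> 3) \<times> (nat \<Rightarrow> bool)) \<times> (nat \<Rightarrow> real^3)"
    obtain n js s ks where w: "w = ((n, js, s), ks)" by (metis prod.exhaust)
    show "flat (spin_op m l \<Psi>) (flip_pt m l w) \<bullet> flat \<Phi> (flip_pt m l w) = flat \<Psi> w \<bullet> flat (spin_op m l \<Phi>) w"
      by (simp add: w spin_op_flip inner_cnj cnj_spin_phase[OF m])
  qed
  finally show ?thesis .
qed

lemma nm_spin_op:
  assumes "flat \<Psi> \<in> L2 (fmeas P)" shows "Fock.nm P (spin_op m l \<Psi>) = Fock.nm P \<Psi>"
proof -
  have "fock_inner P (spin_op m l \<Psi>) (spin_op m l \<Psi>) = (\<integral> w. (cmod (flat \<Psi> (flip_pt m l w)))\<^sup>2 \<partial>fmeas P)"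
    by (simp add: fock_inner_def l2ip_self flat_spin_op_cmod)
  also have "\<dots> = fock_inner P \<Psi> \<Psi>"
    unfolding fock_inner_def l2ip_self
    by (rule integral_flip_pt[OF l]) (use assms in \<open>auto dest!: L2_measurable\<close>)
  finally show ?thesis by (simp add: Fock.nm_def)
qed

lemma spin_op_Htot:
  assumes "\<Psi> \<in> Htot P" shows "spin_op m l \<Psi> \<in> Htot P"
proof -
  have "symmetric_fock P (spin_op m l \<Psi>)" unfolding symmetric_fock_def
  proof (intro allI impI)
    fix n \<pi> assume "\<pi> permutes {..<n::nat}"
    then have "AE ks in nmeas n. \<forall>js\<in>pols n. \<forall>s\<in>spins P. \<Psi> n (ks \<circ> \<pi>) (js \<circ> \<pi>) s = \<Psi> n ks js s"
      using assms by (auto simp: Htot_iff symmetric_fock_def)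
    then show "AE ks in nmeas n. \<forall>js\<in>pols n. \<forall>s\<in>spins P. spin_op m l \<Psi> n (ks \<circ> \<pi>) (js \<circ> \<pi>) s = spin_op m l \<Psi> n ks js s"
      by eventually_elim (auto simp: spin_op_flip spin_flip_mem[OF l])
  qed
  moreover have "transversal_fock P (spin_op m l \<Psi>)" unfolding transversal_fock_def
  proof (intro allI impI)
    fix n i assume "i < (n::nat)"
    then have "AE ks in nmeas n. \<forall>js\<in>pols n. \<forall>s\<in>spins P.
       (\<Sum>j\<in>UNIV. complex_of_real (ks i $ j) * \<Psi> n ks (js(i := j)) s) = 0"
      using assms by (auto simp: Htot_iff transversal_fock_def)
    then show "AE ks in nmeas n. \<forall>js\<in>pols n. \<forall>s\<in>spins P.
       (\<Sum>j\<in>UNIV. complex_of_real (ks i $ j) * spin_op m l \<Psi> n ks (js(i := j)) s) = 0"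
    proof (eventually_elim, intro ballI)
      fix ks js s assume h: "\<forall>js\<in>pols n. \<forall>s\<in>spins P. (\<Sum>j\<in>UNIV. complex_of_real (ks i $ j) * \<Psi> n ks (js(i := j)) s) = 0"
        and a: "js \<in> pols n" "s \<in> spins P"
      have "(\<Sum>j\<in>UNIV. complex_of_real (ks i $ j) * spin_op m l \<Psi> n ks (js(i := j)) s)
        = spin_phase m (s l) * (\<Sum>j\<in>UNIV. complex_of_real (ks i $ j) * \<Psi> n ks (js(i := j)) (spin_flip m l s))"
        by (simp add: spin_op_flip sum_distrib_left mult.left_commute)
      then show "(\<Sum>j\<in>UNIV. complex_of_real (ks i $ j) * spin_op m l \<Psi> n ks (js(i := j)) s) = 0"
        using h a by (simp add: spin_flip_mem[OF l])
    qed
  qed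
  ultimately show ?thesis using assms L2_spin_op by (simp add: Htot_iff)
qed

lemma hph_spin_op: "hph (spin_op m l \<Psi>) = spin_op m l (hph \<Psi>)"
  by (simp add: hph_photon_energy spin_op_flip fun_eq_iff mult.left_commute)

lemma spin_op_domH: "\<Psi> \<in> domH P \<Longrightarrow> spin_op m l \<Psi> \<in> domH P"
  by (simp add: domH_iff spin_op_Htot hph_spin_op L2_spin_op)

lemma create_spin_op: "create V (spin_op m l \<Psi>) = spin_op m l (create V \<Psi>)"
  by (auto simp: create_def spin_op_flip fun_eq_iff sum_distrib_left mult.left_commute)

end

section \<open>The Hamiltonian\<close>

lemma subspace_domH: "subspace (domH P)"
proof (rule subspaceI)
  have hph_add: "hph (\<Psi> + \<Phi>) = hph \<Psi> + hph \<Phi>" for \<Psi> \<Phi> :: fock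
    by (simp add: hph_photon_energy fun_eq_iff distrib_left)
  have hph_scale: "hph (c *\<^sub>R \<Psi>) = c *\<^sub>R hph \<Psi>" for c and \<Psi> :: fock
    by (simp add: hph_photon_energy fun_eq_iff)
  have hph_zero: "hph 0 = 0" by (simp add: hph_photon_energy fun_eq_iff)
  show "0 \<in> domH P"
    unfolding domH_iff hph_zero flat_zero using subspace_0[OF subspace_Htot] subspace_0[OF subspace_L2] by blast
  fix \<Psi> \<Phi> assume "\<Psi> \<in> domH P" "\<Phi> \<in> domH P"
  then show "\<Psi> + \<Phi> \<in> domH P"
    unfolding domH_iff hph_add flat_add using subspace_add[OF subspace_Htot] subspace_add[OF subspace_L2] by blast
next
  have hph_scale: "hph (c *\<^sub>R \<Psi>) = c *\<^sub>R hph \<Psi>" for c and \<Psi> :: fock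
    by (simp add: hph_photon_energy fun_eq_iff)
  fix c \<Psi> assume "\<Psi> \<in> domH P"
  then show "c *\<^sub>R \<Psi> \<in> domH P"
    unfolding domH_iff hph_scale flat_scale using subspace_scale[OF subspace_Htot] subspace_scale[OF subspace_L2] by blast
qed

lemma domH_Htot: "\<Psi> \<in> domH P \<Longrightarrow> \<Psi> \<in> Htot P"
  by (simp add: domH_iff)

lemma photon_energy_permute: "\<pi> permutes {..<n} \<Longrightarrow> photon_energy n (ks \<circ> \<pi>) = photon_energy n ks"
  unfolding photon_energy_def comp_def by (rule sum.permute[symmetric, unfolded comp_def])

text \<open>The functional calculus of the free energy: a function of the total energy is invariant
  under permutations and does not touch polarisations, so both constraints survive multiplication by
  it.\<close>

lemma mult_photon_energy_Htot:
  fixes h :: "real \<Rightarrow> real"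
  assumes \<Psi>: "\<Psi> \<in> Htot P" and h: "h \<in> borel_measurable borel"
    and L2: "(\<integral>\<^sup>+ w. ennreal ((cmod (flat (\<lambda>n ks js s. complex_of_real (h (photon_energy n ks)) * \<Psi> n ks js s) w))\<^sup>2) \<partial>fmeas P) < \<infinity>"
  shows "(\<lambda>n ks js s. complex_of_real (h (photon_energy n ks)) * \<Psi> n ks js s) \<in> Htot P" (is "?F \<in> _")
proof -
  have "flat ?F \<in> borel_measurable (fmeas P)" unfolding measurable_flat_iff
  proof (intro allI ballI)
    fix n js s assume a: "js \<in> pols n" "s \<in> spins P"
    have [measurable]: "(\<lambda>ks. \<Psi> n ks js s) \<in> borel_measurable (nmeas n)"
      by (rule measurable_section[OF Htot_measurable[OF \<Psi>] a])
    note [measurable] = h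
    show "(\<lambda>ks. complex_of_real (h (photon_energy n ks)) * \<Psi> n ks js s) \<in> borel_measurable (nmeas n)" by measurable
  qed
  then have "flat ?F \<in> L2 (fmeas P)" using L2 by (simp add: L2_iff)
  moreover have "symmetric_fock P ?F" unfolding symmetric_fock_def
  proof (intro allI impI)
    fix n \<pi> assume \<pi>: "\<pi> permutes {..<n::nat}"
    then have "AE ks in nmeas n. \<forall>js\<in>pols n. \<forall>s\<in>spins P. \<Psi> n (ks \<circ> \<pi>) (js \<circ> \<pi>) s = \<Psi> n ks js s"
      using \<Psi> by (auto simp: Htot_iff symmetric_fock_def)
    then show "AE ks in nmeas n. \<forall>js\<in>pols n. \<forall>s\<in>spins P. ?F n (ks \<circ> \<pi>) (js \<circ> \<pi>) s = ?F n ks js s"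
      by eventually_elim (simp add: photon_energy_permute[OF \<pi>])
  qed
  moreover have "transversal_fock P ?F" unfolding transversal_fock_def
  proof (intro allI impI)
    fix n i assume "i < (n::nat)"
    then have "AE ks in nmeas n. \<forall>js\<in>pols n. \<forall>s\<in>spins P.
       (\<Sum>j\<in>UNIV. complex_of_real (ks i $ j) * \<Psi> n ks (js(i := j)) s) = 0"
      using \<Psi> by (auto simp: Htot_iff transversal_fock_def)
    then show "AE ks in nmeas n. \<forall>js\<in>pols n. \<forall>s\<in>spins P.
       (\<Sum>j\<in>UNIV. complex_of_real (ks i $ j) * ?F n ks (js(i := j)) s) = 0"
    proof (eventually_elim, intro ballI)
      fix ks js s assume h: "\<forall>js\<in>pols n. \<forall>s\<in>spins P. (\<Sum>j\<in>UNIV. complex_of_real (ks i $ j) * \<Psi> n ks (js(i := j)) s) = 0"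
        and a: "js \<in> pols n" "s \<in> spins P"
      have "(\<Sum>j\<in>UNIV. complex_of_real (ks i $ j) * ?F n ks (js(i := j)) s)
        = complex_of_real (h (photon_energy n ks)) * (\<Sum>j\<in>UNIV. complex_of_real (ks i $ j) * \<Psi> n ks (js(i := j)) s)"
        by (simp add: sum_distrib_left mult.left_commute)
      then show "(\<Sum>j\<in>UNIV. complex_of_real (ks i $ j) * ?F n ks (js(i := j)) s) = 0" using h a by simp
    qed
  qed
  ultimately show ?thesis by (simp add: Htot_iff)
qed

lemma hph_Htot:
  assumes "\<Psi> \<in> domH P" shows "hph \<Psi> \<in> Htot P"
proof -
  have "(\<lambda>n ks js s. complex_of_real (id (photon_energy n ks)) * \<Psi> n ks js s) \<in> Htot P"
    by (rule mult_photon_energy_Htot) (use assms in \<open>auto simp: domH_iff L2_iff hph_photon_energy id_def\<close>)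
  then show ?thesis by (simp add: hph_photon_energy)
qed

text \<open>For \<open>r \<le> -1\<close> both \<open>1 / (e - r)\<close> and
  \<open>e / (e - r)\<close> are bounded by 1 on energies \<open>e \<ge> 0\<close>, so the quotient
  lies in the domain. The solution is exact, not just modulo null vectors.\<close>

lemma free_resolvent_surj:
  assumes r: "r \<le> -1" and \<Phi>: "\<Phi> \<in> Htot P"
  shows "\<exists>\<Psi>\<in>domH P. hph \<Psi> - r *\<^sub>R \<Psi> = \<Phi>"
proof -
  have bound: "(\<lambda>n ks js s. complex_of_real (h (photon_energy n ks)) * \<Phi> n ks js s) \<in> Htot P"
    if h: "h \<in> borel_measurable borel" "\<And>e. 0 \<le> e \<Longrightarrow> \<bar>h e\<bar> \<le> 1" for h :: "real \<Rightarrow> real"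
  proof (rule mult_photon_energy_Htot[OF \<Phi> h(1)])
    have "(\<integral>\<^sup>+ w. ennreal ((cmod (flat (\<lambda>n ks js s. complex_of_real (h (photon_energy n ks)) * \<Phi> n ks js s) w))\<^sup>2) \<partial>fmeas P)
      \<le> (\<integral>\<^sup>+ w. ennreal ((cmod (flat \<Phi> w))\<^sup>2) \<partial>fmeas P)"
    proof (rule nn_integral_mono)
      fix w :: "(nat \<times> (nat \<Rightarrow> 3) \<times> (nat \<Rightarrow> bool)) \<times> (nat \<Rightarrow> real^3)"
      obtain n js s ks where w: "w = ((n, js, s), ks)" by (metis prod.exhaust)
      have "\<bar>h (photon_energy n ks)\<bar> * cmod (\<Phi> n ks js s) \<le> 1 * cmod (\<Phi> n ks js s)"
        by (intro mult_right_mono h) auto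
      then show "ennreal ((cmod (flat (\<lambda>n ks js s. complex_of_real (h (photon_energy n ks)) * \<Phi> n ks js s) w))\<^sup>2) \<le> ennreal ((cmod (flat \<Phi> w))\<^sup>2)"
        unfolding w by (intro ennreal_leI power_mono) (auto simp: norm_mult)
    qed
    also have "\<dots> < \<infinity>" using \<Phi> by (simp add: Htot_iff L2_iff)
    finally show "(\<integral>\<^sup>+ w. ennreal ((cmod (flat (\<lambda>n ks js s. complex_of_real (h (photon_energy n ks)) * \<Phi> n ks js s) w))\<^sup>2) \<partial>fmeas P) < \<infinity>" .
  qed
  define \<Psi> :: fock where "\<Psi> = (\<lambda>n ks js s. complex_of_real (1 / (photon_energy n ks - r)) * \<Phi> n ks js s)"
  have pos: "photon_energy n ks - r > 0" for n ks using r photon_energy_nonneg[of n ks] by linarith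
  have "\<Psi> \<in> Htot P" unfolding \<Psi>_def
    by (rule bound[of "\<lambda>e. 1 / (e - r)"]) (use r in \<open>auto simp: field_simps\<close>)
  moreover have "flat (hph \<Psi>) \<in> L2 (fmeas P)"
  proof -
    have "hph \<Psi> = (\<lambda>n ks js s. complex_of_real (photon_energy n ks / (photon_energy n ks - r)) * \<Phi> n ks js s)"
      by (simp add: hph_photon_energy \<Psi>_def)
    also have "\<dots> \<in> Htot P"
      by (rule bound[of "\<lambda>e. e / (e - r)"]) (use r in \<open>auto simp: field_simps\<close>)
    finally show ?thesis by (simp add: Htot_iff)
  qed
  moreover have "hph \<Psi> - r *\<^sub>R \<Psi> = \<Phi>"
  proof (intro ext)
    fix n ks js s
    have "(hph \<Psi> - r *\<^sub>R \<Psi>) n ks js s = complex_of_real ((photon_energy n ks - r) * (1 / (photon_energy n ks - r))) * \<Phi> n ks js s"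
    proof -
      have "complex_of_real e * (complex_of_real c * u) - r *\<^sub>R (complex_of_real c * u) = complex_of_real ((e - r) * c) * u"
        for e c u by (simp add: scaleR_conv_of_real algebra_simps)
      then show ?thesis unfolding minus_apply scaleR_fun_apply hph_photon_energy \<Psi>_def .
    qed
    also have "(photon_energy n ks - r) * (1 / (photon_energy n ks - r)) = 1" using pos[of n ks] by simp
    finally show "(hph \<Psi> - r *\<^sub>R \<Psi>) n ks js s = \<Phi> n ks js s" by simp
  qed
  ultimately show ?thesis by (auto simp: domH_iff)
qed

section \<open>Linearity and relative bound of the interaction\<close>

lemma spin_op_linear: "spin_op m l (\<Psi> + c *\<^sub>R \<Phi>) = spin_op m l \<Psi> + c *\<^sub>R spin_op m l \<Phi>"
  by (simp add: spin_op_def fun_eq_iff sum.distrib algebra_simps scaleR_sum_right)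

lemma spin_op_diff: "spin_op m l (\<Psi> - \<Phi>) = spin_op m l \<Psi> - spin_op m l \<Phi>"
  by (simp add: spin_op_def fun_eq_iff sum_subtractf algebra_simps)

lemma create_linear: "create V (\<Psi> + c *\<^sub>R \<Phi>) = create V \<Psi> + c *\<^sub>R create V \<Phi>"
proof (intro ext)
  fix n ks js s
  show "create V (\<Psi> + c *\<^sub>R \<Phi>) n ks js s = (create V \<Psi> + c *\<^sub>R create V \<Phi>) n ks js s"
    by (simp add: create_def scaleR_conv_of_real distrib_left sum.distrib sum_distrib_left sum_divide_distrib mult_ac add_divide_distrib)
qed

lemma segal_eq: "segal V \<Psi> = (1 / sqrt 2) *\<^sub>R (create V \<Psi> + annih V \<Psi>)"
  by (simp add: segal_def fun_eq_iff scaleR_conv_of_real)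

context form_factor
begin

text \<open>Linearity of the integral is available at the configurations where both integrals
  converge; elsewhere the default value 0 may break it.\<close>

lemma annih_linear_AE:
  assumes "\<Psi> \<in> domH P" "\<Phi> \<in> domH P"
  shows "AE w in fmeas P. flat (annih V (\<Psi> + c *\<^sub>R \<Phi>) - (annih V \<Psi> + c *\<^sub>R annih V \<Phi>)) w = 0"
  using AE_annih_integrable[OF assms(1)] AE_annih_integrable[OF assms(2)]
proof eventually_elim
  fix w :: "(nat \<times> (nat \<Rightarrow> 3) \<times> (nat \<Rightarrow> bool)) \<times> (nat \<Rightarrow> real^3)"
  obtain n js s ks where w: "w = ((n, js, s), ks)" by (metis prod.exhaust)
  assume "flat (\<lambda>n ks js s. \<forall>j. integrable lborel (\<lambda>k. cnj (V k j) * ann_field \<Psi> n (k, ks) j js s)) w"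
    "flat (\<lambda>n ks js s. \<forall>j. integrable lborel (\<lambda>k. cnj (V k j) * ann_field \<Phi> n (k, ks) j js s)) w"
  then have i: "integrable lborel (\<lambda>k. \<Sum>j\<in>UNIV. cnj (V k j) * ann_field \<Psi> n (k, ks) j js s)"
    "integrable lborel (\<lambda>k. c *\<^sub>R (\<Sum>j\<in>UNIV. cnj (V k j) * ann_field \<Phi> n (k, ks) j js s))"
    unfolding w by (auto intro!: Bochner_Integration.integrable_sum integrable_scaleR_right)
  have "annih V (\<Psi> + c *\<^sub>R \<Phi>) n ks js s
    = (\<integral> k. (\<Sum>j\<in>UNIV. cnj (V k j) * ann_field \<Psi> n (k, ks) j js s) + c *\<^sub>R (\<Sum>j\<in>UNIV. cnj (V k j) * ann_field \<Phi> n (k, ks) j js s) \<partial>lborel)"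
    unfolding annih_ann_field
    by (rule arg_cong[where f = "integral\<^sup>L lborel"])
       (simp add: fun_eq_iff ann_field_def distrib_left sum.distrib scaleR_sum_right)
  also have "\<dots> = annih V \<Psi> n ks js s + c *\<^sub>R annih V \<Phi> n ks js s"
    unfolding annih_ann_field by (subst Bochner_Integration.integral_add[OF i]) simp
  finally show "flat (annih V (\<Psi> + c *\<^sub>R \<Phi>) - (annih V \<Psi> + c *\<^sub>R annih V \<Phi>)) w = 0"
    by (simp add: w)
qed

lemma domH_linear: "\<Psi> \<in> domH P \<Longrightarrow> \<Phi> \<in> domH P \<Longrightarrow> \<Psi> + c *\<^sub>R \<Phi> \<in> domH P"
  by (intro subspace_add[OF subspace_domH] subspace_scale[OF subspace_domH])

lemma segal_Htot: "\<Psi> \<in> domH P \<Longrightarrow> segal V \<Psi> \<in> Htot P"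
  unfolding segal_eq by (intro Fock.V_closed create_Htot annih_Htot)

lemma segal_linear_null:
  assumes "\<Psi> \<in> domH P" "\<Phi> \<in> domH P"
  shows "Fock.nm P (segal V (\<Psi> + c *\<^sub>R \<Phi>) - (segal V \<Psi> + c *\<^sub>R segal V \<Phi>)) = 0"
proof -
  let ?d = "annih V (\<Psi> + c *\<^sub>R \<Phi>) - (annih V \<Psi> + c *\<^sub>R annih V \<Phi>)"
  have eq: "segal V (\<Psi> + c *\<^sub>R \<Phi>) - (segal V \<Psi> + c *\<^sub>R segal V \<Phi>) = (1 / sqrt 2) *\<^sub>R ?d"
    unfolding segal_eq create_linear by (simp add: algebra_simps)
  have "?d \<in> Htot P" by (intro Fock.V_closed annih_Htot assms domH_linear)
  moreover have "Fock.nm P ?d = 0" by (rule nm_zero_of_AE[OF annih_linear_AE[OF assms]])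
  ultimately show ?thesis unfolding eq by (simp add: Fock.nm_scale)
qed

lemma fock_inner_hph_add_sq:
  assumes \<Psi>: "\<Psi> \<in> domH P"
  shows "(Fock.nm P (hph \<Psi> - r *\<^sub>R \<Psi>))\<^sup>2
     = fock_inner P (hph \<Psi>) (hph \<Psi>) - 2 * r * fock_inner P \<Psi> (hph \<Psi>) + r\<^sup>2 * fock_inner P \<Psi> \<Psi>"
proof -
  note V = domH_Htot[OF \<Psi>] hph_Htot[OF \<Psi>]
  have "hph \<Psi> - r *\<^sub>R \<Psi> \<in> Htot P" using V by simp
  then show ?thesis using V
    by (simp add: Fock.nm_sq Fock.ip_diff Fock.ip_diff2 Fock.ip_scale Fock.ip_scale2
        Fock.ip_sym[of "hph \<Psi>" P \<Psi>] power2_eq_square[of r] algebra_simps)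
qed

text \<open>For \<open>r \<le> -1\<close> the squared norm of
  \<open>hph \<Psi> - r *\<^sub>R \<Psi>\<close> dominates both the squared norm and the energy of
  \<open>\<Psi>\<close>, so the constant does not depend on \<open>r\<close>. The 2 adds creation
  and annihilation; the factor 1 / sqrt 2 is estimated by 1.\<close>

lemma nm_segal_le:
  assumes \<Psi>: "\<Psi> \<in> domH P" and r: "r \<le> -1"
  shows "Fock.nm P (segal V \<Psi>) \<le> 2 * sqrt (3 * (c0 + c1)) * Fock.nm P (hph \<Psi> - r *\<^sub>R \<Psi>)"
proof -
  note V = domH_Htot[OF \<Psi>] hph_Htot[OF \<Psi>] create_Htot[OF \<Psi>] annih_Htot[OF \<Psi>]
  let ?R = "Fock.nm P (hph \<Psi> - r *\<^sub>R \<Psi>)" and ?N = "fock_inner P \<Psi> \<Psi>" and ?E = "fock_inner P \<Psi> (hph \<Psi>)"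
  have S0: "3 * (c0 + c1) \<ge> 0" using c_nonneg by simp
  have R0: "?R \<ge> 0" using V by simp
  have E0: "?E \<ge> 0" and N0: "?N \<ge> 0" and H0: "fock_inner P (hph \<Psi>) (hph \<Psi>) \<ge> 0"
    using fock_inner_hph[OF \<Psi>] Fock.ip_nonneg V by auto
  have rr: "r * ?E \<le> -1 * ?E" by (rule mult_right_mono[OF r E0])
  have r2: "1 * ?N \<le> r\<^sup>2 * ?N"
    using r power_mono[of 1 "- r" 2] by (intro mult_right_mono N0) simp
  have RN: "?N \<le> ?R\<^sup>2" "?E \<le> ?R\<^sup>2"
    unfolding fock_inner_hph_add_sq[OF \<Psi>] using E0 H0 rr r2 N0 by linarith+
  have "fock_inner P (create V \<Psi>) (create V \<Psi>) \<le> 3 * (c0 * ?N + c1 * ?E)" by (rule create_bound(2)[OF \<Psi>])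
  also have "\<dots> \<le> 3 * (c0 * ?R\<^sup>2 + c1 * ?R\<^sup>2)"
    using RN c_nonneg by (intro mult_left_mono add_mono) auto
  also have "\<dots> = 3 * (c0 + c1) * ?R\<^sup>2" by (simp add: algebra_simps)
  finally have "(Fock.nm P (create V \<Psi>))\<^sup>2 \<le> 3 * (c0 + c1) * ?R\<^sup>2"
    unfolding Fock.nm_sq[OF V(3)] .
  also have "\<dots> = (sqrt (3 * (c0 + c1)) * ?R)\<^sup>2"
    using S0 by (simp only: power_mult_distrib real_sqrt_pow2)
  finally have c: "Fock.nm P (create V \<Psi>) \<le> sqrt (3 * (c0 + c1)) * ?R"
    by (rule power2_le_imp_le) (intro mult_nonneg_nonneg R0 real_sqrt_ge_zero S0)
  have "fock_inner P (annih V \<Psi>) (annih V \<Psi>) \<le> 3 * c1 * ?E" by (rule annih_bound(2)[OF \<Psi>])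
  also have "\<dots> \<le> 3 * (c0 + c1) * ?R\<^sup>2"
    using RN c_nonneg E0 by (intro mult_mono) auto
  also have "\<dots> = (sqrt (3 * (c0 + c1)) * ?R)\<^sup>2"
    using S0 by (simp only: power_mult_distrib real_sqrt_pow2)
  finally have "(Fock.nm P (annih V \<Psi>))\<^sup>2 \<le> (sqrt (3 * (c0 + c1)) * ?R)\<^sup>2"
    unfolding Fock.nm_sq[OF V(4)] .
  then have a: "Fock.nm P (annih V \<Psi>) \<le> sqrt (3 * (c0 + c1)) * ?R"
    by (rule power2_le_imp_le) (intro mult_nonneg_nonneg R0 real_sqrt_ge_zero S0)
  have "Fock.nm P (segal V \<Psi>) = 1 / sqrt 2 * Fock.nm P (create V \<Psi> + annih V \<Psi>)"
    unfolding segal_eq using V by (subst Fock.nm_scale) auto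
  also have "\<dots> \<le> 1 * Fock.nm P (create V \<Psi> + annih V \<Psi>)"
    by (intro mult_right_mono Fock.nm_nonneg Fock.V_closed V) simp
  also have "\<dots> \<le> Fock.nm P (create V \<Psi>) + Fock.nm P (annih V \<Psi>)"
    unfolding mult_1 by (rule Fock.nm_triangle[OF V(3,4)])
  finally show ?thesis using a c by (simp add: algebra_simps)
qed

end

text \<open>A single majorant \<open>g\<close> serves all points and field components, as moving the
  point only changes a phase. \<open>g_int2\<close> is the additional infrared condition under which
  the one-photon part of the trial vector has finite norm.\<close>

locale spin_photon =
  fixes P :: nat and x :: "nat \<Rightarrow> real^3" and \<phi> :: "real \<Rightarrow> complex" and g :: "real^3 \<Rightarrow> real"
  assumes form_factors: "form_factor (Bfield \<phi> (x l) m) g"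
    and g_int2: "integrable lborel (\<lambda>k. (g k)\<^sup>2 / (norm k)\<^sup>2)"
begin

abbreviation "B l m \<equiv> Bfield \<phi> (x l) m"

definition modes :: "(nat \<times> nat) set" where
  "modes = {1..P} \<times> {1..3}"

lemma finite_modes [simp]: "finite modes"
  by (simp add: modes_def)

lemma card_modes: "card modes = 3 * P"
  by (simp add: modes_def)

lemma modesD: "q \<in> modes \<Longrightarrow> fst q \<in> {1..P}" "q \<in> modes \<Longrightarrow> snd q \<in> {1..3}"
  by (auto simp: modes_def)

lemma Hint_modes:
  "Hint P x \<phi> M \<Psi> = (\<Sum>q\<in>modes. M (fst q) *\<^sub>R spin_op (snd q) (fst q) (segal (B (fst q) (snd q)) \<Psi>))"
  by (simp add: Hint_def fun_eq_iff sum_fun_apply modes_def sum.cartesian_product scaleR_conv_of_real case_prod_unfold)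

lemma Hfull_eq: "Hfull P x \<phi> M \<Psi> = hph \<Psi> + Hint P x \<phi> M \<Psi>"
  by (simp add: Hfull_def fun_eq_iff)

lemma term_Htot:
  assumes "\<Psi> \<in> domH P" "q \<in> modes"
  shows "spin_op (snd q) (fst q) (segal (B (fst q) (snd q)) \<Psi>) \<in> Htot P"
  by (intro spin_op_Htot modesD assms form_factor.segal_Htot[OF form_factors])

lemma Hint_Htot: "\<Psi> \<in> domH P \<Longrightarrow> Hint P x \<phi> M \<Psi> \<in> Htot P"
  unfolding Hint_modes by (intro Fock.nm_sum Fock.V_closed term_Htot)

lemma Hfull_Htot: "\<Psi> \<in> domH P \<Longrightarrow> Hfull P x \<phi> M \<Psi> \<in> Htot P"
  unfolding Hfull_eq by (intro Fock.V_closed hph_Htot Hint_Htot)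

lemma nm_sum_null:
  assumes "finite A" "\<And>i. i \<in> A \<Longrightarrow> f i \<in> Htot P" "\<And>i. i \<in> A \<Longrightarrow> Fock.nm P (f i) = 0"
  shows "Fock.nm P (\<Sum>i\<in>A. f i) = 0"
  using Fock.nm_sum[of A f P] assms Fock.nm_nonneg[of "\<Sum>i\<in>A. f i" P] by (intro antisym) auto

lemma Hint_linear_null:
  assumes \<Psi>: "\<Psi> \<in> domH P" and \<Phi>: "\<Phi> \<in> domH P"
  shows "Fock.nm P (Hint P x \<phi> M (\<Psi> + c *\<^sub>R \<Phi>) - (Hint P x \<phi> M \<Psi> + c *\<^sub>R Hint P x \<phi> M \<Phi>)) = 0"
proof -
  let ?d = "\<lambda>q. segal (B (fst q) (snd q)) (\<Psi> + c *\<^sub>R \<Phi>)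
     - (segal (B (fst q) (snd q)) \<Psi> + c *\<^sub>R segal (B (fst q) (snd q)) \<Phi>)"
  have d: "?d q \<in> Htot P" "Fock.nm P (?d q) = 0" for q
    by (intro Fock.V_closed form_factor.segal_Htot[OF form_factors] form_factor.domH_linear[OF form_factors] \<Psi> \<Phi>,
        rule form_factor.segal_linear_null[OF form_factors \<Psi> \<Phi>])
  have eq: "Hint P x \<phi> M (\<Psi> + c *\<^sub>R \<Phi>) - (Hint P x \<phi> M \<Psi> + c *\<^sub>R Hint P x \<phi> M \<Phi>)
     = (\<Sum>q\<in>modes. M (fst q) *\<^sub>R spin_op (snd q) (fst q) (?d q))"
    unfolding Hint_modes spin_op_diff spin_op_linear
    by (simp add: sum_subtractf sum.distrib scaleR_sum_right scaleR_diff_right scaleR_add_right mult.commute)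
  show ?thesis unfolding eq
  proof (rule nm_sum_null)
    fix q assume q: "q \<in> modes"
    have s: "spin_op (snd q) (fst q) (?d q) \<in> Htot P" by (intro spin_op_Htot modesD q d)
    then show "M (fst q) *\<^sub>R spin_op (snd q) (fst q) (?d q) \<in> Htot P" by simp
    have "Fock.nm P (spin_op (snd q) (fst q) (?d q)) = 0"
      using nm_spin_op[OF modesD[OF q] Htot_L2[OF d(1)]] d(2) by simp
    then show "Fock.nm P (M (fst q) *\<^sub>R spin_op (snd q) (fst q) (?d q)) = 0"
      using s by (simp add: Fock.nm_scale)
  qed simp
qed

lemma Hfull_linear_null:
  assumes \<Psi>: "\<Psi> \<in> domH P" and \<Phi>: "\<Phi> \<in> domH P"
  shows "Fock.nm P (Hfull P x \<phi> M (\<Psi> + c *\<^sub>R \<Phi>) - (Hfull P x \<phi> M \<Psi> + c *\<^sub>R Hfull P x \<phi> M \<Phi>)) = 0"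
proof -
  have "hph (\<Psi> + c *\<^sub>R \<Phi>) = hph \<Psi> + c *\<^sub>R hph \<Phi>"
    by (simp add: hph_photon_energy fun_eq_iff distrib_left)
  then have "Hfull P x \<phi> M (\<Psi> + c *\<^sub>R \<Phi>) - (Hfull P x \<phi> M \<Psi> + c *\<^sub>R Hfull P x \<phi> M \<Phi>)
    = Hint P x \<phi> M (\<Psi> + c *\<^sub>R \<Phi>) - (Hint P x \<phi> M \<Psi> + c *\<^sub>R Hint P x \<phi> M \<Phi>)"
    unfolding Hfull_eq by (simp add: scaleR_add_right)
  then show ?thesis using Hint_linear_null[OF assms] by simp
qed

lemma M_le_mnorm: "q \<in> modes \<Longrightarrow> \<bar>M (fst q)\<bar> \<le> mnorm P M"
proof -
  assume "q \<in> modes"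
  then have "(M (fst q))\<^sup>2 \<le> (\<Sum>l=1..P. (M l)\<^sup>2)"
    by (intro member_le_sum[of "fst q" "{1..P}" "\<lambda>l. (M l)\<^sup>2"]) (auto dest: modesD)
  then show ?thesis unfolding mnorm_def using real_sqrt_le_mono by fastforce
qed

text \<open>The bound of \<open>nm_segal_le\<close> for one field times the number of modes; each
  coefficient is estimated by \<open>mnorm\<close>.\<close>

definition Kint :: real where
  "Kint = real (3 * P) * (2 * sqrt (3 * (form_factor.c0 g + form_factor.c1 g)))"

lemma Kint_nonneg: "Kint \<ge> 0"
  using form_factor.c_nonneg[OF form_factors] by (simp add: Kint_def)

lemma nm_Hint_le:
  assumes \<Psi>: "\<Psi> \<in> domH P" and r: "r \<le> -1"
  shows "Fock.nm P (Hint P x \<phi> M \<Psi>) \<le> Kint * mnorm P M * Fock.nm P (hph \<Psi> - r *\<^sub>R \<Psi>)"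
proof -
  let ?K = "2 * sqrt (3 * (form_factor.c0 g + form_factor.c1 g))" and ?R = "Fock.nm P (hph \<Psi> - r *\<^sub>R \<Psi>)"
  have R0: "?R \<ge> 0" using domH_Htot[OF \<Psi>] hph_Htot[OF \<Psi>] by simp
  have K0: "?K \<ge> 0" using form_factor.c_nonneg[OF form_factors] by simp
  have "Fock.nm P (Hint P x \<phi> M \<Psi>)
     \<le> (\<Sum>q\<in>modes. Fock.nm P (M (fst q) *\<^sub>R spin_op (snd q) (fst q) (segal (B (fst q) (snd q)) \<Psi>)))"
    unfolding Hint_modes by (intro Fock.nm_sum Fock.V_closed term_Htot \<Psi>)
  also have "\<dots> \<le> (\<Sum>q\<in>modes. mnorm P M * (?K * ?R))"
  proof (rule sum_mono)
    fix q assume q: "q \<in> modes"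
    have seg: "segal (B (fst q) (snd q)) \<Psi> \<in> Htot P" by (rule form_factor.segal_Htot[OF form_factors \<Psi>])
    have "Fock.nm P (M (fst q) *\<^sub>R spin_op (snd q) (fst q) (segal (B (fst q) (snd q)) \<Psi>))
      = \<bar>M (fst q)\<bar> * Fock.nm P (segal (B (fst q) (snd q)) \<Psi>)"
      by (subst Fock.nm_scale[OF term_Htot[OF \<Psi> q]]) (simp only: nm_spin_op[OF modesD[OF q] Htot_L2[OF seg]])
    also have "\<dots> \<le> mnorm P M * (?K * ?R)"
      by (intro mult_mono M_le_mnorm q form_factor.nm_segal_le[OF form_factors \<Psi> r]) (use seg in \<open>auto simp: mnorm_def sum_nonneg\<close>)
    finally show "Fock.nm P (M (fst q) *\<^sub>R spin_op (snd q) (fst q) (segal (B (fst q) (snd q)) \<Psi>)) \<le> mnorm P M * (?K * ?R)" .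
  qed
  also have "\<dots> = Kint * mnorm P M * ?R" by (simp add: Kint_def card_modes)
  finally show ?thesis .
qed

text \<open>A step of Kato-Rellich type: at small coupling the interaction is bounded relative to
  the free energy shifted by \<open>r\<close>, with a constant below 1 that is uniform in
  \<open>r \<le> -1\<close>. This is the source of the smallness condition on
  \<open>M\<close>.\<close>

lemma Hfull_surj:
  assumes small: "Kint * mnorm P M < 1" and r: "r \<le> -1" and \<Phi>: "\<Phi> \<in> Htot P"
  shows "\<exists>\<Psi>\<in>domH P. Fock.nm P (Hfull P x \<phi> M \<Psi> - r *\<^sub>R \<Psi> - \<Phi>) = 0"
proof -
  have "\<exists>\<Psi>\<in>domH P. Fock.nm P ((hph \<Psi> - r *\<^sub>R \<Psi>) + Hint P x \<phi> M \<Psi> - \<Phi>) = 0"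
  proof (rule Fock.perturbation_surj[OF subspace_domH])
    show "domH P \<subseteq> Htot P" using domH_Htot by blast
    show "hph \<Psi> - r *\<^sub>R \<Psi> \<in> Htot P" if "\<Psi> \<in> domH P" for \<Psi>
      using that by (intro Fock.V_closed hph_Htot domH_Htot)
    show "Hint P x \<phi> M \<Psi> \<in> Htot P" if "\<Psi> \<in> domH P" for \<Psi> by (rule Hint_Htot[OF that])
    show "Fock.nm P (hph (\<Psi> - \<Phi>) - r *\<^sub>R (\<Psi> - \<Phi>) - (hph \<Psi> - r *\<^sub>R \<Psi> - (hph \<Phi> - r *\<^sub>R \<Phi>))) = 0"
      for \<Psi> \<Phi>
    proof -
      have "hph (\<Psi> - \<Phi>) - r *\<^sub>R (\<Psi> - \<Phi>) - (hph \<Psi> - r *\<^sub>R \<Psi> - (hph \<Phi> - r *\<^sub>R \<Phi>)) = 0"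
        by (simp add: hph_photon_energy fun_eq_iff algebra_simps)
      then show ?thesis by simp
    qed
    show "Fock.nm P (Hint P x \<phi> M (\<Psi> - \<Phi>) - (Hint P x \<phi> M \<Psi> - Hint P x \<phi> M \<Phi>)) = 0"
      if "\<Psi> \<in> domH P" "\<Phi> \<in> domH P" for \<Psi> \<Phi>
      using Hint_linear_null[OF that, of M "-1"] by simp
    show "\<exists>\<Psi>\<in>domH P. Fock.nm P (hph \<Psi> - r *\<^sub>R \<Psi> - \<Phi>) = 0" if "\<Phi> \<in> Htot P" for \<Phi>
      using free_resolvent_surj[OF r that] by (metis Fock.nm_zero diff_self)
    show "Fock.nm P (Hint P x \<phi> M \<Psi>) \<le> Kint * mnorm P M * Fock.nm P (hph \<Psi> - r *\<^sub>R \<Psi>)" if "\<Psi> \<in> domH P" for \<Psi>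
      by (rule nm_Hint_le[OF that r])
    show "0 \<le> Kint * mnorm P M" using Kint_nonneg by (simp add: mnorm_def sum_nonneg)
  qed (use small \<Phi> in auto)
  then show ?thesis unfolding Hfull_eq by (simp add: algebra_simps)
qed

text \<open>The spin operator is carried over to \<open>\<Phi>\<close>, and in the creation part it
  is carried back and commuted past creation. Both parts become \<open>cross\<close>, and the result
  is visibly symmetric in \<open>\<Psi>\<close> and \<open>\<Phi>\<close>.\<close>

lemma term_form:
  assumes q: "q \<in> modes" and \<Psi>: "\<Psi> \<in> domH P" and \<Phi>: "\<Phi> \<in> domH P"
  shows "fock_inner P (spin_op (snd q) (fst q) (segal (B (fst q) (snd q)) \<Psi>)) \<Phi>
    = 1 / sqrt 2 * (form_factor.cross (B (fst q) (snd q)) P (spin_op (snd q) (fst q) \<Psi>) \<Phi>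
       + form_factor.cross (B (fst q) (snd q)) P (spin_op (snd q) (fst q) \<Phi>) \<Psi>)"
proof -
  let ?B = "B (fst q) (snd q)" and ?\<sigma> = "spin_op (snd q) (fst q)"
  note s\<Psi> = spin_op_domH[OF modesD[OF q] \<Psi>] and s\<Phi> = spin_op_domH[OF modesD[OF q] \<Phi>]
  note c = form_factor.create_Htot[OF form_factors \<Psi>, of "fst q" "snd q"] and a = form_factor.annih_Htot[OF form_factors \<Psi>, of "fst q" "snd q"]
  have L: "flat (segal ?B \<Psi>) \<in> L2 (fmeas P)" by (rule Htot_L2[OF form_factor.segal_Htot[OF form_factors \<Psi>]])
  have "fock_inner P (?\<sigma> (segal ?B \<Psi>)) \<Phi> = fock_inner P (segal ?B \<Psi>) (?\<sigma> \<Phi>)"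
    by (rule fock_inner_spin_op[OF modesD[OF q] L Htot_L2[OF domH_Htot[OF \<Phi>]]])
  also have "\<dots> = 1 / sqrt 2 * (fock_inner P (create ?B \<Psi>) (?\<sigma> \<Phi>) + fock_inner P (annih ?B \<Psi>) (?\<sigma> \<Phi>))"
    unfolding segal_eq using c a domH_Htot[OF s\<Phi>] by (simp only: Fock.ip_scale Fock.ip_add Fock.V_closed)
  also have "fock_inner P (create ?B \<Psi>) (?\<sigma> \<Phi>) = fock_inner P (?\<sigma> (create ?B \<Psi>)) \<Phi>"
    by (rule fock_inner_spin_op[OF modesD[OF q] Htot_L2[OF c] Htot_L2[OF domH_Htot[OF \<Phi>]], symmetric])
  also have "\<dots> = fock_inner P (create ?B (?\<sigma> \<Psi>)) \<Phi>"
    by (simp only: create_spin_op[OF modesD[OF q]])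
  also have "\<dots> = form_factor.cross ?B P (?\<sigma> \<Psi>) \<Phi>"
    by (rule form_factor.create_cross[OF form_factors s\<Psi> \<Phi>])
  also have "fock_inner P (annih ?B \<Psi>) (?\<sigma> \<Phi>) = form_factor.cross ?B P (?\<sigma> \<Phi>) \<Psi>"
    using form_factor.annih_cross[OF form_factors domH_Htot[OF s\<Phi>] \<Psi>] Fock.ip_sym[OF a domH_Htot[OF s\<Phi>]] by simp
  finally show ?thesis .
qed

lemma fock_inner_sum_left:
  assumes "\<And>i. i \<in> A \<Longrightarrow> f i \<in> Htot P" "\<Phi> \<in> Htot P"
  shows "fock_inner P (\<Sum>i\<in>A. f i) \<Phi> = (\<Sum>i\<in>A. fock_inner P (f i) \<Phi>)"
  using assms(1)
proof (induction A rule: infinite_finite_induct)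
  case (insert i A)
  then have "fock_inner P (f i + sum f A) \<Phi> = fock_inner P (f i) \<Phi> + fock_inner P (sum f A) \<Phi>"
    by (intro Fock.ip_add Fock.nm_sum(1) assms(2)) auto
  then show ?case using insert by (simp only: sum.insert insert_iff simp_thms)
qed (use assms(2) Fock.ip_scale[of 0 P \<Phi> 0] in simp_all)

lemma Hint_form:
  assumes \<Psi>: "\<Psi> \<in> domH P" and \<Phi>: "\<Phi> \<in> domH P"
  shows "fock_inner P (Hint P x \<phi> M \<Psi>) \<Phi> = (\<Sum>q\<in>modes. M (fst q) / sqrt 2 *
     (form_factor.cross (B (fst q) (snd q)) P (spin_op (snd q) (fst q) \<Psi>) \<Phi>
       + form_factor.cross (B (fst q) (snd q)) P (spin_op (snd q) (fst q) \<Phi>) \<Psi>))"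
  unfolding Hint_modes
  using term_Htot[OF \<Psi>] domH_Htot[OF \<Phi>] term_form[OF _ \<Psi> \<Phi>]
  by (subst fock_inner_sum_left) (auto simp: Fock.ip_scale intro!: sum.cong)

text \<open>The free part is multiplication by a real function, and \<open>Hint_form\<close> does
  not change when its two arguments are exchanged.\<close>

lemma Hfull_symmetric:
  assumes \<Psi>: "\<Psi> \<in> domH P" and \<Phi>: "\<Phi> \<in> domH P"
  shows "fock_inner P (Hfull P x \<phi> M \<Psi>) \<Phi> = fock_inner P \<Psi> (Hfull P x \<phi> M \<Phi>)"
proof -
  note V = domH_Htot[OF \<Psi>] domH_Htot[OF \<Phi>] hph_Htot[OF \<Psi>] hph_Htot[OF \<Phi>] Hint_Htot[OF \<Psi>, of M] Hint_Htot[OF \<Phi>, of M]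
  have "fock_inner P (hph \<Psi>) \<Phi> = fock_inner P \<Psi> (hph \<Phi>)"
    unfolding fock_inner_def l2ip_def
  proof (rule Bochner_Integration.integral_cong[OF refl])
    fix w :: "(nat \<times> (nat \<Rightarrow> 3) \<times> (nat \<Rightarrow> bool)) \<times> (nat \<Rightarrow> real^3)"
    show "flat (hph \<Psi>) w \<bullet> flat \<Phi> w = flat \<Psi> w \<bullet> flat (hph \<Phi>) w"
      by (cases w) (auto simp: hph_photon_energy inner_cnj)
  qed
  moreover have "fock_inner P (Hint P x \<phi> M \<Psi>) \<Phi> = fock_inner P (Hint P x \<phi> M \<Phi>) \<Psi>"
    unfolding Hint_form[OF \<Psi> \<Phi>] Hint_form[OF \<Phi> \<Psi>] by (simp add: add.commute)
  then have "fock_inner P (Hint P x \<phi> M \<Psi>) \<Phi> = fock_inner P \<Psi> (Hint P x \<phi> M \<Phi>)"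
    using Fock.ip_sym V by metis
  ultimately show ?thesis unfolding Hfull_eq using V by (simp add: Fock.ip_add Fock.ip_add2)
qed

end

section \<open>The effective spin Hamiltonian\<close>

lemma spin_act_sym:
  assumes "l \<in> {1..P}" "m \<in> {1..3}"
  shows "(\<Sum>s\<in>spins P. spin_act m l Y s \<bullet> X s) = (\<Sum>s\<in>spins P. Y s \<bullet> spin_act m l X s)"
proof -
  have "(\<Sum>s\<in>spins P. Y s \<bullet> spin_act m l X s) = (\<Sum>s\<in>spins P. Y (spin_flip m l s) \<bullet> spin_act m l X (spin_flip m l s))"
    by (rule sum.reindex_bij_witness[where i = "spin_flip m l" and j = "spin_flip m l"])
       (auto simp: spin_flip_mem[OF assms(1)])
  also have "\<dots> = (\<Sum>s\<in>spins P. spin_act m l Y s \<bullet> X s)"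
  proof (rule sum.cong[OF refl])
    fix s
    have "spin_act m l Y s \<bullet> X s = Y (spin_flip m l s) \<bullet> (cnj (spin_phase m (s l)) * X s)"
      by (simp add: spin_act_flip[OF assms(2)] inner_cnj)
    also have "cnj (spin_phase m (s l)) = spin_phase m (spin_flip m l s l)"
      using cnj_spin_phase[OF assms(2), of l "spin_flip m l s"] by simp
    finally show "Y (spin_flip m l s) \<bullet> spin_act m l X (spin_flip m l s) = spin_act m l Y s \<bullet> X s"
      by (simp add: spin_act_flip[OF assms(2)])
  qed
  finally show ?thesis by simp
qed

lemma sum_flip:
  assumes "l \<in> {1..P}"
  shows "(\<Sum>s\<in>spins P. f (spin_flip m l s)) = (\<Sum>s\<in>spins P. f s)"
  by (rule sum.reindex_bij_witness[where i = "spin_flip m l" and j = "spin_flip m l"])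
     (auto simp: spin_flip_mem[OF assms])

context spin_photon
begin

text \<open>Component \<open>j\<close> of the spin matrix V(k) applied to the spin vector
  \<open>X\<close>, with the 1 / sqrt 2 of the Segal field included.\<close>

definition coupling :: "(nat \<Rightarrow> real) \<Rightarrow> real^3 \<Rightarrow> 3 \<Rightarrow> ((nat \<Rightarrow> bool) \<Rightarrow> complex) \<Rightarrow> (nat \<Rightarrow> bool) \<Rightarrow> complex" where
  "coupling M k j X s = (\<Sum>q\<in>modes. complex_of_real (M (fst q) / sqrt 2) *
     (B (fst q) (snd q) k j * spin_act (snd q) (fst q) X s))"

lemma g_nonneg: "g k \<ge> 0" and g_zero: "g 0 = 0" and g_measurable: "g \<in> borel_measurable borel"
  and g_int0: "integrable lborel (\<lambda>k. (g k)\<^sup>2)" and g_int1: "integrable lborel (\<lambda>k. (g k)\<^sup>2 / norm k)"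
  using form_factor.g_nonneg[OF form_factors] form_factor.g_zero[OF form_factors] form_factor.measurable_g[OF form_factors]
    form_factor.g_int0[OF form_factors] form_factor.g_int1[OF form_factors] by auto

lemma B_le: "cmod (B l m k j) \<le> g k"
  by (rule form_factor.V_le[OF form_factors])

lemma B_measurable: "(\<lambda>k. B l m k j) \<in> borel_measurable borel"
  by (rule form_factor.measurable_V[OF form_factors])

lemma mnorm_nonneg: "mnorm P M \<ge> 0"
  by (simp add: mnorm_def sum_nonneg)

lemma coupling_bound:
  "(cmod (coupling M k j X s))\<^sup>2 \<le> (mnorm P M)\<^sup>2 * (g k)\<^sup>2 * (real (3 * P) * (\<Sum>q\<in>modes. (cmod (spin_act (snd q) (fst q) X s))\<^sup>2))"
proof -
  let ?y = "\<lambda>q. cmod (spin_act (snd q) (fst q) X s)"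
  have "cmod (coupling M k j X s) \<le> (\<Sum>q\<in>modes. mnorm P M * (g k * ?y q))"
    unfolding coupling_def
  proof (rule order.trans[OF norm_sum], rule sum_mono)
    fix q assume q: "q \<in> modes"
    have "\<bar>M (fst q)\<bar> / sqrt 2 \<le> \<bar>M (fst q)\<bar> / 1" by (intro divide_left_mono) auto
    also have "\<dots> \<le> mnorm P M" using M_le_mnorm[OF q] by simp
    finally have "\<bar>M (fst q) / sqrt 2\<bar> \<le> mnorm P M" by simp
    then have "\<bar>M (fst q) / sqrt 2\<bar> * (cmod (B (fst q) (snd q) k j) * ?y q) \<le> mnorm P M * (g k * ?y q)"
      by (intro mult_mono mult_nonneg_nonneg B_le mnorm_nonneg) (auto simp: g_nonneg)
    then show "cmod (complex_of_real (M (fst q) / sqrt 2) * (B (fst q) (snd q) k j * spin_act (snd q) (fst q) X s)) \<le> mnorm P M * (g k * ?y q)"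
      unfolding norm_mult norm_of_real .
  qed
  also have "\<dots> = mnorm P M * g k * (\<Sum>q\<in>modes. ?y q)" by (simp add: sum_distrib_left mult.assoc)
  finally have "(cmod (coupling M k j X s))\<^sup>2 \<le> (mnorm P M * g k * (\<Sum>q\<in>modes. ?y q))\<^sup>2"
    by (rule power_mono) simp
  also have "\<dots> = (mnorm P M)\<^sup>2 * (g k)\<^sup>2 * (\<Sum>q\<in>modes. ?y q)\<^sup>2" by (simp add: power_mult_distrib)
  also have "\<dots> \<le> (mnorm P M)\<^sup>2 * (g k)\<^sup>2 * (real (3 * P) * (\<Sum>q\<in>modes. (?y q)\<^sup>2))"
    using Cauchy_Schwarz_ineq_sum[of ?y "\<lambda>_. 1" modes]
    by (intro mult_left_mono) (simp_all add: card_modes mult.commute)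
  finally show ?thesis .
qed

text \<open>\<open>coupling_bound\<close> has one factor \<open>3 * P\<close> from Cauchy-Schwarz
  over the modes. Summation over spins, where each Pauli matrix preserves the norm, turns the
  remaining sum over modes into a second one.\<close>

lemma coupling_sum_bound:
  "(\<Sum>s\<in>spins P. (cmod (coupling M k j X s))\<^sup>2) \<le> (real (3 * P))\<^sup>2 * (mnorm P M)\<^sup>2 * (g k)\<^sup>2 * (\<Sum>s\<in>spins P. (cmod (X s))\<^sup>2)"
proof -
  let ?c = "(mnorm P M)\<^sup>2 * (g k)\<^sup>2 * real (3 * P)"
  have "(\<Sum>s\<in>spins P. (cmod (coupling M k j X s))\<^sup>2) \<le> (\<Sum>s\<in>spins P. ?c * (\<Sum>q\<in>modes. (cmod (spin_act (snd q) (fst q) X s))\<^sup>2))"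
    by (rule sum_mono) (use coupling_bound in \<open>simp add: mult.assoc\<close>)
  also have "\<dots> = ?c * (\<Sum>q\<in>modes. \<Sum>s\<in>spins P. (cmod (spin_act (snd q) (fst q) X s))\<^sup>2)"
    unfolding sum_distrib_left[symmetric] by (subst sum.swap) simp
  also have "(\<Sum>q\<in>modes. \<Sum>s\<in>spins P. (cmod (spin_act (snd q) (fst q) X s))\<^sup>2) = (\<Sum>q\<in>modes. \<Sum>s\<in>spins P. (cmod (X s))\<^sup>2)"
  proof (rule sum.cong[OF refl])
    fix q assume q: "q \<in> modes"
    have "(\<Sum>s\<in>spins P. (cmod (spin_act (snd q) (fst q) X s))\<^sup>2) = (\<Sum>s\<in>spins P. (cmod (X (spin_flip (snd q) (fst q) s)))\<^sup>2)"
      by (simp add: spin_act_flip[OF modesD(2)[OF q]] norm_mult cmod_spin_phase[OF modesD(2)[OF q]])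
    then show "(\<Sum>s\<in>spins P. (cmod (spin_act (snd q) (fst q) X s))\<^sup>2) = (\<Sum>s\<in>spins P. (cmod (X s))\<^sup>2)"
      using sum_flip[OF modesD(1)[OF q], of "\<lambda>s. (cmod (X s))\<^sup>2" "snd q"] by simp
  qed
  finally show ?thesis by (simp add: card_modes power2_eq_square mult_ac)
qed

lemma coupling_zero: "coupling M 0 j X s = 0"
proof -
  have "B l m 0 j = 0" for l m using B_le[of l m 0 j] g_zero by simp
  then show ?thesis by (simp add: coupling_def)
qed

lemma coupling_measurable: "(\<lambda>k. coupling M k j X s) \<in> borel_measurable borel"
  unfolding coupling_def by (intro borel_measurable_sum borel_measurable_times B_measurable borel_measurable_const)

lemma coupling_integrable: "integrable lborel (\<lambda>k. (cmod (coupling M k j X s))\<^sup>2 / norm k)"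
proof -
  let ?c = "(mnorm P M)\<^sup>2 * (real (3 * P) * (\<Sum>q\<in>modes. (cmod (spin_act (snd q) (fst q) X s))\<^sup>2))"
  show ?thesis
  proof (rule Bochner_Integration.integrable_bound)
    show "integrable lborel (\<lambda>k. ?c * ((g k)\<^sup>2 / norm k))" by (intro integrable_mult_right g_int1)
    show "(\<lambda>k. (cmod (coupling M k j X s))\<^sup>2 / norm k) \<in> borel_measurable lborel"
      using coupling_measurable[of M j X s] by simp
    have "(cmod (coupling M k j X s))\<^sup>2 / norm k \<le> ?c * ((g k)\<^sup>2 / norm k)" for k
      using divide_right_mono[OF coupling_bound[of M k j X s], of "norm k"] by (simp add: mult_ac)
    moreover have "?c * ((g k)\<^sup>2 / norm k) \<ge> 0" for k by (intro mult_nonneg_nonneg sum_nonneg) auto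
    ultimately show "AE k in lborel. norm ((cmod (coupling M k j X s))\<^sup>2 / norm k) \<le> norm (?c * ((g k)\<^sup>2 / norm k))"
      by (intro AE_I2) (simp only: real_norm_def abs_of_nonneg zero_le_power2 norm_ge_zero zero_le_divide_iff simp_thms)
  qed
qed

lemma coupling_inner_integrable: "integrable lborel (\<lambda>k. (coupling M k j Y s \<bullet> coupling M k j X s) / norm k)"
proof (rule Bochner_Integration.integrable_bound)
  show "integrable lborel (\<lambda>k. (cmod (coupling M k j Y s))\<^sup>2 / norm k + (cmod (coupling M k j X s))\<^sup>2 / norm k)"
    by (intro Bochner_Integration.integrable_add coupling_integrable)
  show "(\<lambda>k. (coupling M k j Y s \<bullet> coupling M k j X s) / norm k) \<in> borel_measurable lborel"
    using coupling_measurable[of M j X s] coupling_measurable[of M j Y s] by simp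
  show "AE k in lborel. norm ((coupling M k j Y s \<bullet> coupling M k j X s) / norm k)
     \<le> norm ((cmod (coupling M k j Y s))\<^sup>2 / norm k + (cmod (coupling M k j X s))\<^sup>2 / norm k)"
  proof (rule AE_I2)
    fix k
    have "\<bar>coupling M k j Y s \<bullet> coupling M k j X s\<bar> \<le> (cmod (coupling M k j Y s))\<^sup>2 + (cmod (coupling M k j X s))\<^sup>2"
      by (rule order.trans[OF inner_le_half_squares]) simp
    from divide_right_mono[OF this norm_ge_zero[of k]]
    show "norm ((coupling M k j Y s \<bullet> coupling M k j X s) / norm k)
     \<le> norm ((cmod (coupling M k j Y s))\<^sup>2 / norm k + (cmod (coupling M k j X s))\<^sup>2 / norm k)"
      by (simp add: add_divide_distrib)
  qed
qed

text \<open>The real form of the integral of V(k)* V(k) / |k|; \<open>A_op_form\<close> identifies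
  it with that of minus \<open>A_op\<close>.\<close>

definition second_order_form :: "(nat \<Rightarrow> real) \<Rightarrow> ((nat \<Rightarrow> bool) \<Rightarrow> complex) \<Rightarrow> ((nat \<Rightarrow> bool) \<Rightarrow> complex) \<Rightarrow> real" where
  "second_order_form M Y X = (\<Sum>s\<in>spins P. \<integral> k. (\<Sum>j\<in>UNIV. (coupling M k j Y s \<bullet> coupling M k j X s) / norm k) \<partial>lborel)"

lemma second_order_form_sym: "second_order_form M Y X = second_order_form M X Y"
  by (simp add: second_order_form_def inner_commute)

lemma second_order_form_nonneg: "second_order_form M X X \<ge> 0"
  unfolding second_order_form_def by (intro sum_nonneg integral_nonneg_AE AE_I2) (simp add: sum_nonneg)

text \<open>Annihilation in mode \<open>q\<close> of the one-photon state H_ph^(-1) H_int E X,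
  without the Segal factor.\<close>

definition ann_coupling :: "(nat \<Rightarrow> real) \<Rightarrow> nat \<times> nat \<Rightarrow> ((nat \<Rightarrow> bool) \<Rightarrow> complex) \<Rightarrow> (nat \<Rightarrow> bool) \<Rightarrow> complex" where
  "ann_coupling M q X s = (\<integral> k. (\<Sum>j\<in>UNIV. cnj (B (fst q) (snd q) k j) * (complex_of_real (inverse (norm k)) * coupling M k j X s)) \<partial>lborel)"

lemma ann_coupling_integrable:
  "integrable lborel (\<lambda>k. cnj (B l m k j) * (complex_of_real (inverse (norm k)) * coupling M k j X s))"
proof (rule Bochner_Integration.integrable_bound)
  show "integrable lborel (\<lambda>k. (g k)\<^sup>2 / norm k + (cmod (coupling M k j X s))\<^sup>2 / norm k)"
    by (intro Bochner_Integration.integrable_add coupling_integrable g_int1)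
  have m: "(\<lambda>k. complex_of_real (inverse (norm k))) \<in> borel_measurable lborel" by measurable
  show "(\<lambda>k. cnj (B l m k j) * (complex_of_real (inverse (norm k)) * coupling M k j X s)) \<in> borel_measurable lborel"
    by (intro borel_measurable_times measurable_cnj m) (use B_measurable coupling_measurable in simp_all)
  show "AE k in lborel. norm (cnj (B l m k j) * (complex_of_real (inverse (norm k)) * coupling M k j X s))
     \<le> norm ((g k)\<^sup>2 / norm k + (cmod (coupling M k j X s))\<^sup>2 / norm k)"
  proof (rule AE_I2)
    fix k
    have "cmod (B l m k j) * cmod (coupling M k j X s) \<le> g k * cmod (coupling M k j X s)"
      by (intro mult_right_mono B_le) simp
    also have "\<dots> \<le> (g k)\<^sup>2 + (cmod (coupling M k j X s))\<^sup>2"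
      using sum_squares_bound[of "g k" "cmod (coupling M k j X s)"] zero_le_power2[of "g k"]
        zero_le_power2[of "cmod (coupling M k j X s)"] by linarith
    finally have "cmod (B l m k j) * cmod (coupling M k j X s) / norm k \<le> ((g k)\<^sup>2 + (cmod (coupling M k j X s))\<^sup>2) / norm k"
      by (rule divide_right_mono) simp
    then show "norm (cnj (B l m k j) * (complex_of_real (inverse (norm k)) * coupling M k j X s))
     \<le> norm ((g k)\<^sup>2 / norm k + (cmod (coupling M k j X s))\<^sup>2 / norm k)"
      by (simp add: norm_mult norm_inverse divide_inverse mult_ac distrib_left)
  qed
qed

lemma Hint_apply:
  "Hint P x \<phi> M \<Psi> n ks js s = (\<Sum>q\<in>modes. complex_of_real (M (fst q)) *
     spin_act (snd q) (fst q) (\<lambda>s'. (create (B (fst q) (snd q)) \<Psi> n ks js s' + annih (B (fst q) (snd q)) \<Psi> n ks js s') / complex_of_real (sqrt 2)) s)"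
  unfolding Hint_modes sum_fun_apply scaleR_fun_apply spin_op_act segal_def scaleR_conv_of_real by simp

lemma spin_act_divide: "spin_act m l (\<lambda>s. X s / c) s = spin_act m l X s / c"
  by (simp add: spin_act_def sum_divide_distrib)

lemma spin_act_mult: "spin_act m l (\<lambda>s. c * X s) s = c * spin_act m l X s"
  by (simp add: spin_act_def sum_distrib_left mult.left_commute)

text \<open>The one-photon component receives creation from the vacuum and annihilation from two
  photons, and the hypotheses leave only the former. It serves both \<open>embE\<close> and the
  trial vector.\<close>

lemma Hint_one_photon:
  assumes \<Psi>0: "\<And>ks js. \<Psi> 0 ks js = X" and \<Psi>2: "\<And>ks js s. \<Psi> (Suc (Suc 0)) ks js s = 0"
  shows "Hint P x \<phi> M \<Psi> (Suc 0) ks js s = coupling M (ks 0) (js 0) X s"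
proof -
  have c: "create (B l m) \<Psi> (Suc 0) ks js s' = B l m (ks 0) (js 0) * X s'" for l m s'
    by (simp add: create_def \<Psi>0)
  have a: "annih (B l m) \<Psi> (Suc 0) ks js s' = 0" for l m s'
    by (simp add: annih_def \<Psi>2)
  show ?thesis
    unfolding Hint_apply coupling_def c a by (simp add: spin_act_divide spin_act_mult)
qed

lemma Hint_vacuum:
  "Hint P x \<phi> M \<Psi> 0 ks js s = (\<Sum>q\<in>modes. complex_of_real (M (fst q) / sqrt 2) *
     spin_act (snd q) (fst q) (\<lambda>s'. \<integral> k. (\<Sum>j\<in>UNIV. cnj (B (fst q) (snd q) k j) * \<Psi> (Suc 0) (fcons k ks) (fcons j js) s') \<partial>lborel) s)"
  unfolding Hint_apply
  by (intro sum.cong refl) (simp add: create_def annih_def spin_act_divide)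

lemma A_op_eq:
  "A_op P x \<phi> M X s = - (\<Sum>q\<in>modes. complex_of_real (M (fst q) / sqrt 2) * spin_act (snd q) (fst q) (ann_coupling M q X) s)"
proof -
  have "hphinv (Hint P x \<phi> M (embE X)) (Suc 0) ks js s = complex_of_real (inverse (norm (ks 0))) * coupling M (ks 0) (js 0) X s" for ks js s
    unfolding hphinv_def by (subst Hint_one_photon[where X = X]) (auto simp: embE_def)
  then show ?thesis
    unfolding A_op_def Hint_vacuum ann_coupling_def by (simp add: fcons_def)
qed

text \<open>Moving the spin matrices and the conjugated form factors over to \<open>Y\<close>
  assembles a second \<open>coupling\<close>; the weight 1/|k| is what the inverse free energy
  leaves on the one-photon sector.\<close>

lemma A_op_form: "(\<Sum>s\<in>spins P. Y s \<bullet> A_op P x \<phi> M X s) = - second_order_form M Y X"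
proof -
  have "(\<Sum>s\<in>spins P. Y s \<bullet> A_op P x \<phi> M X s)
    = - (\<Sum>q\<in>modes. M (fst q) / sqrt 2 * (\<Sum>s\<in>spins P. Y s \<bullet> spin_act (snd q) (fst q) (ann_coupling M q X) s))"
    unfolding A_op_eq scaleR_conv_of_real[symmetric] inner_minus_right inner_sum_right inner_scaleR_right
    by (simp only: sum_negf sum_distrib_left) (subst sum.swap, rule refl)
  also have "\<dots> = - (\<Sum>q\<in>modes. M (fst q) / sqrt 2 * (\<Sum>s\<in>spins P. spin_act (snd q) (fst q) Y s \<bullet> ann_coupling M q X s))"
    by (simp add: spin_act_sym[OF modesD] cong: sum.cong)
  also have "\<dots> = - (\<Sum>q\<in>modes. M (fst q) / sqrt 2 * (\<Sum>s\<in>spins P. \<integral> k. (\<Sum>j\<in>UNIV. ((B (fst q) (snd q) k j * spin_act (snd q) (fst q) Y s) \<bullet> coupling M k j X s) / norm k) \<partial>lborel))"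
  proof -
    have "spin_act (snd q) (fst q) Y s \<bullet> ann_coupling M q X s
       = (\<integral> k. (\<Sum>j\<in>UNIV. ((B (fst q) (snd q) k j * spin_act (snd q) (fst q) Y s) \<bullet> coupling M k j X s) / norm k) \<partial>lborel)" for q s
    proof -
      have "spin_act (snd q) (fst q) Y s \<bullet> ann_coupling M q X s = (\<integral> k. spin_act (snd q) (fst q) Y s \<bullet>
        (\<Sum>j\<in>UNIV. cnj (B (fst q) (snd q) k j) * (complex_of_real (inverse (norm k)) * coupling M k j X s)) \<partial>lborel)"
        unfolding ann_coupling_def
        by (rule integral_inner_right[symmetric]) (intro Bochner_Integration.integrable_sum ann_coupling_integrable)
      also have "\<dots> = (\<integral> k. (\<Sum>j\<in>UNIV. ((B (fst q) (snd q) k j * spin_act (snd q) (fst q) Y s) \<bullet> coupling M k j X s) / norm k) \<partial>lborel)"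
      proof (intro Bochner_Integration.integral_cong refl)
        fix k :: "real^3"
        have "spin_act (snd q) (fst q) Y s \<bullet> (cnj (B (fst q) (snd q) k j) * (complex_of_real (inverse (norm k)) * coupling M k j X s))
          = ((B (fst q) (snd q) k j * spin_act (snd q) (fst q) Y s) \<bullet> coupling M k j X s) / norm k" for j
          unfolding inner_cnj scaleR_conv_of_real[symmetric] mult_scaleR_right inner_scaleR_right by (simp add: divide_inverse)
        then show "spin_act (snd q) (fst q) Y s \<bullet> (\<Sum>j\<in>UNIV. cnj (B (fst q) (snd q) k j) * (complex_of_real (inverse (norm k)) * coupling M k j X s))
          = (\<Sum>j\<in>UNIV. ((B (fst q) (snd q) k j * spin_act (snd q) (fst q) Y s) \<bullet> coupling M k j X s) / norm k)"
          unfolding inner_sum_right by simp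
      qed
      finally show ?thesis .
    qed
    then show ?thesis by simp
  qed
  also have "\<dots> = - (\<Sum>s\<in>spins P. \<Sum>q\<in>modes. \<integral> k. M (fst q) / sqrt 2 * (\<Sum>j\<in>UNIV. ((B (fst q) (snd q) k j * spin_act (snd q) (fst q) Y s) \<bullet> coupling M k j X s) / norm k) \<partial>lborel)"
  proof -
    have "(\<Sum>q\<in>modes. c q * (\<Sum>s\<in>spins P. \<integral> k. G q s k \<partial>lborel)) = (\<Sum>s\<in>spins P. \<Sum>q\<in>modes. \<integral> k. c q * G q s k \<partial>lborel)"
      for c :: "nat \<times> nat \<Rightarrow> real" and G :: "nat \<times> nat \<Rightarrow> (nat \<Rightarrow> bool) \<Rightarrow> real^3 \<Rightarrow> real"
      unfolding sum_distrib_left by (subst sum.swap) simp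
    then show ?thesis by (simp only:)
  qed
  also have "\<dots> = - second_order_form M Y X"
    unfolding second_order_form_def
  proof (intro arg_cong[where f = uminus] sum.cong refl)
    fix s
    have int: "integrable lborel (\<lambda>k. ((B l m k j * y) \<bullet> coupling M k j X s) / norm k)" for l m j y
    proof -
      have "((B l m k j * y) \<bullet> coupling M k j X s) / norm k
         = y \<bullet> (cnj (B l m k j) * (complex_of_real (inverse (norm k)) * coupling M k j X s))" for k
        unfolding inner_cnj scaleR_conv_of_real[symmetric] mult_scaleR_right inner_scaleR_right by (simp add: divide_inverse)
      then show ?thesis by (simp only:) (intro integrable_inner_right ann_coupling_integrable)
    qed
    have "(\<Sum>q\<in>modes. \<integral> k. M (fst q) / sqrt 2 * (\<Sum>j\<in>UNIV. ((B (fst q) (snd q) k j * spin_act (snd q) (fst q) Y s) \<bullet> coupling M k j X s) / norm k) \<partial>lborel)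
      = (\<integral> k. (\<Sum>q\<in>modes. M (fst q) / sqrt 2 * (\<Sum>j\<in>UNIV. ((B (fst q) (snd q) k j * spin_act (snd q) (fst q) Y s) \<bullet> coupling M k j X s) / norm k)) \<partial>lborel)"
      by (rule Bochner_Integration.integral_sum[symmetric])
         (intro integrable_mult_right Bochner_Integration.integrable_sum int)
    also have "\<dots> = (\<integral> k. (\<Sum>j\<in>UNIV. (coupling M k j Y s \<bullet> coupling M k j X s) / norm k) \<partial>lborel)"
    proof (intro Bochner_Integration.integral_cong refl)
      fix k :: "real^3"
      have "coupling M k j Y s \<bullet> coupling M k j X s / norm k
         = (\<Sum>q\<in>modes. M (fst q) / sqrt 2 * (((B (fst q) (snd q) k j * spin_act (snd q) (fst q) Y s) \<bullet> coupling M k j X s) / norm k))" for j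
        unfolding coupling_def[of M k j Y] scaleR_conv_of_real[symmetric] inner_sum_left inner_scaleR_left
        by (simp add: sum_divide_distrib)
      then show "(\<Sum>q\<in>modes. M (fst q) / sqrt 2 * (\<Sum>j\<in>UNIV. ((B (fst q) (snd q) k j * spin_act (snd q) (fst q) Y s) \<bullet> coupling M k j X s) / norm k))
        = (\<Sum>j\<in>UNIV. (coupling M k j Y s \<bullet> coupling M k j X s) / norm k)"
        unfolding sum_distrib_left by (subst sum.swap) simp
    qed
    finally show "(\<Sum>q\<in>modes. \<integral> k. M (fst q) / sqrt 2 * (\<Sum>j\<in>UNIV. ((B (fst q) (snd q) k j * spin_act (snd q) (fst q) Y s) \<bullet> coupling M k j X s) / norm k) \<partial>lborel)
      = (\<integral> k. (\<Sum>j\<in>UNIV. (coupling M k j Y s \<bullet> coupling M k j X s) / norm k) \<partial>lborel)" .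
  qed
  finally show ?thesis .
qed

lemma coupling_matrix:
  assumes "s \<in> spins P"
  shows "coupling M k j X s = (\<Sum>t\<in>spins P. X t * coupling M k j (\<lambda>s'. if s' = t then 1 else 0) s)"
proof -
  have act: "spin_act (snd q) (fst q) X s = (\<Sum>t\<in>spins P. X t * spin_act (snd q) (fst q) (\<lambda>s'. if s' = t then 1 else 0) s)"
    if q: "q \<in> modes" for q
  proof -
    have "spin_flip (snd q) (fst q) s \<in> spins P" using assms spin_flip_mem[OF modesD(1)[OF q]] by simp
    then have "(\<Sum>t\<in>spins P. X t * (spin_phase (snd q) (s (fst q)) * (if spin_flip (snd q) (fst q) s = t then 1 else 0)))
      = X (spin_flip (snd q) (fst q) s) * spin_phase (snd q) (s (fst q))"
    proof -
      assume f: "spin_flip (snd q) (fst q) s \<in> spins P"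
      have "X t * (spin_phase (snd q) (s (fst q)) * (if spin_flip (snd q) (fst q) s = t then 1 else 0))
        = (if t = spin_flip (snd q) (fst q) s then X (spin_flip (snd q) (fst q) s) * spin_phase (snd q) (s (fst q)) else 0)" for t
        by auto
      then show ?thesis using f by (simp only: sum.delta[OF finite_spins] if_True)
    qed
    then show ?thesis
      unfolding spin_act_flip[OF modesD(2)[OF q]] by (simp only: mult.commute)
  qed
  have "coupling M k j X s = (\<Sum>q\<in>modes. \<Sum>t\<in>spins P. X t * (complex_of_real (M (fst q) / sqrt 2) *
      (B (fst q) (snd q) k j * spin_act (snd q) (fst q) (\<lambda>s'. if s' = t then 1 else 0) s)))"
    unfolding coupling_def
    by (intro sum.cong refl, subst act) (simp_all add: sum_distrib_left mult_ac)
  then show ?thesis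
    unfolding coupling_def by (subst (asm) sum.swap) (simp only: sum_distrib_left)
qed

text \<open>The matrix form is what the minimisation below requires: it yields continuity of the
  quadratic form and shows that \<open>A_op\<close> depends only on the values of \<open>X\<close>
  on \<open>spins P\<close>.\<close>

lemma A_op_matrix:
  assumes "s \<in> spins P"
  shows "A_op P x \<phi> M X s = (\<Sum>t\<in>spins P. A_op P x \<phi> M (\<lambda>s'. if s' = t then 1 else 0) s * X t)"
proof -
  let ?d = "\<lambda>t s'. if s' = t then 1 else (0::complex)"
  have ann: "ann_coupling M q X s = (\<Sum>t\<in>spins P. X t * ann_coupling M q (?d t) s)" if "s \<in> spins P" for q s
  proof -
    have "ann_coupling M q X s = (\<integral> k. (\<Sum>t\<in>spins P. X t * (\<Sum>j\<in>UNIV. cnj (B (fst q) (snd q) k j) * (complex_of_real (inverse (norm k)) * coupling M k j (?d t) s))) \<partial>lborel)"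
      unfolding ann_coupling_def
    proof (intro Bochner_Integration.integral_cong refl)
      fix k :: "real^3"
      have "(\<Sum>j\<in>UNIV. cnj (B (fst q) (snd q) k j) * (complex_of_real (inverse (norm k)) * coupling M k j X s))
        = (\<Sum>j\<in>UNIV. \<Sum>t\<in>spins P. X t * (cnj (B (fst q) (snd q) k j) * (complex_of_real (inverse (norm k)) * coupling M k j (?d t) s)))"
        by (rule sum.cong[OF refl], subst coupling_matrix[OF that]) (simp add: sum_distrib_left mult.left_commute)
      then show "(\<Sum>j\<in>UNIV. cnj (B (fst q) (snd q) k j) * (complex_of_real (inverse (norm k)) * coupling M k j X s))
        = (\<Sum>t\<in>spins P. X t * (\<Sum>j\<in>UNIV. cnj (B (fst q) (snd q) k j) * (complex_of_real (inverse (norm k)) * coupling M k j (?d t) s)))"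
        by (subst (asm) sum.swap) (simp only: sum_distrib_left)
    qed
    also have "\<dots> = (\<Sum>t\<in>spins P. X t * ann_coupling M q (?d t) s)"
      unfolding ann_coupling_def
      by (subst Bochner_Integration.integral_sum,
          intro integrable_mult_right Bochner_Integration.integrable_sum ann_coupling_integrable)
         (simp only: integral_mult_right_zero)
    finally show ?thesis .
  qed
  have act: "spin_act (snd q) (fst q) (ann_coupling M q X) s = (\<Sum>t\<in>spins P. X t * spin_act (snd q) (fst q) (ann_coupling M q (?d t)) s)"
    if q: "q \<in> modes" for q
    unfolding spin_act_flip[OF modesD(2)[OF q]]
    using assms by (subst ann) (simp_all add: spin_flip_mem[OF modesD(1)[OF q]] sum_distrib_left mult.left_commute)
  have "A_op P x \<phi> M X s = - (\<Sum>q\<in>modes. \<Sum>t\<in>spins P. complex_of_real (M (fst q) / sqrt 2) * spin_act (snd q) (fst q) (ann_coupling M q (?d t)) s * X t)"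
    unfolding A_op_eq by (intro arg_cong[where f = uminus] sum.cong refl, subst act) (simp_all add: sum_distrib_left mult_ac)
  also have "\<dots> = (\<Sum>t\<in>spins P. A_op P x \<phi> M (?d t) s * X t)"
    unfolding A_op_eq by (subst sum.swap) (simp add: sum_distrib_right sum_negf)
  finally show ?thesis .
qed

end

section \<open>The lower bound\<close>

context spin_photon
begin

text \<open>The density |V(k) Psi|^2 / |k| of the term added in completing the square.\<close>

definition shift_dens :: "(nat \<Rightarrow> real) \<Rightarrow> fock \<Rightarrow> nat \<Rightarrow> (real^3) \<times> (nat \<Rightarrow> real^3) \<Rightarrow> (nat \<Rightarrow> 3) \<Rightarrow> (nat \<Rightarrow> bool) \<Rightarrow> real" where
  "shift_dens M \<Psi> n z js s = (\<Sum>j\<in>UNIV. (cmod (coupling M (fst z) j (\<Psi> n (snd z) js) s))\<^sup>2 / norm (fst z))"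

lemma shift_dens_nonneg: "shift_dens M \<Psi> n z js s \<ge> 0"
  by (simp add: shift_dens_def sum_nonneg)

lemma measurable_coupling_fock:
  assumes \<Psi>: "\<Psi> \<in> Htot P" and a: "js \<in> pols n" "s \<in> spins P"
  shows "(\<lambda>z. coupling M (fst z) j (\<Psi> n (snd z) js) s) \<in> borel_measurable (lborel \<Otimes>\<^sub>M nmeas n)"
  unfolding coupling_def
proof (intro borel_measurable_sum borel_measurable_times borel_measurable_const)
  fix q assume q: "q \<in> modes"
  show "(\<lambda>z. B (fst q) (snd q) (fst z) j) \<in> borel_measurable (lborel \<Otimes>\<^sub>M nmeas n)"
    by (rule measurable_compose[OF measurable_fst]) (use B_measurable in simp)
  have "(\<lambda>ks. spin_op (snd q) (fst q) \<Psi> n ks js s) \<in> borel_measurable (nmeas n)"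
    by (rule measurable_section[OF Htot_measurable[OF spin_op_Htot[OF modesD[OF q] \<Psi>]] a])
  from measurable_compose[OF measurable_snd this]
  show "(\<lambda>z. spin_act (snd q) (fst q) (\<Psi> n (snd z) js) s) \<in> borel_measurable (lborel \<Otimes>\<^sub>M nmeas n)"
    unfolding spin_op_act .
qed

lemma measurable_shift_dens:
  assumes \<Psi>: "\<Psi> \<in> Htot P" and a: "js \<in> pols n" "s \<in> spins P"
  shows "(\<lambda>z. shift_dens M \<Psi> n z js s) \<in> borel_measurable (lborel \<Otimes>\<^sub>M nmeas n)"
proof -
  have [measurable]: "(\<lambda>z. coupling M (fst z) j (\<Psi> n (snd z) js) s) \<in> borel_measurable (lborel \<Otimes>\<^sub>M nmeas n)" for j
    by (rule measurable_coupling_fock[OF assms])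
  show ?thesis unfolding shift_dens_def by measurable
qed

lemma second_order_form_nn:
  "(\<Sum>s\<in>spins P. \<integral>\<^sup>+ k. ennreal (\<Sum>j\<in>UNIV. (cmod (coupling M k j X s))\<^sup>2 / norm k) \<partial>lborel) = ennreal (second_order_form M X X)"
proof -
  have "(\<integral>\<^sup>+ k. ennreal (\<Sum>j\<in>UNIV. (cmod (coupling M k j X s))\<^sup>2 / norm k) \<partial>lborel)
     = ennreal (\<integral> k. (\<Sum>j\<in>UNIV. (coupling M k j X s \<bullet> coupling M k j X s) / norm k) \<partial>lborel)" for s
    unfolding power2_norm_eq_inner
    by (intro nn_integral_eq_integral Bochner_Integration.integrable_sum coupling_inner_integrable AE_I2 sum_nonneg) simp
  then show ?thesis unfolding second_order_form_def
    by (simp add: sum_ennreal integral_nonneg_AE sum_nonneg)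
qed

text \<open>At a fixed photon configuration the integral over k, summed over spins, is
  \<open>second_order_form\<close> at the spin vector \<open>\<Psi> n ks js\<close>, to which
  \<open>low\<close> applies.\<close>

lemma shift_dens_integral:
  assumes \<Psi>: "\<Psi> \<in> Htot P" and a: "a \<le> 0"
    and low: "\<And>X. second_order_form M X X \<le> - a * (\<Sum>s\<in>spins P. (cmod (X s))\<^sup>2)"
  shows "integrable (fmeas1 P) (flat (shift_dens M \<Psi>))"
    "(\<integral> w. flat (shift_dens M \<Psi>) w \<partial>fmeas1 P) \<le> - a * fock_inner P \<Psi> \<Psi>"
proof -
  have meas: "flat (shift_dens M \<Psi>) \<in> borel_measurable (fmeas1 P)"
    unfolding measurable_flat1_iff using measurable_shift_dens[OF \<Psi>] by blast
  have nn: "flat (shift_dens M \<Psi>) w \<ge> 0" for w by (cases w) (auto simp: shift_dens_nonneg)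
  have m\<Psi>: "(\<lambda>ks. \<Psi> n ks js s) \<in> borel_measurable (nmeas n)" if "js \<in> pols n" "s \<in> spins P" for n js s
    by (rule measurable_section[OF Htot_measurable[OF \<Psi>] that])
  have md: "(\<lambda>z. ennreal (shift_dens M \<Psi> n z js s)) \<in> borel_measurable (lborel \<Otimes>\<^sub>M nmeas n)"
    if "js \<in> pols n" "s \<in> spins P" for n js s
    by (rule measurable_compose[OF measurable_shift_dens[OF \<Psi> that] measurable_ennreal])
  have "(\<integral>\<^sup>+ w. ennreal (flat (shift_dens M \<Psi>) w) \<partial>fmeas1 P)
    = (\<integral>\<^sup>+ w. flat (\<lambda>n z js s. ennreal (shift_dens M \<Psi> n z js s)) w \<partial>fmeas1 P)"
    by (intro nn_integral_cong) auto
  also have "\<dots> = (\<Sum>n. \<Sum>js\<in>pols n. \<Sum>s\<in>spins P. \<integral>\<^sup>+ z. ennreal (shift_dens M \<Psi> n z js s) \<partial>(lborel \<Otimes>\<^sub>M nmeas n))"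
    by (rule nn_integral_fmeas1, unfold measurable_flat1_iff, intro allI ballI md)
  also have "\<dots> \<le> (\<Sum>n. \<Sum>js\<in>pols n. \<Sum>s\<in>spins P. \<integral>\<^sup>+ ks. ennreal (- a * (cmod (\<Psi> n ks js s))\<^sup>2) \<partial>nmeas n)"
  proof (intro suminf_le summableI, rule sum_mono)
    fix n js assume js: "js \<in> pols n"
    interpret pair_sigma_finite "lborel :: (real^3) measure" "nmeas n" by (rule pair_sigma_finite_nmeas)
    let ?I = "\<lambda>s ks. \<integral>\<^sup>+ k. ennreal (shift_dens M \<Psi> n (k, ks) js s) \<partial>lborel"
    have mI: "?I s \<in> borel_measurable (nmeas n)" if "s \<in> spins P" for s
    proof -
      have "(\<lambda>z. ennreal (shift_dens M \<Psi> n (snd z, fst z) js s)) \<in> borel_measurable (nmeas n \<Otimes>\<^sub>M lborel)"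
        by (rule measurable_compose[OF _ md[OF js that]]) measurable
      then show ?thesis
        by (intro sigma_finite_measure.borel_measurable_nn_integral[OF sigma_finite_lborel])
           (simp add: case_prod_unfold)
    qed
    have "(\<Sum>s\<in>spins P. \<integral>\<^sup>+ z. ennreal (shift_dens M \<Psi> n z js s) \<partial>(lborel \<Otimes>\<^sub>M nmeas n))
      = (\<Sum>s\<in>spins P. \<integral>\<^sup>+ ks. ?I s ks \<partial>nmeas n)"
      by (intro sum.cong refl nn_integral_snd[symmetric] md[OF js])
    also have "\<dots> = (\<integral>\<^sup>+ ks. (\<Sum>s\<in>spins P. ?I s ks) \<partial>nmeas n)"
      by (rule nn_integral_sum[symmetric]) (rule mI)
    also have "\<dots> \<le> (\<integral>\<^sup>+ ks. (\<Sum>s\<in>spins P. ennreal (- a * (cmod (\<Psi> n ks js s))\<^sup>2)) \<partial>nmeas n)"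
    proof (rule nn_integral_mono)
      fix ks
      have "(\<Sum>s\<in>spins P. ?I s ks) = ennreal (second_order_form M (\<Psi> n ks js) (\<Psi> n ks js))"
        unfolding shift_dens_def fst_conv snd_conv by (rule second_order_form_nn)
      also have "\<dots> \<le> ennreal (- a * (\<Sum>s\<in>spins P. (cmod (\<Psi> n ks js s))\<^sup>2))"
        by (intro ennreal_leI low)
      also have "\<dots> = (\<Sum>s\<in>spins P. ennreal (- a * (cmod (\<Psi> n ks js s))\<^sup>2))"
        unfolding sum_distrib_left using a by (intro sum_ennreal[symmetric]) (auto intro: mult_nonpos_nonneg)
      finally show "(\<Sum>s\<in>spins P. ?I s ks) \<le> (\<Sum>s\<in>spins P. ennreal (- a * (cmod (\<Psi> n ks js s))\<^sup>2))" .
    qed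
    also have "\<dots> = (\<Sum>s\<in>spins P. \<integral>\<^sup>+ ks. ennreal (- a * (cmod (\<Psi> n ks js s))\<^sup>2) \<partial>nmeas n)"
    proof (rule nn_integral_sum)
      fix s assume "s \<in> spins P"
      note [measurable] = m\<Psi>[OF js this]
      show "(\<lambda>ks. ennreal (- a * (cmod (\<Psi> n ks js s))\<^sup>2)) \<in> borel_measurable (nmeas n)" by measurable
    qed
    finally show "(\<Sum>s\<in>spins P. \<integral>\<^sup>+ z. ennreal (shift_dens M \<Psi> n z js s) \<partial>(lborel \<Otimes>\<^sub>M nmeas n))
      \<le> (\<Sum>s\<in>spins P. \<integral>\<^sup>+ ks. ennreal (- a * (cmod (\<Psi> n ks js s))\<^sup>2) \<partial>nmeas n)" .
  qed
  also have "\<dots> = (\<integral>\<^sup>+ w. flat (\<lambda>n ks js s. ennreal (- a * (cmod (\<Psi> n ks js s))\<^sup>2)) w \<partial>fmeas P)"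
  proof (rule nn_integral_fmeas[symmetric], unfold measurable_flat_iff, intro allI ballI)
    fix n js s assume "js \<in> pols n" "s \<in> spins P"
    note [measurable] = m\<Psi>[OF this]
    show "(\<lambda>ks. ennreal (- a * (cmod (\<Psi> n ks js s))\<^sup>2)) \<in> borel_measurable (nmeas n)" by measurable
  qed
  also have "\<dots> = (\<integral>\<^sup>+ w. ennreal (- a) * ennreal ((cmod (flat \<Psi> w))\<^sup>2) \<partial>fmeas P)"
    by (intro nn_integral_cong) (use a in \<open>auto simp: ennreal_mult[symmetric]\<close>)
  also have "\<dots> = ennreal (- a) * (\<integral>\<^sup>+ w. ennreal ((cmod (flat \<Psi> w))\<^sup>2) \<partial>fmeas P)"
    using Htot_measurable[OF \<Psi>] by (intro nn_integral_cmult) simp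
  also have "\<dots> = ennreal (- a * fock_inner P \<Psi> \<Psi>)"
    unfolding l2ip_self_nn[OF Htot_L2[OF \<Psi>]] fock_inner_def[symmetric]
    using a Fock.ip_nonneg[OF \<Psi>] by (intro ennreal_mult[symmetric]) auto
  finally have le: "(\<integral>\<^sup>+ w. ennreal (flat (shift_dens M \<Psi>) w) \<partial>fmeas1 P) \<le> ennreal (- a * fock_inner P \<Psi> \<Psi>)" .
  show int: "integrable (fmeas1 P) (flat (shift_dens M \<Psi>))"
    by (rule integrableI_nonneg[OF meas]) (use nn le in \<open>auto intro: le_less_trans\<close>)
  have "- a * fock_inner P \<Psi> \<Psi> \<ge> 0" using a Fock.ip_nonneg[OF \<Psi>] by (intro mult_nonneg_nonneg) auto
  then show "(\<integral> w. flat (shift_dens M \<Psi>) w \<partial>fmeas1 P) \<le> - a * fock_inner P \<Psi> \<Psi>"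
    using le nn_integral_eq_integral[OF int] nn by (simp add: ennreal_le_iff)
qed

text \<open>This is \<open>Hint_form\<close> on the diagonal, where its two \<open>cross\<close>
  terms coincide; hence the 2.\<close>

lemma Hint_form_density:
  assumes \<Psi>: "\<Psi> \<in> domH P"
  shows "integrable (fmeas1 P) (flat (\<lambda>n z js s. \<Sum>j\<in>UNIV. 2 * (coupling M (fst z) j (\<Psi> n (snd z) js) s \<bullet> ann_field \<Psi> n z j js s)))"
    "fock_inner P \<Psi> (Hint P x \<phi> M \<Psi>) = (\<integral> w. flat (\<lambda>n z js s. \<Sum>j\<in>UNIV. 2 * (coupling M (fst z) j (\<Psi> n (snd z) js) s \<bullet> ann_field \<Psi> n z j js s)) w \<partial>fmeas1 P)"
proof -
  let ?c = "\<lambda>q. form_factor.cross_dens (B (fst q) (snd q)) (spin_op (snd q) (fst q) \<Psi>) \<Psi>"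
  let ?D = "\<lambda>q. flat (\<lambda>n z js s. \<Sum>j\<in>UNIV. ?c q n z j js s)"
  have int: "integrable (fmeas1 P) (?D q)" if q: "q \<in> modes" for q
    by (intro form_factor.cross_integrable[OF form_factors] spin_op_Htot modesD q domH_Htot \<Psi>)
  have eq: "flat (\<lambda>n z js s. \<Sum>j\<in>UNIV. 2 * (coupling M (fst z) j (\<Psi> n (snd z) js) s \<bullet> ann_field \<Psi> n z j js s)) w
     = (\<Sum>q\<in>modes. 2 * (M (fst q) / sqrt 2) * ?D q w)" for w
  proof -
    obtain n js s z where w: "w = ((n, js, s), z)" by (metis prod.exhaust)
    have "2 * (coupling M (fst z) j (\<Psi> n (snd z) js) s \<bullet> ann_field \<Psi> n z j js s)
      = (\<Sum>q\<in>modes. 2 * (M (fst q) / sqrt 2) * ?c q n z j js s)" for j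
      unfolding coupling_def form_factor.cross_dens_def[OF form_factors] scaleR_conv_of_real[symmetric] inner_sum_left inner_scaleR_left spin_op_act
      by (simp add: sum_distrib_left mult.assoc)
    then show ?thesis
      unfolding w flat_apply sum_distrib_left by (subst sum.swap) simp
  qed
  show "integrable (fmeas1 P) (flat (\<lambda>n z js s. \<Sum>j\<in>UNIV. 2 * (coupling M (fst z) j (\<Psi> n (snd z) js) s \<bullet> ann_field \<Psi> n z j js s)))"
    unfolding eq[abs_def] by (intro Bochner_Integration.integrable_sum integrable_mult_right int)
  have "fock_inner P \<Psi> (Hint P x \<phi> M \<Psi>) = fock_inner P (Hint P x \<phi> M \<Psi>) \<Psi>"
    by (intro Fock.ip_sym domH_Htot Hint_Htot \<Psi>)
  also have "\<dots> = (\<Sum>q\<in>modes. 2 * (M (fst q) / sqrt 2) * (\<integral> w. ?D q w \<partial>fmeas1 P))"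
    unfolding Hint_form[OF \<Psi> \<Psi>] form_factor.cross_def[OF form_factors] by (simp add: mult_ac)
  also have "\<dots> = (\<integral> w. (\<Sum>q\<in>modes. 2 * (M (fst q) / sqrt 2) * ?D q w) \<partial>fmeas1 P)"
    by (subst Bochner_Integration.integral_sum, intro integrable_mult_right int)
       (simp_all only: integral_mult_right_zero)
  finally show "fock_inner P \<Psi> (Hint P x \<phi> M \<Psi>) = (\<integral> w. flat (\<lambda>n z js s. \<Sum>j\<in>UNIV. 2 * (coupling M (fst z) j (\<Psi> n (snd z) js) s \<bullet> ann_field \<Psi> n z j js s)) w \<partial>fmeas1 P)"
    unfolding eq .
qed

text \<open>Completing the square in the annihilation field.\<close>

lemma Hfull_lower_bound:
  assumes \<Psi>: "\<Psi> \<in> domH P" and a: "a \<le> 0"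
    and low: "\<And>X. second_order_form M X X \<le> - a * (\<Sum>s\<in>spins P. (cmod (X s))\<^sup>2)"
  shows "a * fock_inner P \<Psi> \<Psi> \<le> fock_inner P \<Psi> (Hfull P x \<phi> M \<Psi>)"
proof -
  note H = domH_Htot[OF \<Psi>]
  let ?E = "flat (\<lambda>n z js s. \<Sum>j\<in>UNIV. norm (fst z) * (cmod (ann_field \<Psi> n z j js s))\<^sup>2)"
  let ?I = "flat (\<lambda>n z js s. \<Sum>j\<in>UNIV. 2 * (coupling M (fst z) j (\<Psi> n (snd z) js) s \<bullet> ann_field \<Psi> n z j js s))"
  let ?S = "flat (shift_dens M \<Psi>)"
  note iE = fmeas1_energy[OF \<Psi>] and iI = Hint_form_density[OF \<Psi>, of M] and iS = shift_dens_integral[OF H a low]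
  \<comment> \<open>The square of sqrt |k| u + w / sqrt |k|. At k = 0 the weighted terms vanish by
    convention and the mixed term has to vanish too, so \<open>w = 0\<close> is demanded there;
    \<open>coupling_zero\<close> supplies it.\<close>
  have sq: "0 \<le> norm k * (cmod u)\<^sup>2 + 2 * (w \<bullet> u) + (cmod w)\<^sup>2 / norm k" if "k = 0 \<longrightarrow> w = 0" for k :: "real^3" and u w :: complex
  proof (cases "k = 0")
    case False
    have "0 \<le> (cmod (sqrt (norm k) *\<^sub>R u + (1 / sqrt (norm k)) *\<^sub>R w))\<^sup>2" by simp
    also have "\<dots> = norm k * (cmod u)\<^sup>2 + 2 * (w \<bullet> u) + (cmod w)\<^sup>2 / norm k"
      unfolding power2_norm_eq_inner inner_add_left inner_add_right inner_scaleR_left inner_scaleR_right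
      using False by (simp add: inner_commute field_simps flip: power2_eq_square)
    finally show ?thesis .
  qed (use that in simp)
  have "0 \<le> (\<integral> w. ?E w + ?I w + ?S w \<partial>fmeas1 P)"
  proof (intro integral_nonneg_AE AE_I2)
    fix w :: "(nat \<times> (nat \<Rightarrow> 3) \<times> (nat \<Rightarrow> bool)) \<times> (real^3) \<times> (nat \<Rightarrow> real^3)"
    obtain n js s z where w: "w = ((n, js, s), z)" by (metis prod.exhaust)
    have "0 \<le> (\<Sum>j\<in>UNIV. norm (fst z) * (cmod (ann_field \<Psi> n z j js s))\<^sup>2
        + 2 * (coupling M (fst z) j (\<Psi> n (snd z) js) s \<bullet> ann_field \<Psi> n z j js s)
        + (cmod (coupling M (fst z) j (\<Psi> n (snd z) js) s))\<^sup>2 / norm (fst z))"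
      by (intro sum_nonneg sq) (simp add: coupling_zero)
    then show "0 \<le> ?E w + ?I w + ?S w"
      unfolding w flat_apply shift_dens_def sum.distrib .
  qed
  also have "\<dots> = fock_inner P \<Psi> (hph \<Psi>) + fock_inner P \<Psi> (Hint P x \<phi> M \<Psi>) + (\<integral> w. ?S w \<partial>fmeas1 P)"
    using iE iI iS by simp
  also have "\<dots> \<le> fock_inner P \<Psi> (Hfull P x \<phi> M \<Psi>) + (- a * fock_inner P \<Psi> \<Psi>)"
    unfolding Hfull_eq using Fock.ip_add2[OF hph_Htot[OF \<Psi>] Hint_Htot[OF \<Psi>] H, of M] iS(2) by simp
  finally show ?thesis by simp
qed

end

section \<open>The lowest eigenvalue of the effective Hamiltonian\<close>

text \<open>Tychonoff in the product topology. It makes the unit sphere of functions supported on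
  \<open>S\<close> a closed part of a compact set, whatever the index type.\<close>

lemma compact_box_functions:
  "compact {X :: 's \<Rightarrow> complex. \<forall>s. X s \<in> (if s \<in> S then cball 0 1 else {0})}"
proof -
  have "compactin (product_topology (\<lambda>_. euclidean) UNIV) (PiE UNIV (\<lambda>s::'s. if s \<in> S then cball 0 1 else {0::complex}))"
    unfolding compactin_PiE by auto
  then have "compact (PiE UNIV (\<lambda>s::'s. if s \<in> S then cball 0 1 else {0::complex}))"
    by (simp add: euclidean_product_topology)
  moreover have "PiE UNIV (\<lambda>s::'s. if s \<in> S then cball 0 1 else {0::complex})
      = {X. \<forall>s. X s \<in> (if s \<in> S then cball 0 1 else {0})}"
    by (auto simp: PiE_UNIV_domain Pi_def)
  ultimately show ?thesis by simp
qed

text \<open>The minimum of the Rayleigh quotient is attained by compactness, and a minimiser is an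
  eigenvector by the first variation. Symmetry of the real form is enough: with the residual itself
  as the direction, one real condition gives the full complex equation.\<close>

lemma hermitian_lowest_eigenvector:
  fixes S :: "'s set" and A :: "('s \<Rightarrow> complex) \<Rightarrow> 's \<Rightarrow> complex"
  assumes S: "finite S" "S \<noteq> {}"
    and mat: "\<And>X s. s \<in> S \<Longrightarrow> A X s = (\<Sum>t\<in>S. m s t * X t)"
    and sym: "\<And>X Y. (\<Sum>s\<in>S. Y s \<bullet> A X s) = (\<Sum>s\<in>S. X s \<bullet> A Y s)"
  obtains a :: real and X where "\<forall>s. s \<notin> S \<longrightarrow> X s = 0" "\<exists>s\<in>S. X s \<noteq> 0"
    "\<forall>s\<in>S. A X s = complex_of_real a * X s"
    "\<And>Y. a * (\<Sum>s\<in>S. (cmod (Y s))\<^sup>2) \<le> (\<Sum>s\<in>S. Y s \<bullet> A Y s)"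
proof -
  define N where "N X = (\<Sum>s\<in>S. (cmod (X s))\<^sup>2)" for X :: "'s \<Rightarrow> complex"
  define Q where "Q Y X = (\<Sum>s\<in>S. Y s \<bullet> A X s)" for X Y :: "'s \<Rightarrow> complex"
  define T where "T = {X :: 's \<Rightarrow> complex. \<forall>s. X s \<in> (if s \<in> S then cball 0 1 else {0})}"
  define K where "K = T \<inter> {X. N X = 1}"
  have cont: "continuous_on UNIV N" unfolding N_def
    by (intro continuous_intros continuous_on_product_coordinates)
  have "closed {X. N X = 1}"
    by (rule closed_Collect_eq[OF cont continuous_on_const])
  then have "compact K" unfolding K_def T_def by (intro compact_Int_closed compact_box_functions)
  obtain s0 where s0: "s0 \<in> S" using S by blast
  have "(\<lambda>s. if s = s0 then 1 else 0) \<in> K"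
  proof -
    have "N (\<lambda>s. if s = s0 then 1 else 0) = (\<Sum>s\<in>S. if s = s0 then 1 else 0)"
      unfolding N_def by (intro sum.cong) auto
    then show ?thesis using s0 S by (auto simp: K_def T_def)
  qed
  then have "K \<noteq> {}" by blast
  have contQ: "continuous_on K (\<lambda>X. Q X X)"
  proof -
    have "Q X X = (\<Sum>s\<in>S. X s \<bullet> (\<Sum>t\<in>S. m s t * X t))" for X
      unfolding Q_def by (intro sum.cong refl) (simp add: mat)
    then show ?thesis
      by (simp only:) (intro continuous_intros continuous_on_subset[OF continuous_on_product_coordinates] subset_UNIV)
  qed
  obtain X where X: "X \<in> K" and min: "\<And>Y. Y \<in> K \<Longrightarrow> Q X X \<le> Q Y Y"
    using continuous_attains_inf[OF \<open>compact K\<close> \<open>K \<noteq> {}\<close> contQ] by blast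
  define a where "a = Q X X"
  have NX: "N X = 1" and X0: "\<And>s. s \<notin> S \<Longrightarrow> X s = 0"
    using X by (auto simp: K_def T_def split: if_splits)
  have A_scale: "A (\<lambda>s. complex_of_real c * Y s) s = complex_of_real c * A Y s" if "s \<in> S" for c Y s
    by (simp add: mat[OF that] sum_distrib_left mult.left_commute)
  have A_cong: "A Y s = A Z s" if "s \<in> S" "\<And>t. t \<in> S \<Longrightarrow> Y t = Z t" for Y Z s
    using that by (simp add: mat cong: sum.cong)
  have low: "a * N Y \<le> Q Y Y" for Y
  proof (cases "N Y = 0")
    case True
    then have "\<forall>s\<in>S. Y s = 0" using S by (simp add: N_def sum_nonneg_eq_0_iff)
    then show ?thesis using True by (simp add: Q_def)
  next
    case False
    then have pos: "N Y > 0" by (simp add: N_def sum_nonneg less_le)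
    define c where "c = 1 / sqrt (N Y)"
    have c2: "c\<^sup>2 * N Y = 1" using pos by (simp add: c_def power_divide)
    define Z where "Z s = (if s \<in> S then complex_of_real c * Y s else 0)" for s
    have NZ: "N Z = 1"
    proof -
      have "N Z = (\<Sum>s\<in>S. c\<^sup>2 * (cmod (Y s))\<^sup>2)"
        unfolding N_def by (intro sum.cong refl) (simp add: Z_def norm_mult power_mult_distrib)
      then show ?thesis using c2 by (simp add: N_def sum_distrib_left)
    qed
    have "cmod (Z s) \<le> 1" if "s \<in> S" for s
    proof -
      have "(cmod (Z s))\<^sup>2 \<le> N Z" unfolding N_def using S that by (intro member_le_sum) auto
      then show ?thesis using NZ by (simp add: power_le_one_iff)
    qed
    then have "Z \<in> K" using NZ by (auto simp: K_def T_def Z_def)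
    then have "a \<le> Q Z Z" using min a_def by simp
    also have "Q Z Z = c\<^sup>2 * Q Y Y"
    proof -
      have "Z s \<bullet> A Z s = c\<^sup>2 * (Y s \<bullet> A Y s)" if s: "s \<in> S" for s
      proof -
        have "A Z s = A (\<lambda>s. complex_of_real c * Y s) s" by (rule A_cong[OF s]) (simp add: Z_def)
        also have "\<dots> = c *\<^sub>R A Y s" unfolding A_scale[OF s] scaleR_conv_of_real ..
        finally have AZ: "A Z s = c *\<^sub>R A Y s" .
        have "Z s = c *\<^sub>R Y s" using s by (simp add: Z_def scaleR_conv_of_real)
        then show ?thesis unfolding AZ by (simp add: power2_eq_square)
      qed
      then show ?thesis by (simp add: Q_def sum_distrib_left)
    qed
    finally have "a * N Y \<le> c\<^sup>2 * Q Y Y * N Y" using pos by (intro mult_right_mono) auto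
    also have "\<dots> = Q Y Y" using c2 by (metis mult.assoc mult.commute mult.right_neutral)
    finally show ?thesis .
  qed
  \<comment> \<open>The residual. The form \<open>Q - a * N\<close> is nonnegative and vanishes at
    \<open>X\<close>, so along \<open>R + t *\<^sub>R X\<close> it is affine in \<open>t\<close>;
    its slope is twice the squared norm of \<open>R\<close> and must be 0.\<close>
  define R where "R s = A X s - complex_of_real a * X s" for s
  have "(\<Sum>s\<in>S. (cmod (R s))\<^sup>2) = 0"
  proof -
    have QN: "(\<Sum>s\<in>S. R s \<bullet> R s) = Q R X - a * (\<Sum>s\<in>S. R s \<bullet> X s)"
      unfolding Q_def sum_distrib_left sum_subtractf[symmetric]
      by (intro sum.cong refl)
         (subst (2) R_def, simp add: inner_diff_right scaleR_conv_of_real[symmetric])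
    let ?b = "Q R X - a * (\<Sum>s\<in>S. R s \<bullet> X s)"
    have "0 \<le> (Q R R - a * N R) + 2 * t * ?b + t\<^sup>2 * 0" for t
    proof -
      define Y where "Y s = R s + t *\<^sub>R X s" for s
      have AY: "A Y s = A R s + t *\<^sub>R A X s" if "s \<in> S" for s
        unfolding mat[OF that] Y_def
        by (simp add: scaleR_conv_of_real distrib_left sum.distrib sum_distrib_left mult.left_commute)
      have "Q Y Y = (\<Sum>s\<in>S. R s \<bullet> A R s + t * (R s \<bullet> A X s) + t * (X s \<bullet> A R s) + t\<^sup>2 * (X s \<bullet> A X s))"
        unfolding Q_def
        by (intro sum.cong refl) (simp add: AY, simp add: Y_def inner_add_left inner_add_right algebra_simps power2_eq_square)
      also have "\<dots> = Q R R + t * Q R X + t * Q X R + t\<^sup>2 * Q X X"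
        unfolding Q_def by (simp add: sum.distrib sum_distrib_left)
      also have "Q X R = Q R X" unfolding Q_def by (rule sym)
      finally have QY: "Q Y Y = Q R R + 2 * t * Q R X + t\<^sup>2 * a" by (simp add: a_def)
      have "N Y = (\<Sum>s\<in>S. R s \<bullet> R s + 2 * t * (R s \<bullet> X s) + t\<^sup>2 * (X s \<bullet> X s))"
        unfolding N_def power2_norm_eq_inner
        by (intro sum.cong refl) (simp add: Y_def inner_add_left inner_add_right inner_commute algebra_simps power2_eq_square)
      also have "\<dots> = N R + 2 * t * (\<Sum>s\<in>S. R s \<bullet> X s) + t\<^sup>2 * N X"
        unfolding N_def power2_norm_eq_inner by (simp add: sum.distrib sum_distrib_left)
      finally have NY: "N Y = N R + 2 * t * (\<Sum>s\<in>S. R s \<bullet> X s) + t\<^sup>2" by (simp add: NX)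
      show ?thesis using low[of Y] unfolding QY NY by (simp add: algebra_simps)
    qed
    then have "?b\<^sup>2 \<le> (Q R R - a * N R) * 0" by (rule discriminant_le) simp
    then have "?b = 0" by simp
    then show ?thesis using QN by (simp add: power2_norm_eq_inner)
  qed
  then have "\<forall>s\<in>S. R s = 0" using S by (simp add: sum_nonneg_eq_0_iff)
  then have eig: "\<forall>s\<in>S. A X s = complex_of_real a * X s" by (simp add: R_def)
  have "\<exists>s\<in>S. X s \<noteq> 0"
  proof (rule ccontr)
    assume "\<not> ?thesis"
    then have "N X = 0" by (simp add: N_def)
    then show False using NX by simp
  qed
  then show ?thesis using that[of X a] X0 eig low unfolding N_def Q_def by blast
qed

context spin_photon
begin

lemma spins_nonempty: "spins P \<noteq> {}"
  by (auto simp: spins_def)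

text \<open>The minimum is the least real eigenvalue since every real eigenvalue is a Rayleigh
  quotient. The eigenvector is kept for the trial state, the form inequality for the lower bound on
  the full Hamiltonian.\<close>

lemma lowest_eigenvector_A:
  obtains a :: real and X where "\<forall>s. s \<notin> spins P \<longrightarrow> X s = 0" "\<exists>s\<in>spins P. X s \<noteq> 0"
    "\<forall>s\<in>spins P. A_op P x \<phi> M X s = complex_of_real a * X s"
    "\<And>Y. second_order_form M Y Y \<le> - a * (\<Sum>s\<in>spins P. (cmod (Y s))\<^sup>2)"
    "inf_spec (spec_A P x \<phi> M) = a"
proof -
  have sym: "(\<Sum>s\<in>spins P. Y s \<bullet> A_op P x \<phi> M X s) = (\<Sum>s\<in>spins P. X s \<bullet> A_op P x \<phi> M Y s)" for X Y
    unfolding A_op_form by (simp add: second_order_form_sym)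
  obtain a :: real and X where X: "\<forall>s. s \<notin> spins P \<longrightarrow> X s = 0" "\<exists>s\<in>spins P. X s \<noteq> 0"
    "\<forall>s\<in>spins P. A_op P x \<phi> M X s = complex_of_real a * X s"
    and low: "\<And>Y. a * (\<Sum>s\<in>spins P. (cmod (Y s))\<^sup>2) \<le> (\<Sum>s\<in>spins P. Y s \<bullet> A_op P x \<phi> M Y s)"
    by (rule hermitian_lowest_eigenvector[OF finite_spins spins_nonempty A_op_matrix sym]) blast+
  have "Inf {r. complex_of_real r \<in> spec_A P x \<phi> M} = a"
  proof (rule cInf_eq_minimum)
    show "a \<in> {r. complex_of_real r \<in> spec_A P x \<phi> M}" using X by (auto simp: spec_A_def)
    fix r assume "r \<in> {r. complex_of_real r \<in> spec_A P x \<phi> M}"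
    then obtain Y where Y: "\<exists>s\<in>spins P. Y s \<noteq> 0" "\<forall>s\<in>spins P. A_op P x \<phi> M Y s = complex_of_real r * Y s"
      by (auto simp: spec_A_def)
    have "(\<Sum>s\<in>spins P. Y s \<bullet> A_op P x \<phi> M Y s) = r * (\<Sum>s\<in>spins P. (cmod (Y s))\<^sup>2)"
      unfolding sum_distrib_left using Y(2) by (intro sum.cong refl) (simp add: inner_hph)
    then have "a * (\<Sum>s\<in>spins P. (cmod (Y s))\<^sup>2) \<le> r * (\<Sum>s\<in>spins P. (cmod (Y s))\<^sup>2)"
      using low[of Y] by simp
    moreover have "(\<Sum>s\<in>spins P. (cmod (Y s))\<^sup>2) > 0"
      using Y(1) by (auto intro!: sum_pos2)
    ultimately show "a \<le> r" by simp
  qed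
  then have "inf_spec (spec_A P x \<phi> M) = a" by (simp add: inf_spec_def)
  moreover have "second_order_form M Y Y \<le> - a * (\<Sum>s\<in>spins P. (cmod (Y s))\<^sup>2)" for Y
    using low[of Y] unfolding A_op_form by simp
  ultimately show ?thesis using that X by blast
qed

end

section \<open>The ultraviolet cutoff\<close>

text \<open>Dyadic balls in place of polar coordinates. Near 0 a value of order 2^j on a ball of
  radius 2^(-j) contributes of order 4^(-j) in dimension 3; far out, 32^(-j) on a ball of radius
  2^(j+1) does the same.\<close>

lemma integrable_inverse_norm_decay:
  fixes F :: "real^3 \<Rightarrow> real"
  assumes F: "F \<in> borel_measurable borel" "\<And>k. 0 \<le> F k" "F 0 = 0"
    and small: "\<And>k. k \<noteq> 0 \<Longrightarrow> norm k \<le> 1 \<Longrightarrow> F k \<le> C / norm k"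
    and large: "\<And>k. norm k \<ge> 1 \<Longrightarrow> F k \<le> C / norm k ^ 5" and C: "C \<ge> 0"
  shows "integrable lborel F"
proof (rule integrableI_nonneg)
  define v where "v = unit_ball_vol (real DIM(real^3))"
  have v: "v \<ge> 0" by (simp add: v_def)
  define G :: "nat \<Rightarrow> real^3 \<Rightarrow> ennreal" where
    "G j k = ennreal (C * 2 ^ Suc j) * indicator (cball 0 ((1/2) ^ j)) k
       + ennreal (C * (1/32) ^ j) * indicator (cball 0 (2 ^ Suc j)) k" for j k
  have GF: "ennreal (F k) \<le> (\<Sum>j. G j k)" for k
  proof -
    have "\<exists>j. ennreal (F k) \<le> G j k" if k: "k \<noteq> 0"
    proof (cases "norm k \<le> 1")
      case True
      \<comment> \<open>The least exponent places \<open>norm k\<close> between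
        \<open>(1/2) ^ Suc j\<close> and \<open>(1/2) ^ j\<close>, which bounds
        \<open>1 / norm k\<close> by \<open>2 ^ Suc j\<close>.\<close>
      define n where "n = (LEAST n. (1/2::real) ^ n < norm k)"
      obtain m where "(1/2::real) ^ m < norm k" using real_arch_pow_inv[of "norm k" "1/2"] k by auto
      then have n: "(1/2::real) ^ n < norm k" unfolding n_def by (rule LeastI)
      then have "n \<noteq> 0" using True by (cases n) auto
      then obtain j where j: "n = Suc j" by (cases n) auto
      then have "norm k \<le> (1/2) ^ j" using not_less_Least[of j "\<lambda>n. (1/2::real) ^ n < norm k"]
        by (simp add: n_def[symmetric] not_less)
      have "F k \<le> C / norm k" by (rule small[OF k True])
      also have "\<dots> \<le> C / ((1/2) ^ n)" by (rule divide_left_mono[OF less_imp_le[OF n] C]) (simp add: k)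
      also have "\<dots> = C * 2 ^ Suc j" by (simp add: j power_one_over)
      finally have "ennreal (F k) \<le> ennreal (C * 2 ^ Suc j) * indicator (cball 0 ((1/2) ^ j)) k"
        using \<open>norm k \<le> (1/2) ^ j\<close> by (simp add: ennreal_leI)
      then show ?thesis unfolding G_def by (metis add_increasing2 zero_le)
    next
      case False
      define n where "n = (LEAST n. norm k \<le> (2::real) ^ n)"
      obtain m where "norm k < (2::real) ^ m" using real_arch_pow[of 2 "norm k"] by auto
      then have n: "norm k \<le> (2::real) ^ n" unfolding n_def by (rule LeastI[OF less_imp_le])
      then have "n \<noteq> 0" using False by (cases n) auto
      then obtain j where j: "n = Suc j" by (cases n) auto
      then have lt: "2 ^ j < norm k" using not_less_Least[of j "\<lambda>n. norm k \<le> (2::real) ^ n"]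
        by (simp add: n_def[symmetric] not_le)
      have "F k \<le> C / norm k ^ 5" using False by (intro large) simp
      also have "\<dots> \<le> C / (2 ^ j) ^ 5"
        by (rule divide_left_mono[OF power_mono[OF less_imp_le[OF lt]] C]) (simp_all add: k)
      also have "((2::real) ^ j) ^ 5 = (2 ^ 5) ^ j"
        by (simp only: power_mult[symmetric] mult.commute[of j])
      also have "C / (2 ^ 5) ^ j = C * (1/32) ^ j" by (simp add: power_one_over)
      finally have "ennreal (F k) \<le> ennreal (C * (1/32) ^ j) * indicator (cball 0 (2 ^ Suc j)) k"
        using n j by (simp add: ennreal_leI)
      then show ?thesis unfolding G_def by (metis add_increasing zero_le)
    qed
    then consider "k = 0" | j where "ennreal (F k) \<le> G j k" by blast
    then show ?thesis
    proof cases
      case 1 then show ?thesis by (simp add: F(3))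
    next
      case (2 j)
      also have "G j k \<le> (\<Sum>j. G j k)"
        using sum_le_suminf[of "\<lambda>j. G j k" "{j}"] by simp
      finally show ?thesis .
    qed
  qed
  have cs: "cball (0::real^3) r \<in> sets lborel" for r by simp
  have m: "(\<lambda>k. c * indicator (cball (0::real^3) r) k) \<in> borel_measurable lborel" for c :: ennreal and r
    by (intro borel_measurable_times_ennreal borel_measurable_const borel_measurable_indicator cs)
  have Gm: "G j \<in> borel_measurable lborel" for j
    unfolding G_def by (intro borel_measurable_add m)
  have "(\<integral>\<^sup>+ k. ennreal (F k) \<partial>lborel) \<le> (\<integral>\<^sup>+ k. (\<Sum>j. G j k) \<partial>lborel)"
    by (rule nn_integral_mono) (rule GF)
  also have "\<dots> = (\<Sum>j. \<integral>\<^sup>+ k. G j k \<partial>lborel)" by (rule nn_integral_suminf) (rule Gm)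
  \<comment> \<open>10 = 2 + 8: the 2 comes from the coefficient \<open>2 ^ Suc j\<close> of the
    small balls, the 8 from the cubed radius \<open>2 ^ Suc j\<close> of the large ones.\<close>
  also have "\<dots> = (\<Sum>j. ennreal (10 * C * v * (1/4) ^ j))"
  proof (rule suminf_cong)
    fix j
    have "(\<integral>\<^sup>+ k. G j k \<partial>lborel) = ennreal (C * 2 ^ Suc j) * emeasure lborel (cball (0::real^3) ((1/2) ^ j))
       + ennreal (C * (1/32) ^ j) * emeasure lborel (cball (0::real^3) (2 ^ Suc j))"
      unfolding G_def nn_integral_add[OF m m] nn_integral_cmult_indicator[OF cs] ..
    also have "\<dots> = ennreal (C * 2 ^ Suc j) * ennreal (v * ((1/2) ^ j) ^ 3)
       + ennreal (C * (1/32) ^ j) * ennreal (v * (2 ^ Suc j) ^ 3)"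
      by (simp add: emeasure_cball v_def)
    also have "\<dots> = ennreal (C * 2 ^ Suc j * (v * ((1/2) ^ j) ^ 3) + C * (1/32) ^ j * (v * (2 ^ Suc j) ^ 3))"
      using C v by (simp add: ennreal_mult ennreal_plus del: power_Suc)
    also have "C * 2 ^ Suc j * (v * ((1/2) ^ j) ^ 3) + C * (1/32) ^ j * (v * (2 ^ Suc j) ^ 3) = 10 * C * v * (1/4) ^ j"
    proof -
      have a: "((1/2::real) ^ j) ^ 3 * 2 ^ j = (1/4) ^ j"
      proof -
        have "((1/2::real) ^ j) ^ 3 * 2 ^ j = (((1/2) ^ 3) * 2) ^ j"
          by (simp only: power_mult[symmetric] power_mult_distrib mult.commute[of j])
        then show ?thesis by (simp add: power_divide)
      qed
      have b: "(1/32::real) ^ j * (2 ^ j) ^ 3 = (1/4) ^ j"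
      proof -
        have "(1/32::real) ^ j * (2 ^ j) ^ 3 = ((1/32) * 2 ^ 3) ^ j"
          by (simp only: power_mult[symmetric] power_mult_distrib mult.commute[of j])
        then show ?thesis by (simp add: power_divide)
      qed
      have "C * 2 ^ Suc j * (v * ((1/2) ^ j) ^ 3) = 2 * C * v * (((1/2) ^ j) ^ 3 * 2 ^ j)" by simp
      moreover have "C * (1/32) ^ j * (v * (2 ^ Suc j) ^ 3) = 8 * C * v * ((1/32) ^ j * (2 ^ j) ^ 3)"
        by (simp add: power_mult_distrib)
      ultimately show ?thesis unfolding a b by linarith
    qed
    finally show "(\<integral>\<^sup>+ k. G j k \<partial>lborel) = ennreal (10 * C * v * (1/4) ^ j)" .
  qed
  also have "\<dots> = ennreal (\<Sum>j. 10 * C * v * (1/4) ^ j)"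
  proof (rule suminf_ennreal2)
    show "0 \<le> 10 * C * v * (1/4) ^ j" for j using C v by simp
    show "summable (\<lambda>j. 10 * C * v * (1/4) ^ j)"
      by (rule summable_mult) (rule summable_geometric, simp)
  qed
  also have "\<dots> < \<infinity>" by simp
  finally show "(\<integral>\<^sup>+ k. ennreal (F k) \<partial>lborel) < \<infinity>" .
qed (use F in auto)

section \<open>Decay of the form factors for a Schwartz cutoff\<close>

lemma schwartz_continuous: "schwartz \<phi> \<Longrightarrow> continuous_on UNIV \<phi>"
proof -
  assume "schwartz \<phi>"
  then have "vderivs 0 \<phi> differentiable (at t)" for t unfolding schwartz_def by blast
  then have "isCont \<phi> t" for t by (simp add: differentiable_imp_continuous_within)
  then show ?thesis by (simp add: continuous_on_eq_continuous_at)
qed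

text \<open>The power 3 is chosen because \<open>\<phi>\<close> enters squared and with a factor
  |k|, which gives the decay |k|^(-5) at infinity.\<close>

lemma schwartz_bound:
  assumes "schwartz \<phi>"
  obtains C where "C \<ge> 0" "\<And>t. cmod (\<phi> t) \<le> C" "\<And>t. \<bar>t\<bar> ^ 3 * cmod (\<phi> t) \<le> C"
proof -
  have "bounded (range (\<lambda>t. complex_of_real (t ^ a) * vderivs 0 \<phi> t))" for a
    using assms unfolding schwartz_def by blast
  then have b: "\<exists>C. \<forall>t. cmod (complex_of_real (t ^ a) * \<phi> t) \<le> C" for a
    by (auto simp: bounded_iff)
  obtain C0 C3 where C: "\<And>t. cmod (complex_of_real (t ^ 0) * \<phi> t) \<le> C0" "\<And>t. cmod (complex_of_real (t ^ 3) * \<phi> t) \<le> C3"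
    using b[of 0] b[of 3] by blast
  show ?thesis
  proof
    show "0 \<le> max 0 (max C0 C3)" by simp
    show "cmod (\<phi> t) \<le> max 0 (max C0 C3)" for t using C(1)[of t] by simp
    show "\<bar>t\<bar> ^ 3 * cmod (\<phi> t) \<le> max 0 (max C0 C3)" for t
      using C(2)[of t] by (simp add: norm_mult norm_power)
  qed
qed

lemma evec_norm: "norm (evec m) = 1"
  by (simp add: evec_def norm_eq_sqrt_inner inner_vec_def sum_3)

lemma Bfield_transversal: "(\<Sum>j\<in>UNIV. complex_of_real (k $ j) * Bfield \<phi> y m k j) = 0"
proof -
  have "(\<Sum>j\<in>UNIV. complex_of_real (k $ j) * Bfield \<phi> y m k j)
    = \<i> * \<phi> (norm k) * complex_of_real (sqrt (norm k) / ((2 * pi) powr (3/2))) * exp (- \<i> * complex_of_real (k \<bullet> y))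
      * complex_of_real ((\<Sum>j\<in>UNIV. k $ j * cross3 k (evec m) $ j) / norm k)"
    unfolding Bfield_def sum_divide_distrib of_real_sum sum_distrib_left
    by (intro sum.cong refl) (simp add: mult_ac)
  also have "(\<Sum>j\<in>UNIV. k $ j * cross3 k (evec m) $ j) = k \<bullet> cross3 k (evec m)"
    by (simp add: inner_vec_def)
  also have "\<dots> = 0" by (simp add: dot_cross_self)
  finally show ?thesis by simp
qed

text \<open>The majorant of the form factors: the phase, the components of the cross product divided
  by |k|, and the factor (2 pi)^(-3/2) are all estimated by 1.\<close>

definition cutoff_weight :: "(real \<Rightarrow> complex) \<Rightarrow> real^3 \<Rightarrow> real" where
  "cutoff_weight \<phi> k = cmod (\<phi> (norm k)) * sqrt (norm k)"

lemma Bfield_le: "cmod (Bfield \<phi> y m k j) \<le> cutoff_weight \<phi> k"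
proof -
  have "(norm (cross3 k (evec m)))\<^sup>2 \<le> (norm k)\<^sup>2"
    by (simp add: norm_cross evec_norm)
  then have "norm (cross3 k (evec m)) \<le> norm k" by (rule power2_le_imp_le) simp
  then have "\<bar>cross3 k (evec m) $ j\<bar> \<le> norm k"
    using component_le_norm_cart[of "cross3 k (evec m)" j] by simp
  then have c: "\<bar>cross3 k (evec m) $ j\<bar> / norm k \<le> 1" by (simp add: divide_le_eq)
  have "1 \<le> (2 * pi) powr (3/2)" using pi_gt3 by (intro ge_one_powr_ge_zero) auto
  then have s: "sqrt (norm k) / ((2 * pi) powr (3/2)) \<le> sqrt (norm k)"
    by (simp add: divide_le_eq mult_le_cancel_left1)
  have "cmod (exp (- \<i> * complex_of_real (k \<bullet> y))) = 1" by (simp add: norm_exp_eq_Re)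
  then have "cmod (Bfield \<phi> y m k j) = cmod (\<phi> (norm k)) * (sqrt (norm k) / ((2 * pi) powr (3/2))) * (\<bar>cross3 k (evec m) $ j\<bar> / norm k)"
    by (simp add: Bfield_def norm_mult norm_divide)
  also have "\<dots> \<le> cmod (\<phi> (norm k)) * sqrt (norm k) * 1"
    using s c by (intro mult_mono mult_nonneg_nonneg) auto
  finally show ?thesis by (simp add: cutoff_weight_def)
qed

lemma Bfield_measurable:
  assumes "schwartz \<phi>" shows "(\<lambda>k. Bfield \<phi> y m k j) \<in> borel_measurable borel"
proof -
  have [measurable]: "\<phi> \<in> borel_measurable borel"
    by (rule borel_measurable_continuous_onI[OF schwartz_continuous[OF assms]])
  have [measurable]: "(\<lambda>k. cross3 k (evec m) $ j) \<in> borel_measurable borel"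
    by (intro borel_measurable_continuous_onI continuous_on_component continuous_on_cross continuous_intros)
  have [measurable]: "(\<lambda>k. exp (- \<i> * complex_of_real (k \<bullet> y))) \<in> borel_measurable borel"
    by (intro borel_measurable_continuous_onI continuous_intros)
  show ?thesis unfolding Bfield_def by measurable
qed

text \<open>The three integrals are the cases \<open>p = 0, 1, 2\<close> of one bound. The squared
  weight is |phi|^2 |k|, so dividing by |k|^p leaves at worst |k|^(-1) near the origin.\<close>

lemma cutoff_weight_integrable:
  assumes "schwartz \<phi>"
  shows "integrable lborel (\<lambda>k. (cutoff_weight \<phi> k)\<^sup>2)"
    "integrable lborel (\<lambda>k. (cutoff_weight \<phi> k)\<^sup>2 / norm k)"
    "integrable lborel (\<lambda>k. (cutoff_weight \<phi> k)\<^sup>2 / (norm k)\<^sup>2)"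
proof -
  obtain C where C: "C \<ge> 0" "\<And>t. cmod (\<phi> t) \<le> C" "\<And>t. \<bar>t\<bar> ^ 3 * cmod (\<phi> t) \<le> C"
    by (rule schwartz_bound[OF assms]) (rule that)
  have [measurable]: "\<phi> \<in> borel_measurable borel"
    by (rule borel_measurable_continuous_onI[OF schwartz_continuous[OF assms]])
  have int: "integrable lborel (\<lambda>k. (cutoff_weight \<phi> k)\<^sup>2 / norm k ^ p)" if p: "p \<le> 2" for p
  proof (rule integrable_inverse_norm_decay[where C = "C\<^sup>2"])
    have sq: "(cutoff_weight \<phi> k)\<^sup>2 = (cmod (\<phi> (norm k)))\<^sup>2 * norm k" for k
      by (simp add: cutoff_weight_def power_mult_distrib)
    show "(\<lambda>k. (cutoff_weight \<phi> k)\<^sup>2 / norm k ^ p) \<in> borel_measurable borel"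
      unfolding cutoff_weight_def by measurable
    show "(cutoff_weight \<phi> 0)\<^sup>2 / norm (0::real^3) ^ p = 0" by (simp add: cutoff_weight_def)
    fix k :: "real^3"
    have c2: "(cmod (\<phi> (norm k)))\<^sup>2 \<le> C\<^sup>2" using C(2) by (intro power_mono) auto
    show "(cutoff_weight \<phi> k)\<^sup>2 / norm k ^ p \<le> C\<^sup>2 / norm k" if k: "k \<noteq> 0" "norm k \<le> 1"
    proof -
      have "norm k * norm k = norm k ^ 2" by (simp add: power2_eq_square)
      also have "\<dots> \<le> norm k ^ p" using k p by (intro power_decreasing) auto
      finally have "norm k / norm k ^ p \<le> 1 / norm k" using k by (simp add: field_simps)
      then have "(cmod (\<phi> (norm k)))\<^sup>2 * (norm k / norm k ^ p) \<le> C\<^sup>2 * (1 / norm k)"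
        using c2 by (intro mult_mono) auto
      then show ?thesis by (simp add: sq)
    qed
    show "(cutoff_weight \<phi> k)\<^sup>2 / norm k ^ p \<le> C\<^sup>2 / norm k ^ 5" if k: "norm k \<ge> 1"
    proof -
      have "(norm k ^ 3 * cmod (\<phi> (norm k)))\<^sup>2 \<le> C\<^sup>2" using C(3)[of "norm k"] by (intro power_mono) auto
      then have a: "norm k ^ 6 * (cmod (\<phi> (norm k)))\<^sup>2 \<le> C\<^sup>2" by (simp add: power_mult_distrib power_mult[symmetric])
      have "(cutoff_weight \<phi> k)\<^sup>2 / norm k ^ p \<le> (cutoff_weight \<phi> k)\<^sup>2 / 1"
        using k by (intro divide_left_mono) (auto simp: one_le_power intro: zero_less_power less_le_trans[of 0 1])
      also have "\<dots> = (norm k ^ 6 * (cmod (\<phi> (norm k)))\<^sup>2) / norm k ^ 5"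
      proof -
        have "norm k ^ 6 = norm k * norm k ^ 5" by (simp flip: power_Suc)
        then show ?thesis using k by (auto simp: sq)
      qed
      also have "\<dots> \<le> C\<^sup>2 / norm k ^ 5" by (intro divide_right_mono a) auto
      finally show ?thesis .
    qed
  qed auto
  show "integrable lborel (\<lambda>k. (cutoff_weight \<phi> k)\<^sup>2)" using int[of 0] by simp
  show "integrable lborel (\<lambda>k. (cutoff_weight \<phi> k)\<^sup>2 / norm k)" using int[of 1] by simp
  show "integrable lborel (\<lambda>k. (cutoff_weight \<phi> k)\<^sup>2 / (norm k)\<^sup>2)" using int[of 2] by simp
qed

lemma spin_photon_schwartz:
  assumes "schwartz \<phi>" shows "spin_photon x \<phi> (cutoff_weight \<phi>)"
proof
  have [measurable]: "\<phi> \<in> borel_measurable borel"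
    by (rule borel_measurable_continuous_onI[OF schwartz_continuous[OF assms]])
  show "cutoff_weight \<phi> \<in> borel_measurable borel"
    unfolding cutoff_weight_def[abs_def] by measurable
qed (use cutoff_weight_integrable[OF assms] Bfield_le Bfield_measurable[OF assms] Bfield_transversal
      in \<open>auto simp: cutoff_weight_def\<close>)

section \<open>The upper bound\<close>

lemma nmeas_0: "nmeas 0 = count_space {\<lambda>_. undefined}"
  by (simp add: nmeas_def PiM_empty)

lemma pols_0: "pols 0 = {\<lambda>_. undefined}"
  by (simp add: pols_def)

text \<open>Without photons there is a single configuration, of mass 1, for each spin; with one
  photon a copy of momentum space for each polarisation and spin. The trial vector lives in these
  two sectors.\<close>

lemma nn_integral_low_sectors:
  fixes f0 :: "(nat \<Rightarrow> bool) \<Rightarrow> ennreal" and f1 :: "real^3 \<Rightarrow> 3 \<Rightarrow> (nat \<Rightarrow> bool) \<Rightarrow> ennreal"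
  assumes m: "\<And>j s. (\<lambda>k. f1 k j s) \<in> borel_measurable borel"
  shows "(\<integral>\<^sup>+ w. flat (\<lambda>n ks js s. if n = 0 then f0 s else if n = 1 then f1 (ks 0) (js 0) s else 0) w \<partial>fmeas P)
    = (\<Sum>s\<in>spins P. f0 s) + (\<Sum>j\<in>UNIV. \<Sum>s\<in>spins P. \<integral>\<^sup>+ k. f1 k j s \<partial>lborel)"
proof -
  let ?F = "\<lambda>n ks js s. if n = 0 then f0 s else if n = (1::nat) then f1 (ks (0::nat)) (js (0::nat)) s else 0"
  have m1: "(\<lambda>ks. f1 (ks 0) j s) \<in> borel_measurable (nmeas 1)" for j s
    by (rule measurable_compose[OF measurable_nmeas_component m]) simp
  have "(\<integral>\<^sup>+ w. flat ?F w \<partial>fmeas P) = (\<Sum>n. \<Sum>js\<in>pols n. \<Sum>s\<in>spins P. \<integral>\<^sup>+ ks. ?F n ks js s \<partial>nmeas n)"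
  proof (rule nn_integral_fmeas, unfold measurable_flat_iff, intro allI ballI)
    fix n js s
    show "(\<lambda>ks. ?F n ks js s) \<in> borel_measurable (nmeas n)"
      using m1[of "js 0" s] by (cases "n = 1"; cases "n = 0") simp_all
  qed
  also have "\<dots> = (\<Sum>n\<in>{0,1}. \<Sum>js\<in>pols n. \<Sum>s\<in>spins P. \<integral>\<^sup>+ ks. ?F n ks js s \<partial>nmeas n)"
    by (rule suminf_finite) auto
  also have "\<dots> = (\<Sum>js\<in>pols 0. \<Sum>s\<in>spins P. \<integral>\<^sup>+ ks. f0 s \<partial>nmeas 0)
      + (\<Sum>js\<in>pols (Suc 0). \<Sum>s\<in>spins P. \<integral>\<^sup>+ ks. f1 (ks 0) (js 0) s \<partial>nmeas (Suc 0))"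
    by simp
  also have "(\<Sum>js\<in>pols 0. \<Sum>s\<in>spins P. \<integral>\<^sup>+ ks. f0 s \<partial>nmeas 0) = (\<Sum>s\<in>spins P. f0 s)"
    by (simp add: pols_0 nmeas_0 nn_integral_count_space_finite)
  also have "(\<Sum>js\<in>pols (Suc 0). \<Sum>s\<in>spins P. \<integral>\<^sup>+ ks. f1 (ks 0) (js 0) s \<partial>nmeas (Suc 0))
    = (\<Sum>j\<in>UNIV. \<Sum>s\<in>spins P. \<integral>\<^sup>+ ks. f1 (ks 0) j s \<partial>nmeas (Suc 0))"
    by (subst sum_pols_Suc[of 0 0]) (simp_all add: pols_0)
  also have "\<dots> = (\<Sum>j\<in>UNIV. \<Sum>s\<in>spins P. \<integral>\<^sup>+ k. f1 k j s \<partial>lborel)"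
  proof (intro sum.cong refl)
    fix j s
    interpret pair_sigma_finite "lborel :: (real^3) measure" "nmeas 0" by (rule pair_sigma_finite_nmeas)
    have "(\<integral>\<^sup>+ ks. f1 (ks 0) j s \<partial>nmeas (Suc 0)) = (\<integral>\<^sup>+ z. f1 (fst z) j s \<partial>(lborel \<Otimes>\<^sub>M nmeas 0))"
      using nn_integral_nmeas_Suc[of 0 0 "\<lambda>ks. f1 (ks 0) j s"] m1[of j s] by simp
    also have "\<dots> = (\<integral>\<^sup>+ ks. \<integral>\<^sup>+ k. f1 k j s \<partial>lborel \<partial>nmeas 0)"
      using nn_integral_snd[of "\<lambda>z. f1 (fst z) j s"] measurable_compose[OF measurable_fst[of lborel "nmeas 0"], of "\<lambda>k. f1 k j s" borel] m
      by simp
    also have "\<dots> = (\<integral>\<^sup>+ k. f1 k j s \<partial>lborel)"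
      by (simp add: nmeas_0 nn_integral_count_space_finite)
    finally show "(\<integral>\<^sup>+ ks. f1 (ks 0) j s \<partial>nmeas (Suc 0)) = (\<integral>\<^sup>+ k. f1 k j s \<partial>lborel)" .
  qed
  finally show ?thesis .
qed

context spin_photon
begin

definition trial :: "(nat \<Rightarrow> real) \<Rightarrow> ((nat \<Rightarrow> bool) \<Rightarrow> complex) \<Rightarrow> fock" where
  "trial M X = (\<lambda>n ks js s. if n = 0 then X s
     else if n = 1 then - (complex_of_real (inverse (norm (ks 0))) * coupling M (ks 0) (js 0) X s) else 0)"

definition spin_norm2 :: "((nat \<Rightarrow> bool) \<Rightarrow> complex) \<Rightarrow> real" where
  "spin_norm2 X = (\<Sum>s\<in>spins P. (cmod (X s))\<^sup>2)"

definition c2 :: real where "c2 = (\<integral> k. (g k)\<^sup>2 / (norm k)\<^sup>2 \<partial>lborel)"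

lemma c2_nonneg: "c2 \<ge> 0"
  by (simp add: c2_def integral_nonneg_AE)

lemma spin_norm2_nonneg: "spin_norm2 X \<ge> 0"
  by (simp add: spin_norm2_def sum_nonneg)

text \<open>One estimate for three weights: \<open>h = 1\<close> puts the trial vector into the
  domain, \<open>1 / norm k\<close> bounds \<open>A_op\<close>, and
  \<open>1 / (norm k)\<^sup>2\<close> bounds the norm of the trial vector. The leading 3 sums over
  polarisations.\<close>

lemma coupling_weighted_bound:
  assumes h: "integrable lborel (\<lambda>k. (g k)\<^sup>2 * h k)" "h \<in> borel_measurable borel" "\<And>k. 0 \<le> h k"
  shows "(\<Sum>j\<in>UNIV. \<Sum>s\<in>spins P. \<integral>\<^sup>+ k. ennreal ((cmod (coupling M k j X s))\<^sup>2 * h k) \<partial>lborel)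
     \<le> ennreal (3 * (real (3 * P))\<^sup>2 * (mnorm P M)\<^sup>2 * spin_norm2 X * (\<integral> k. (g k)\<^sup>2 * h k \<partial>lborel))"
proof -
  let ?c = "(real (3 * P))\<^sup>2 * (mnorm P M)\<^sup>2 * spin_norm2 X"
  have c0: "?c \<ge> 0" by (intro mult_nonneg_nonneg spin_norm2_nonneg) auto
  have one: "(\<Sum>s\<in>spins P. \<integral>\<^sup>+ k. ennreal ((cmod (coupling M k j X s))\<^sup>2 * h k) \<partial>lborel)
     \<le> ennreal (?c * (\<integral> k. (g k)\<^sup>2 * h k \<partial>lborel))" for j
  proof -
    have "(\<Sum>s\<in>spins P. \<integral>\<^sup>+ k. ennreal ((cmod (coupling M k j X s))\<^sup>2 * h k) \<partial>lborel)
      = (\<integral>\<^sup>+ k. (\<Sum>s\<in>spins P. ennreal ((cmod (coupling M k j X s))\<^sup>2 * h k)) \<partial>lborel)"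
    proof (rule nn_integral_sum[symmetric])
      fix s
      note [measurable] = coupling_measurable[of M j X s] h(2)
      show "(\<lambda>k. ennreal ((cmod (coupling M k j X s))\<^sup>2 * h k)) \<in> borel_measurable lborel" by measurable
    qed
    also have "\<dots> \<le> (\<integral>\<^sup>+ k. ennreal (?c * ((g k)\<^sup>2 * h k)) \<partial>lborel)"
    proof (rule nn_integral_mono)
      fix k
      have "(\<Sum>s\<in>spins P. ennreal ((cmod (coupling M k j X s))\<^sup>2 * h k)) = ennreal ((\<Sum>s\<in>spins P. (cmod (coupling M k j X s))\<^sup>2) * h k)"
        unfolding sum_distrib_right by (rule sum_ennreal) (simp add: h(3))
      also have "\<dots> \<le> ennreal (?c * ((g k)\<^sup>2 * h k))"
      proof (rule ennreal_leI)
        have "(\<Sum>s\<in>spins P. (cmod (coupling M k j X s))\<^sup>2) * h k \<le> ((real (3 * P))\<^sup>2 * (mnorm P M)\<^sup>2 * (g k)\<^sup>2 * spin_norm2 X) * h k"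
          unfolding spin_norm2_def by (rule mult_right_mono[OF coupling_sum_bound h(3)])
        then show "(\<Sum>s\<in>spins P. (cmod (coupling M k j X s))\<^sup>2) * h k \<le> ?c * ((g k)\<^sup>2 * h k)" by (simp add: mult_ac)
      qed
      finally show "(\<Sum>s\<in>spins P. ennreal ((cmod (coupling M k j X s))\<^sup>2 * h k)) \<le> ennreal (?c * ((g k)\<^sup>2 * h k))" .
    qed
    also have "\<dots> = ennreal (\<integral> k. ?c * ((g k)\<^sup>2 * h k) \<partial>lborel)"
      by (intro nn_integral_eq_integral integrable_mult_right h(1) AE_I2 mult_nonneg_nonneg[OF c0]) (simp add: h(3))
    also have "(\<integral> k. ?c * ((g k)\<^sup>2 * h k) \<partial>lborel) = ?c * (\<integral> k. (g k)\<^sup>2 * h k \<partial>lborel)"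
      by (rule integral_mult_right_zero)
    finally show ?thesis .
  qed
  have "(\<Sum>j\<in>(UNIV::3 set). \<Sum>s\<in>spins P. \<integral>\<^sup>+ k. ennreal ((cmod (coupling M k j X s))\<^sup>2 * h k) \<partial>lborel)
     \<le> (\<Sum>j\<in>(UNIV::3 set). ennreal (?c * (\<integral> k. (g k)\<^sup>2 * h k \<partial>lborel)))"
    by (rule sum_mono) (rule one)
  also have "\<dots> = ennreal (3 * (?c * (\<integral> k. (g k)\<^sup>2 * h k \<partial>lborel)))"
  proof -
    have "(\<Sum>j\<in>(UNIV::3 set). ennreal y) = ennreal (3 * y)" for y by (simp add: ennreal_mult')
    then show ?thesis .
  qed
  finally show ?thesis by (simp add: mult_ac)
qed

lemma second_order_form_le: "second_order_form M X X \<le> 3 * (real (3 * P))\<^sup>2 * (mnorm P M)\<^sup>2 * spin_norm2 X * form_factor.c1 g"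
proof -
  have i: "integrable lborel (\<lambda>k. (g k)\<^sup>2 * (1 / norm k))" using g_int1 by simp
  have "ennreal (second_order_form M X X) = (\<Sum>s\<in>spins P. \<Sum>j\<in>UNIV. \<integral>\<^sup>+ k. ennreal ((cmod (coupling M k j X s))\<^sup>2 * (1 / norm k)) \<partial>lborel)"
    unfolding second_order_form_nn[symmetric]
  proof (rule sum.cong[OF refl])
    fix s
    have "(\<integral>\<^sup>+ k. ennreal (\<Sum>j\<in>UNIV. (cmod (coupling M k j X s))\<^sup>2 / norm k) \<partial>lborel)
      = (\<integral>\<^sup>+ k. (\<Sum>j\<in>UNIV. ennreal ((cmod (coupling M k j X s))\<^sup>2 * (1 / norm k))) \<partial>lborel)"
      by (simp add: sum_ennreal)
    also have "\<dots> = (\<Sum>j\<in>UNIV. \<integral>\<^sup>+ k. ennreal ((cmod (coupling M k j X s))\<^sup>2 * (1 / norm k)) \<partial>lborel)"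
    proof (rule nn_integral_sum)
      fix j
      note [measurable] = coupling_measurable[of M j X s]
      show "(\<lambda>k. ennreal ((cmod (coupling M k j X s))\<^sup>2 * (1 / norm k))) \<in> borel_measurable lborel" by measurable
    qed
    finally show "(\<integral>\<^sup>+ k. ennreal (\<Sum>j\<in>UNIV. (cmod (coupling M k j X s))\<^sup>2 / norm k) \<partial>lborel)
      = (\<Sum>j\<in>UNIV. \<integral>\<^sup>+ k. ennreal ((cmod (coupling M k j X s))\<^sup>2 * (1 / norm k)) \<partial>lborel)" .
  qed
  also have "\<dots> \<le> ennreal (3 * (real (3 * P))\<^sup>2 * (mnorm P M)\<^sup>2 * spin_norm2 X * (\<integral> k. (g k)\<^sup>2 * (1 / norm k) \<partial>lborel))"
    by (subst sum.swap) (rule coupling_weighted_bound[OF i], auto)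
  also have "(\<integral> k. (g k)\<^sup>2 * (1 / norm k) \<partial>lborel) = form_factor.c1 g"
    unfolding form_factor.c1_def[OF form_factors] by simp
  finally show ?thesis
    using spin_norm2_nonneg[of X] form_factor.c_nonneg[OF form_factors] by (subst (asm) ennreal_le_iff) auto
qed

lemma trial_sq: "ennreal ((cmod (flat (trial M X) w))\<^sup>2) = flat (\<lambda>n ks js s. if n = 0 then ennreal ((cmod (X s))\<^sup>2)
   else if n = 1 then ennreal ((cmod (coupling M (ks 0) (js 0) X s))\<^sup>2 * (1 / (norm (ks 0))\<^sup>2)) else 0) w"
  by (cases w) (auto simp: trial_def norm_mult norm_inverse power_mult_distrib power_inverse inverse_eq_divide power_divide norm_divide)

lemma measurable_low_sectors:
  assumes "\<And>j s. (\<lambda>k. f k j s) \<in> borel_measurable borel"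
  shows "flat (\<lambda>n ks js s. if n = 0 then f0 s else if n = 1 then f (ks 0) (js 0) s else (0::complex)) \<in> borel_measurable (fmeas P)"
  unfolding measurable_flat_iff
proof (intro allI ballI)
  fix n js s
  have "(\<lambda>ks. f (ks 0) (js 0) s) \<in> borel_measurable (nmeas 1)"
    by (rule measurable_compose[OF measurable_nmeas_component assms]) simp
  then show "(\<lambda>ks. if n = 0 then f0 s else if n = 1 then f (ks 0) (js 0) s else (0::complex)) \<in> borel_measurable (nmeas n)"
    by (cases "n = 1"; cases "n = 0") simp_all
qed

text \<open>The vacuum part contributes \<open>spin_norm2 X\<close> and the one-photon part a
  correction of second order in \<open>M\<close>. The lower estimate ensures that the trial vector
  is not null.\<close>

lemma trial_norm:
  shows "flat (trial M X) \<in> L2 (fmeas P)"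
    "spin_norm2 X \<le> fock_inner P (trial M X) (trial M X)"
    "fock_inner P (trial M X) (trial M X) \<le> spin_norm2 X * (1 + 3 * (real (3 * P))\<^sup>2 * c2 * (mnorm P M)\<^sup>2)"
proof -
  let ?n = "\<lambda>k::real^3. 1 / (norm k)\<^sup>2"
  let ?S = "\<Sum>j\<in>UNIV. \<Sum>s\<in>spins P. \<integral>\<^sup>+ k. ennreal ((cmod (coupling M k j X s))\<^sup>2 * ?n k) \<partial>lborel"
  have meas: "flat (trial M X) \<in> borel_measurable (fmeas P)"
    unfolding trial_def
  proof (rule measurable_low_sectors)
    fix j s
    note [measurable] = coupling_measurable[of M j X s]
    show "(\<lambda>k. - (complex_of_real (inverse (norm k)) * coupling M k j X s)) \<in> borel_measurable borel" by measurable
  qed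
  have eq: "(\<integral>\<^sup>+ w. ennreal ((cmod (flat (trial M X) w))\<^sup>2) \<partial>fmeas P) = ennreal (spin_norm2 X) + ?S"
    unfolding trial_sq
  proof (subst nn_integral_low_sectors)
    fix j s
    note [measurable] = coupling_measurable[of M j X s]
    show "(\<lambda>k. ennreal ((cmod (coupling M k j X s))\<^sup>2 * ?n k)) \<in> borel_measurable borel" by measurable
  qed (simp add: spin_norm2_def sum_ennreal)
  have i: "integrable lborel (\<lambda>k. (g k)\<^sup>2 * ?n k)" using g_int2 by simp
  have "?S \<le> ennreal (3 * (real (3 * P))\<^sup>2 * (mnorm P M)\<^sup>2 * spin_norm2 X * (\<integral> k. (g k)\<^sup>2 * ?n k \<partial>lborel))"
    by (rule coupling_weighted_bound[OF i]) auto
  also have "(\<integral> k. (g k)\<^sup>2 * ?n k \<partial>lborel) = c2" by (simp add: c2_def)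
  finally have S: "?S \<le> ennreal (3 * (real (3 * P))\<^sup>2 * (mnorm P M)\<^sup>2 * spin_norm2 X * c2)" .
  have pos: "0 \<le> 3 * (real (3 * P))\<^sup>2 * (mnorm P M)\<^sup>2 * spin_norm2 X * c2"
    by (intro mult_nonneg_nonneg spin_norm2_nonneg c2_nonneg) auto
  have le: "(\<integral>\<^sup>+ w. ennreal ((cmod (flat (trial M X) w))\<^sup>2) \<partial>fmeas P)
     \<le> ennreal (spin_norm2 X * (1 + 3 * (real (3 * P))\<^sup>2 * c2 * (mnorm P M)\<^sup>2))"
  proof -
    have "ennreal (spin_norm2 X) + ?S \<le> ennreal (spin_norm2 X) + ennreal (3 * (real (3 * P))\<^sup>2 * (mnorm P M)\<^sup>2 * spin_norm2 X * c2)"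
      by (rule add_left_mono[OF S])
    also have "\<dots> = ennreal (spin_norm2 X + 3 * (real (3 * P))\<^sup>2 * (mnorm P M)\<^sup>2 * spin_norm2 X * c2)"
      by (rule ennreal_plus[OF spin_norm2_nonneg pos, symmetric])
    finally show ?thesis unfolding eq by (simp add: algebra_simps)
  qed
  then show L: "flat (trial M X) \<in> L2 (fmeas P)"
    using meas by (auto simp: L2_iff intro: le_less_trans)
  have f0: "fock_inner P (trial M X) (trial M X) \<ge> 0" by (simp add: fock_inner_def l2ip_self)
  have nn: "(\<integral>\<^sup>+ w. ennreal ((cmod (flat (trial M X) w))\<^sup>2) \<partial>fmeas P) = ennreal (fock_inner P (trial M X) (trial M X))"
    unfolding fock_inner_def by (rule l2ip_self_nn[OF L])
  have "0 \<le> spin_norm2 X * (1 + 3 * (real (3 * P))\<^sup>2 * c2 * (mnorm P M)\<^sup>2)"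
    by (intro mult_nonneg_nonneg add_nonneg_nonneg spin_norm2_nonneg c2_nonneg) auto
  then show "fock_inner P (trial M X) (trial M X) \<le> spin_norm2 X * (1 + 3 * (real (3 * P))\<^sup>2 * c2 * (mnorm P M)\<^sup>2)"
    using le unfolding nn by (simp add: ennreal_le_iff)
  have "ennreal (spin_norm2 X) \<le> ennreal (fock_inner P (trial M X) (trial M X))"
    unfolding nn[symmetric] eq by simp
  then show "spin_norm2 X \<le> fock_inner P (trial M X) (trial M X)" using f0 by (simp add: ennreal_le_iff)
qed

text \<open>The energy cancels its inverse, also at momentum 0, where \<open>coupling\<close>
  vanishes.\<close>

lemma hph_trial: "hph (trial M X) = (\<lambda>n ks js s. if n = 0 then 0 else if n = 1 then - coupling M (ks 0) (js 0) X s else 0)"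
proof (intro ext)
  fix n s and ks :: "nat \<Rightarrow> real^3" and js :: "nat \<Rightarrow> 3"
  have "complex_of_real (norm (ks 0)) * (complex_of_real (inverse (norm (ks 0))) * coupling M (ks 0) (js 0) X s) = coupling M (ks 0) (js 0) X s"
    by (cases "ks 0 = 0") (simp_all add: coupling_zero)
  then show "hph (trial M X) n ks js s = (if n = 0 then 0 else if n = 1 then - coupling M (ks 0) (js 0) X s else 0)"
    by (simp add: hph_def trial_def)
qed

lemma coupling_transversal: "(\<Sum>c\<in>UNIV. complex_of_real (k $ c) * coupling M k c X s) = 0"
proof -
  have "(\<Sum>c\<in>UNIV. complex_of_real (k $ c) * coupling M k c X s)
    = (\<Sum>q\<in>modes. \<Sum>c\<in>UNIV. complex_of_real (M (fst q) / sqrt 2) * spin_act (snd q) (fst q) X s *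
        (complex_of_real (k $ c) * B (fst q) (snd q) k c))"
    unfolding coupling_def sum_distrib_left by (subst sum.swap) (simp add: mult_ac)
  also have "\<dots> = (\<Sum>q\<in>modes. complex_of_real (M (fst q) / sqrt 2) * spin_act (snd q) (fst q) X s *
       (\<Sum>c\<in>UNIV. complex_of_real (k $ c) * B (fst q) (snd q) k c))"
    by (simp only: sum_distrib_left)
  also have "\<dots> = 0" by (simp add: form_factor.V_transversal[OF form_factors])
  finally show ?thesis .
qed

lemma trial_domH: "trial M X \<in> domH P"
proof -
  have "symmetric_fock P (trial M X)" unfolding symmetric_fock_def
  proof (intro allI impI)
    fix n \<pi> assume \<pi>: "\<pi> permutes {..<n::nat}"
    consider "n = 0" | "n = 1" | "n \<ge> 2" by linarith
    then show "AE ks in nmeas n. \<forall>js\<in>pols n. \<forall>s\<in>spins P. trial M X n (ks \<circ> \<pi>) (js \<circ> \<pi>) s = trial M X n ks js s"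
    proof cases
      case 2
      have "\<pi> 0 = 0" using permutes_in_image[OF \<pi>, of 0] 2 by simp
      then show ?thesis by (simp add: trial_def)
    qed (simp_all add: trial_def)
  qed
  moreover have "transversal_fock P (trial M X)" unfolding transversal_fock_def
  proof (intro allI impI AE_I2 ballI)
    fix n i s and ks :: "nat \<Rightarrow> real^3" and js :: "nat \<Rightarrow> 3" assume "i < (n::nat)"
    moreover have "(\<Sum>j\<in>UNIV. complex_of_real (ks 0 $ j) * - (complex_of_real (inverse (norm (ks 0))) * coupling M (ks 0) j X s))
      = - complex_of_real (inverse (norm (ks 0))) * (\<Sum>j\<in>UNIV. complex_of_real (ks 0 $ j) * coupling M (ks 0) j X s)"
      by (simp add: sum_distrib_left sum_negf mult_ac)
    ultimately show "(\<Sum>j\<in>UNIV. complex_of_real (ks i $ j) * trial M X n ks (js(i := j)) s) = 0"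
      by (cases "n = 1") (simp_all add: trial_def coupling_transversal)
  qed
  moreover have "flat (hph (trial M X)) \<in> L2 (fmeas P)"
  proof -
    have sq: "ennreal ((cmod (flat (hph (trial M X)) w))\<^sup>2) = flat (\<lambda>n ks js s. if n = 0 then 0
      else if n = 1 then ennreal ((cmod (coupling M (ks 0) (js 0) X s))\<^sup>2 * 1) else 0) w" for w
      by (cases w) (auto simp: hph_trial)
    have "(\<integral>\<^sup>+ w. ennreal ((cmod (flat (hph (trial M X)) w))\<^sup>2) \<partial>fmeas P)
      = (\<Sum>s\<in>spins P. 0) + (\<Sum>j\<in>UNIV. \<Sum>s\<in>spins P. \<integral>\<^sup>+ k. ennreal ((cmod (coupling M k j X s))\<^sup>2 * 1) \<partial>lborel)"
      unfolding sq
    proof (rule nn_integral_low_sectors)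
      fix j s
      note [measurable] = coupling_measurable[of M j X s]
      show "(\<lambda>k. ennreal ((cmod (coupling M k j X s))\<^sup>2 * 1)) \<in> borel_measurable borel" by measurable
    qed
    also have "\<dots> \<le> ennreal (3 * (real (3 * P))\<^sup>2 * (mnorm P M)\<^sup>2 * spin_norm2 X * (\<integral> k. (g k)\<^sup>2 * 1 \<partial>lborel))"
      unfolding sum.neutral_const add_0 by (rule coupling_weighted_bound) (use g_int0 in auto)
    also have "\<dots> < \<infinity>" by simp
    finally show ?thesis
      using measurable_hph[OF L2_measurable[OF trial_norm(1)], of M X] by (simp only: L2_iff)
  qed
  ultimately show ?thesis using trial_norm(1)[of M X] by (simp add: domH_iff Htot_iff)
qed

text \<open>The last branch repeats the left side: components with two or more photons are left
  open, since the trial vector has none there and its form does not see them.\<close>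

lemma Hfull_trial:
  "Hfull P x \<phi> M (trial M X) n ks js s = (if n = 0 then A_op P x \<phi> M X s else if n = 1 then 0 else Hfull P x \<phi> M (trial M X) n ks js s)"
proof -
  have "Hfull P x \<phi> M (trial M X) 0 ks js s = A_op P x \<phi> M X s" for ks js s
  proof -
    have "(\<integral> k. (\<Sum>j\<in>UNIV. cnj (B (fst q) (snd q) k j) * trial M X (Suc 0) (fcons k ks) (fcons j js) s') \<partial>lborel) = (-1) * ann_coupling M q X s'" for q s'
      unfolding ann_coupling_def by (simp add: trial_def fcons_def sum_negf)
    then show ?thesis
      unfolding Hfull_eq plus_fun_apply Hint_vacuum A_op_eq
      by (simp only: hph_trial spin_act_mult) (simp add: sum_negf)
  qed
  moreover have "Hfull P x \<phi> M (trial M X) (Suc 0) ks js s = 0" for ks js s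
    unfolding Hfull_eq plus_fun_apply
    by (subst Hint_one_photon[where X = X]) (auto simp: hph_trial, auto simp: trial_def)
  ultimately show ?thesis by simp
qed

text \<open>Only the vacuum sector contributes: \<open>Hfull\<close> applied to the trial vector has
  no one-photon component, and above it the trial vector is 0.\<close>

lemma trial_form:
  assumes eig: "\<forall>s\<in>spins P. A_op P x \<phi> M X s = complex_of_real a * X s"
  shows "fock_inner P (trial M X) (Hfull P x \<phi> M (trial M X)) = a * spin_norm2 X"
proof -
  let ?h = "flat (\<lambda>n ks js s. if n = 0 then (cmod (X s))\<^sup>2 else 0 :: real)"
  have m: "?h \<in> borel_measurable (fmeas P)" by (auto simp: measurable_flat_iff)
  have "(\<integral>\<^sup>+ w. ennreal (?h w) \<partial>fmeas P) = (\<integral>\<^sup>+ w. flat (\<lambda>n ks js s. if n = 0 then ennreal ((cmod (X s))\<^sup>2) else if n = 1 then 0 else 0) w \<partial>fmeas P)"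
    by (intro nn_integral_cong) auto
  also have "\<dots> = (\<Sum>s\<in>spins P. ennreal ((cmod (X s))\<^sup>2)) + (\<Sum>j\<in>(UNIV::3 set). \<Sum>s\<in>spins P. \<integral>\<^sup>+ k. 0 \<partial>(lborel :: (real^3) measure))"
    by (rule nn_integral_low_sectors) simp
  also have "\<dots> = ennreal (spin_norm2 X)" by (simp add: spin_norm2_def sum_ennreal)
  finally have nn: "(\<integral>\<^sup>+ w. ennreal (?h w) \<partial>fmeas P) = ennreal (spin_norm2 X)" .
  have "(\<integral> w. ?h w \<partial>fmeas P) = spin_norm2 X"
    by (subst integral_eq_nn_integral[OF m]) (auto simp: nn spin_norm2_nonneg)
  moreover have "fock_inner P (trial M X) (Hfull P x \<phi> M (trial M X)) = (\<integral> w. a * ?h w \<partial>fmeas P)"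
    unfolding fock_inner_def l2ip_def
  proof (rule Bochner_Integration.integral_cong[OF refl])
    fix w assume "w \<in> space (fmeas P)"
    then obtain n js s ks where w: "w = ((n, js, s), ks)" "s \<in> spins P" by (cases w) (auto simp: fmeas_def)
    consider "n = 0" | "n = 1" | "n \<ge> 2" by linarith
    then show "flat (trial M X) w \<bullet> flat (Hfull P x \<phi> M (trial M X)) w = a * ?h w"
    proof cases
      case 1
      then have "Hfull P x \<phi> M (trial M X) n ks js s = A_op P x \<phi> M X s" "trial M X n ks js s = X s"
        using Hfull_trial[of M X n ks js s] by (simp, simp add: trial_def)
      then show ?thesis using eig w 1 by (simp add: inner_hph)
    next
      case 2 then show ?thesis using w Hfull_trial[of M X 1] by simp
    next
      case 3 then show ?thesis using w by (simp add: trial_def)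
    qed
  qed
  ultimately show ?thesis by simp
qed

section \<open>Comparison of the two infima\<close>

lemma real_spectrum_eq:
  "{r. complex_of_real r \<in> spec_H P x \<phi> M} = {r. \<not> Fock.resolvent_pt P (domH P) (Hfull P x \<phi> M) r}"
proof -
  have L: "flat \<Psi> \<in> L2 (fmeas P)" if "\<Psi> \<in> Htot P" for \<Psi> using that by (rule Htot_L2)
  have inV: "Hfull P x \<phi> M \<Psi> - r *\<^sub>R \<Psi> \<in> Htot P" if "\<Psi> \<in> domH P" for \<Psi> r
    using that by (intro Fock.V_closed Hfull_Htot domH_Htot)
  have e1: "(\<lambda>n ks js s. Hfull P x \<phi> M \<Psi> n ks js s - complex_of_real r * \<Psi> n ks js s - \<Phi> n ks js s)
      = Hfull P x \<phi> M \<Psi> - r *\<^sub>R \<Psi> - \<Phi>" for \<Psi> \<Phi> r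
    by (simp add: fun_eq_iff scaleR_conv_of_real)
  have e2: "(\<lambda>n ks js s. Hfull P x \<phi> M \<Psi> n ks js s - complex_of_real r * \<Psi> n ks js s)
      = Hfull P x \<phi> M \<Psi> - r *\<^sub>R \<Psi>" for \<Psi> r
    by (simp add: fun_eq_iff scaleR_conv_of_real)
  have z: "fnorm2 P (Hfull P x \<phi> M \<Psi> - r *\<^sub>R \<Psi> - \<Phi>) = 0 \<longleftrightarrow> Fock.nm P (Hfull P x \<phi> M \<Psi> - r *\<^sub>R \<Psi> - \<Phi>) = 0"
    if "\<Psi> \<in> domH P" "\<Phi> \<in> Htot P" for \<Psi> \<Phi> r
    by (intro fnorm2_zero_iff L Fock.V_closed inV that)
  have n: "fnorm P (Hfull P x \<phi> M \<Psi> - r *\<^sub>R \<Psi>) = Fock.nm P (Hfull P x \<phi> M \<Psi> - r *\<^sub>R \<Psi>)"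
    "fnorm P \<Psi> = Fock.nm P \<Psi>" if "\<Psi> \<in> domH P" for \<Psi> r
    by (intro fnorm_eq_nm L inV domH_Htot that)+
  have D: "dom_H P \<Psi> \<longleftrightarrow> \<Psi> \<in> domH P" "in_Htot P \<Psi> \<longleftrightarrow> \<Psi> \<in> Htot P" for \<Psi>
    by (simp_all add: domH_def Htot_def)
  show ?thesis
    unfolding spec_H_def Fock.resolvent_pt_def mem_Collect_eq e1 e2 D
    by (intro Collect_cong arg_cong[where f = Not] conj_cong) (auto simp: z n Bex_def cong: conj_cong)
qed

text \<open>The trial energy is \<open>a * spin_norm2 X\<close> with \<open>a \<le> 0\<close>.
  Dividing by a squared norm that is larger by at most a factor \<open>1 + d\<close> raises it at
  worst to \<open>a / (1 + d)\<close>, which is at most \<open>a * (1 - d)\<close>. The error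
  \<open>- a * d\<close> is a product of two quantities of order |M|^2.\<close>

lemma inf_spec_estimate:
  assumes small: "Kint * mnorm P M < 1"
  shows "\<bar>inf_spec (spec_H P x \<phi> M) - inf_spec (spec_A P x \<phi> M)\<bar>
     \<le> (3 * (real (3 * P))\<^sup>2 * form_factor.c1 g) * (3 * (real (3 * P))\<^sup>2 * c2) * mnorm P M ^ 4"
proof -
  \<comment> \<open>\<open>?E\<close> bounds \<open>- a\<close>, and \<open>?D\<close> the relative
    excess of the squared norm of the trial vector, both in units of
    \<open>?m\<^sup>2\<close>.\<close>
  let ?m = "mnorm P M" and ?D = "3 * (real (3 * P))\<^sup>2 * c2" and ?E = "3 * (real (3 * P))\<^sup>2 * form_factor.c1 g"
  obtain a :: real and X where X: "\<exists>s\<in>spins P. X s \<noteq> 0"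
    and eig: "\<forall>s\<in>spins P. A_op P x \<phi> M X s = complex_of_real a * X s"
    and low: "\<And>Y. second_order_form M Y Y \<le> - a * (\<Sum>s\<in>spins P. (cmod (Y s))\<^sup>2)"
    and inf: "inf_spec (spec_A P x \<phi> M) = a"
    by (rule lowest_eigenvector_A[of M]) (rule that)
  have N: "spin_norm2 X > 0" unfolding spin_norm2_def using X by (auto intro!: sum_pos2)
  have "a * spin_norm2 X = - second_order_form M X X"
    unfolding A_op_form[symmetric] spin_norm2_def sum_distrib_left
    using eig by (intro sum.cong refl) (simp add: inner_hph)
  moreover have "second_order_form M X X \<le> ?E * ?m\<^sup>2 * spin_norm2 X" using second_order_form_le[of M X] by (simp add: mult_ac)
  ultimately have "a * spin_norm2 X \<le> 0" "(- a) * spin_norm2 X \<le> ?E * ?m\<^sup>2 * spin_norm2 X"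
    using second_order_form_nonneg[of M X] by auto
  then have a: "a \<le> 0" "- a \<le> ?E * ?m\<^sup>2"
    using N mult_right_le_imp_le[of "- a" "spin_norm2 X" "?E * ?m\<^sup>2"] by (auto simp only: mult_le_0_iff)
  have D0: "?D * ?m\<^sup>2 \<ge> 0" by (intro mult_nonneg_nonneg c2_nonneg) auto
  let ?T = "fock_inner P (trial M X) (trial M X)"
  have T: "spin_norm2 X \<le> ?T" "?T \<le> spin_norm2 X * (1 + ?D * ?m\<^sup>2)"
    using trial_norm(2,3) by auto
  \<comment> \<open>If \<open>?D * ?m\<^sup>2 \<ge> 1\<close>, the right side is nonnegative and the
    left side is not positive; otherwise \<open>(1 - d) * (1 + d) \<le> 1\<close> is used.\<close>
  have trial: "fock_inner P (trial M X) (Hfull P x \<phi> M (trial M X)) \<le> (a - a * (?D * ?m\<^sup>2)) * ?T"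
  proof (cases "?D * ?m\<^sup>2 \<ge> 1")
    case True
    then have "a - a * (?D * ?m\<^sup>2) = (- a) * (?D * ?m\<^sup>2 - 1)" by (simp add: algebra_simps)
    also have "\<dots> \<ge> 0" using True a by (intro mult_nonneg_nonneg) auto
    finally have "0 \<le> (a - a * (?D * ?m\<^sup>2)) * ?T" using T N by (intro mult_nonneg_nonneg) auto
    then show ?thesis unfolding trial_form[OF eig] using \<open>a * spin_norm2 X \<le> 0\<close> by simp
  next
    case False
    define d where "d = ?D * ?m\<^sup>2"
    have d: "0 \<le> d" "d < 1" using D0 False by (auto simp: d_def)
    have "a * (1 - d) \<le> 0" using a d by (intro mult_nonpos_nonneg) auto
    then have "a * (1 - d) * (spin_norm2 X * (1 + d)) \<le> a * (1 - d) * ?T"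
      using T(2) by (intro mult_left_mono_neg) (simp_all add: d_def)
    moreover have "a * spin_norm2 X \<le> a * spin_norm2 X * (1 - d\<^sup>2)"
      using \<open>a * spin_norm2 X \<le> 0\<close> mult_nonpos_nonneg[of "a * spin_norm2 X" "d\<^sup>2"] by (simp add: algebra_simps)
    moreover have "a * (1 - d) * (spin_norm2 X * (1 + d)) = a * spin_norm2 X * (1 - d\<^sup>2)"
      by algebra
    ultimately have "a * spin_norm2 X \<le> a * (1 - d) * ?T" by linarith
    then show ?thesis unfolding trial_form[OF eig] d_def by (simp add: right_diff_distrib)
  qed
  have surj: "\<exists>\<Psi>\<in>domH P. Fock.nm P (Hfull P x \<phi> M \<Psi> - r *\<^sub>R \<Psi> - \<Phi>) = 0" if "r \<le> -1" "\<Phi> \<in> Htot P" for r \<Phi>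
    by (rule Hfull_surj[OF small that])
  have "a \<le> Inf {r. \<not> Fock.resolvent_pt P (domH P) (Hfull P x \<phi> M) r}
      \<and> Inf {r. \<not> Fock.resolvent_pt P (domH P) (Hfull P x \<phi> M) r} \<le> a - a * (?D * ?m\<^sup>2)"
    by (intro conjI Fock.Inf_spectrum_between[OF subspace_domH, where R = "-1" and ?x0.0 = "trial M X"])
      (use domH_Htot Hfull_Htot Hfull_linear_null Hfull_symmetric Hfull_lower_bound[OF _ a(1) low] surj trial_domH trial T N trial in auto)
  then have "a \<le> inf_spec (spec_H P x \<phi> M)" "inf_spec (spec_H P x \<phi> M) \<le> a + (- a) * (?D * ?m\<^sup>2)"
    unfolding inf_spec_def real_spectrum_eq by auto
  moreover have "(- a) * (?D * ?m\<^sup>2) \<le> (?E * ?m\<^sup>2) * (?D * ?m\<^sup>2)"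
    by (rule mult_right_mono[OF a(2) D0])
  moreover have "(?E * ?m\<^sup>2) * (?D * ?m\<^sup>2) = ?E * ?D * ?m ^ 4" by algebra
  ultimately show ?thesis unfolding inf by linarith
qed

end

theorem theorem2p4:
  fixes P :: nat and x :: "nat \<Rightarrow> real^3" and \<phi> :: "real \<Rightarrow> complex"
  assumes "P \<ge> 1" and "schwartz \<phi>"
  shows "\<exists>C \<delta>. C > 0 \<and> \<delta> > 0 \<and> (\<forall>M :: nat \<Rightarrow> real. mnorm P M < \<delta> \<longrightarrow>
           \<bar>inf_spec (spec_H P x \<phi> M) - inf_spec (spec_A P x \<phi> M)\<bar> \<le> C * mnorm P M ^ 3)"
proof -
  interpret spin_photon P x \<phi> "cutoff_weight \<phi>" by (rule spin_photon_schwartz[OF assms(2)])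
  define K where "K = (3 * (real (3 * P))\<^sup>2 * form_factor.c1 (cutoff_weight \<phi>)) * (3 * (real (3 * P))\<^sup>2 * c2)"
  have K: "K \<ge> 0"
    unfolding K_def by (intro mult_nonneg_nonneg c2_nonneg form_factor.c_nonneg[OF form_factors]) auto
  \<comment> \<open>The radius \<open>1 / (Kint + 1)\<close> makes sense also for
    \<open>Kint = 0\<close> and forces both \<open>Kint * mnorm P M < 1\<close> and
    \<open>mnorm P M \<le> 1\<close>; the latter bounds the fourth power by the third. Adding 1 to
    \<open>K\<close> makes the constant positive.\<close>
  have "\<bar>inf_spec (spec_H P x \<phi> M) - inf_spec (spec_A P x \<phi> M)\<bar> \<le> (K + 1) * mnorm P M ^ 3"
    if M: "mnorm P M < 1 / (Kint + 1)" for M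
  proof -
    have "mnorm P M * (Kint + 1) < 1" using M Kint_nonneg by (simp add: pos_less_divide_eq)
    moreover have "0 \<le> Kint * mnorm P M" using Kint_nonneg mnorm_nonneg by simp
    ultimately have small: "Kint * mnorm P M < 1" "mnorm P M \<le> 1"
      using mnorm_nonneg[of M] by (auto simp: algebra_simps)
    have "\<bar>inf_spec (spec_H P x \<phi> M) - inf_spec (spec_A P x \<phi> M)\<bar> \<le> K * mnorm P M ^ 4"
      unfolding K_def by (rule inf_spec_estimate[OF small(1)])
    also have "\<dots> \<le> (K + 1) * mnorm P M ^ 3"
      using K mnorm_nonneg[of M] small(2) by (intro mult_mono power_decreasing) auto
    finally show ?thesis .
  qed
  then show ?thesis
    using K Kint_nonneg by (intro exI[of _ "K + 1"] exI[of _ "1 / (Kint + 1)"]) auto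
qed

end
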